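(* Let $T\in(0,\infty)$, and let $b:\mathbb{R}\times\mathbb{R}^d\to\mathbb{R}^d$ and $\sigma:\mathbb{R}\times\mathbb{R}^d\to\mathbb{R}^d\otimes\mathbb{R}^m$ be continuous. Let $f,g,l$ be nonnegative integrable functions on $[0,T]$. Suppose that the following four assumptions hold. (1) For every $R>0$, $$\int_0^T\sup_{|x|\le R}\big(|b(s,x)|+\|\sigma(s,x)\|^2\big)\,ds<\infty .$$ (2) There is $\varepsilon_0\in(0,1)$ such that for every $R>0$ there is an increasing, continuous function $\eta_R:[0,1)\to\mathbb{R}_+$ with $$\eta_R(0)=0,\qquad \int_{0^+}\frac{dx}{\eta_R(x)}=+\infty,$$ such that for all $x,y\in\mathbb{R}^d$ with $|x|\vee|y|\le R$ and $|x-y|\le\varepsilon_0$ and all $s\in[0,T]$, $$2\langle x-y,b(s,x)-b(s,y)\rangle+\|\sigma(s,x)-\sigma(s,y)\|^2\le g(s)\,\eta_R(|x-y|^2).$$ (3) There exist a function $V\in C^2(\mathbb{R}^d;\mathbb{R}_+)$, constants $\theta>0$, $\eta>0$, $K>0$, $M>0$, and a continuous, increasing function $\gamma:[0,+\infty)\to\mathbb{R}_+$ with $\int_0^{+\infty}\frac{1}{\gamma(s)+1}\,ds=\infty$, such that $\lim_{|x|\to+\infty}V(x)=+\infty$ and, for all $s\in[0,T]$ and $x\in\mathbb{R}^d$, $$\langle b(s,x),\nabla V(x)\rangle+\frac{\theta}{2}\mathrm{Trace}\big(\sigma^*(s,x)\nabla^2V(x)\sigma(s,x)\big)+\frac{|\sigma^*(s,x)\nabla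 V(x)|^2}{\eta V(x)}\le f(s)\big(1+\gamma(V(x))\big),$$ $$\mathrm{Trace}\big(\sigma^*(s,x)\nabla^2V(x)\sigma(s,x)\big)\ge -l(s)\big[M+K\gamma(V(x))\big].$$ (4) For every $0\le c\le 1$ and every $R>0$, $$\sup_{s\in[0,\varepsilon_0]}\frac{c\,\eta_R(s)}{\eta_R(cs)}<\infty,\qquad \sup_{s\in[0,\infty)}\frac{c\,\gamma(s)}{\gamma(cs)}<\infty .$$ For $x\in\mathbb{R}^d$ and (small) $\varepsilon>0$, let $X^{\varepsilon,x}$ be the solution of $$dX^{\varepsilon}(t)=b(t,X^{\varepsilon}(t))\,dt+\sqrt{\varepsilon}\,\sigma(t,X^{\varepsilon}(t))\,dB(t),\quad t\in[0,T],\qquad X^{\varepsilon}(0)=x .$$ For $x\in\mathbb{R}^d$ and $\phi\in C([0,T],\mathbb{R}^d)$ define $$I_x(\phi)=\inf_{\{h\in L^2([0,T];\mathbb{R}^m):\ \phi=X_x^h\}}\left\{\frac12\int_0^T|h(s)|^2\,ds\right\},\qquad \inf\emptyset=\infty,$$ where $X_x^h\in C([0,T],\mathbb{R}^d)$ is the solution of the skeleton equation $$dX_x^h(t)=b(t,X_x^h(t))\,dt+\sigma(t,X_x^h(t))h(t)\,dt,\quad t\in[0,T],\qquad X_x^h(0)=x .$$ Then for every $x\in\mathbb{R}^d$, $I_x$ is a rate function on $C([0,T],\mathbb{R}^d)$; the family $\{I_x,\ x\in\mathbb{R}^d\}$ of rate functions has compact level sets on compacts; and $\{X^{\varepsilon,x}\}_{\varepsilon>0}$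 satisfies the uniform large deviation principle on the space $C([0,T],\mathbb{R}^d)$ with rate function $I_x$, uniformly over the initial value $x$ in bounded subsets of $\mathbb{R}^d$.
   Context: Setting and notation. $(\Omega,\mathcal{F},\{\mathcal{F}_t\}_{t\ge0},\mathbb{P})$ is a complete probability space with a filtration satisfying the usual conditions, and $\{B(t)\}_{t\ge0}$ is an $m$-dimensional Brownian motion on it. $\langle\cdot,\cdot\rangle$ and $|\cdot|$ are the Euclidean inner product and norm; $\mathbb{R}^d\otimes\mathbb{R}^m$ is the space of real $d\times m$ matrices with Hilbert-Schmidt norm $\|\sigma\|^2=\sum_{i=1}^d\sum_{j=1}^m\sigma_{ij}^2$; $\sigma^*$ is the transpose of $\sigma$; $\nabla V$ and $\nabla^2V$ are the gradient and Hessian of $V$; $\mathbb{R}_+=[0,\infty)$; $a\vee b=\max(a,b)$. The space $C([0,T],\mathbb{R}^d)$ carries the uniform metric $\rho(\phi,\psi)=\sup_{t\in[0,T]}|\phi(t)-\psi(t)|$. Conventions for quotients: $0/0=0$ and $a/0=+\infty$ for $a>0$. (When $V(x)=0$ one has $\nabla V(x)=0$, since $V\ge0$ is $C^2$, so the corresponding quotient is read as $0$.) Solutions. A solution $X^{\varepsilon,x}$ is a continuous $\{\mathcal{F}_t\}$-adapted process on $[0,T]$ satisfying the integrated equation almost surely. The family is given for all $\varepsilon$ in some interval $(0,\varepsilon_1)$, $0<\varepsilon_1\le1$, and all $x\in\mathbb{R}^d$; only the limit $\varepsilon\to0$ matters for the conclusion. Under the stated assumptions the skeleton equation has, for each $x\in\mathbb{R}^d$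 and $h\in L^2([0,T];\mathbb{R}^m)$, a unique solution $X_x^h\in C([0,T],\mathbb{R}^d)$ (understood in integrated form). Rate function: a function $I:C([0,T],\mathbb{R}^d)\to[0,\infty]$ such that $\{\phi: I(\phi)\le a\}$ is compact for every $a<\infty$. Compact level sets on compacts: for every compact $A\subset\mathbb{R}^d$ and every $a<\infty$, the set $\bigcup_{x\in A}\{\phi\in C([0,T],\mathbb{R}^d): I_x(\phi)\le a\}$ is a compact subset of $C([0,T],\mathbb{R}^d)$. Uniform large deviation principle (in the sense of Freidlin-Wentzell), uniformly over bounded subsets. Write $\Phi_x(s)=\{\phi\in C([0,T],\mathbb{R}^d): I_x(\phi)\le s\}$ and $\rho(\psi,\Phi_x(s))=\inf_{\phi\in\Phi_x(s)}\rho(\psi,\phi)$. The principle holds if for every bounded set $A\subset\mathbb{R}^d$ and all $\delta>0$, $\kappa>0$, $s_0>0$ there exists $\bar\varepsilon>0$ such that for all $\varepsilon\in(0,\bar\varepsilon)$ and all $x\in A$: (lower bound) $\mathbb{P}\big(\rho(X^{\varepsilon,x},\phi)<\delta\big)\ge\exp\!\big(-\tfrac{I_x(\phi)+\kappa}{\varepsilon}\big)$ for all $\phi\in\Phi_x(s_0)$; (upper bound) $\mathbb{P}\big(\rho(X^{\varepsilon,x},\Phi_x(s))\ge\delta\big)\le\exp\!\big(-\tfrac{s-\kappa}{\varepsilon}\big)$ for all $s\in[0,s_0]$. *)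

theory Defs
  imports "HOL-Probability.Probability"
begin

section \<open>Twice continuously differentiable functions\<close>

definition gradient :: "(real ^ 'd \<Rightarrow> real) \<Rightarrow> real ^ 'd \<Rightarrow> real ^ 'd" where
  "gradient V x = (THE v. GDERIV V x :> v)"

definition hessian :: "(real ^ 'd \<Rightarrow> real) \<Rightarrow> real ^ 'd \<Rightarrow> real ^ 'd ^ 'd" where
  "hessian V x = matrix (frechet_derivative (gradient V) (at x))"

definition C2 :: "(real ^ 'd \<Rightarrow> real) \<Rightarrow> bool" where
  "C2 V \<longleftrightarrow>
     (\<forall>x. GDERIV V x :> gradient V x) \<and>
     (\<forall>x. (gradient V has_derivative (\<lambda>v. hessian V x *v v)) (at x)) \<and>
     continuous_on UNIV (hessian V)"

section \<open>The path space\<close>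

text \<open>Elements of the path space are extensional, i.e. they are \<^term>\<open>undefined\<close> off the interval,
  so equality of paths is equality on \<open>[0,T]\<close>.\<close>

definition path_space :: "real \<Rightarrow> (real \<Rightarrow> real ^ 'd) metric" where
  "path_space T = cfunspace (top_of_set {0..T}) euclidean_metric"

lemma mspace_path_space:
  "mspace (path_space T) = {\<phi>. \<phi> \<in> extensional {0..T} \<and> continuous_on {0..T} \<phi>}"
proof -
  have "bounded (\<phi> ` {0..T})" if "continuous_on {0..T} \<phi>" for \<phi> :: "real \<Rightarrow> real ^ 'd"
    using that compact_continuous_image compact_imp_bounded compact_Icc by blast
  then show ?thesis
    unfolding path_space_def by auto
qed

lemma mdist_path_space:
  assumes "0 \<le> T" "\<phi> \<in> mspace (path_space T)" "\<psi> \<in> mspace (path_space T)"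
  shows "mdist (path_space T) \<phi> \<psi> = (SUP t\<in>{0..T}. dist (\<phi> t) (\<psi> t))"
proof -
  have "\<phi> \<in> Metric_space.fspace UNIV dist {0..T}" "\<psi> \<in> Metric_space.fspace UNIV dist {0..T}"
    using assms(2,3) unfolding path_space_def
    by (auto simp: Metric_space.fspace_def Met_TC.Metric_space_axioms)
  then show ?thesis
    unfolding path_space_def
    using assms(1)
    by (simp add: mdist_cfunspace_eq_mdist_funspace Metric_space.fdist_def Met_TC.Metric_space_axioms)
qed

section \<open>Stochastic bases and Brownian motion\<close>

text \<open>The filtration is indexed by the nonnegative reals; its values at negative times are
  irrelevant.\<close>

definition usual_conditions :: "'w measure \<Rightarrow> (real \<Rightarrow> 'w measure) \<Rightarrow> bool" where
  "usual_conditions M F \<longleftrightarrow>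
     (\<forall>t\<ge>0. subalgebra M (F t)) \<and>
     (\<forall>s\<ge>0. \<forall>t\<ge>s. sets (F s) \<subseteq> sets (F t)) \<and>
     null_sets M \<subseteq> sets (F 0) \<and>
     (\<forall>t\<ge>0. sets (F t) = (\<Inter>s\<in>{t<..}. sets (F s)))"

definition adapted_on :: "real set \<Rightarrow> (real \<Rightarrow> 'w measure) \<Rightarrow>
    (real \<Rightarrow> 'w \<Rightarrow> 'b::topological_space) \<Rightarrow> bool" where
  "adapted_on S F Y \<longleftrightarrow> (\<forall>t\<in>S. Y t \<in> borel_measurable (F t))"

text \<open>The product density says that \<open>B(t) - B(s)\<close> is centred Gaussian with covariance
  \<open>(t - s)\<close> times the identity.\<close>

definition brownian_motion ::
    "'w measure \<Rightarrow> (real \<Rightarrow> 'w measure) \<Rightarrow> (real \<Rightarrow> 'w \<Rightarrow> real ^ 'm) \<Rightarrow> bool" where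
  "brownian_motion M F B \<longleftrightarrow>
     adapted_on {0..} F B \<and>
     (AE \<omega> in M. B 0 \<omega> = 0) \<and>
     (AE \<omega> in M. continuous_on {0..} (\<lambda>t. B t \<omega>)) \<and>
     (\<forall>s\<ge>0. \<forall>t>s.
        prob_space.indep_set M (sets (F s))
          {(\<lambda>\<omega>. B t \<omega> - B s \<omega>) -` A \<inter> space M |A. A \<in> sets borel} \<and>
        distributed M lborel (\<lambda>\<omega>. B t \<omega> - B s \<omega>)
          (\<lambda>y. ennreal (\<Prod>i\<in>UNIV. normal_density 0 (sqrt (t - s)) (y $ i))))"

section \<open>The Ito integral\<close>

definition null_in_probability :: "'w measure \<Rightarrow> (nat \<Rightarrow> 'w \<Rightarrow> ennreal) \<Rightarrow> bool" where
  "null_in_probability M Y \<longleftrightarrow>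
     (\<forall>e>0. (\<lambda>n. measure M {\<omega> \<in> space M. ennreal e < Y n \<omega>}) \<longlonglongrightarrow> 0)"

definition progressive :: "real \<Rightarrow> (real \<Rightarrow> 'w measure) \<Rightarrow>
    (real \<Rightarrow> 'w \<Rightarrow> 'b::topological_space) \<Rightarrow> bool" where
  "progressive T F Z \<longleftrightarrow>
     (\<forall>t\<in>{0..T}. (\<lambda>(s, \<omega>). Z s \<omega>) \<in> borel_measurable (restrict_space borel {0..t} \<Otimes>\<^sub>M F t))"

text \<open>A simple integrand is given by partition points \<open>\<tau> 0 < \<dots> < \<tau> N\<close> in \<open>[0,T]\<close> and bounded
  coefficients \<open>\<xi> k\<close>, measurable at the left end point, on \<open>(\<tau> k, \<tau> (k+1)]\<close>.\<close>

definition simple_integrand :: "'w measure \<Rightarrow> (real \<Rightarrow> 'w measure) \<Rightarrow> real \<Rightarrow>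
    nat \<Rightarrow> (nat \<Rightarrow> real) \<Rightarrow> (nat \<Rightarrow> 'w \<Rightarrow> real ^ 'm ^ 'd) \<Rightarrow> bool" where
  "simple_integrand M F T N \<tau> \<xi> \<longleftrightarrow>
     0 \<le> \<tau> 0 \<and> \<tau> N \<le> T \<and>
     (\<forall>k<N. \<tau> k < \<tau> (Suc k) \<and> \<xi> k \<in> borel_measurable (F (\<tau> k)) \<and> bounded (\<xi> k ` space M))"

definition simple_process :: "nat \<Rightarrow> (nat \<Rightarrow> real) \<Rightarrow> (nat \<Rightarrow> 'w \<Rightarrow> real ^ 'm ^ 'd) \<Rightarrow>
    real \<Rightarrow> 'w \<Rightarrow> real ^ 'm ^ 'd" where
  "simple_process N \<tau> \<xi> s \<omega> = (\<Sum>k<N. indicator {\<tau> k<..\<tau> (Suc k)} s *\<^sub>R \<xi> k \<omega>)"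

definition simple_integral :: "(real \<Rightarrow> 'w \<Rightarrow> real ^ 'm) \<Rightarrow>
    nat \<Rightarrow> (nat \<Rightarrow> real) \<Rightarrow> (nat \<Rightarrow> 'w \<Rightarrow> real ^ 'm ^ 'd) \<Rightarrow> real \<Rightarrow> 'w \<Rightarrow> real ^ 'd" where
  "simple_integral B N \<tau> \<xi> t \<omega> =
     (\<Sum>k<N. \<xi> k \<omega> *v (B (min t (\<tau> (Suc k))) \<omega> - B (min t (\<tau> k)) \<omega>))"

text \<open>\<open>J\<close> is a continuous version of \<open>t \<mapsto> \<integral>\<^sub>0\<^sup>t Z(s) dB(s)\<close> on \<open>[0,T]\<close>, for progressively measurable
  \<open>Z\<close> with almost surely square integrable paths: simple integrals converge to \<open>J(t)\<close> in probability
  along simple processes converging to \<open>Z\<close> in \<open>L\<^sup>2([0,T])\<close> in probability. This determines \<open>J\<close> up to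
  indistinguishability. The norm on \<^typ>\<open>real ^ 'm ^ 'd\<close> is the Hilbert-Schmidt norm.\<close>

definition is_ito_integral :: "'w measure \<Rightarrow> (real \<Rightarrow> 'w measure) \<Rightarrow> (real \<Rightarrow> 'w \<Rightarrow> real ^ 'm) \<Rightarrow>
    real \<Rightarrow> (real \<Rightarrow> 'w \<Rightarrow> real ^ 'm ^ 'd) \<Rightarrow> (real \<Rightarrow> 'w \<Rightarrow> real ^ 'd) \<Rightarrow> bool" where
  "is_ito_integral M F B T Z J \<longleftrightarrow>
     progressive T F Z \<and>
     (AE \<omega> in M. (\<integral>\<^sup>+s\<in>{0..T}. ennreal ((norm (Z s \<omega>))\<^sup>2) \<partial>lborel) < \<infinity>) \<and>
     adapted_on {0..T} F J \<and>
     (\<forall>\<omega>\<in>space M. continuous_on {0..T} (\<lambda>t. J t \<omega>)) \<and>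
     (\<exists>N \<tau> \<xi>.
        (\<forall>n. simple_integrand M F T (N n) (\<tau> n) (\<xi> n)) \<and>
        null_in_probability M (\<lambda>n \<omega>.
          \<integral>\<^sup>+s\<in>{0..T}. ennreal ((norm (simple_process (N n) (\<tau> n) (\<xi> n) s \<omega> - Z s \<omega>))\<^sup>2) \<partial>lborel) \<and>
        (\<forall>t\<in>{0..T}. null_in_probability M (\<lambda>n \<omega>.
          ennreal (dist (simple_integral B (N n) (\<tau> n) (\<xi> n) t \<omega>) (J t \<omega>)))))"

section \<open>The stochastic differential equation and the skeleton equation\<close>

text \<open>\<open>Y\<close> solves \<open>dY = b(t,Y) dt + \<surd>\<epsilon> \<sigma>(t,Y) dB\<close>, \<open>Y(0) = x\<close>, on \<open>[0,T]\<close>.\<close>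

definition sde_solution :: "'w measure \<Rightarrow> (real \<Rightarrow> 'w measure) \<Rightarrow> (real \<Rightarrow> 'w \<Rightarrow> real ^ 'm) \<Rightarrow> real \<Rightarrow>
    (real \<Rightarrow> real ^ 'd \<Rightarrow> real ^ 'd) \<Rightarrow> (real \<Rightarrow> real ^ 'd \<Rightarrow> real ^ 'm ^ 'd) \<Rightarrow>
    real \<Rightarrow> real ^ 'd \<Rightarrow> (real \<Rightarrow> 'w \<Rightarrow> real ^ 'd) \<Rightarrow> bool" where
  "sde_solution M F B T b \<sigma> \<epsilon> x Y \<longleftrightarrow>
     adapted_on {0..T} F Y \<and>
     (\<forall>\<omega>\<in>space M. continuous_on {0..T} (\<lambda>t. Y t \<omega>)) \<and>
     (\<exists>J. is_ito_integral M F B T (\<lambda>s \<omega>. \<sigma> s (Y s \<omega>)) J \<and>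
        (AE \<omega> in M. \<forall>t\<in>{0..T}.
           Y t \<omega> = x + (LINT s:{0..t}|lborel. b s (Y s \<omega>)) + sqrt \<epsilon> *\<^sub>R J t \<omega>))"

definition sample_path :: "real \<Rightarrow> (real \<Rightarrow> 'w \<Rightarrow> real ^ 'd) \<Rightarrow> 'w \<Rightarrow> (real \<Rightarrow> real ^ 'd)" where
  "sample_path T Y \<omega> = restrict (\<lambda>t. Y t \<omega>) {0..T}"

definition L2_control :: "real \<Rightarrow> (real \<Rightarrow> real ^ 'm) \<Rightarrow> bool" where
  "L2_control T h \<longleftrightarrow>
     set_borel_measurable lebesgue {0..T} h \<and> set_integrable lebesgue {0..T} (\<lambda>s. (norm (h s))\<^sup>2)"

definition skeleton_solution :: "real \<Rightarrow>
    (real \<Rightarrow> real ^ 'd \<Rightarrow> real ^ 'd) \<Rightarrow> (real \<Rightarrow> real ^ 'd \<Rightarrow> real ^ 'm ^ 'd) \<Rightarrow>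
    real ^ 'd \<Rightarrow> (real \<Rightarrow> real ^ 'm) \<Rightarrow> (real \<Rightarrow> real ^ 'd) \<Rightarrow> bool" where
  "skeleton_solution T b \<sigma> x h \<phi> \<longleftrightarrow>
     \<phi> \<in> mspace (path_space T) \<and>
     (\<forall>t\<in>{0..T}. \<phi> t = x + (LINT s:{0..t}|lebesgue. b s (\<phi> s))
                          + (LINT s:{0..t}|lebesgue. \<sigma> s (\<phi> s) *v h s))"

definition skeleton :: "real \<Rightarrow>
    (real \<Rightarrow> real ^ 'd \<Rightarrow> real ^ 'd) \<Rightarrow> (real \<Rightarrow> real ^ 'd \<Rightarrow> real ^ 'm ^ 'd) \<Rightarrow>
    real ^ 'd \<Rightarrow> (real \<Rightarrow> real ^ 'm) \<Rightarrow> (real \<Rightarrow> real ^ 'd)" where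
  "skeleton T b \<sigma> x h = (THE \<phi>. skeleton_solution T b \<sigma> x h \<phi>)"

text \<open>The infimum is taken in \<^typ>\<open>ennreal\<close>, so the infimum over the empty set is \<open>\<infinity>\<close>.\<close>

definition action :: "real \<Rightarrow>
    (real \<Rightarrow> real ^ 'd \<Rightarrow> real ^ 'd) \<Rightarrow> (real \<Rightarrow> real ^ 'd \<Rightarrow> real ^ 'm ^ 'd) \<Rightarrow>
    real ^ 'd \<Rightarrow> (real \<Rightarrow> real ^ 'd) \<Rightarrow> ennreal" where
  "action T b \<sigma> x \<phi> =
     (INF h \<in> {h. L2_control T h \<and> \<phi> = skeleton T b \<sigma> x h}.
        ennreal (1 / 2 * (LINT s:{0..T}|lebesgue. (norm (h s))\<^sup>2)))"

section \<open>Rate functions and the uniform large deviation principle\<close>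

definition level_set :: "'p metric \<Rightarrow> ('p \<Rightarrow> ennreal) \<Rightarrow> ennreal \<Rightarrow> 'p set" where
  "level_set m I a = {\<phi> \<in> mspace m. I \<phi> \<le> a}"

definition rate_function :: "'p metric \<Rightarrow> ('p \<Rightarrow> ennreal) \<Rightarrow> bool" where
  "rate_function m I \<longleftrightarrow> (\<forall>a<\<infinity>. compactin (mtopology_of m) (level_set m I a))"

definition compact_level_sets_on_compacts ::
    "'p metric \<Rightarrow> ('x::topological_space \<Rightarrow> 'p \<Rightarrow> ennreal) \<Rightarrow> bool" where
  "compact_level_sets_on_compacts m I \<longleftrightarrow>
     (\<forall>A. compact A \<longrightarrow> (\<forall>a<\<infinity>. compactin (mtopology_of m) (\<Union>x\<in>A. level_set m (I x) a)))"

definition dist_to_set :: "'p metric \<Rightarrow> 'p \<Rightarrow> 'p set \<Rightarrow> ennreal" where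
  "dist_to_set m \<psi> S = (INF \<phi>\<in>S. ennreal (mdist m \<psi> \<phi>))"

text \<open>In the lower bound \<^term>\<open>enn2real\<close> is only applied to the finite value of the rate function
  at a point of a level set.\<close>

definition uniform_ldp :: "'w measure \<Rightarrow> 'p metric \<Rightarrow> (real \<Rightarrow> 'x::metric_space \<Rightarrow> 'w \<Rightarrow> 'p) \<Rightarrow>
    ('x \<Rightarrow> 'p \<Rightarrow> ennreal) \<Rightarrow> bool" where
  "uniform_ldp M m Y I \<longleftrightarrow>
     (\<forall>A \<delta> \<kappa> s0. bounded A \<and> 0 < \<delta> \<and> 0 < \<kappa> \<and> 0 < s0 \<longrightarrow>
        (\<exists>\<epsilon>'>0. \<forall>\<epsilon>\<in>{0<..<\<epsilon>'}. \<forall>x\<in>A.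
           (\<forall>\<phi>\<in>level_set m (I x) (ennreal s0).
              measure M {\<omega> \<in> space M. mdist m (Y \<epsilon> x \<omega>) \<phi> < \<delta>}
                \<ge> exp (- (enn2real (I x \<phi>) + \<kappa>) / \<epsilon>)) \<and>
           (\<forall>s\<in>{0..s0}.
              measure M {\<omega> \<in> space M.
                  dist_to_set m (Y \<epsilon> x \<omega>) (level_set m (I x) (ennreal s)) \<ge> ennreal \<delta>}
                \<le> exp (- (s - \<kappa>) / \<epsilon>))))"

end

theory Submission
  imports Defs "HOL-Complex_Analysis.Great_Picard" "HOL-Real_Asymp.Real_Asymp"
begin

text \<open>No Ito formula or change of measure is needed. Call \<open>Y\<close> an approximate solution of the skeleton
  equation with control \<open>h\<close> if its defect \<open>Y(t) - x - \<integral>\<^sub>0\<^sup>t b(s,Y) ds - \<integral>\<^sub>0\<^sup>t \<sigma>(s,Y) h ds\<close> is uniformly small.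
  The Lyapunov condition keeps approximate solutions with controls of bounded energy in a ball, since
  the term \<open>|\<sigma>\<^sup>* \<nabla>V|\<^sup>2 / V\<close> absorbs the control; there the Osgood condition and Bihari's inequality force
  them close to the exact solution. Subtracting the defect makes the path differentiable, so the
  ordinary chain rule is enough.

  For small \<open>\<epsilon>\<close> the diffusion is, off an event of probability at most \<open>exp (- L / \<epsilon>)\<close>, an approximate
  solution for every control whose integrals over the cells of a fixed grid are close to the scaled
  Brownian increments: freezing \<open>\<sigma>\<close> at the left end points leaves a stochastic integral with small
  integrand, controlled by an exponential supermartingale and a maximal inequality. Both large deviation
  bounds thus reduce to finitely many independent Gaussian increments. For the upper bound take the
  piecewise constant control built from the increments and bound the tail of their square sum; for the
  lower bound take a near optimal control for \<open>\<phi>\<close> and bound from below the probability that all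
  increments are close to its cell integrals. Compactness of the level sets follows from the same
  stability, as weakly close controls have nearly the same grid increments.\<close>

section \<open>Integration on intervals\<close>

text \<open>A circle has to be broken: the stochastic estimates need \<open>\<sigma>\<close>
  bounded, hence a path in a ball, while confinement to a ball is itself deduced from these
  estimates. So the defect at time \<open>t\<close> is required to be small only if the path has
  stayed in the ball of radius \<open>R\<close> up to \<open>t\<close>, and a first hitting time
  turns this conditional smallness into confinement. \<open>R\<close> and the admissible defect
  depend only on the initial set, the energy bound and the accuracy; they are fixed before the grid
  and before \<epsilon>, which yields the uniformity.

  The trace in the Lyapunov hypothesis belongs to second order calculus. Absolutely continuous paths
  produce no such term, so it must be removed, and the lower bound on the trace does this. Absorbing
  the control costs a multiple of \<open>V\<close>, which is added to \<gamma>; near zero the same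
  happens to \<open>\<eta> R\<close>. Divergence survives, as dyadic levels show: if y / (q + y) is
  summable, so is y / q.

  Constants lost in the exponential inequalities are harmless: they affect only exceptional events,
  whose rate \<open>L\<close> is free. The exact cost comes from the Gaussian increments.\<close>

lemma norm_matrix_vector_mult_le: "norm (A *v x) \<le> norm A * norm (x :: real ^ 'n)"
  for A :: "real ^ 'n ^ 'm"
proof -
  have "norm (A *v x) = L2_set (\<lambda>i. norm ((A *v x) $ i)) UNIV"
    by (simp add: norm_vec_def)
  also have "\<dots> \<le> L2_set (\<lambda>i. norm (A $ i) * norm x) UNIV"
    by (intro L2_set_mono) (auto simp: matrix_vector_mul_component Cauchy_Schwarz_ineq2)
  also have "\<dots> = norm A * norm x"
    by (simp add: norm_vec_def[of A] L2_set_left_distrib)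
  finally show ?thesis .
qed

lemma inner_matrix_vector_mult: "(A *v x) \<bullet> y = x \<bullet> (transpose A *v y)"
  for A :: "real ^ 'n ^ 'm"
  by (metis dot_lmul_matrix inner_commute transpose_matrix_vector)

text \<open>Duality: pairing \<open>transpose A *v y\<close> with itself moves one copy over to
  \<open>A\<close>, and the bound for \<open>A\<close> then divides out one factor of the
  norm.\<close>

lemma norm_transpose_mult_le: "norm (transpose A *v y) \<le> norm A * norm y"
  for A :: "real ^ 'n ^ 'm"
proof (cases "transpose A *v y = 0")
  case False
  let ?z = "transpose A *v y"
  have "(norm ?z)\<^sup>2 = (A *v ?z) \<bullet> y"
    by (simp add: inner_matrix_vector_mult power2_norm_eq_inner)
  also have "\<dots> \<le> norm (A *v ?z) * norm y"
    by (rule norm_cauchy_schwarz)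
  also have "\<dots> \<le> (norm A * norm ?z) * norm y"
    by (intro mult_right_mono norm_matrix_vector_mult_le) auto
  finally have "norm ?z * norm ?z \<le> (norm A * norm y) * norm ?z"
    by (simp add: power2_eq_square mult_ac)
  then show ?thesis
    using False by (simp add: mult_right_le_imp_le)
qed auto

lemma bilinear_matrix_vector_mult: "bilinear ((*v) :: real ^ 'n ^ 'm \<Rightarrow> real ^ 'n \<Rightarrow> real ^ 'm)"
  unfolding bilinear_def
  by (auto intro!: linearI simp: matrix_vector_right_distrib matrix_vector_mult_scaleR
      matrix_vector_mult_add_rdistrib scaleR_matrix_vector_assoc[symmetric])

lemma absolutely_integrable_matrix_vector_mult:
  fixes Z :: "real \<Rightarrow> real ^ 'n ^ 'm"
  assumes "continuous_on {a..b} Z" "h absolutely_integrable_on {a..b}"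
  shows "(\<lambda>s. Z s *v h s) absolutely_integrable_on {a..b}"
proof (rule absolutely_integrable_bounded_measurable_product[OF bilinear_matrix_vector_mult])
  show "bounded (Z ` {a..b})"
    using assms(1) by (simp add: compact_continuous_image compact_imp_bounded)
qed (use assms in \<open>auto intro: continuous_imp_measurable_on_sets_lebesgue\<close>)

lemma absolutely_integrable_inner_continuous:
  fixes Z :: "real \<Rightarrow> 'a::euclidean_space"
  assumes "continuous_on {a..b} Z" "h absolutely_integrable_on {a..b}"
  shows "(\<lambda>s. Z s \<bullet> h s) absolutely_integrable_on {a..b}"
proof (rule absolutely_integrable_bounded_measurable_product[where h = inner])
  show "bilinear (inner :: 'a \<Rightarrow> 'a \<Rightarrow> real)"
    by (simp add: bilinear_conv_bounded_bilinear bounded_bilinear_inner)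
  show "bounded (Z ` {a..b})"
    using assms(1) by (simp add: compact_continuous_image compact_imp_bounded)
qed (use assms in \<open>auto intro: continuous_imp_measurable_on_sets_lebesgue\<close>)

lemma absolutely_integrable_mult_continuous:
  fixes Z :: "real \<Rightarrow> real"
  assumes "continuous_on {a..b} Z" "h absolutely_integrable_on {a..b}"
  shows "(\<lambda>s. h s * Z s) absolutely_integrable_on {a..b}"
  using absolutely_integrable_inner_continuous[OF assms] by (simp add: mult.commute)

lemma integral_norm_bound:
  fixes h :: "real \<Rightarrow> 'a::euclidean_space"
  assumes "h absolutely_integrable_on S"
  shows "norm (integral S h) \<le> integral S (\<lambda>s. norm (h s))"
  using assms by (intro integral_norm_bound_integral) (auto simp: absolutely_integrable_on_def)

lemma integral_diff_interval:
  fixes h :: "real \<Rightarrow> 'a::euclidean_space"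
  assumes "h integrable_on {a..b}" "a \<le> s" "s \<le> t" "t \<le> b"
  shows "integral {a..t} h - integral {a..s} h = integral {s..t} h"
proof -
  have "h integrable_on {a..t}"
    by (rule integrable_subinterval_real[OF assms(1)]) (use assms in auto)
  from Henstock_Kurzweil_Integration.integral_combine[OF assms(2,3) this] show ?thesis
    by (simp add: algebra_simps)
qed

text \<open>Integrating \<open>2 |h| \<le> c + |h|\<^sup>2 / c\<close> with the optimal constant \<open>c\<close>.\<close>

lemma integral_norm_le_sqrt:
  fixes h :: "real \<Rightarrow> 'a::euclidean_space"
  assumes ab: "a \<le> b" and h: "h absolutely_integrable_on {a..b}"
    and h2: "(\<lambda>s. (norm (h s))\<^sup>2) integrable_on {a..b}"
    and N: "integral {a..b} (\<lambda>s. (norm (h s))\<^sup>2) \<le> N"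
  shows "integral {a..b} (\<lambda>s. norm (h s)) \<le> sqrt ((b - a) * N)"
proof -
  have hn: "(\<lambda>s. norm (h s)) integrable_on {a..b}"
    using h by (simp add: absolutely_integrable_on_def)
  have N0: "0 \<le> N"
    using N integral_nonneg[OF h2] by simp
  show ?thesis
  proof (cases "b = a")
    case True
    then show ?thesis by simp
  next
    case False
    then have ba: "0 < b - a" using ab by simp
    \<comment> \<open>A strict bound \<open>N < N'\<close> keeps the optimal \<open>c\<close>
      positive even when the energy vanishes; the claim for \<open>N\<close> follows as
      \<open>N'\<close> decreases to \<open>N\<close>.\<close>
    have *: "integral {a..b} (\<lambda>s. norm (h s)) \<le> sqrt ((b - a) * N')" if N': "N < N'" for N'
    proof -
      define c where "c = sqrt (N' / (b - a))"
      have c: "0 < c" using that N0 ba by (simp add: c_def)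
      have c2: "c * c = N' / (b - a)"
        using that N0 ba by (simp add: c_def)
      have pt: "norm (h s) \<le> c / 2 + (norm (h s))\<^sup>2 * (1 / (2 * c))" for s
      proof -
        have "0 \<le> (norm (h s) - c)\<^sup>2" by simp
        then have "norm (h s) * (2 * c) \<le> (norm (h s))\<^sup>2 + c * c"
          by (simp add: power2_eq_square algebra_simps)
        then have "norm (h s) \<le> ((norm (h s))\<^sup>2 + c * c) / (2 * c)"
          using c by (simp add: pos_le_divide_eq)
        also have "\<dots> = c / 2 + (norm (h s))\<^sup>2 * (1 / (2 * c))"
          using c by (simp add: field_simps)
        finally show ?thesis .
      qed
      have i2: "(\<lambda>s. (norm (h s))\<^sup>2 * (1 / (2 * c))) integrable_on {a..b}"
        using h2 by (rule integrable_on_mult_left)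
      have "integral {a..b} (\<lambda>s. norm (h s)) \<le> integral {a..b} (\<lambda>s. c / 2 + (norm (h s))\<^sup>2 * (1 / (2 * c)))"
        using hn i2 pt by (intro integral_le integrable_add) auto
      also have "\<dots> = (b - a) * (c / 2) + integral {a..b} (\<lambda>s. (norm (h s))\<^sup>2) * (1 / (2 * c))"
        using i2 ab by (subst Henstock_Kurzweil_Integration.integral_add) (auto simp: )
      also have "\<dots> \<le> (b - a) * (c / 2) + N' * (1 / (2 * c))"
        using N N' c by (intro add_left_mono mult_right_mono) auto
      also have "\<dots> = (b - a) * c"
        using c ba c2 by (simp add: field_simps)
      also have "\<dots> = sqrt (((b - a) * c)\<^sup>2)"
        using c ba by simp
      also have "((b - a) * c)\<^sup>2 = (b - a) * N'"
      proof -
        have "((b - a) * c)\<^sup>2 = (b - a) * (b - a) * (c * c)"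
          by (simp add: power2_eq_square algebra_simps)
        then show ?thesis using ba by (simp add: c2)
      qed
      finally show ?thesis .
    qed
    have "((\<lambda>N'. sqrt ((b - a) * N')) \<longlongrightarrow> sqrt ((b - a) * N)) (at_right N)"
      by (intro tendsto_intros)
    then show ?thesis
      by (rule tendsto_lowerbound) (auto intro!: eventually_at_rightI[of N "N + 1"] *)
  qed
qed

text \<open>\<open>D\<close> is only a primitive of an integrable function, so it need not be
  differentiable at a given point. The identity is therefore proved up to an error \<open>e\<close>
  times the integral of the norm of \<open>w\<close>. This error is additive over adjacent
  intervals, so local estimates extend to the whole interval by bisection; then \<open>e\<close>
  tends to 0.\<close>

lemma chain_rule_integral:
  fixes V :: "'a::euclidean_space \<Rightarrow> real" and w :: "real \<Rightarrow> 'a"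
  assumes w: "w absolutely_integrable_on {a..b}" and ab: "a \<le> b"
    and D: "\<And>t. t \<in> {a..b} \<Longrightarrow> D t = x + integral {a..t} w"
    and V: "\<And>y. GDERIV V y :> G y" and G: "continuous_on UNIV G"
  shows "V (D b) - V (D a) = integral {a..b} (\<lambda>s. G (D s) \<bullet> w s)"
proof -
  have wi: "w integrable_on {a..b}" and wn: "(\<lambda>s. norm (w s)) integrable_on {a..b}"
    using w by (simp_all add: absolutely_integrable_on_def)
  have Dc: "continuous_on {a..b} D"
    using continuous_on_add[OF continuous_on_const indefinite_integral_continuous_1[OF wi]]
    by (subst continuous_on_cong[OF refl D])
  have GD: "continuous_on {a..b} (\<lambda>s. G (D s))"
    using continuous_on_compose2[OF G Dc] by simp
  have gi: "(\<lambda>s. G (D s) \<bullet> w s) absolutely_integrable_on {a..b}"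
    by (rule absolutely_integrable_inner_continuous[OF GD w])
  define I where "I = (\<lambda>p q. integral {p..q} (\<lambda>s. G (D s) \<bullet> w s))"
  have main: "\<bar>V (D b) - V (D a) - I a b\<bar> \<le> e * integral {a..b} (\<lambda>s. norm (w s))" if e: "0 < e" for e
  proof -
    \<comment> \<open>The premises inside \<open>P\<close> make it trivially true for intervals that
      stick out of \<open>{a..b}\<close>, over which the local condition of \<open>Bolzano\<close>
      also ranges.\<close>
    define P where "P = (\<lambda>p q. a \<le> p \<longrightarrow> p \<le> q \<longrightarrow> q \<le> b \<longrightarrow>
        \<bar>V (D q) - V (D p) - I p q\<bar> \<le> e * integral {p..q} (\<lambda>s. norm (w s)))"
    have "P a b"
      using ab
    proof (induction rule: Bolzano)
      case (trans p q r)
      show ?case unfolding P_def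
      proof (intro impI)
        assume *: "a \<le> p" "p \<le> r" "r \<le> b"
        have sub: "{p..r} \<subseteq> {a..b}" using * by auto
        have "I p r = I p q + I q r"
          unfolding I_def using trans(3,4)
          by (subst Henstock_Kurzweil_Integration.integral_combine)
             (auto intro: integrable_subinterval_real[OF set_lebesgue_integral_eq_integral(1)[OF gi] sub])
        moreover have "integral {p..r} (\<lambda>s. norm (w s)) = integral {p..q} (\<lambda>s. norm (w s)) + integral {q..r} (\<lambda>s. norm (w s))"
          using trans(3,4)
          by (subst Henstock_Kurzweil_Integration.integral_combine)
             (auto intro: integrable_subinterval_real[OF wn sub])
        moreover have "\<bar>V (D q) - V (D p) - I p q\<bar> \<le> e * integral {p..q} (\<lambda>s. norm (w s))"
          "\<bar>V (D r) - V (D q) - I q r\<bar> \<le> e * integral {q..r} (\<lambda>s. norm (w s))"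
          using trans * unfolding P_def by auto
        ultimately show "\<bar>V (D r) - V (D p) - I p r\<bar> \<le> e * integral {p..r} (\<lambda>s. norm (w s))"
          by (simp add: algebra_simps abs_le_iff)
      qed
    next
      case (local y)
      then have yab: "y \<in> {a..b}" by auto
      have "continuous (at (D y)) G"
        using G by (simp add: continuous_on_eq_continuous_at)
      then obtain r where r: "0 < r" "\<And>z. dist z (D y) < r \<Longrightarrow> dist (G z) (G (D y)) < e / 2"
        using e unfolding continuous_at_eps_delta by (metis half_gt_zero)
      obtain d where d: "0 < d" "\<And>s. s \<in> {a..b} \<Longrightarrow> dist s y < d \<Longrightarrow> dist (D s) (D y) < r"
        using Dc yab r(1) unfolding continuous_on_iff by metis
      show ?case
      proof (intro exI[of _ d] conjI allI impI)
        fix p q assume pq: "p \<le> y \<and> y \<le> q \<and> q - p < d"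
        show "P p q"
          unfolding P_def
        proof (intro impI)
          assume *: "a \<le> p" "p \<le> q" "q \<le> b"
          have sub: "{p..q} \<subseteq> {a..b}" using * by auto
          have near: "dist (D s) (D y) < r" if "s \<in> {p..q}" for s
            using that pq * by (intro d) (auto simp: dist_real_def)
          have w': "w absolutely_integrable_on {p..q}"
            by (rule absolutely_integrable_on_subinterval[OF w sub])
          have wn': "(\<lambda>s. norm (w s)) integrable_on {p..q}" and wi': "w integrable_on {p..q}"
            using w' by (simp_all add: absolutely_integrable_on_def)
          have Dpq: "D q - D p = integral {p..q} w"
            using D[of p] D[of q] * integral_diff_interval[OF wi, of p q] by simp
          have nD: "norm (D q - D p) \<le> integral {p..q} (\<lambda>s. norm (w s))"
            unfolding Dpq by (rule integral_norm_bound[OF w'])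
          let ?S = "ball (D y) r"
          \<comment> \<open>The gradient is frozen at \<open>D y\<close> twice, at a cost of
            \<open>e / 2\<close> each: in the increment of \<open>V\<close>, by the mean value
            theorem on a ball where the gradient varies little, and below in the integrand.\<close>
          have 1: "norm (V (D q) - V (D p) - (\<lambda>h. h \<bullet> G (D y)) (D q - D p)) \<le> norm (D q - D p) * (e / 2)"
          proof (rule differentiable_bound_linearization[where S = ?S and f' = "\<lambda>z h. h \<bullet> G z"])
            show "D p + t *\<^sub>R (D q - D p) \<in> ?S" if "t \<in> {0..1}" for t
            proof -
              have "(1 - t) *\<^sub>R D p + t *\<^sub>R D q \<in> ?S"
                using that near[of p] near[of q] * by (intro convexD_alt[OF convex_ball]) (auto simp: dist_commute)
              then show ?thesis by (simp add: algebra_simps)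
            qed
            show "(V has_derivative (\<lambda>h. h \<bullet> G z)) (at z within ?S)" for z
              using V[of z] by (simp add: gderiv_def has_derivative_at_withinI)
            show "onorm ((\<lambda>h. h \<bullet> G z) - (\<lambda>h. h \<bullet> G (D y))) \<le> e / 2" if "z \<in> ?S" for z
            proof (rule onorm_le)
              fix h
              have "norm (((\<lambda>h. h \<bullet> G z) - (\<lambda>h. h \<bullet> G (D y))) h) = \<bar>h \<bullet> (G z - G (D y))\<bar>"
                by (simp add: inner_diff_right)
              also have "\<dots> \<le> norm h * norm (G z - G (D y))"
                by (rule Cauchy_Schwarz_ineq2)
              also have "\<dots> \<le> norm h * (e / 2)"
                using r(2)[of z] that by (intro mult_left_mono) (auto simp: dist_norm dist_commute norm_minus_commute)
              finally show "norm (((\<lambda>h. h \<bullet> G z) - (\<lambda>h. h \<bullet> G (D y))) h) \<le> e / 2 * norm h"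
                by (simp add: mult.commute)
            qed
            show "D y \<in> ?S" using r by simp
          qed
          have gi': "(\<lambda>s. G (D s) \<bullet> w s) absolutely_integrable_on {p..q}"
            by (rule absolutely_integrable_on_subinterval[OF gi sub])
          have ci: "(\<lambda>s. G (D y) \<bullet> w s) absolutely_integrable_on {p..q}"
            by (rule absolutely_integrable_inner_continuous[OF _ w']) auto
          have gi1: "(\<lambda>s. G (D s) \<bullet> w s) integrable_on {p..q}" "(\<lambda>s. G (D y) \<bullet> w s) integrable_on {p..q}"
            using gi' ci by (auto intro: set_lebesgue_integral_eq_integral(1))
          have 2: "integral {p..q} (\<lambda>s. G (D y) \<bullet> w s) = (D q - D p) \<bullet> G (D y)"
            unfolding Dpq using integral_linear[OF wi' bounded_linear_inner_right[of "G (D y)"]]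
            by (simp add: o_def inner_commute)
          have "\<bar>integral {p..q} (\<lambda>s. G (D y) \<bullet> w s) - I p q\<bar>
              = norm (integral {p..q} (\<lambda>s. G (D y) \<bullet> w s - G (D s) \<bullet> w s))"
            unfolding I_def using gi1 by (simp add: Henstock_Kurzweil_Integration.integral_diff)
          also have "\<dots> \<le> integral {p..q} (\<lambda>s. (e / 2) * norm (w s))"
          proof (rule integral_norm_bound_integral)
            show "norm (G (D y) \<bullet> w s - G (D s) \<bullet> w s) \<le> e / 2 * norm (w s)" if "s \<in> {p..q}" for s
            proof -
              have "norm (G (D y) \<bullet> w s - G (D s) \<bullet> w s) = \<bar>(G (D y) - G (D s)) \<bullet> w s\<bar>"
                by (simp add: inner_diff_left)
              also have "\<dots> \<le> norm (G (D y) - G (D s)) * norm (w s)"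
                by (rule Cauchy_Schwarz_ineq2)
              also have "\<dots> \<le> e / 2 * norm (w s)"
                using r(2)[OF near[OF that]]
                by (intro mult_right_mono) (auto simp: dist_norm norm_minus_commute)
              finally show ?thesis .
            qed
          qed (use gi1 integrable_on_mult_right[OF wn', of "e / 2"] in \<open>auto intro!: integrable_diff\<close>)
          also have "\<dots> = (e / 2) * integral {p..q} (\<lambda>s. norm (w s))"
            by simp
          finally have 3: "\<bar>integral {p..q} (\<lambda>s. G (D y) \<bullet> w s) - I p q\<bar> \<le> (e / 2) * integral {p..q} (\<lambda>s. norm (w s))" .
          have 4: "norm (D q - D p) * (e / 2) \<le> (e / 2) * integral {p..q} (\<lambda>s. norm (w s))"
            using mult_right_mono[OF nD, of "e/2"] e by (simp add: mult.commute)
          show "\<bar>V (D q) - V (D p) - I p q\<bar> \<le> e * integral {p..q} (\<lambda>s. norm (w s))"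
            using 1 2 3 4 unfolding real_norm_def by argo
        qed
      qed (use d in auto)
    qed
    then show ?thesis using ab by (auto simp: P_def)
  qed
  let ?W = "integral {a..b} (\<lambda>s. norm (w s))"
  have "((\<lambda>e. e * ?W) \<longlongrightarrow> 0 * ?W) (at_right 0)"
    by (intro tendsto_intros)
  then have "\<bar>V (D b) - V (D a) - I a b\<bar> \<le> 0 * ?W"
    by (rule tendsto_lowerbound) (auto intro!: eventually_at_rightI[of 0 1] main)
  then show ?thesis by (simp add: I_def)
qed

section \<open>Bihari's inequality\<close>

text \<open>By continuity \<open>w\<close> takes the value \<open>L (Suc J)\<close> at some
  \<open>c\<close> and, before that, the value \<open>L J\<close> at some \<open>a\<close>. The
  climb between them uses up at least its height divided by \<open>\<Gamma> (L (Suc J))\<close> of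
  the integral of \<open>k\<close>, and the induction continues on \<open>{0..a}\<close>. The finite
  sum replaces the integral of 1 / \<Gamma> and its inverse function in the usual
  formulation.\<close>

lemma discrete_bihari:
  fixes w k \<Gamma> :: "real \<Rightarrow> real" and L :: "nat \<Rightarrow> real"
  assumes "0 \<le> \<tau>" "continuous_on {0..\<tau>} w" "k integrable_on {0..\<tau>}" "\<And>s. s \<in> {0..\<tau>} \<Longrightarrow> 0 \<le> k s"
    and "\<And>a c. 0 \<le> a \<Longrightarrow> a \<le> c \<Longrightarrow> c \<le> \<tau> \<Longrightarrow> w c - w a \<le> \<Gamma> (w c) * integral {a..c} k"
    and L: "\<And>j. L j \<le> L (Suc j)" "\<And>j. 0 < \<Gamma> (L (Suc j))" "w 0 \<le> L 0"
    and "L J \<le> w \<tau>"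
  shows "(\<Sum>j<J. (L (Suc j) - L j) / \<Gamma> (L (Suc j))) \<le> integral {0..\<tau>} k"
  using assms(1-5,9)
proof (induction J arbitrary: \<tau>)
  case 0
  then show ?case using integral_nonneg[of k "{0..\<tau>}"] by simp
next
  case (Suc J)
  have Lm: "L 0 \<le> L j" for j
    using L(1) by (induction j) (auto intro: order_trans)
  obtain c where c: "0 \<le> c" "c \<le> \<tau>" "w c = L (Suc J)"
    using IVT'[of w 0 "L (Suc J)" \<tau>] Suc.prems L(3) Lm[of "Suc J"] by force
  have "continuous_on {0..c} w"
    using Suc.prems(2) c by (auto intro: continuous_on_subset)
  then obtain a where a: "0 \<le> a" "a \<le> c" "w a = L J"
    using IVT'[of w 0 "L J" c] L(3) Lm[of J] c L(1)[of J] by force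
  have ka: "k integrable_on {p..q}" if "0 \<le> p" "q \<le> \<tau>" for p q
    by (rule integrable_subinterval_real[OF Suc.prems(3)]) (use that in auto)
  have IH: "(\<Sum>j<J. (L (Suc j) - L j) / \<Gamma> (L (Suc j))) \<le> integral {0..a} k"
  proof (rule Suc.IH)
    show "continuous_on {0..a} w" using Suc.prems(2) a c by (auto intro: continuous_on_subset)
  qed (use a c Suc.prems ka in auto)
  have "L (Suc J) - L J \<le> \<Gamma> (L (Suc J)) * integral {a..c} k"
    using Suc.prems(5)[of a c] a c by simp
  then have 1: "(L (Suc J) - L J) / \<Gamma> (L (Suc J)) \<le> integral {a..c} k"
    using L(2)[of J] by (simp add: divide_le_eq mult.commute)
  have 2: "integral {0..c} k = integral {0..a} k + integral {a..c} k"
    using Henstock_Kurzweil_Integration.integral_combine[OF a(1,2) ka] c by simp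
  have 3: "integral {0..c} k \<le> integral {0..\<tau>} k"
    by (rule integral_subset_le) (use c ka Suc.prems in auto)
  show ?case
    using IH 1 2 3 by simp
qed

text \<open>The right-hand side of the assumed integral inequality, called \<open>w\<close>,
  dominates \<open>v\<close> and is nondecreasing. Monotonicity of \<Gamma> then bounds the growth
  of \<open>w\<close> on \<open>{s..t}\<close> by \<open>\<Gamma> (w t)\<close> times the integral
  of \<open>k\<close>, which is what \<open>discrete_bihari\<close> asks for. Since the sum over
  \<open>J\<close> levels exceeds the whole integral of \<open>k\<close>, the level
  \<open>L J\<close> is out of reach.\<close>

lemma bihari_bound:
  fixes v k \<Gamma> :: "real \<Rightarrow> real" and L :: "nat \<Rightarrow> real"
  assumes \<tau>: "0 \<le> \<tau>" and v: "continuous_on {0..\<tau>} v" "\<And>s. s \<in> {0..\<tau>} \<Longrightarrow> 0 \<le> v s"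
    and k: "k absolutely_integrable_on {0..\<tau>}" "\<And>s. s \<in> {0..\<tau>} \<Longrightarrow> 0 \<le> k s"
    and \<Gamma>: "continuous_on {0..} \<Gamma>" "mono_on {0..} \<Gamma>" "\<And>u. 0 \<le> u \<Longrightarrow> 0 \<le> \<Gamma> u"
    and bound: "\<And>t. t \<in> {0..\<tau>} \<Longrightarrow> v t \<le> c + integral {0..t} (\<lambda>s. k s * \<Gamma> (v s))"
    and L: "\<And>j. L j \<le> L (Suc j)" "\<And>j. 0 < \<Gamma> (L (Suc j))" "0 \<le> c" "c \<le> L 0"
    and J: "integral {0..\<tau>} k < (\<Sum>j<J. (L (Suc j) - L j) / \<Gamma> (L (Suc j)))"
  shows "v \<tau> < L J"
proof (rule ccontr)
  assume neg: "\<not> v \<tau> < L J"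
  have ki: "k integrable_on {0..\<tau>}"
    using k(1) by (rule set_lebesgue_integral_eq_integral(1))
  have \<Gamma>v: "continuous_on {0..\<tau>} (\<lambda>s. \<Gamma> (v s))"
    by (rule continuous_on_compose2[OF \<Gamma>(1) v(1)]) (use v(2) in auto)
  have int: "(\<lambda>s. k s * \<Gamma> (v s)) integrable_on {0..\<tau>}"
    using absolutely_integrable_mult_continuous[OF \<Gamma>v k(1)] by (rule set_lebesgue_integral_eq_integral(1))
  define w where "w = (\<lambda>t. c + integral {0..t} (\<lambda>s. k s * \<Gamma> (v s)))"
  have wc: "continuous_on {0..\<tau>} w"
    unfolding w_def by (intro continuous_intros indefinite_integral_continuous_1[OF int])
  have diff: "w t - w s = integral {s..t} (\<lambda>s. k s * \<Gamma> (v s))" if "0 \<le> s" "s \<le> t" "t \<le> \<tau>" for s t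
    unfolding w_def using integral_diff_interval[OF int that] by simp
  have ints: "(\<lambda>s. k s * \<Gamma> (v s)) integrable_on {s..t}" "k integrable_on {s..t}"
    if "0 \<le> s" "t \<le> \<tau>" for s t
    using that by (auto intro: integrable_subinterval_real[OF int] integrable_subinterval_real[OF ki])
  have wm: "w s \<le> w t" if "0 \<le> s" "s \<le> t" "t \<le> \<tau>" for s t
  proof -
    have "0 \<le> integral {s..t} (\<lambda>s. k s * \<Gamma> (v s))"
      using that by (intro integral_nonneg ints) (auto intro!: mult_nonneg_nonneg k \<Gamma> v)
    then show ?thesis using diff[OF that] by simp
  qed
  have vw: "v t \<le> w t" if "t \<in> {0..\<tau>}" for t
    using bound[OF that] by (simp add: w_def)
  have inc: "w t - w s \<le> \<Gamma> (w t) * integral {s..t} k" if "0 \<le> s" "s \<le> t" "t \<le> \<tau>" for s t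
  proof -
    have "w t - w s \<le> integral {s..t} (\<lambda>r. k r * \<Gamma> (w t))"
      unfolding diff[OF that]
    proof (rule integral_le)
      fix r assume r: "r \<in> {s..t}"
      then have r': "r \<in> {0..\<tau>}" using that by auto
      have "v r \<le> w t"
        using vw[OF r'] wm[of r t] r that by auto
      then have "\<Gamma> (v r) \<le> \<Gamma> (w t)"
        using v(2)[OF r'] by (intro mono_onD[OF \<Gamma>(2)]) auto
      then show "k r * \<Gamma> (v r) \<le> k r * \<Gamma> (w t)"
        using k(2)[OF r'] by (intro mult_left_mono)
    qed (use that in \<open>auto intro!: ints integrable_on_mult_left\<close>)
    then show ?thesis by (simp add: mult.commute)
  qed
  have "(\<Sum>j<J. (L (Suc j) - L j) / \<Gamma> (L (Suc j))) \<le> integral {0..\<tau>} k"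
  proof (rule discrete_bihari[OF \<tau> wc ki k(2) inc])
    show "w 0 \<le> L 0" using L(4) by (simp add: w_def)
    show "L J \<le> w \<tau>" using neg vw[of \<tau>] \<tau> by auto
  qed (use L in auto)
  with J show False by simp
qed

text \<open>Bounded sums force the ratios y / (q + y) to 0. Once they are below 1/2 one has y < q,
  and then y / q is at most twice the ratio. This is the reason why adding the identity to \<gamma>
  or to \<open>\<eta> R\<close> does not spoil the Bihari argument.\<close>

lemma summable_ratio:
  fixes y q :: "nat \<Rightarrow> real"
  assumes y: "\<And>j. 0 < y j" and q: "\<And>j. 0 \<le> q j"
    and G: "\<And>J. (\<Sum>j<J. y j / (q j + y j)) \<le> G"
  obtains j0 where "\<And>j. j0 \<le> j \<Longrightarrow> y j < q j" "summable (\<lambda>j. y (j + j0) / q (j + j0))"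
proof -
  have pos: "0 \<le> y j / (q j + y j)" for j
    using y[of j] q[of j] by auto
  have s: "summable (\<lambda>j. y j / (q j + y j))"
    by (rule summableI_nonneg_bounded[OF pos G])
  then have "(\<lambda>j. y j / (q j + y j)) \<longlonglongrightarrow> 0"
    by (rule summable_LIMSEQ_zero)
  then have "\<forall>\<^sub>F j in sequentially. y j / (q j + y j) < 1 / 2"
    by (rule order_tendstoD) simp
  then obtain j0 where j0: "\<And>j. j0 \<le> j \<Longrightarrow> y j / (q j + y j) < 1 / 2"
    by (auto simp: eventually_sequentially)
  have less: "y j < q j" if "j0 \<le> j" for j
    using j0[OF that] y[of j] q[of j] by (simp add: divide_less_eq)
  moreover have "summable (\<lambda>j. y (j + j0) / q (j + j0))"
  proof (rule summable_comparison_test')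
    show "summable (\<lambda>j. 2 * (y (j + j0) / (q (j + j0) + y (j + j0))))"
      by (intro summable_mult summable_ignore_initial_segment[OF s])
    show "norm (y (j + j0) / q (j + j0)) \<le> 2 * (y (j + j0) / (q (j + j0) + y (j + j0)))" for j
    proof -
      have *: "y (j + j0) < q (j + j0)" "0 < y (j + j0)"
        using less[of "j + j0"] y by auto
      then have "y (j + j0) * (q (j + j0) + y (j + j0)) \<le> y (j + j0) * (2 * q (j + j0))"
        by (intro mult_left_mono) auto
      then show ?thesis using * by (simp add: field_simps)
    qed
  qed
  ultimately show ?thesis using that by blast
qed

section \<open>Divergent growth integrals turned into divergent sums over dyadic levels\<close>

lemma le_suminf_ennreal: "f j \<le> (\<Sum>j. f j)" for f :: "nat \<Rightarrow> ennreal"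
  using sum_le_suminf[OF summableI, of "{j}" f] by simp

text \<open>If all sums stayed below \<open>G\<close>, \<open>summable_ratio\<close> would remove
  the summand \<open>c * 2 ^ Suc j\<close> from the denominators, and a step function made from the
  values of \<gamma> at the levels would be an integrable majorant of 1 / (\<gamma> + 1).\<close>

lemma levels_at_infinity:
  fixes \<gamma> :: "real \<Rightarrow> real"
  assumes \<gamma>: "\<And>u. 0 \<le> u \<Longrightarrow> 0 \<le> \<gamma> u" "mono_on {0..} \<gamma>"
    and div: "(\<integral>\<^sup>+u\<in>{0..}. ennreal (1 / (\<gamma> u + 1)) \<partial>lborel) = \<infinity>" and c: "0 < c"
  obtains J where "G < (\<Sum>j<J. (c * 2 ^ Suc j - c * 2 ^ j) / (1 + \<gamma> (c * 2 ^ Suc j) + c * 2 ^ Suc j))"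
proof (rule ccontr)
  assume "\<not> thesis"
  with that have le: "(\<Sum>j<J. (c * 2 ^ Suc j - c * 2 ^ j) / (1 + \<gamma> (c * 2 ^ Suc j) + c * 2 ^ Suc j)) \<le> G" for J
    by (meson not_less)
  \<comment> \<open>\<open>y j\<close> is twice the gap below the level
    \<open>c * 2 ^ Suc j\<close>, so the bound \<open>G\<close> becomes
    \<open>2 * G\<close>.\<close>
  define y where "y = (\<lambda>j::nat. c * 2 ^ Suc j)"
  define q where "q = (\<lambda>j. 1 + \<gamma> (y j))"
  have y: "0 < y j" for j using c by (simp add: y_def)
  have q1: "1 \<le> q j" for j using \<gamma>(1)[of "y j"] y[of j] by (simp add: q_def)
  have "(\<Sum>j<J. y j / (q j + y j)) \<le> 2 * G" for J
  proof -
    have "(\<Sum>j<J. y j / (q j + y j)) = 2 * (\<Sum>j<J. (c * 2 ^ Suc j - c * 2 ^ j) / (1 + \<gamma> (c * 2 ^ Suc j) + c * 2 ^ Suc j))"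
      unfolding sum_distrib_left by (intro sum.cong) (auto simp: y_def q_def)
    then show ?thesis using le[of J] by simp
  qed
  then obtain j0 where j0: "summable (\<lambda>j. y (j + j0) / q (j + j0))"
    using summable_ratio[of y q "2 * G"] y q1 by (metis order_trans zero_le_one)
  \<comment> \<open>Up to \<open>y j0\<close> the integrand is at most 1. On the cell starting at
    \<open>y (j + j0)\<close> monotonicity bounds it by its value at the left end, and by doubling
    the length of the cell equals \<open>y (j + j0)\<close>.\<close>
  define S where "S = (\<lambda>u. indicator {0..y j0} u
      + (\<Sum>j. ennreal (1 / q (j + j0)) * indicator {y (j + j0)..y (Suc j + j0)} u) :: ennreal)"
  have pt: "ennreal (1 / (\<gamma> u + 1)) * indicator {0..} u \<le> S u" for u
  proof (cases "0 \<le> u")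
    case u: True
    have le1: "ennreal (1 / (\<gamma> u + 1)) \<le> 1"
      using \<gamma>(1)[OF u] by simp
    show ?thesis
    proof (cases "u \<le> y j0")
      case True
      then show ?thesis using u le1 by (simp add: S_def add_increasing2)
    next
      case False
      have "\<exists>j. u < y (j + j0)"
      proof -
        obtain n where "u / c < 2 ^ n"
          using real_arch_pow[of 2 "u / c"] by auto
        then have "u < c * 2 ^ n" using c by (simp add: field_simps)
        also have "\<dots> \<le> y (n + j0)"
          unfolding y_def using c by (intro mult_left_mono power_increasing) auto
        finally show ?thesis by blast
      qed
      \<comment> \<open>The first level above \<open>u\<close> is not the initial one, because
        \<open>u\<close> lies above \<open>y j0\<close>; so it has a predecessor, which bounds
        \<open>u\<close> from below.\<close>
      define m where "m = (LEAST j. u < y (j + j0))"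
      have m: "u < y (m + j0)"
        unfolding m_def using \<open>\<exists>j. u < y (j + j0)\<close> by (rule LeastI_ex)
      have "m \<noteq> 0"
      proof
        assume "m = 0" with m False show False by simp
      qed
      then obtain j where j: "m = Suc j" by (cases m) auto
      then have "\<not> u < y (j + j0)"
        using not_less_Least[of j "\<lambda>j. u < y (j + j0)"] by (simp add: m_def)
      then have ju: "y (j + j0) \<le> u" "u \<le> y (Suc j + j0)" using m j by auto
      have "\<gamma> (y (j + j0)) \<le> \<gamma> u"
        using ju y[of "j + j0"] u by (intro mono_onD[OF \<gamma>(2)]) auto
      then have "1 / (\<gamma> u + 1) \<le> 1 / q (j + j0)"
        using q1[of "j + j0"] by (intro divide_left_mono mult_pos_pos) (auto simp: q_def)
      then have "ennreal (1 / (\<gamma> u + 1)) \<le> ennreal (1 / q (j + j0)) * indicator {y (j + j0)..y (Suc j + j0)} u"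
        using ju by (simp add: ennreal_leI)
      also have "\<dots> \<le> (\<Sum>j. ennreal (1 / q (j + j0)) * indicator {y (j + j0)..y (Suc j + j0)} u)"
        by (rule le_suminf_ennreal)
      also have "\<dots> \<le> S u" by (simp add: S_def)
      finally show ?thesis using u by simp
    qed
  qed simp
  have "(\<integral>\<^sup>+u\<in>{0..}. ennreal (1 / (\<gamma> u + 1)) \<partial>lborel) \<le> (\<integral>\<^sup>+u. S u \<partial>lborel)"
    by (intro nn_integral_mono pt)
  also have "\<dots> = y j0 + (\<Sum>j. ennreal (y (j + j0) / q (j + j0)))"
  proof -
    have "(\<integral>\<^sup>+u. ennreal (1 / q (j + j0)) * indicator {y (j + j0)..y (Suc j + j0)} u \<partial>lborel)
        = ennreal (y (j + j0) / q (j + j0))" for j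
    proof -
      have yy: "y (Suc j + j0) - y (j + j0) = y (j + j0)" by (simp add: y_def)
      then have "y (j + j0) \<le> y (Suc j + j0)" using y[of "j + j0"] by simp
      then have "emeasure lborel {y (j + j0)..y (Suc j + j0)} = ennreal (y (j + j0))"
        using yy by simp
      then show ?thesis
        using q1[of "j + j0"] y[of "j + j0"]
        by (simp add: nn_integral_cmult_indicator ennreal_mult[symmetric])
    qed
    then show ?thesis
      unfolding S_def using y[of j0] by (subst nn_integral_add) (auto simp: nn_integral_suminf)
  qed
  also have "\<dots> < \<infinity>"
  proof -
    have "0 \<le> y (j + j0) / q (j + j0)" for j
      using y[of "j + j0"] q1[of "j + j0"] by simp
    then have "(\<Sum>j. ennreal (y (j + j0) / q (j + j0))) = ennreal (\<Sum>j. y (j + j0) / q (j + j0))"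
      using j0 by (intro suminf_ennreal2) auto
    then show ?thesis by simp
  qed
  finally show False using div by simp
qed

text \<open>The mirror image of \<open>levels_at_infinity\<close>, with levels descending to 0. The
  values of \<eta> at the levels are not known to be positive in advance; positivity comes out of
  \<open>summable_ratio\<close>, which gives \<open>y j < q j\<close> from \<open>j0\<close>
  on.\<close>

lemma levels_at_zero:
  fixes \<eta> :: "real \<Rightarrow> real"
  assumes \<eta>: "\<And>u. u \<in> {0..<1} \<Longrightarrow> 0 \<le> \<eta> u" "mono_on {0..<1} \<eta>"
    and div: "\<And>\<delta>. \<delta> \<in> {0<..<1} \<Longrightarrow> (\<integral>\<^sup>+u\<in>{0<..<\<delta>}. 1 / ennreal (\<eta> u) \<partial>lborel) = \<infinity>"
    and c: "0 < c" "c < 1"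
  obtains J where "G < (\<Sum>j<J. (c / 2 ^ j - c / 2 ^ Suc j) / (\<eta> (c / 2 ^ j) + c / 2 ^ j))"
proof (rule ccontr)
  assume "\<not> thesis"
  with that have le: "(\<Sum>j<J. (c / 2 ^ j - c / 2 ^ Suc j) / (\<eta> (c / 2 ^ j) + c / 2 ^ j)) \<le> G" for J
    by (meson not_less)
  define y where "y = (\<lambda>j::nat. c / 2 ^ j)"
  define q where "q = (\<lambda>j. \<eta> (y j))"
  have y: "0 < y j" "y j < 1" for j
  proof -
    show "0 < y j" using c by (simp add: y_def)
    have "y j \<le> c / 1" unfolding y_def using c by (intro divide_left_mono) auto
    then show "y j < 1" using c by simp
  qed
  have yS: "y (Suc j) = y j / 2" for j by (simp add: y_def)
  have q: "0 \<le> q j" for j using \<eta>(1)[of "y j"] y[of j] by (simp add: q_def)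
  have "(\<Sum>j<J. y j / (q j + y j)) \<le> 2 * G" for J
  proof -
    have "(\<Sum>j<J. y j / (q j + y j)) = 2 * (\<Sum>j<J. (c / 2 ^ j - c / 2 ^ Suc j) / (\<eta> (c / 2 ^ j) + c / 2 ^ j))"
      unfolding sum_distrib_left by (intro sum.cong) (auto simp: y_def q_def)
    then show ?thesis using le[of J] by simp
  qed
  then obtain j0 where less: "\<And>j. j0 \<le> j \<Longrightarrow> y j < q j" and j0: "summable (\<lambda>j. y (j + j0) / q (j + j0))"
    using summable_ratio[of y q "2 * G"] y q by metis
  \<comment> \<open>The smallest value of \<eta> on a cell is taken at its left end
    \<open>y (Suc j + j0)\<close>, and by halving this number is also the length of the
    cell.\<close>
  define S where "S = (\<lambda>u. (\<Sum>j. ennreal (1 / q (Suc j + j0)) * indicator {y (Suc j + j0)..y (j + j0)} u))"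
  have pt: "1 / ennreal (\<eta> u) * indicator {0<..<y j0} u \<le> S u" for u
  proof (cases "u \<in> {0<..<y j0}")
    case u: True
    have "\<exists>j. y (j + j0) < u"
    proof -
      have "(\<lambda>j. c * (1 / 2) ^ (j + j0)) \<longlonglongrightarrow> c * 0"
        by (intro tendsto_mult tendsto_const LIMSEQ_ignore_initial_segment LIMSEQ_realpow_zero) auto
      then have "\<forall>\<^sub>F j in sequentially. c * (1 / 2) ^ (j + j0) < u"
        using u by (intro order_tendstoD) auto
      then show ?thesis
        by (auto simp: eventually_sequentially y_def power_one_over)
    qed
    define m where "m = (LEAST j. y (j + j0) < u)"
    have m: "y (m + j0) < u"
      unfolding m_def using \<open>\<exists>j. y (j + j0) < u\<close> by (rule LeastI_ex)
    have "m \<noteq> 0"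
    proof
      assume "m = 0" with m u show False by simp
    qed
    then obtain j where j: "m = Suc j" by (cases m) auto
    then have "\<not> y (j + j0) < u"
      using not_less_Least[of j "\<lambda>j. y (j + j0) < u"] by (simp add: m_def)
    then have ju: "y (Suc j + j0) \<le> u" "u \<le> y (j + j0)" using m j by auto
    have qp: "0 < q (Suc j + j0)"
      using less[of "Suc j + j0"] y(1)[of "Suc j + j0"] by simp
    have q\<eta>: "q (Suc j + j0) \<le> \<eta> u"
      unfolding q_def using ju y[of "Suc j + j0"] y[of "j + j0"] u by (intro mono_onD[OF \<eta>(2)]) auto
    then have "1 / \<eta> u \<le> 1 / q (Suc j + j0)"
      using qp by (intro divide_left_mono mult_pos_pos) auto
    then have "1 / ennreal (\<eta> u) \<le> ennreal (1 / q (Suc j + j0)) * indicator {y (Suc j + j0)..y (j + j0)} u"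
      using ju q\<eta> qp divide_ennreal[of 1 "\<eta> u"] by (simp add: ennreal_leI)
    also have "\<dots> \<le> S u"
      unfolding S_def
      by (rule le_suminf_ennreal)
    finally show ?thesis using u by simp
  qed simp
  have "(\<integral>\<^sup>+u\<in>{0<..<y j0}. 1 / ennreal (\<eta> u) \<partial>lborel) \<le> (\<integral>\<^sup>+u. S u \<partial>lborel)"
    by (intro nn_integral_mono pt)
  also have "\<dots> = (\<Sum>j. ennreal (y (Suc j + j0) / q (Suc j + j0)))"
  proof -
    have "(\<integral>\<^sup>+u. ennreal (1 / q (Suc j + j0)) * indicator {y (Suc j + j0)..y (j + j0)} u \<partial>lborel)
        = ennreal (y (Suc j + j0) / q (Suc j + j0))" for j
    proof -
      have yy: "y (j + j0) - y (Suc j + j0) = y (Suc j + j0)" by (simp add: yS)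
      then have "y (Suc j + j0) \<le> y (j + j0)" using y(1)[of "Suc j + j0"] by simp
      then have "emeasure lborel {y (Suc j + j0)..y (j + j0)} = ennreal (y (Suc j + j0))"
        using yy by simp
      then show ?thesis
        using q[of "Suc j + j0"] y(1)[of "Suc j + j0"]
        by (simp add: nn_integral_cmult_indicator ennreal_mult[symmetric])
    qed
    then show ?thesis
      unfolding S_def by (subst nn_integral_suminf) auto
  qed
  also have "\<dots> < \<infinity>"
  proof -
    have "0 \<le> y (Suc j + j0) / q (Suc j + j0)" for j
      using y(1)[of "Suc j + j0"] q[of "Suc j + j0"] by simp
    moreover have "summable (\<lambda>j. y (Suc j + j0) / q (Suc j + j0))"
      using j0 summable_Suc_iff[of "\<lambda>j. y (j + j0) / q (j + j0)"] by simp
    ultimately have "(\<Sum>j. ennreal (y (Suc j + j0) / q (Suc j + j0))) = ennreal (\<Sum>j. y (Suc j + j0) / q (Suc j + j0))"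
      by (intro suminf_ennreal2) auto
    then show ?thesis by simp
  qed
  finally show False using div[of "y j0"] y by simp
qed

section \<open>The controlled equation\<close>

text \<open>The times at which \<open>u\<close> is at least \<open>R\<close> form a compact set. Its
  minimum is \<tau>, and the intermediate value theorem makes the value there exactly
  \<open>R\<close>.\<close>

lemma first_hit:
  fixes u :: "real \<Rightarrow> real"
  assumes u: "continuous_on {0..T} u" "u 0 < R" and t: "t \<in> {0..T}" "R \<le> u t"
  obtains \<tau> where "\<tau> \<in> {0..T}" "u \<tau> = R" "\<And>s. s \<in> {0..\<tau>} \<Longrightarrow> u s \<le> R"
proof -
  let ?S = "{s \<in> {0..T}. R \<le> u s}"
  have "closed ?S"
    using continuous_on_closed_Collect_le[OF continuous_on_const u(1)] by auto
  then have "compact ?S"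
    using bounded_subset[OF bounded_closed_interval, of ?S 0 T] by (simp add: compact_eq_bounded_closed subset_eq)
  then obtain \<tau> where \<tau>: "\<tau> \<in> ?S" "\<And>s. s \<in> ?S \<Longrightarrow> \<tau> \<le> s"
    using compact_attains_inf[of ?S] t by blast
  have "continuous_on {0..\<tau>} u" using u(1) \<tau>(1) by (auto intro: continuous_on_subset)
  then obtain s where s: "0 \<le> s" "s \<le> \<tau>" "u s = R"
    using IVT'[of u 0 R \<tau>] u(2) \<tau>(1) by auto
  then have "s = \<tau>" using \<tau> by force
  show ?thesis
  proof
    show "\<tau> \<in> {0..T}" "u \<tau> = R" using \<tau>(1) s \<open>s = \<tau>\<close> by auto
    show "u r \<le> R" if "r \<in> {0..\<tau>}" for r
      using \<tau>(2)[of r] that \<tau>(1) s \<open>s = \<tau>\<close> by force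
  qed
qed

text \<open>A zero of a nonnegative \<open>V\<close> is a minimum, so the gradient vanishes there.
  The quotient with denominator \<open>eta * V x\<close> is then 0 / 0, and its value 0 in HOL
  agrees with the stated convention.\<close>

lemma gradient_eq_0_at_min:
  assumes V: "GDERIV V x :> G" and "\<And>y. V x \<le> V y"
  shows "G = 0"
proof -
  have "(\<lambda>h. h \<bullet> G) = (\<lambda>h. 0)"
    using assms by (intro differential_zero_maxmin[of x UNIV V]) (auto simp: gderiv_def)
  then have "G \<bullet> G = 0" by metis
  then show ?thesis by simp
qed

lemma gradient_norm_power2: "GDERIV (\<lambda>x. (norm x)\<^sup>2) y :> 2 *\<^sub>R y"
  unfolding gderiv_def power2_norm_eq_inner
  by (auto intro!: derivative_eq_intros simp: inner_commute)

section \<open>Controls of finite energy and the controlled vector field\<close>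

definition energy :: "real \<Rightarrow> (real \<Rightarrow> real ^ 'm) \<Rightarrow> real" where
  "energy T h = integral {0..T} (\<lambda>s. (norm (h s))\<^sup>2)"

text \<open>Passage from Lebesgue set integrals, in which controls are defined, to the gauge
  integral used in all estimates. A control is itself integrable because \<open>norm (h s)\<close>
  is at most \<open>1 + (norm (h s))\<^sup>2\<close> and the interval is bounded.\<close>

lemma L2_controlD:
  assumes "L2_control T h"
  shows "h absolutely_integrable_on {0..T}" "(\<lambda>s. (norm (h s))\<^sup>2) absolutely_integrable_on {0..T}"
    "(\<lambda>s. (norm (h s))\<^sup>2) integrable_on {0..T}" "(\<lambda>s. norm (h s)) integrable_on {0..T}"
    "(LINT s:{0..T}|lebesgue. (norm (h s))\<^sup>2) = energy T h"
proof -
  show 1: "(\<lambda>s. (norm (h s))\<^sup>2) absolutely_integrable_on {0..T}"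
    using assms by (simp add: L2_control_def)
  then show 2: "(\<lambda>s. (norm (h s))\<^sup>2) integrable_on {0..T}"
    and "(LINT s:{0..T}|lebesgue. (norm (h s))\<^sup>2) = energy T h"
    unfolding energy_def by (rule set_lebesgue_integral_eq_integral)+
  have "h \<in> borel_measurable (lebesgue_on {0..T})"
    using assms by (simp add: L2_control_def set_borel_measurable_def borel_measurable_restrict_space_iff)
  moreover have "norm (h s) \<le> 1 + (norm (h s))\<^sup>2" for s
    using self_le_power[of "norm (h s)" 2] by (cases "1 \<le> norm (h s)") (auto intro: add_increasing2)
  ultimately show "h absolutely_integrable_on {0..T}"
    using 2 by (intro measurable_bounded_by_integrable_imp_absolutely_integrable[where g = "\<lambda>s. 1 + (norm (h s))\<^sup>2"])
      (auto intro!: integrable_add)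
  then show "(\<lambda>s. norm (h s)) integrable_on {0..T}"
    by (simp add: absolutely_integrable_on_def)
qed

lemma integral_norm_control_le:
  assumes h: "L2_control T h" "energy T h \<le> N" and st: "0 \<le> s" "s \<le> t" "t \<le> T"
  shows "integral {s..t} (\<lambda>r. norm (h r)) \<le> sqrt ((t - s) * N)"
proof (rule integral_norm_le_sqrt)
  have sub: "{s..t} \<subseteq> {0..T}" using st by auto
  show "h absolutely_integrable_on {s..t}"
    by (rule absolutely_integrable_on_subinterval[OF L2_controlD(1)[OF h(1)] sub])
  show i: "(\<lambda>r. (norm (h r))\<^sup>2) integrable_on {s..t}"
    by (rule integrable_subinterval_real[OF L2_controlD(3)[OF h(1)] sub])
  have "integral {s..t} (\<lambda>r. (norm (h r))\<^sup>2) \<le> energy T h"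
    unfolding energy_def by (rule integral_subset_le[OF sub i L2_controlD(3)[OF h(1)]]) simp
  then show "integral {s..t} (\<lambda>r. (norm (h r))\<^sup>2) \<le> N" using h by simp
qed (use st in auto)

lemma energy_nonneg: "0 \<le> energy T h"
  unfolding energy_def using integral_nonneg[of "\<lambda>s. (norm (h s))\<^sup>2" "{0..T}"]
  by (cases "(\<lambda>s. (norm (h s))\<^sup>2) integrable_on {0..T}") (auto simp: not_integrable_integral)

locale continuous_coefficients =
  fixes T :: real
    and b :: "real \<Rightarrow> real ^ 'd \<Rightarrow> real ^ 'd"
    and \<sigma> :: "real \<Rightarrow> real ^ 'd \<Rightarrow> real ^ 'm ^ 'd"
  assumes T: "0 < T"
    and b_cont: "continuous_on UNIV (\<lambda>(s, x). b s x)"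
    and \<sigma>_cont: "continuous_on UNIV (\<lambda>(s, x). \<sigma> s x)"
begin

definition field :: "(real \<Rightarrow> real ^ 'm) \<Rightarrow> (real \<Rightarrow> real ^ 'd) \<Rightarrow> real \<Rightarrow> real ^ 'd" where
  "field h Y s = b s (Y s) + \<sigma> s (Y s) *v h s"

text \<open>A function of time rather than its supremum, for two reasons: smallness is only
  available until the path leaves a ball, and the defect is later subtracted from the path, which
  leaves \<open>x\<close> plus the integral of \<open>field h Y\<close>.\<close>

definition defect :: "real ^ 'd \<Rightarrow> (real \<Rightarrow> real ^ 'm) \<Rightarrow> (real \<Rightarrow> real ^ 'd) \<Rightarrow> real \<Rightarrow> real ^ 'd" where
  "defect x h Y t = Y t - x - integral {0..t} (field h Y)"

lemma coefficients_continuous_on: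
  assumes "continuous_on S Y"
  shows "continuous_on S (\<lambda>s. b s (Y s))" "continuous_on S (\<lambda>s. \<sigma> s (Y s))"
proof -
  have *: "continuous_on S (\<lambda>s. (s, Y s))" using assms by (intro continuous_intros)
  show "continuous_on S (\<lambda>s. b s (Y s))" "continuous_on S (\<lambda>s. \<sigma> s (Y s))"
    using continuous_on_compose2[OF b_cont *] continuous_on_compose2[OF \<sigma>_cont *] by auto
qed

lemma coefficients_bounded:
  obtains C where "0 < C" "\<And>s y. s \<in> {0..T} \<Longrightarrow> norm y \<le> R \<Longrightarrow> norm (b s y) \<le> C \<and> norm (\<sigma> s y) \<le> C"
proof -
  have c: "compact ({0..T} \<times> cball (0::real^'d) R)" by (intro compact_Times) auto
  have "bounded ((\<lambda>(s, x). b s x) ` ({0..T} \<times> cball 0 R))" "bounded ((\<lambda>(s, x). \<sigma> s x) ` ({0..T} \<times> cball 0 R))"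
    by (auto intro!: compact_imp_bounded compact_continuous_image c continuous_on_subset[OF b_cont] continuous_on_subset[OF \<sigma>_cont])
  then obtain C1 C2 where C1: "\<And>p. p \<in> {0..T} \<times> cball 0 R \<Longrightarrow> norm ((\<lambda>(s, x). b s x) p) \<le> C1"
    and C2: "\<And>p. p \<in> {0..T} \<times> cball 0 R \<Longrightarrow> norm ((\<lambda>(s, x). \<sigma> s x) p) \<le> C2"
    unfolding bounded_iff ball_simps by blast
  show ?thesis
  proof
    show "norm (b s y) \<le> max 1 (max C1 C2) \<and> norm (\<sigma> s y) \<le> max 1 (max C1 C2)"
      if "s \<in> {0..T}" "norm y \<le> R" for s y
      using C1[of "(s, y)"] C2[of "(s, y)"] that by auto
  qed auto
qed

lemma coefficients_uniformly_continuous: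
  assumes "0 < e"
  obtains d where "0 < d" "\<And>s s' y y'. s \<in> {0..T} \<Longrightarrow> s' \<in> {0..T} \<Longrightarrow> norm y \<le> R \<Longrightarrow> norm y' \<le> R \<Longrightarrow>
      \<bar>s - s'\<bar> \<le> d \<Longrightarrow> norm (y - y') \<le> d \<Longrightarrow> norm (b s y - b s' y') \<le> e \<and> norm (\<sigma> s y - \<sigma> s' y') \<le> e"
proof -
  let ?S = "{0..T} \<times> cball (0::real^'d) R"
  have c: "compact ?S" by (intro compact_Times) auto
  have "uniformly_continuous_on ?S (\<lambda>(s, x). b s x)"
    by (intro compact_uniformly_continuous c continuous_on_subset[OF b_cont]) auto
  from uniformly_continuous_onE[OF this assms] obtain d1 where d1: "0 < d1"
    "\<And>p q. p \<in> ?S \<Longrightarrow> q \<in> ?S \<Longrightarrow> dist q p < d1 \<Longrightarrow> dist ((\<lambda>(s, x). b s x) q) ((\<lambda>(s, x). b s x) p) < e"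
    by blast
  have "uniformly_continuous_on ?S (\<lambda>(s, x). \<sigma> s x)"
    by (intro compact_uniformly_continuous c continuous_on_subset[OF \<sigma>_cont]) auto
  from uniformly_continuous_onE[OF this assms] obtain d2 where d2: "0 < d2"
    "\<And>p q. p \<in> ?S \<Longrightarrow> q \<in> ?S \<Longrightarrow> dist q p < d2 \<Longrightarrow> dist ((\<lambda>(s, x). \<sigma> s x) q) ((\<lambda>(s, x). \<sigma> s x) p) < e"
    by blast
  show ?thesis
  proof
    \<comment> \<open>A third for each coordinate: the distance in the product is at most the sum of
      the two, hence strictly below both \<open>d1\<close> and \<open>d2\<close>.\<close>
    show "0 < min d1 d2 / 3" using d1 d2 by simp
    fix s s' :: real and y y' :: "real^'d"
    assume *: "s \<in> {0..T}" "s' \<in> {0..T}" "norm y \<le> R" "norm y' \<le> R"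
      "\<bar>s - s'\<bar> \<le> min d1 d2 / 3" "norm (y - y') \<le> min d1 d2 / 3"
    have "dist (s, y) (s', y') \<le> \<bar>s - s'\<bar> + norm (y - y')"
      using sqrt_sum_squares_le_sum_abs[of "dist s s'" "dist y y'"] by (simp add: dist_Pair_Pair dist_real_def dist_norm[of y])
    then have "dist (s, y) (s', y') < d1" "dist (s, y) (s', y') < d2"
      using * d1(1) d2(1) by auto
    then show "norm (b s y - b s' y') \<le> e \<and> norm (\<sigma> s y - \<sigma> s' y') \<le> e"
      using d1(2)[of "(s', y')" "(s, y)"] d2(2)[of "(s', y')" "(s, y)"] * by (auto simp: dist_norm)
  qed
qed

lemma field_absolutely_integrable:
  assumes "continuous_on {0..T} Y" "L2_control T h" "t \<le> T"
  shows "field h Y absolutely_integrable_on {0..t}"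
proof -
  have "(\<lambda>s. b s (Y s) + \<sigma> s (Y s) *v h s) absolutely_integrable_on {0..T}"
    by (intro set_integral_add(1) absolutely_integrable_continuous_real
        absolutely_integrable_matrix_vector_mult coefficients_continuous_on assms L2_controlD)
  then show ?thesis
    unfolding field_def[abs_def] by (rule absolutely_integrable_on_subinterval) (use assms(3) in auto)
qed

text \<open>The control enters only through its energy, by Cauchy-Schwarz. The bound tends to 0 with
  \<open>t - s\<close>, so it acts as a common modulus of continuity for all solutions in a
  ball.\<close>

lemma integral_field_norm_le:
  assumes Y: "continuous_on {0..T} Y" and h: "L2_control T h" "energy T h \<le> N"
    and C: "0 \<le> C" "\<And>r. r \<in> {s..t} \<Longrightarrow> norm (b r (Y r)) \<le> C \<and> norm (\<sigma> r (Y r)) \<le> C"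
    and st: "0 \<le> s" "s \<le> t" "t \<le> T"
  shows "integral {s..t} (\<lambda>r. norm (field h Y r)) \<le> C * (t - s) + C * sqrt ((t - s) * N)"
proof -
  have sub: "{s..t} \<subseteq> {0..T}" using st by auto
  have 1: "(\<lambda>r. norm (field h Y r)) integrable_on {s..t}"
    using absolutely_integrable_on_subinterval[OF field_absolutely_integrable[OF Y h(1) order_refl] sub]
    by (simp add: absolutely_integrable_on_def)
  have 2: "(\<lambda>r. norm (h r)) integrable_on {s..t}"
    by (rule integrable_subinterval_real[OF L2_controlD(4)[OF h(1)] sub])
  have "integral {s..t} (\<lambda>r. norm (field h Y r)) \<le> integral {s..t} (\<lambda>r. C + C * norm (h r))"
  proof (rule integral_le[OF 1])
    show "(\<lambda>r. C + C * norm (h r)) integrable_on {s..t}"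
      by (intro integrable_add integrable_on_mult_right 2) auto
    fix r assume r: "r \<in> {s..t}"
    have "norm (\<sigma> r (Y r) *v h r) \<le> norm (\<sigma> r (Y r)) * norm (h r)" by (rule norm_matrix_vector_mult_le)
    also have "\<dots> \<le> C * norm (h r)" using C(2)[OF r] by (intro mult_right_mono) auto
    finally show "norm (field h Y r) \<le> C + C * norm (h r)"
      unfolding field_def using C(2)[OF r] by (intro norm_triangle_le) auto
  qed
  also have "\<dots> = C * (t - s) + C * integral {s..t} (\<lambda>r. norm (h r))"
    using st by (subst Henstock_Kurzweil_Integration.integral_add) (auto intro!: integrable_on_mult_right 2)
  also have "\<dots> \<le> C * (t - s) + C * sqrt ((t - s) * N)"
    using integral_norm_control_le[OF h st] C(1) by (intro add_left_mono mult_left_mono)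
  finally show ?thesis .
qed

text \<open>The two fields differ by increments of \<open>b\<close> and of \<open>\<sigma>\<close>
  times the control, and the control has bounded L1 norm. So the modulus of uniform continuity of
  the coefficients yields one \<open>d\<close> for all controls of energy at most
  \<open>N\<close>.\<close>

lemma integral_field_close:
  assumes "0 < e" "0 \<le> N"
  obtains d where "0 < d" "\<And>h Y Y' t. L2_control T h \<Longrightarrow> energy T h \<le> N \<Longrightarrow> continuous_on {0..T} Y \<Longrightarrow>
      continuous_on {0..T} Y' \<Longrightarrow> t \<in> {0..T} \<Longrightarrow> (\<And>s. s \<in> {0..t} \<Longrightarrow> norm (Y s) \<le> R \<and> norm (Y' s) \<le> R) \<Longrightarrow>
      (\<And>s. s \<in> {0..t} \<Longrightarrow> norm (Y s - Y' s) \<le> d) \<Longrightarrow>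
      norm (integral {0..t} (field h Y) - integral {0..t} (field h Y')) \<le> e"
proof -
  \<comment> \<open>Bounds the integral of \<open>1 + norm (h s)\<close> over the whole interval;
    hence the tolerance \<open>e / W\<close> for the coefficients.\<close>
  define W where "W = T + sqrt (T * N)"
  have W: "0 < W" using T assms by (simp add: W_def add_pos_nonneg)
  obtain d where d: "0 < d" "\<And>s s' y y'. s \<in> {0..T} \<Longrightarrow> s' \<in> {0..T} \<Longrightarrow> norm y \<le> R \<Longrightarrow> norm y' \<le> R \<Longrightarrow>
      \<bar>s - s'\<bar> \<le> d \<Longrightarrow> norm (y - y') \<le> d \<Longrightarrow> norm (b s y - b s' y') \<le> e / W \<and> norm (\<sigma> s y - \<sigma> s' y') \<le> e / W"
    using coefficients_uniformly_continuous[of "e / W" R] assms W by auto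
  show ?thesis
  proof (rule that[OF d(1)])
    fix h :: "real \<Rightarrow> real ^ 'm" and Y Y' :: "real \<Rightarrow> real ^ 'd" and t
    assume h: "L2_control T h" "energy T h \<le> N" and Y: "continuous_on {0..T} Y" "continuous_on {0..T} Y'"
      and t: "t \<in> {0..T}" and R: "\<And>s. s \<in> {0..t} \<Longrightarrow> norm (Y s) \<le> R \<and> norm (Y' s) \<le> R"
      and close: "\<And>s. s \<in> {0..t} \<Longrightarrow> norm (Y s - Y' s) \<le> d"
    have i: "field h Y integrable_on {0..t}" "field h Y' integrable_on {0..t}"
      using field_absolutely_integrable[OF Y(1) h(1), of t] field_absolutely_integrable[OF Y(2) h(1), of t] t
      by (auto simp: absolutely_integrable_on_def)
    have hn: "(\<lambda>s. norm (h s)) integrable_on {0..t}"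
      by (rule integrable_subinterval_real[OF L2_controlD(4)[OF h(1)]]) (use t in auto)
    have "norm (integral {0..t} (field h Y) - integral {0..t} (field h Y')) = norm (integral {0..t} (\<lambda>s. field h Y s - field h Y' s))"
      using i by (simp add: Henstock_Kurzweil_Integration.integral_diff)
    also have "\<dots> \<le> integral {0..t} (\<lambda>s. e / W + e / W * norm (h s))"
    proof (rule integral_norm_bound_integral)
      show "(\<lambda>s. field h Y s - field h Y' s) integrable_on {0..t}" by (intro integrable_diff i)
      show "(\<lambda>s. e / W + e / W * norm (h s)) integrable_on {0..t}"
        by (intro integrable_add integrable_on_mult_right hn) auto
      fix s assume s: "s \<in> {0..t}"
      have *: "norm (b s (Y s) - b s (Y' s)) \<le> e / W" "norm (\<sigma> s (Y s) - \<sigma> s (Y' s)) \<le> e / W"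
        using d(2)[of s s "Y s" "Y' s"] s t R[OF s] close[OF s] d(1) by auto
      have "norm ((\<sigma> s (Y s) - \<sigma> s (Y' s)) *v h s) \<le> norm (\<sigma> s (Y s) - \<sigma> s (Y' s)) * norm (h s)"
        by (rule norm_matrix_vector_mult_le)
      also have "\<dots> \<le> e / W * norm (h s)" using * by (intro mult_right_mono) auto
      finally have "norm ((b s (Y s) - b s (Y' s)) + (\<sigma> s (Y s) - \<sigma> s (Y' s)) *v h s) \<le> e / W + e / W * norm (h s)"
        using * by (intro norm_triangle_le) auto
      then show "norm (field h Y s - field h Y' s) \<le> e / W + e / W * norm (h s)"
        by (simp add: field_def matrix_vector_mult_diff_rdistrib algebra_simps)
    qed
    also have "\<dots> = e / W * t + e / W * integral {0..t} (\<lambda>s. norm (h s))"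
      using t by (subst Henstock_Kurzweil_Integration.integral_add[OF _ integrable_on_mult_right[OF hn]]) auto
    also have "\<dots> = e / W * (t + integral {0..t} (\<lambda>s. norm (h s)))"
      by (simp add: algebra_simps)
    also have "\<dots> \<le> e / W * W"
    proof (rule mult_left_mono)
      have "integral {0..t} (\<lambda>s. norm (h s)) \<le> sqrt ((t - 0) * N)"
        using integral_norm_control_le[OF h, of 0 t] t by auto
      also have "\<dots> \<le> sqrt (T * N)" using t assms by (auto intro!: mult_right_mono)
      finally show "t + integral {0..t} (\<lambda>s. norm (h s)) \<le> W" using t by (auto simp: W_def)
    qed (use assms W in auto)
    finally show "norm (integral {0..t} (field h Y) - integral {0..t} (field h Y')) \<le> e" using W by simp
  qed
qed

lemma skeleton_solution_iff:
  assumes h: "L2_control T h"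
  shows "skeleton_solution T b \<sigma> x h \<phi> \<longleftrightarrow>
    \<phi> \<in> mspace (path_space T) \<and> (\<forall>t\<in>{0..T}. defect x h \<phi> t = 0)"
proof -
  have *: "(LINT s:{0..t}|lebesgue. b s (\<phi> s)) + (LINT s:{0..t}|lebesgue. \<sigma> s (\<phi> s) *v h s)
      = integral {0..t} (field h \<phi>)" if \<phi>: "continuous_on {0..T} \<phi>" and t: "t \<in> {0..T}" for t
  proof -
    have \<phi>t: "continuous_on {0..t} \<phi>" and ht: "h absolutely_integrable_on {0..t}"
      by (rule continuous_on_subset[OF \<phi>] absolutely_integrable_on_subinterval[OF L2_controlD(1)[OF h]];
          use t in simp)+
    have "(\<lambda>s. b s (\<phi> s)) absolutely_integrable_on {0..t}" "(\<lambda>s. \<sigma> s (\<phi> s) *v h s) absolutely_integrable_on {0..t}"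
      by (intro absolutely_integrable_continuous_real
        absolutely_integrable_matrix_vector_mult coefficients_continuous_on ht \<phi>t)+
    then show ?thesis
      unfolding field_def[abs_def]
      by (simp add: set_lebesgue_integral_eq_integral Henstock_Kurzweil_Integration.integral_add)
  qed
  have "(\<phi> t = x + (LINT s:{0..t}|lebesgue. b s (\<phi> s)) + (LINT s:{0..t}|lebesgue. \<sigma> s (\<phi> s) *v h s))
      \<longleftrightarrow> defect x h \<phi> t = 0" if "continuous_on {0..T} \<phi>" "t \<in> {0..T}" for t
    unfolding defect_def add.assoc *[OF that] diff_diff_eq right_minus_eq by (rule refl)
  note iff = this
  show ?thesis
    unfolding skeleton_solution_def
  proof (intro conj_cong refl ball_cong)
    fix t assume "\<phi> \<in> mspace (path_space T)" "t \<in> {0..T}"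
    then show "(\<phi> t = x + (LINT s:{0..t}|lebesgue. b s (\<phi> s)) + (LINT s:{0..t}|lebesgue. \<sigma> s (\<phi> s) *v h s))
      \<longleftrightarrow> defect x h \<phi> t = 0"
      by (intro iff) (auto simp: mspace_path_space)
  qed
qed

end

section \<open>Lyapunov bounds\<close>

locale osgood_lyapunov = continuous_coefficients T b \<sigma>
  for T :: real and b :: "real \<Rightarrow> real ^ 'd \<Rightarrow> real ^ 'd" and \<sigma> :: "real \<Rightarrow> real ^ 'd \<Rightarrow> real ^ 'm ^ 'd" +
  fixes \<epsilon>0 \<theta> eta K Mc :: real and f g l \<gamma> :: "real \<Rightarrow> real" and \<eta> :: "real \<Rightarrow> real \<Rightarrow> real"
    and V :: "real ^ 'd \<Rightarrow> real"
  assumes f: "set_integrable lebesgue {0..T} f" "\<forall>s\<in>{0..T}. 0 \<le> f s"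
    and g: "set_integrable lebesgue {0..T} g" "\<forall>s\<in>{0..T}. 0 \<le> g s"
    and l: "set_integrable lebesgue {0..T} l" "\<forall>s\<in>{0..T}. 0 \<le> l s"
    and A2: "0 < \<epsilon>0" "\<epsilon>0 < 1"
      "\<forall>R>0. (\<forall>u\<in>{0..<1}. 0 \<le> \<eta> R u) \<and> mono_on {0..<1} (\<eta> R) \<and> continuous_on {0..<1} (\<eta> R)
         \<and> \<eta> R 0 = 0
         \<and> (\<forall>\<delta>\<in>{0<..<1}. (\<integral>\<^sup>+u\<in>{0<..<\<delta>}. 1 / ennreal (\<eta> R u) \<partial>lborel) = \<infinity>)"
      "\<forall>R>0. \<forall>x y. \<forall>s\<in>{0..T}. max (norm x) (norm y) \<le> R \<and> norm (x - y) \<le> \<epsilon>0 \<longrightarrow>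
         2 * ((x - y) \<bullet> (b s x - b s y)) + (norm (\<sigma> s x - \<sigma> s y))\<^sup>2
           \<le> g s * \<eta> R ((norm (x - y))\<^sup>2)"
    and A3: "C2 V" "\<forall>x. 0 \<le> V x" "filterlim V at_top at_infinity"
      "0 < \<theta>" "0 < eta" "0 < K" "0 < Mc"
      "\<forall>u\<in>{0..}. 0 \<le> \<gamma> u" "mono_on {0..} \<gamma>" "continuous_on {0..} \<gamma>"
      "(\<integral>\<^sup>+u\<in>{0..}. ennreal (1 / (\<gamma> u + 1)) \<partial>lborel) = \<infinity>"
      "\<forall>s\<in>{0..T}. \<forall>x.
         b s x \<bullet> gradient V x
           + \<theta> / 2 * trace (transpose (\<sigma> s x) ** hessian V x ** \<sigma> s x)
           + (norm (transpose (\<sigma> s x) *v gradient V x))\<^sup>2 / (eta * V x)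
         \<le> f s * (1 + \<gamma> (V x))"
      "\<forall>s\<in>{0..T}. \<forall>x.
         trace (transpose (\<sigma> s x) ** hessian V x ** \<sigma> s x) \<ge> - l s * (Mc + K * \<gamma> (V x))"
begin

lemma gradient_V: "GDERIV V x :> gradient V x"
  using A3(1) by (simp add: C2_def)

lemma continuous_gradient_V: "continuous_on S (gradient V)"
  using A3(1) by (auto simp: C2_def intro!: continuous_at_imp_continuous_on has_derivative_continuous)

lemma continuous_V: "continuous_on S V"
  using gradient_V by (auto simp: gderiv_def intro!: continuous_at_imp_continuous_on has_derivative_continuous)

text \<open>Young's inequality splits the pairing of the control with
  \<open>transpose (\<sigma> s y) *v gradient V y\<close> into the quotient by
  \<open>eta * V y\<close> and \<open>eta / 4\<close> times \<open>V y\<close> times the squared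
  control. The first Lyapunov inequality takes care of the quotient; the trace that it also contains
  is cancelled by the second. The remaining multiple of \<open>V y\<close> explains the summand
  \<open>V y\<close> in the last factor.\<close>

lemma lyapunov_growth:
  assumes s: "s \<in> {0..T}"
  shows "gradient V y \<bullet> (b s y + \<sigma> s y *v h)
    \<le> (f s + \<theta> / 2 * max Mc K * l s + eta / 4 * (norm h)\<^sup>2) * (1 + \<gamma> (V y) + V y)"
proof -
  define a where "a = norm (transpose (\<sigma> s y) *v gradient V y)"
  define v where "v = V y"
  define Tr where "Tr = trace (transpose (\<sigma> s y) ** hessian V y ** \<sigma> s y)"
  have v: "0 \<le> v" and gv: "0 \<le> \<gamma> v" using A3(2,8) by (auto simp: v_def)
  have 1: "gradient V y \<bullet> (\<sigma> s y *v h) \<le> norm h * a"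
    unfolding a_def by (metis inner_commute inner_matrix_vector_mult norm_cauchy_schwarz)
  \<comment> \<open>Where \<open>V\<close> vanishes the quotient is 0 by the convention for
    division, but so is \<open>a\<close>.\<close>
  have 2: "norm h * a \<le> a\<^sup>2 / (eta * v) + eta / 4 * v * (norm h)\<^sup>2"
  proof (cases "v = 0")
    case True
    then have "gradient V y = 0"
      using gradient_eq_0_at_min[OF gradient_V, of y] A3(2) by (simp add: v_def)
    then show ?thesis using True by (simp add: a_def)
  next
    case False
    then have ev: "0 < eta * v" using v A3(5) by simp
    have "0 \<le> (2 * a - eta * v * norm h)\<^sup>2" by simp
    then have "norm h * a * (4 * (eta * v)) \<le> 4 * a\<^sup>2 + (eta * v)\<^sup>2 * (norm h)\<^sup>2"
      by (simp add: power2_eq_square algebra_simps)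
    then have "norm h * a \<le> (4 * a\<^sup>2 + (eta * v)\<^sup>2 * (norm h)\<^sup>2) / (4 * (eta * v))"
      using ev by (simp add: pos_le_divide_eq)
    also have "\<dots> = a\<^sup>2 / (eta * v) + eta / 4 * v * (norm h)\<^sup>2"
      using ev False A3(5) by (simp add: field_simps power2_eq_square)
    finally show ?thesis .
  qed
  have 3: "b s y \<bullet> gradient V y + \<theta> / 2 * Tr + a\<^sup>2 / (eta * v) \<le> f s * (1 + \<gamma> v)"
    using A3(12) s by (simp add: a_def v_def Tr_def)
  have l0: "0 \<le> l s" and f0: "0 \<le> f s" using l f s by auto
  have "- Tr \<le> l s * (Mc + K * \<gamma> v)"
    using A3(13)[rule_format, OF s, of y] by (simp add: v_def Tr_def)
  \<comment> \<open>Replacing both constants by their maximum makes the trace bound a multiple of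
    \<open>1 + \<gamma> v\<close>, the shape of the first Lyapunov inequality.\<close>
  also have "\<dots> \<le> l s * (max Mc K * (1 + \<gamma> v))"
  proof (rule mult_left_mono[OF _ l0])
    have "K * \<gamma> v \<le> max Mc K * \<gamma> v" using gv by (intro mult_right_mono) auto
    then show "Mc + K * \<gamma> v \<le> max Mc K * (1 + \<gamma> v)" by (simp add: algebra_simps)
  qed
  finally have "- (\<theta> / 2 * Tr) \<le> \<theta> / 2 * (l s * (max Mc K * (1 + \<gamma> v)))"
    using A3(4) mult_left_mono[of "- Tr" "l s * (max Mc K * (1 + \<gamma> v))" "\<theta> / 2"] by simp
  then have 4: "- (\<theta> / 2 * Tr) \<le> (\<theta> / 2 * max Mc K * l s) * (1 + \<gamma> v)"
    by (simp add: mult_ac)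
  have "gradient V y \<bullet> (b s y + \<sigma> s y *v h)
      \<le> (f s + \<theta> / 2 * max Mc K * l s) * (1 + \<gamma> v) + eta / 4 * (norm h)\<^sup>2 * v"
    using 1 2 3 4 unfolding inner_add_right inner_commute[of "gradient V y" "b s y"] distrib_right mult.assoc[of "eta / 4"] mult.commute[of v]
    by linarith
  also have "\<dots> \<le> (f s + \<theta> / 2 * max Mc K * l s) * (1 + \<gamma> v + v) + eta / 4 * (norm h)\<^sup>2 * (1 + \<gamma> v + v)"
  proof (rule add_mono)
    show "(f s + \<theta> / 2 * max Mc K * l s) * (1 + \<gamma> v) \<le> (f s + \<theta> / 2 * max Mc K * l s) * (1 + \<gamma> v + v)"
      using v l0 f0 A3(4-7) by (intro mult_left_mono) auto
    show "eta / 4 * (norm h)\<^sup>2 * v \<le> eta / 4 * (norm h)\<^sup>2 * (1 + \<gamma> v + v)"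
      using gv A3(5) by (intro mult_left_mono) auto
  qed
  finally show ?thesis by (simp add: v_def algebra_simps)
qed

lemma sublevel_set_bounded:
  obtains R where "0 < R" "\<And>x. V x \<le> c \<Longrightarrow> norm x < R"
proof -
  have "\<forall>\<^sub>F x in at_infinity. c + 1 \<le> V x"
    using A3(3) by (simp add: filterlim_at_top)
  then obtain r where "\<And>x. r \<le> norm x \<Longrightarrow> c + 1 \<le> V x"
    by (auto simp: eventually_at_infinity)
  then have "norm x < max r 1" if "V x \<le> c" for x
    using that by (metis add_le_same_cancel1 dual_order.trans linorder_not_le not_one_le_zero max.coboundedI1 max.cobounded1 less_max_iff_disj)
  then show ?thesis using that[of "max r 1"] by auto
qed

text \<open>At the first time with norm \<open>R\<close> the defect has been small so far, so the
  assumption applies on the whole interval up to that time. Bihari's inequality then keeps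
  \<open>V\<close> below the level \<open>R1\<close>, whose sublevel set lies strictly inside the
  ball: a contradiction. Order of choices: \<open>J\<close> from the total growth \<open>G\<close>,
  then \<open>R1\<close>, then \<open>R\<close>, and only then the tolerance
  \<open>e\<close>.\<close>

lemma approximate_solution_bounded:
  assumes A: "bounded A" and N: "0 \<le> N"
  obtains R e where "0 < R" "0 < e" "\<And>x h Y t. x \<in> A \<Longrightarrow> L2_control T h \<Longrightarrow> energy T h \<le> N \<Longrightarrow>
     continuous_on {0..T} Y \<Longrightarrow> Y 0 \<in> A \<Longrightarrow>
     (\<And>t. t \<in> {0..T} \<Longrightarrow> (\<And>s. s \<in> {0..t} \<Longrightarrow> norm (Y s) \<le> R) \<Longrightarrow> norm (defect x h Y t) \<le> e) \<Longrightarrow>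
     t \<in> {0..T} \<Longrightarrow> norm (Y t) < R"
proof -
  \<comment> \<open>The coefficient from \<open>lyapunov_growth\<close>. Its integral over
    \<open>{0..T}\<close> is at most \<open>G\<close> for every control of energy at most
    \<open>N\<close>, so a single \<open>J\<close> serves all of them.\<close>
  define k where "k = (\<lambda>h :: real \<Rightarrow> real ^ 'm. \<lambda>s. f s + \<theta> / 2 * max Mc K * l s + eta / 4 * (norm (h s))\<^sup>2)"
  define \<Gamma> where "\<Gamma> = (\<lambda>u. 1 + \<gamma> u + u)"
  define G where "G = integral {0..T} f + \<theta> / 2 * max Mc K * integral {0..T} l + eta / 4 * N"
  \<comment> \<open>The 2 leaves room for the shift by 1 in \<open>?v\<close> and for the total
    error 1 made by evaluating the gradient at the wrong point.\<close>
  obtain c0 where c0: "0 < c0" "\<And>x. x \<in> A \<Longrightarrow> V x + 2 \<le> c0"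
  proof -
    have "compact (closure A)" using A by (simp add: compact_closure)
    then have "bounded (V ` closure A)"
      by (intro compact_imp_bounded compact_continuous_image continuous_V)
    then obtain B where "\<And>x. x \<in> closure A \<Longrightarrow> norm (V x) \<le> B" by (auto simp: bounded_iff)
    then have B: "\<And>x. x \<in> A \<Longrightarrow> V x \<le> B" using closure_subset[of A] by fastforce
    show ?thesis
    proof
      show "V x + 2 \<le> \<bar>B\<bar> + 2" if "x \<in> A" for x using B[OF that] by simp
    qed simp
  qed
  obtain J where J: "G < (\<Sum>j<J. (c0 * 2 ^ Suc j - c0 * 2 ^ j) / \<Gamma> (c0 * 2 ^ Suc j))"
    using levels_at_infinity[of \<gamma> c0 G] A3 c0 unfolding \<Gamma>_def by auto
  define R1 where "R1 = c0 * 2 ^ J"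
  obtain R where R: "0 < R" "\<And>x. V x \<le> R1 \<Longrightarrow> norm x < R"
    using sublevel_set_bounded by blast
  obtain C where C: "0 < C" "\<And>s y. s \<in> {0..T} \<Longrightarrow> norm y \<le> R \<Longrightarrow> norm (b s y) \<le> C \<and> norm (\<sigma> s y) \<le> C"
    using coefficients_bounded by blast
  \<comment> \<open>Bounds the integral of the norm of the field inside the ball. A gradient error
    below \<open>1 / W\<close> therefore costs at most 1 over the whole interval.\<close>
  define W where "W = C * T + C * sqrt (T * N)"
  have W: "0 < W" using C T N by (simp add: W_def add_pos_nonneg)
  have cb: "compact (cball (0::real^'d) (R + 1))" by simp
  have "uniformly_continuous_on (cball 0 (R + 1)) (gradient V)" "uniformly_continuous_on (cball 0 (R + 1)) V"
    by (intro compact_uniformly_continuous continuous_gradient_V continuous_V cb)+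
  from uniformly_continuous_onE[OF this(1), of "1 / W"] uniformly_continuous_onE[OF this(2), of 1] W
  obtain d1 d2 where d1: "0 < d1" "\<And>y z. y \<in> cball 0 (R + 1) \<Longrightarrow> z \<in> cball 0 (R + 1) \<Longrightarrow> dist z y < d1 \<Longrightarrow> dist (gradient V z) (gradient V y) < 1 / W"
    and d2: "0 < d2" "\<And>y z. y \<in> cball 0 (R + 1) \<Longrightarrow> z \<in> cball 0 (R + 1) \<Longrightarrow> dist z y < d2 \<Longrightarrow> dist (V z) (V y) < 1"
    by (metis zero_less_divide_1_iff zero_less_one)
  define e where "e = min 1 (min d1 d2 / 2)"
  have e: "0 < e" "e \<le> 1" "e < d1" "e < d2" using d1(1) d2(1) by (auto simp: e_def)
  show ?thesis
  proof (rule that[OF R(1) e(1)], rule ccontr)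
    fix x h Y t
    assume x: "x \<in> A" and h: "L2_control T h" "energy T h \<le> N" and Y: "continuous_on {0..T} Y" and Y0: "Y 0 \<in> A"
      and def: "\<And>t. t \<in> {0..T} \<Longrightarrow> (\<And>s. s \<in> {0..t} \<Longrightarrow> norm (Y s) \<le> R) \<Longrightarrow> norm (defect x h Y t) \<le> e"
      and t: "t \<in> {0..T}" and neg: "\<not> norm (Y t) < R"
    have VA: "V y \<le> R1" if "y \<in> A" for y
    proof -
      have "c0 * 1 \<le> R1" unfolding R1_def using c0 by (intro mult_left_mono) auto
      then show ?thesis using c0(2)[OF that] by simp
    qed
    obtain \<tau> where \<tau>: "\<tau> \<in> {0..T}" "norm (Y \<tau>) = R" and YR: "\<And>s. s \<in> {0..\<tau>} \<Longrightarrow> norm (Y s) \<le> R"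
    proof (rule first_hit[of T "\<lambda>s. norm (Y s)" R t])
      show "continuous_on {0..T} (\<lambda>s. norm (Y s))" using Y by (rule continuous_on_norm)
    qed (use t neg R(2)[OF VA[OF Y0]] in auto)
    define E where "E = defect x h Y"
    \<comment> \<open>\<open>P\<close> starts at \<open>x\<close> and has the integrable velocity
      \<open>field h Y\<close>, so the chain rule applies to it. That velocity is evaluated along
      \<open>Y\<close>, not along \<open>P\<close>; hence the comparisons of \<open>V\<close> and of
      its gradient between the two paths.\<close>
    define P where "P = (\<lambda>s. Y s - E s)"
    have P: "P s = x + integral {0..s} (field h Y)" for s by (simp add: P_def E_def defect_def)
    have E: "norm (E s) \<le> e" if "s \<in> {0..\<tau>}" for s
      unfolding E_def by (rule def) (use that \<tau> YR in auto)
    have fi: "field h Y absolutely_integrable_on {0..s}" if "s \<in> {0..\<tau>}" for s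
      using field_absolutely_integrable[OF Y h(1)] that \<tau> by auto
    have fi1: "field h Y integrable_on {0..\<tau>}"
      using fi[of \<tau>] \<tau> by (auto simp: absolutely_integrable_on_def)
    have Pc: "continuous_on {0..\<tau>} P"
      unfolding P[abs_def] by (intro continuous_intros indefinite_integral_continuous_1 fi1)
    have PV: "continuous_on {0..\<tau>} (\<lambda>s. V (P s))" "continuous_on {0..\<tau>} (\<lambda>s. gradient V (P s))"
      using continuous_on_compose2[OF continuous_V Pc] continuous_on_compose2[OF continuous_gradient_V Pc] by auto
    have near: "\<bar>V (P s) - V (Y s)\<bar> < 1" "norm (gradient V (P s) - gradient V (Y s)) < 1 / W" if "s \<in> {0..\<tau>}" for s
    proof -
      have "norm (P s) \<le> norm (Y s) + norm (E s)" unfolding P_def by (rule norm_triangle_ineq4)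
      then have in_ball: "P s \<in> cball 0 (R + 1)" "Y s \<in> cball 0 (R + 1)"
        using YR[OF that] E[OF that] e by auto
      have "dist (P s) (Y s) \<le> e" using E[OF that] by (simp add: P_def dist_norm)
      then show "\<bar>V (P s) - V (Y s)\<bar> < 1" "norm (gradient V (P s) - gradient V (Y s)) < 1 / W"
        using d1(2)[OF in_ball(2,1)] d2(2)[OF in_ball(2,1)] e by (auto simp: dist_norm dist_real_def)
    qed
    have kint: "k h absolutely_integrable_on {0..T}"
      unfolding k_def by (intro set_integral_add set_integrable_mult_right f l L2_controlD h)
    have k0: "0 \<le> k h s" if "s \<in> {0..T}" for s
      unfolding k_def using that f l A3(4-7) by (intro add_nonneg_nonneg mult_nonneg_nonneg) auto
    have Gc: "continuous_on {0..} \<Gamma>" unfolding \<Gamma>_def by (intro continuous_intros A3)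
    have Gm: "mono_on {0..} \<Gamma>"
      using A3(9) by (auto simp: \<Gamma>_def mono_on_def intro!: add_mono)
    have Gp: "0 < \<Gamma> u" if "0 \<le> u" for u using A3(8) that by (auto simp: \<Gamma>_def add_pos_nonneg)
    have k\<tau>: "k h absolutely_integrable_on {0..s}" if "s \<in> {0..\<tau>}" for s
      by (rule absolutely_integrable_on_subinterval[OF kint]) (use that \<tau> in auto)
    \<comment> \<open>The shift by 1 makes \<open>?v s\<close> an upper bound for
      \<open>V (Y s)\<close>, so that monotonicity of \<Gamma> can be used.\<close>
    let ?v = "\<lambda>s. V (P s) + 1"
    have vc: "continuous_on {0..\<tau>} ?v" by (intro continuous_intros PV)
    have v0: "0 \<le> ?v s" for s using A3(2) by (simp add: add_nonneg_nonneg)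
    have "?v \<tau> < c0 * 2 ^ J"
    proof (rule bihari_bound[where v = ?v and J = J and k = "k h" and \<Gamma> = \<Gamma> and c = c0 and L = "\<lambda>j. c0 * 2 ^ j"])
      show "?v t \<le> c0 + integral {0..t} (\<lambda>s. k h s * \<Gamma> (?v s))" if t: "t \<in> {0..\<tau>}" for t
      proof -
        have sub: "{0..t} \<subseteq> {0..\<tau>}" using t by auto
        have i1: "(\<lambda>s. gradient V (P s) \<bullet> field h Y s) integrable_on {0..t}"
          by (rule set_lebesgue_integral_eq_integral(1), rule absolutely_integrable_inner_continuous)
             (use continuous_on_subset[OF PV(2) sub] fi[OF t] in auto)
        have "continuous_on {0..t} (\<lambda>s. \<Gamma> (?v s))"
          by (rule continuous_on_compose2[OF Gc continuous_on_subset[OF vc sub]]) (use v0 in auto)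
        then have i2: "(\<lambda>s. k h s * \<Gamma> (?v s)) integrable_on {0..t}"
          by (intro set_lebesgue_integral_eq_integral(1) absolutely_integrable_mult_continuous k\<tau> t)
        have i3: "(\<lambda>s. norm (field h Y s)) integrable_on {0..t}"
          using fi[OF t] by (simp add: absolutely_integrable_on_def)
        have Px: "P 0 = x" by (simp add: P)
        have "V (P t) - V (P 0) = integral {0..t} (\<lambda>s. gradient V (P s) \<bullet> field h Y s)"
          by (rule chain_rule_integral[OF fi[OF t] _ P gradient_V continuous_gradient_V]) (use t in auto)
        also have "\<dots> \<le> integral {0..t} (\<lambda>s. k h s * \<Gamma> (?v s) + 1 / W * norm (field h Y s))"
        proof (rule integral_le[OF i1 integrable_add[OF i2 integrable_on_mult_right[OF i3]]])
          fix s assume s: "s \<in> {0..t}"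
          then have s\<tau>: "s \<in> {0..\<tau>}" and sT: "s \<in> {0..T}" using t \<tau> by auto
          have "(gradient V (P s) - gradient V (Y s)) \<bullet> field h Y s \<le> norm (gradient V (P s) - gradient V (Y s)) * norm (field h Y s)"
            by (rule norm_cauchy_schwarz)
          also have "\<dots> \<le> 1 / W * norm (field h Y s)"
            using near(2)[OF s\<tau>] by (intro mult_right_mono) auto
          finally have a: "(gradient V (P s) - gradient V (Y s)) \<bullet> field h Y s \<le> 1 / W * norm (field h Y s)" .
          have "gradient V (Y s) \<bullet> field h Y s \<le> k h s * \<Gamma> (V (Y s))"
            using lyapunov_growth[OF sT, of "Y s" "h s"] by (simp add: k_def \<Gamma>_def field_def)
          also have "\<dots> \<le> k h s * \<Gamma> (?v s)"
            using near(1)[OF s\<tau>] A3(2) by (intro mult_left_mono k0 sT mono_onD[OF Gm]) (auto simp: v0)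
          finally show "gradient V (P s) \<bullet> field h Y s \<le> k h s * \<Gamma> (?v s) + 1 / W * norm (field h Y s)"
            using a by (simp add: inner_diff_left)
        qed
        also have "\<dots> = integral {0..t} (\<lambda>s. k h s * \<Gamma> (?v s)) + 1 / W * integral {0..t} (\<lambda>s. norm (field h Y s))"
          by (subst Henstock_Kurzweil_Integration.integral_add[OF i2 integrable_on_mult_right[OF i3]]) simp
        also have "1 / W * integral {0..t} (\<lambda>s. norm (field h Y s)) \<le> 1 / W * W"
        proof (rule mult_left_mono)
          have "integral {0..t} (\<lambda>s. norm (field h Y s)) \<le> C * (t - 0) + C * sqrt ((t - 0) * N)"
            by (rule integral_field_norm_le[OF Y h]) (use C t \<tau> YR in \<open>auto intro: less_imp_le\<close>)
          also have "\<dots> \<le> W"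
            unfolding W_def using t \<tau> C N by (intro add_mono mult_left_mono real_sqrt_le_mono mult_right_mono) auto
          finally show "integral {0..t} (\<lambda>s. norm (field h Y s)) \<le> W" .
        qed (use W in auto)
        finally show ?thesis using c0(2)[OF x] W by (simp add: Px)
      qed
      show "integral {0..\<tau>} (k h) < (\<Sum>j<J. (c0 * 2 ^ Suc j - c0 * 2 ^ j) / \<Gamma> (c0 * 2 ^ Suc j))"
      proof -
        have fi': "f integrable_on {0..T}"
          by (rule set_lebesgue_integral_eq_integral(1)[OF f(1)])
        have li: "(\<lambda>s. \<theta> / 2 * max Mc K * l s) integrable_on {0..T}"
          by (rule integrable_on_mult_right[OF set_lebesgue_integral_eq_integral(1)[OF l(1)]])
        have hi: "(\<lambda>s. eta / 4 * (norm (h s))\<^sup>2) integrable_on {0..T}"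
          by (rule integrable_on_mult_right[OF L2_controlD(3)[OF h(1)]])
        have "integral {0..\<tau>} (k h) \<le> integral {0..T} (k h)"
          by (rule integral_subset_le)
            (use \<tau> k0 kint k\<tau>[of \<tau>] in \<open>auto intro: set_lebesgue_integral_eq_integral(1)\<close>)
        also have "\<dots> = integral {0..T} f + \<theta> / 2 * max Mc K * integral {0..T} l + eta / 4 * energy T h"
          unfolding k_def energy_def
          by (simp only: Henstock_Kurzweil_Integration.integral_add[OF integrable_add[OF fi' li] hi]
              Henstock_Kurzweil_Integration.integral_add[OF fi' li] integral_mult_right)
        also have "\<dots> \<le> G" unfolding G_def using h(2) A3(5) by (intro add_left_mono mult_left_mono) auto
        finally show ?thesis using J by simp
      qed
      show "continuous_on {0..\<tau>} ?v" by (rule vc)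
    qed (use \<tau> v0 k\<tau>[of \<tau>] k0 Gc Gm Gp c0 in \<open>auto intro: less_imp_le\<close>)
    then have "V (Y \<tau>) \<le> R1" using near(1)[of \<tau>] \<tau> by (auto simp: R1_def)
    then show False using R(2) \<tau>(2) by force
  qed
qed

end

section \<open>Osgood stability\<close>

context osgood_lyapunov begin

text \<open>Twice the pairing with the control is at most the square of the increment of
  \<open>\<sigma>\<close> plus the squared control times the squared distance. The first square is
  the one already contained in the left-hand side of the Osgood condition.\<close>

lemma field_diff_inner_le:
  assumes "0 < R" "s \<in> {0..T}" "norm y \<le> R" "norm z \<le> R" "norm (y - z) \<le> \<epsilon>0"
  shows "2 * ((y - z) \<bullet> ((b s y + \<sigma> s y *v h) - (b s z + \<sigma> s z *v h)))
    \<le> g s * \<eta> R ((norm (y - z))\<^sup>2) + (norm h)\<^sup>2 * (norm (y - z))\<^sup>2"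
proof -
  let ?S = "\<sigma> s y - \<sigma> s z" and ?D = "y - z"
  have 1: "2 * (?D \<bullet> (b s y - b s z)) + (norm ?S)\<^sup>2 \<le> g s * \<eta> R ((norm ?D)\<^sup>2)"
    using A2(4) assms by simp
  have "?D \<bullet> (?S *v h) \<le> norm ?D * norm (?S *v h)" by (rule norm_cauchy_schwarz)
  also have "\<dots> \<le> norm ?D * (norm ?S * norm h)"
    by (intro mult_left_mono norm_matrix_vector_mult_le) auto
  finally have 2: "?D \<bullet> (?S *v h) \<le> norm ?S * (norm h * norm ?D)" by (simp add: mult_ac)
  have "0 \<le> (norm ?S - norm h * norm ?D)\<^sup>2" by simp
  then have 3: "2 * (norm ?S * (norm h * norm ?D)) \<le> (norm ?S)\<^sup>2 + (norm h)\<^sup>2 * (norm ?D)\<^sup>2"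
    by (simp add: power2_diff power_mult_distrib)
  have 4: "(b s y + \<sigma> s y *v h) - (b s z + \<sigma> s z *v h) = (b s y - b s z) + ?S *v h"
    by (simp add: matrix_vector_mult_diff_rdistrib)
  show ?thesis unfolding 4 inner_add_right using 1 2 3 by argo
qed

text \<open>Subtracting both defects makes the difference of the paths absolutely continuous, and
  the chain rule for the squared norm with \<open>field_diff_inner_le\<close> gives an integral
  inequality of Osgood type. Its initial value is governed by \<open>e\<close> and can be put below
  the lowest of \<open>J\<close> levels that end at \<rho> squared; the distance then cannot reach
  \<rho>.\<close>

lemma approximate_solutions_close:
  assumes R: "0 < R" and N: "0 \<le> N" and \<delta>: "0 < \<delta>"
  obtains e where "0 < e" "\<And>x h Y Y' t. L2_control T h \<Longrightarrow> energy T h \<le> N \<Longrightarrow>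
     continuous_on {0..T} Y \<Longrightarrow> continuous_on {0..T} Y' \<Longrightarrow>
     (\<And>s. s \<in> {0..T} \<Longrightarrow> norm (Y s) \<le> R \<and> norm (Y' s) \<le> R \<and> norm (defect x h Y s) \<le> e \<and> norm (defect x h Y' s) \<le> e) \<Longrightarrow>
     t \<in> {0..T} \<Longrightarrow> norm (Y t - Y' t) < \<delta>"
proof -
  \<comment> \<open>At most \<open>\<epsilon>0\<close>, so that the Osgood condition holds until the
    distance reaches \<rho>; also below 1, because \<open>\<eta> R\<close> is controlled on
    \<open>{0..<1}\<close> only.\<close>
  define \<rho> where "\<rho> = min \<delta> \<epsilon>0"
  have \<rho>: "0 < \<rho>" "\<rho> \<le> \<delta>" "\<rho> \<le> \<epsilon>0" "\<rho> < 1" using \<delta> A2(1,2) by (auto simp: \<rho>_def)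
  define c where "c = \<rho>\<^sup>2"
  have c: "0 < c" "c < 1" using \<rho> by (auto simp: c_def power_less_one_iff)
  have \<eta>R: "\<And>u. u \<in> {0..<1} \<Longrightarrow> 0 \<le> \<eta> R u" "mono_on {0..<1} (\<eta> R)" "continuous_on {0..<1} (\<eta> R)"
    "\<And>d. d \<in> {0<..<1} \<Longrightarrow> (\<integral>\<^sup>+u\<in>{0<..<d}. 1 / ennreal (\<eta> R u) \<partial>lborel) = \<infinity>"
    using A2(3) R by auto
  \<comment> \<open>Truncation at \<open>c\<close> extends \<open>\<eta> R\<close> monotonically and
    continuously to the half line, where \<open>?v\<close> takes its values. The summand
    \<open>u\<close> serves the control term.\<close>
  define \<Gamma> where "\<Gamma> = (\<lambda>u. \<eta> R (min u c) + u)"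
  have Gc: "continuous_on {0..} \<Gamma>"
    unfolding \<Gamma>_def using c
    by (intro continuous_on_add continuous_on_compose2[OF \<eta>R(3)] continuous_intros) auto
  have Gm: "mono_on {0..} \<Gamma>"
    using mono_onD[OF \<eta>R(2)] c by (auto simp: \<Gamma>_def mono_on_def intro!: add_mono)
  have Gnn: "u \<le> \<Gamma> u" if "0 \<le> u" for u using \<eta>R(1)[of "min u c"] that c by (auto simp: \<Gamma>_def)
  define G where "G = 2 * integral {0..T} g + 2 * N"
  obtain J where J0: "G < (\<Sum>j<J. (c / 2 ^ j - c / 2 ^ Suc j) / (\<eta> R (c / 2 ^ j) + c / 2 ^ j))"
    using levels_at_zero[of "\<eta> R" c G] \<eta>R c by auto
  \<comment> \<open>\<open>levels_at_zero\<close> counts downwards from \<open>c\<close>, Bihari's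
    inequality upwards; the reversed numbering starts at \<open>c / 2 ^ J\<close> and ends with
    \<open>L J = c\<close>.\<close>
  define L where "L = (\<lambda>j. c / 2 ^ (J - j))"
  have Lpos: "0 < L j" "L j \<le> c" for j
    using c unfolding L_def by (auto simp: divide_le_eq)
  have LS: "L j \<le> L (Suc j)" for j
    unfolding L_def using c by (intro divide_left_mono power_increasing) auto
  have "(\<Sum>j<J. (c / 2 ^ j - c / 2 ^ Suc j) / (\<eta> R (c / 2 ^ j) + c / 2 ^ j))
      = (\<Sum>j<J. (L (Suc j) - L j) / \<Gamma> (L (Suc j)))"
  proof -
    have "(L (Suc j) - L j) / \<Gamma> (L (Suc j))
        = (\<lambda>j. (c / 2 ^ j - c / 2 ^ Suc j) / (\<eta> R (c / 2 ^ j) + c / 2 ^ j)) (J - Suc j)" if "j < J" for j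
    proof -
      have "J - j = Suc (J - Suc j)" using that by simp
      moreover have "min (L (Suc j)) c = L (Suc j)" using Lpos by simp
      ultimately show ?thesis by (simp add: \<Gamma>_def L_def)
    qed
    then show ?thesis
      using sum.nat_diff_reindex[of "\<lambda>j. (c / 2 ^ j - c / 2 ^ Suc j) / (\<eta> R (c / 2 ^ j) + c / 2 ^ j)" J]
      by simp
  qed
  with J0 have J: "G < (\<Sum>j<J. (L (Suc j) - L j) / \<Gamma> (L (Suc j)))" by simp
  obtain C where C: "0 < C" "\<And>s y. s \<in> {0..T} \<Longrightarrow> norm y \<le> R \<Longrightarrow> norm (b s y) \<le> C \<and> norm (\<sigma> s y) \<le> C"
    using coefficients_bounded by blast
  define W where "W = 2 * (C * T + C * sqrt (T * N))"
  have W: "0 < W" using C T N by (simp add: W_def add_pos_nonneg)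
  \<comment> \<open>The second bound keeps the initial distance, at most \<open>2 * e\<close>, below
    \<rho>. The third puts the constant \<open>8 * e\<^sup>2 + 8 * e * W\<close> of the integral
    inequality below \<open>L 0\<close>.\<close>
  define e where "e = min 1 (min (\<rho> / 4) (L 0 / (8 + 8 * W)))"
  have e: "0 < e" "e \<le> 1" "4 * e \<le> \<rho>" "e * (8 + 8 * W) \<le> L 0"
  proof -
    have "e \<le> L 0 / (8 + 8 * W)" by (simp add: e_def)
    then show "e * (8 + 8 * W) \<le> L 0" using W by (simp add: le_divide_eq)
  qed (use Lpos[of 0] W \<rho> in \<open>auto simp: e_def\<close>)
  have e8: "8 * e\<^sup>2 + 8 * e * W \<le> L 0"
  proof -
    have "e\<^sup>2 \<le> e" using e self_le_power[of e 2] by (simp add: power2_eq_square mult_left_le)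
    then show ?thesis using e(4) by (simp add: algebra_simps)
  qed
  show ?thesis
  proof (rule that[OF e(1)], rule ccontr)
    fix x h Y Y' t
    assume h: "L2_control T h" "energy T h \<le> N" and Y: "continuous_on {0..T} Y" and Y': "continuous_on {0..T} Y'"
      and hyp: "\<And>s. s \<in> {0..T} \<Longrightarrow> norm (Y s) \<le> R \<and> norm (Y' s) \<le> R \<and> norm (defect x h Y s) \<le> e \<and> norm (defect x h Y' s) \<le> e"
      and t: "t \<in> {0..T}" and neg: "\<not> norm (Y t - Y' t) < \<delta>"
    define D where "D = (\<lambda>s. Y s - Y' s)"
    define w where "w = (\<lambda>s. field h Y s - field h Y' s)"
    define P where "P = (\<lambda>s. (Y s - defect x h Y s) - (Y' s - defect x h Y' s))"
    have fi: "field h Y absolutely_integrable_on {0..s}" "field h Y' absolutely_integrable_on {0..s}" if "s \<in> {0..T}" for s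
      using field_absolutely_integrable[OF Y h(1)] field_absolutely_integrable[OF Y' h(1)] that by auto
    have wi: "w absolutely_integrable_on {0..s}" if "s \<in> {0..T}" for s
      unfolding w_def by (intro set_integral_diff fi that)
    have P: "P s = 0 + integral {0..s} w" if "s \<in> {0..T}" for s
      unfolding P_def w_def defect_def using fi[OF that]
      by (simp add: Henstock_Kurzweil_Integration.integral_diff absolutely_integrable_on_def)
    have PD: "norm (P s - D s) \<le> 2 * e" if "s \<in> {0..T}" for s
    proof -
      have "P s - D s = defect x h Y' s - defect x h Y s" by (simp add: P_def D_def)
      then show ?thesis using hyp[OF that] norm_triangle_ineq4[of "defect x h Y' s" "defect x h Y s"] by simp
    qed
    have D0: "norm (D 0) < \<rho>"
      using PD[of 0] P[of 0] T e \<rho> by simp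
    obtain \<tau> where \<tau>: "\<tau> \<in> {0..T}" "norm (D \<tau>) = \<rho>" and D\<rho>: "\<And>s. s \<in> {0..\<tau>} \<Longrightarrow> norm (D s) \<le> \<rho>"
    proof (rule first_hit[of T "\<lambda>s. norm (D s)" \<rho> t])
      show "continuous_on {0..T} (\<lambda>s. norm (D s))" unfolding D_def by (intro continuous_intros Y Y')
    qed (use t neg \<rho> D0 in \<open>auto simp: D_def\<close>)
    \<comment> \<open>From the bound \<open>norm (P s) + 2 * e\<close> for the distance of the
      paths: its square is at most twice the sum of the two squares.\<close>
    let ?v = "\<lambda>s. 2 * (norm (P s))\<^sup>2 + 8 * e\<^sup>2"
    let ?k = "\<lambda>s. 2 * g s + 2 * (norm (h s))\<^sup>2"
    have wi1: "w integrable_on {0..T}" using wi[of T] T by (auto simp: absolutely_integrable_on_def)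
    have Pc0: "continuous_on {0..T} P"
      using continuous_on_add[OF continuous_on_const indefinite_integral_continuous_1[OF wi1]]
      by (subst continuous_on_cong[OF refl P])
    then have Pc: "continuous_on {0..\<tau>} P" using \<tau> by (auto intro: continuous_on_subset)
    have vc: "continuous_on {0..\<tau>} ?v" by (intro continuous_intros Pc)
    have v0: "0 \<le> ?v s" for s by simp
    have Dv: "(norm (D s))\<^sup>2 \<le> ?v s" if "s \<in> {0..T}" for s
    proof -
      have "norm (D s) \<le> norm (P s) + norm (P s - D s)"
        using norm_triangle_ineq4[of "P s" "P s - D s"] by simp
      then have "norm (D s) \<le> norm (P s) + 2 * e" using PD[OF that] by simp
      then have "(norm (D s))\<^sup>2 \<le> (norm (P s) + 2 * e)\<^sup>2" by (intro power_mono) auto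
      also have "\<dots> \<le> ?v s"
        using zero_le_power2[of "norm (P s) - 2 * e"] by (simp add: power2_eq_square algebra_simps)
      finally show ?thesis .
    qed
    have kint: "?k absolutely_integrable_on {0..T}"
      by (intro set_integral_add set_integrable_mult_right g L2_controlD h)
    have k0: "0 \<le> ?k s" if "s \<in> {0..T}" for s
      using that g by (intro add_nonneg_nonneg) auto
    have k\<tau>: "?k absolutely_integrable_on {0..s}" if "s \<in> {0..T}" for s
      by (rule absolutely_integrable_on_subinterval[OF kint]) (use that \<tau> in auto)
    have "?v \<tau> < L J"
    proof (rule bihari_bound[where v = ?v and J = J and k = ?k and \<Gamma> = \<Gamma> and c = "8 * e\<^sup>2 + 8 * e * W" and L = L])
      show "?v t \<le> 8 * e\<^sup>2 + 8 * e * W + integral {0..t} (\<lambda>s. ?k s * \<Gamma> (?v s))" if t: "t \<in> {0..\<tau>}" for t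
      proof -
        have tT: "t \<in> {0..T}" using t \<tau> by auto
        have sub: "{0..t} \<subseteq> {0..\<tau>}" using t by auto
        have i1: "(\<lambda>s. (2 *\<^sub>R P s) \<bullet> w s) integrable_on {0..t}"
          by (rule set_lebesgue_integral_eq_integral(1), rule absolutely_integrable_inner_continuous)
             (auto intro!: continuous_intros continuous_on_subset[OF Pc sub] wi tT)
        have "continuous_on {0..t} (\<lambda>s. \<Gamma> (?v s))"
          by (rule continuous_on_compose2[OF Gc continuous_on_subset[OF vc sub]]) auto
        then have i2a: "(\<lambda>s. ?k s * \<Gamma> (?v s)) integrable_on {0..t}"
          by (intro set_lebesgue_integral_eq_integral(1) absolutely_integrable_mult_continuous k\<tau> tT)
        have i2: "(\<lambda>s. 1 / 2 * (?k s * \<Gamma> (?v s))) integrable_on {0..t}"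
          by (rule integrable_on_mult_right[OF i2a])
        have i3: "(\<lambda>s. norm (w s)) integrable_on {0..t}"
          using wi[OF tT] by (simp add: absolutely_integrable_on_def)
        have "(norm (P t))\<^sup>2 - (norm (P 0))\<^sup>2 = integral {0..t} (\<lambda>s. (2 *\<^sub>R P s) \<bullet> w s)"
        proof (rule chain_rule_integral[OF wi[OF tT] _ P gradient_norm_power2])
          show "continuous_on UNIV ((*\<^sub>R) (2::real) :: real^'d \<Rightarrow> _)" by (intro continuous_intros)
        qed (use t tT in auto)
        also have "\<dots> \<le> integral {0..t} (\<lambda>s. 1 / 2 * (?k s * \<Gamma> (?v s)) + 4 * e * norm (w s))"
        proof (rule integral_le[OF i1 integrable_add[OF i2 integrable_on_mult_right[OF i3]]])
          fix s assume s: "s \<in> {0..t}"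
          then have s\<tau>: "s \<in> {0..\<tau>}" and sT: "s \<in> {0..T}" using t \<tau> by auto
          have "(2 *\<^sub>R P s) \<bullet> w s = 2 * (D s \<bullet> w s) + 2 * ((P s - D s) \<bullet> w s)"
            by (simp add: inner_diff_left algebra_simps)
          also have "(P s - D s) \<bullet> w s \<le> norm (P s - D s) * norm (w s)" by (rule norm_cauchy_schwarz)
          also have "\<dots> \<le> 2 * e * norm (w s)" using PD[OF sT] by (intro mult_right_mono) auto
          also have "2 * (D s \<bullet> w s) \<le> g s * \<eta> R ((norm (D s))\<^sup>2) + (norm (h s))\<^sup>2 * (norm (D s))\<^sup>2"
            using field_diff_inner_le[OF R sT, of "Y s" "Y' s" "h s"] hyp[OF sT] D\<rho>[OF s\<tau>] \<rho>
            by (simp add: D_def w_def field_def)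
          also have "\<dots> \<le> g s * \<Gamma> (?v s) + (norm (h s))\<^sup>2 * \<Gamma> (?v s)"
          proof (intro add_mono mult_left_mono)
            have "(norm (D s))\<^sup>2 \<le> c" unfolding c_def using D\<rho>[OF s\<tau>] by (intro power_mono) auto
            then have "\<eta> R ((norm (D s))\<^sup>2) \<le> \<eta> R (min (?v s) c)"
              using Dv[OF sT] c by (intro mono_onD[OF \<eta>R(2)]) auto
            also have "\<dots> \<le> \<Gamma> (?v s)" by (simp add: \<Gamma>_def)
            finally show "\<eta> R ((norm (D s))\<^sup>2) \<le> \<Gamma> (?v s)" .
            show "(norm (D s))\<^sup>2 \<le> \<Gamma> (?v s)" using Dv[OF sT] Gnn[OF v0, of s] by simp
          qed (use g sT in auto)
          finally show "(2 *\<^sub>R P s) \<bullet> w s \<le> 1 / 2 * (?k s * \<Gamma> (?v s)) + 4 * e * norm (w s)"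
            by (simp add: algebra_simps)
        qed
        also have "\<dots> = 1 / 2 * integral {0..t} (\<lambda>s. ?k s * \<Gamma> (?v s)) + 4 * e * integral {0..t} (\<lambda>s. norm (w s))"
          by (simp only: Henstock_Kurzweil_Integration.integral_add[OF i2 integrable_on_mult_right[OF i3]] integral_mult_right)
        also have "4 * e * integral {0..t} (\<lambda>s. norm (w s)) \<le> 4 * e * W"
        proof (rule mult_left_mono)
          have i4: "(\<lambda>s. norm (field h Y s)) integrable_on {0..t}" "(\<lambda>s. norm (field h Y' s)) integrable_on {0..t}"
            using fi[OF tT] by (simp_all add: absolutely_integrable_on_def)
          have "integral {0..t} (\<lambda>s. norm (w s)) \<le> integral {0..t} (\<lambda>s. norm (field h Y s) + norm (field h Y' s))"
            unfolding w_def
            by (rule integral_le) (use i3 i4 in \<open>auto simp: w_def intro!: integrable_add norm_triangle_ineq4\<close>)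
          also have "\<dots> = integral {0..t} (\<lambda>s. norm (field h Y s)) + integral {0..t} (\<lambda>s. norm (field h Y' s))"
            by (rule Henstock_Kurzweil_Integration.integral_add[OF i4])
          also have "\<dots> \<le> (C * (t - 0) + C * sqrt ((t - 0) * N)) + (C * (t - 0) + C * sqrt ((t - 0) * N))"
            by (intro add_mono integral_field_norm_le[OF Y h] integral_field_norm_le[OF Y' h])
               (use C t \<tau> hyp in \<open>auto intro: less_imp_le\<close>)
          also have "\<dots> \<le> (C * T + C * sqrt (T * N)) + (C * T + C * sqrt (T * N))"
            using t \<tau> C N by (intro add_mono mult_left_mono real_sqrt_le_mono mult_right_mono) auto
          also have "\<dots> = W" by (simp add: W_def)
          finally show "integral {0..t} (\<lambda>s. norm (w s)) \<le> W" .
        qed (use e in auto)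
        finally show ?thesis using P[of 0] T by simp
      qed
      show "integral {0..\<tau>} ?k < (\<Sum>j<J. (L (Suc j) - L j) / \<Gamma> (L (Suc j)))"
      proof -
        have gi: "(\<lambda>s. 2 * g s) integrable_on {0..T}"
          by (rule integrable_on_mult_right[OF set_lebesgue_integral_eq_integral(1)[OF g(1)]])
        have hi: "(\<lambda>s. 2 * (norm (h s))\<^sup>2) integrable_on {0..T}"
          by (rule integrable_on_mult_right[OF L2_controlD(3)[OF h(1)]])
        have "integral {0..\<tau>} ?k \<le> integral {0..T} ?k"
          by (rule integral_subset_le)
            (use \<tau> k0 kint k\<tau>[of \<tau>] in \<open>auto intro: set_lebesgue_integral_eq_integral(1)\<close>)
        also have "\<dots> = 2 * integral {0..T} g + 2 * energy T h"
          unfolding energy_def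
          by (simp only: Henstock_Kurzweil_Integration.integral_add[OF gi hi] integral_mult_right)
        also have "\<dots> \<le> G" unfolding G_def using h(2) by (intro add_left_mono mult_left_mono) auto
        finally show ?thesis using J by simp
      qed
      show "0 < \<Gamma> (L (Suc j))" for j using Gnn[of "L (Suc j)"] Lpos[of "Suc j"] by simp
      show "0 \<le> \<Gamma> u" if "0 \<le> u" for u using Gnn[OF that] that by simp
    qed (use \<tau> k\<tau>[of \<tau>] k0 Gc Gm LS e8 e W vc in auto)
    then have "(norm (D \<tau>))\<^sup>2 < c" using Dv[OF \<tau>(1)] by (simp add: L_def)
    then show False using \<tau>(2) by (simp add: c_def)
  qed
qed

end

section \<open>Square integrable controls\<close>

text \<open>The Riesz-Fischer argument: along a fast subsequence the successive differences have
  summable norms almost everywhere, which defines the limit. The rate \<rho> passes from the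
  sequence to the limit by Fatou's lemma.\<close>

lemma L2_complete:
  fixes u :: "nat \<Rightarrow> 'a \<Rightarrow> 'b::euclidean_space"
  assumes M: "finite_measure M" and u[measurable]: "\<And>n. u n \<in> borel_measurable M"
    and \<rho>: "\<And>n m. n \<le> m \<Longrightarrow> (\<integral>\<^sup>+x. ennreal ((norm (u n x - u m x))\<^sup>2) \<partial>M) \<le> ennreal (\<rho> n)" "\<rho> \<longlonglongrightarrow> 0"
  obtains v where "v \<in> borel_measurable M" "\<And>n. (\<integral>\<^sup>+x. ennreal ((norm (u n x - v x))\<^sup>2) \<partial>M) \<le> ennreal (\<rho> n)"
proof -
  interpret finite_measure M by (rule M)
  have ex: "\<exists>n. \<forall>j\<ge>n. \<rho> j \<le> (1/4)^k" for k :: nat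
  proof -
    have "\<forall>\<^sub>F n in sequentially. \<rho> n < (1/4)^k" by (rule order_tendstoD(2)[OF \<rho>(2)]) simp
    then show ?thesis by (auto simp: eventually_sequentially intro: less_imp_le)
  qed
  then obtain q where q: "\<And>k j. q k \<le> j \<Longrightarrow> \<rho> j \<le> (1/4)^k" by metis
  \<comment> \<open>The sum makes \<open>r\<close> nondecreasing and at least \<open>q k\<close>;
    the summand \<open>k\<close> makes it tend to infinity.\<close>
  define r where "r = (\<lambda>k. k + (\<Sum>i\<le>k. q i))"
  have rq: "q k \<le> r k" for k unfolding r_def by (rule trans_le_add2, rule member_le_sum) auto
  have rS: "r k \<le> r (Suc k)" for k by (simp add: r_def)
  have rk: "k \<le> r k" for k by (simp add: r_def)
  define d where "d = (\<lambda>k x. u (r (Suc k)) x - u (r k) x)"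
  have [measurable]: "d k \<in> borel_measurable M" for k unfolding d_def by measurable
  have dn: "(\<integral>\<^sup>+x. ennreal (norm (d k x)) \<partial>M) \<le> ennreal ((1/2)^k * (measure M (space M) + 1))" for k
  proof -
    have "(\<integral>\<^sup>+x. ennreal (norm (d k x)) \<partial>M) \<le> (\<integral>\<^sup>+x. ennreal ((1/2)^k) + ennreal (2^k) * ennreal ((norm (d k x))\<^sup>2) \<partial>M)"
    proof (rule nn_integral_mono)
      fix x
      let ?y = "norm (d k x)"
      \<comment> \<open>An L1 bound from the L2 bound \<open>(1/4)^k\<close>: either the norm is
        below \<open>(1/2)^k\<close>, or one factor of its square can be replaced by that
        number.\<close>
      have "?y \<le> (1/2)^k + 2^k * ?y\<^sup>2"
      proof (cases "?y \<le> (1/2)^k")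
        case False
        then have "1 \<le> 2^k * ?y" by (simp add: power_one_over field_simps)
        then have "?y * 1 \<le> ?y * (2^k * ?y)" by (rule mult_left_mono) simp
        then have "?y \<le> 2^k * ?y\<^sup>2" by (simp add: power2_eq_square mult_ac)
        moreover have "(0::real) \<le> (1/2)^k" by simp
        ultimately show ?thesis by linarith
      qed (simp add: add_increasing2)
      then show "ennreal ?y \<le> ennreal ((1/2)^k) + ennreal (2^k) * ennreal (?y\<^sup>2)"
        by (simp add: ennreal_mult[symmetric] ennreal_plus[symmetric] ennreal_leI del: ennreal_plus)
    qed
    also have "\<dots> = ennreal ((1/2)^k) * emeasure M (space M) + ennreal (2^k) * (\<integral>\<^sup>+x. ennreal ((norm (d k x))\<^sup>2) \<partial>M)"
      by (simp add: nn_integral_add nn_integral_cmult)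
    also have "\<dots> \<le> ennreal ((1/2)^k) * ennreal (measure M (space M)) + ennreal (2^k) * ennreal ((1/4)^k)"
    proof (intro add_mono mult_left_mono)
      have "(\<integral>\<^sup>+x. ennreal ((norm (d k x))\<^sup>2) \<partial>M) = (\<integral>\<^sup>+x. ennreal ((norm (u (r k) x - u (r (Suc k)) x))\<^sup>2) \<partial>M)"
        by (simp add: d_def norm_minus_commute)
      also have "\<dots> \<le> ennreal (\<rho> (r k))" by (rule \<rho>(1)[OF rS])
      also have "\<dots> \<le> ennreal ((1/4)^k)" by (intro ennreal_leI q rq)
      finally show "(\<integral>\<^sup>+x. ennreal ((norm (d k x))\<^sup>2) \<partial>M) \<le> ennreal ((1/4)^k)" .
    qed (simp_all add: emeasure_eq_measure)
    also have "\<dots> = ennreal ((1/2)^k * measure M (space M) + 2^k * (1/4)^k)"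
      by (simp add: ennreal_mult[symmetric] ennreal_plus[symmetric] del: ennreal_plus)
    also have "(2::real)^k * (1/4)^k = (1/2)^k" by (simp add: power_mult_distrib[symmetric])
    also have "(1/2)^k * measure M (space M) + (1/2)^k = (1/2)^k * (measure M (space M) + 1)"
      by (simp add: algebra_simps)
    finally show ?thesis .
  qed
  have "(\<integral>\<^sup>+x. (\<Sum>k. ennreal (norm (d k x))) \<partial>M) = (\<Sum>k. \<integral>\<^sup>+x. ennreal (norm (d k x)) \<partial>M)"
    by (rule nn_integral_suminf) simp
  also have "\<dots> \<le> (\<Sum>k. ennreal ((1/2)^k * (measure M (space M) + 1)))"
    by (intro suminf_le dn summableI)
  also have "\<dots> = ennreal (\<Sum>k. (1/2)^k * (measure M (space M) + 1))"
    by (intro suminf_ennreal2 summable_mult2 summable_geometric) auto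
  finally have "(\<integral>\<^sup>+x. (\<Sum>k. ennreal (norm (d k x))) \<partial>M) \<noteq> \<infinity>"
    by (metis ennreal_less_top infinity_ennreal_def leD)
  then have "AE x in M. (\<Sum>k. ennreal (norm (d k x))) \<noteq> \<infinity>"
    by (intro nn_integral_noteq_infinite) auto
  then have conv: "AE x in M. convergent (\<lambda>k. u (r k) x)"
  proof (rule AE_mp, intro AE_I2 impI)
    fix x assume "(\<Sum>k. ennreal (norm (d k x))) \<noteq> \<infinity>"
    then have "summable (\<lambda>k. norm (d k x))"
      by (intro summable_suminf_not_top) auto
    then have "summable (\<lambda>k. d k x)" by (rule summable_norm_cancel)
    then have "convergent (\<lambda>n. \<Sum>k<n. d k x)" by (simp add: summable_iff_convergent)
    moreover have "(\<Sum>k<n. d k x) = u (r n) x - u (r 0) x" for n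
      unfolding d_def by (rule sum_lessThan_telescope)
    ultimately have "convergent (\<lambda>n. (u (r n) x - u (r 0) x) + u (r 0) x)"
      by (intro convergent_add convergent_const) simp
    then show "convergent (\<lambda>k. u (r k) x)" by simp
  qed
  define v where "v = (\<lambda>x. lim (\<lambda>k. u (r k) x))"
  have v[measurable]: "v \<in> borel_measurable M" unfolding v_def by measurable
  show ?thesis
  proof (rule that[OF v])
    fix n
    have "(\<integral>\<^sup>+x. ennreal ((norm (u n x - v x))\<^sup>2) \<partial>M)
        = (\<integral>\<^sup>+x. liminf (\<lambda>k. ennreal ((norm (u n x - u (r k) x))\<^sup>2)) \<partial>M)"
    proof (rule nn_integral_cong_AE, use conv in eventually_elim)
      fix x assume "convergent (\<lambda>k. u (r k) x)"
      then have "(\<lambda>k. u (r k) x) \<longlonglongrightarrow> v x" by (simp add: v_def convergent_LIMSEQ_iff)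
      then have "(\<lambda>k. ennreal ((norm (u n x - u (r k) x))\<^sup>2)) \<longlonglongrightarrow> ennreal ((norm (u n x - v x))\<^sup>2)"
        by (intro tendsto_intros)
      then show "ennreal ((norm (u n x - v x))\<^sup>2) = liminf (\<lambda>k. ennreal ((norm (u n x - u (r k) x))\<^sup>2))"
        by (rule lim_imp_Liminf[OF trivial_limit_sequentially, symmetric])
    qed
    also have "\<dots> \<le> liminf (\<lambda>k. \<integral>\<^sup>+x. ennreal ((norm (u n x - u (r k) x))\<^sup>2) \<partial>M)"
      by (rule nn_integral_liminf) measurable
    also have "\<dots> \<le> liminf (\<lambda>k::nat. ennreal (\<rho> n))"
    proof (rule Liminf_mono)
      show "\<forall>\<^sub>F k in sequentially. (\<integral>\<^sup>+x. ennreal ((norm (u n x - u (r k) x))\<^sup>2) \<partial>M) \<le> ennreal (\<rho> n)"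
        using eventually_ge_at_top[of n]
      proof eventually_elim
        case (elim k)
        then show ?case using rk[of k] by (intro \<rho>(1)) simp
      qed
    qed
    also have "\<dots> = ennreal (\<rho> n)" by (simp add: Liminf_const)
    finally show "(\<integral>\<^sup>+x. ennreal ((norm (u n x - v x))\<^sup>2) \<partial>M) \<le> ennreal (\<rho> n)" .
  qed
qed

lemma L2_control_iff:
  "L2_control T h \<longleftrightarrow> h \<in> borel_measurable (lebesgue_on {0..T}) \<and>
     (\<integral>\<^sup>+s. ennreal ((norm (h s))\<^sup>2) \<partial>lebesgue_on {0..T}) < \<infinity>" (is "?l \<longleftrightarrow> ?r")
proof -
  have 1: "set_borel_measurable lebesgue {0..T} h \<longleftrightarrow> h \<in> borel_measurable (lebesgue_on {0..T})"
    by (simp add: set_borel_measurable_def borel_measurable_restrict_space_iff)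
  have 2: "set_integrable lebesgue {0..T} (\<lambda>s. (norm (h s))\<^sup>2) \<longleftrightarrow> integrable (lebesgue_on {0..T}) (\<lambda>s. (norm (h s))\<^sup>2)"
    by (simp add: set_integrable_def integrable_restrict_space)
  have 3: "integrable (lebesgue_on {0..T}) (\<lambda>s. (norm (h s))\<^sup>2) \<longleftrightarrow>
     (\<integral>\<^sup>+s. ennreal ((norm (h s))\<^sup>2) \<partial>lebesgue_on {0..T}) < \<infinity>" if "h \<in> borel_measurable (lebesgue_on {0..T})"
    using that by (simp add: integrable_iff_bounded)
  show ?thesis unfolding L2_control_def 1 2 using 3 by blast
qed

lemma nn_integral_L2_control:
  assumes "L2_control T h"
  shows "(\<integral>\<^sup>+s. ennreal ((norm (h s))\<^sup>2) \<partial>lebesgue_on {0..T}) = ennreal (energy T h)"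
proof -
  have i: "integrable (lebesgue_on {0..T}) (\<lambda>s. (norm (h s))\<^sup>2)"
    using L2_controlD(2)[OF assms] by (rule absolutely_integrable_imp_integrable) simp
  have "(\<integral>\<^sup>+s. ennreal ((norm (h s))\<^sup>2) \<partial>lebesgue_on {0..T}) = ennreal (integral\<^sup>L (lebesgue_on {0..T}) (\<lambda>s. (norm (h s))\<^sup>2))"
    by (rule nn_integral_eq_integral[OF i]) simp
  also have "integral\<^sup>L (lebesgue_on {0..T}) (\<lambda>s. (norm (h s))\<^sup>2) = energy T h"
    unfolding energy_def by (rule lebesgue_integral_eq_integral[OF i]) simp
  finally show ?thesis .
qed

lemma L2_control_add:
  assumes "L2_control T h" "L2_control T k"
  shows "L2_control T (\<lambda>s. h s + k s)"
proof -
  have m[measurable]: "h \<in> borel_measurable (lebesgue_on {0..T})" "k \<in> borel_measurable (lebesgue_on {0..T})"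
    using assms by (simp_all add: L2_control_iff)
  have "(\<integral>\<^sup>+s. ennreal ((norm (h s + k s))\<^sup>2) \<partial>lebesgue_on {0..T})
      \<le> (\<integral>\<^sup>+s. 2 * ennreal ((norm (h s))\<^sup>2) + 2 * ennreal ((norm (k s))\<^sup>2) \<partial>lebesgue_on {0..T})"
  proof (rule nn_integral_mono)
    fix s
    have "norm (h s + k s) \<le> norm (h s) + norm (k s)" by (rule norm_triangle_ineq)
    then have "(norm (h s + k s))\<^sup>2 \<le> (norm (h s) + norm (k s))\<^sup>2" by (intro power_mono) auto
    also have "\<dots> \<le> 2 * (norm (h s))\<^sup>2 + 2 * (norm (k s))\<^sup>2"
      using zero_le_power2[of "norm (h s) - norm (k s)"] by (simp add: power2_eq_square algebra_simps)
    finally have "ennreal ((norm (h s + k s))\<^sup>2) \<le> ennreal (2 * (norm (h s))\<^sup>2 + 2 * (norm (k s))\<^sup>2)"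
      by (rule ennreal_leI)
    then show "ennreal ((norm (h s + k s))\<^sup>2) \<le> 2 * ennreal ((norm (h s))\<^sup>2) + 2 * ennreal ((norm (k s))\<^sup>2)"
      by (simp add: ennreal_plus ennreal_mult)
  qed
  also have "\<dots> = 2 * ennreal (energy T h) + 2 * ennreal (energy T k)"
    by (simp add: nn_integral_add nn_integral_cmult nn_integral_L2_control assms)
  also have "\<dots> < \<infinity>" by (simp add: ennreal_mult_less_top)
  finally show ?thesis by (simp add: L2_control_iff)
qed

lemma L2_control_scale:
  assumes "L2_control T h"
  shows "L2_control T (\<lambda>s. c *\<^sub>R h s)" "energy T (\<lambda>s. c *\<^sub>R h s) = c\<^sup>2 * energy T h"
proof -
  have m[measurable]: "h \<in> borel_measurable (lebesgue_on {0..T})"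
    using assms by (simp_all add: L2_control_iff)
  have "(\<integral>\<^sup>+s. ennreal ((norm (c *\<^sub>R h s))\<^sup>2) \<partial>lebesgue_on {0..T}) = ennreal (c\<^sup>2) * ennreal (energy T h)"
    by (simp add: power_mult_distrib ennreal_mult nn_integral_cmult nn_integral_L2_control assms)
  also have "\<dots> < \<infinity>" by (simp add: ennreal_mult_less_top)
  finally show "L2_control T (\<lambda>s. c *\<^sub>R h s)" by (simp add: L2_control_iff)
  show "energy T (\<lambda>s. c *\<^sub>R h s) = c\<^sup>2 * energy T h"
    by (simp add: energy_def power_mult_distrib)
qed

lemma L2_control_diff:
  assumes "L2_control T h" "L2_control T k"
  shows "L2_control T (\<lambda>s. h s - k s)"
  using L2_control_add[OF assms(1) L2_control_scale(1)[OF assms(2), of "-1"]] by simp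

lemma energy_parallelogram:
  assumes "L2_control T h" "L2_control T k"
  shows "energy T (\<lambda>s. h s + k s) + energy T (\<lambda>s. h s - k s) = 2 * energy T h + 2 * energy T k"
proof -
  note i = L2_controlD(3)
  have "energy T (\<lambda>s. h s + k s) + energy T (\<lambda>s. h s - k s)
      = integral {0..T} (\<lambda>s. (norm (h s + k s))\<^sup>2 + (norm (h s - k s))\<^sup>2)"
    unfolding energy_def
    by (rule Henstock_Kurzweil_Integration.integral_add[symmetric])
       (intro i L2_control_add L2_control_diff assms)+
  also have "\<dots> = integral {0..T} (\<lambda>s. 2 * (norm (h s))\<^sup>2 + 2 * (norm (k s))\<^sup>2)"
    by (rule integral_cong) (simp add: power2_norm_eq_inner algebra_simps inner_commute)
  also have "\<dots> = 2 * energy T h + 2 * energy T k"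
    unfolding energy_def
    by (simp only: Henstock_Kurzweil_Integration.integral_add[OF integrable_on_mult_right[OF i[OF assms(1)]] integrable_on_mult_right[OF i[OF assms(2)]]]
        integral_mult_right)
  finally show ?thesis .
qed

lemma integral_control_diff_le:
  assumes T: "0 \<le> T" and "L2_control T h" "L2_control T k" and N: "energy T (\<lambda>s. h s - k s) \<le> N" and t: "t \<in> {0..T}"
  shows "norm (integral {0..t} h - integral {0..t} k) \<le> sqrt (T * N)"
proof -
  have d: "L2_control T (\<lambda>s. h s - k s)" by (rule L2_control_diff) fact+
  have sub: "{0..t} \<subseteq> {0..T}" using t by auto
  have "h absolutely_integrable_on {0..t}" "k absolutely_integrable_on {0..t}"
    by (rule absolutely_integrable_on_subinterval[OF L2_controlD(1)[OF assms(2)] sub]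
        absolutely_integrable_on_subinterval[OF L2_controlD(1)[OF assms(3)] sub])+
  then have "norm (integral {0..t} h - integral {0..t} k) = norm (integral {0..t} (\<lambda>s. h s - k s))"
    by (simp add: absolutely_integrable_on_def Henstock_Kurzweil_Integration.integral_diff)
  also have "\<dots> \<le> integral {0..t} (\<lambda>s. norm (h s - k s))"
    by (rule integral_norm_bound[OF absolutely_integrable_on_subinterval[OF L2_controlD(1)[OF d] sub]])
  also have "\<dots> \<le> sqrt ((t - 0) * N)"
    by (rule integral_norm_control_le[OF d N]) (use t in auto)
  also have "\<dots> \<le> sqrt (T * N)"
    using t order_trans[OF energy_nonneg N] by (intro real_sqrt_le_mono mult_right_mono) auto
  finally show ?thesis .
qed

text \<open>Near minimisers of the energy over the decreasing convex sets of controls with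
  primitive \<open>1/n\<close>-close to \<open>H\<close> form a Cauchy sequence by the parallelogram law.\<close>

lemma control_with_primitive:
  fixes H :: "real \<Rightarrow> real ^ 'm"
  assumes T: "0 < T"
    and H: "\<And>e. 0 < e \<Longrightarrow> \<exists>u. L2_control T u \<and> energy T u \<le> E + e \<and> (\<forall>t\<in>{0..T}. norm (integral {0..t} u - H t) \<le> e)"
  obtains h where "L2_control T h" "energy T h \<le> E" "\<And>t. t \<in> {0..T} \<Longrightarrow> integral {0..t} h = H t"
proof -
  define K where "K = (\<lambda>n::nat. {u. L2_control T u \<and> (\<forall>t\<in>{0..T}. norm (integral {0..t} u - H t) \<le> 1 / (real n + 1))})"
  define c where "c = (\<lambda>n. Inf (energy T ` K n))"
  have ne: "\<exists>u\<in>K n. energy T u \<le> E + e" if "0 < e" for n e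
  proof -
    have "0 < min e (1 / (real n + 1))" using that by simp
    from H[OF this] obtain u where "L2_control T u" "energy T u \<le> E + min e (1 / (real n + 1))"
      "\<forall>t\<in>{0..T}. norm (integral {0..t} u - H t) \<le> min e (1 / (real n + 1))" by blast
    then show ?thesis unfolding K_def by (intro bexI[of _ u]) auto
  qed
  have Kmono: "K m \<subseteq> K n" if "n \<le> m" for n m
  proof -
    have "1 / (real m + 1) \<le> 1 / (real n + 1)" using that by (intro divide_left_mono) auto
    then show ?thesis unfolding K_def by (auto intro: order_trans)
  qed
  have bdd: "bdd_below (energy T ` K n)" for n by (auto intro!: bdd_belowI[of _ 0] simp: energy_nonneg)
  have cE: "c n \<le> E" for n
  proof (rule field_le_epsilon)
    fix e :: real assume "0 < e"
    then obtain u where "u \<in> K n" "energy T u \<le> E + e" using ne by blast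
    then show "c n \<le> E + e" unfolding c_def by (intro cInf_lower2[OF _ _ bdd]) auto
  qed
  have cmono: "c n \<le> c m" if "n \<le> m" for n m
    unfolding c_def using Kmono[OF that] ne[of 1 m] by (intro cInf_superset_mono bdd) auto
  have "\<exists>u\<in>K n. energy T u \<le> c n + 1 / (real n + 1)" for n
  proof -
    have "energy T ` K n \<noteq> {}" using ne[of 1 n] by auto
    then obtain y where "y \<in> energy T ` K n" "y < c n + 1 / (real n + 1)"
      unfolding c_def using cInf_lessD[of "energy T ` K n" "Inf (energy T ` K n) + 1 / (real n + 1)"] by auto
    then show ?thesis by (metis imageE less_imp_le)
  qed
  then obtain u where uK: "\<And>n. u n \<in> K n" and uE: "\<And>n. energy T (u n) \<le> c n + 1 / (real n + 1)" by metis
  have uL: "L2_control T (u n)" for n using uK[of n] by (simp add: K_def)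
  obtain cl where cl: "c \<longlonglongrightarrow> cl" "\<And>n. c n \<le> cl"
    using incseq_convergent[of c E] cE cmono by (auto simp: incseq_def)
  note cle = cl(2)
  \<comment> \<open>Midpoints of \<open>u n\<close> and \<open>u m\<close> stay in the convex set
    \<open>K n\<close>, so the energy of the sum is at least \<open>4 * c n\<close>. The
    parallelogram law then leaves \<open>2 * (c m - c n)\<close> plus the slacks of the two near
    minimisers, and \<open>c m\<close> is at most \<open>cl\<close>.\<close>
  define \<rho> where "\<rho> = (\<lambda>n. 2 * (cl - c n) + 4 / (real n + 1))"
  have \<rho>0: "\<rho> \<longlonglongrightarrow> 0"
  proof -
    have "(\<lambda>n. 4 / (real n + 1)) \<longlonglongrightarrow> 0" by real_asymp
    then have "\<rho> \<longlonglongrightarrow> 2 * (cl - cl) + 0" unfolding \<rho>_def by (intro tendsto_intros cl(1))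
    then show ?thesis by simp
  qed
  have cauchy: "energy T (\<lambda>s. u n s - u m s) \<le> \<rho> n" if "n \<le> m" for n m
  proof -
    let ?w = "\<lambda>s. (1/2) *\<^sub>R (u n s + u m s)"
    have wK: "?w \<in> K n"
      unfolding K_def
    proof (intro CollectI conjI ballI)
      show "L2_control T ?w" by (intro L2_control_scale L2_control_add uL)
      fix t assume t: "t \<in> {0..T}"
      have sub: "{0..t} \<subseteq> {0..T}" using t by auto
      have i: "u k integrable_on {0..t}" for k
        using absolutely_integrable_on_subinterval[OF L2_controlD(1)[OF uL] sub] by (simp add: absolutely_integrable_on_def)
      have "H t = (1/2) *\<^sub>R H t + (1/2) *\<^sub>R H t" by (simp flip: scaleR_add_left)
      moreover have "integral {0..t} ?w = (1/2) *\<^sub>R (integral {0..t} (u n) + integral {0..t} (u m))"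
        using i by (simp add: Henstock_Kurzweil_Integration.integral_add)
      ultimately have "integral {0..t} ?w - H t = (1/2) *\<^sub>R (integral {0..t} (u n) - H t) + (1/2) *\<^sub>R (integral {0..t} (u m) - H t)"
        by (simp add: scaleR_diff_right scaleR_add_right del: scaleR_half_double)
      also have "norm \<dots> \<le> norm ((1/2) *\<^sub>R (integral {0..t} (u n) - H t)) + norm ((1/2) *\<^sub>R (integral {0..t} (u m) - H t))"
        by (rule norm_triangle_ineq)
      also have "\<dots> = norm (integral {0..t} (u n) - H t) / 2 + norm (integral {0..t} (u m) - H t) / 2"
        by simp
      also have "\<dots> \<le> 1 / (real n + 1)"
      proof -
        have "norm (integral {0..t} (u n) - H t) \<le> 1 / (real n + 1)" using uK[of n] t unfolding K_def by blast
        moreover have "norm (integral {0..t} (u m) - H t) \<le> 1 / (real n + 1)"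
          using uK[of m] Kmono[OF that] t unfolding K_def by blast
        ultimately show ?thesis by linarith
      qed
      finally show "norm (integral {0..t} ?w - H t) \<le> 1 / (real n + 1)" .
    qed
    then have "c n \<le> energy T ?w" unfolding c_def by (intro cInf_lower bdd) auto
    then have "4 * c n \<le> energy T (\<lambda>s. u n s + u m s)"
      using L2_control_scale(2)[OF L2_control_add[OF uL uL], of "1/2" n m] by (simp add: power2_eq_square)
    moreover have "energy T (\<lambda>s. u n s + u m s) + energy T (\<lambda>s. u n s - u m s) = 2 * energy T (u n) + 2 * energy T (u m)"
      by (rule energy_parallelogram[OF uL uL])
    moreover have "1 / (real m + 1) \<le> 1 / (real n + 1)" using that by (intro divide_left_mono) auto
    ultimately show ?thesis
      using uE[of n] uE[of m] cle[of m] by (simp add: \<rho>_def)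
  qed
  have fm: "finite_measure (lebesgue_on {0..T})" by (rule finite_measure_lebesgue_on) simp
  obtain h where hm: "h \<in> borel_measurable (lebesgue_on {0..T})"
    and hn: "\<And>n. (\<integral>\<^sup>+s. ennreal ((norm (u n s - h s))\<^sup>2) \<partial>lebesgue_on {0..T}) \<le> ennreal (\<rho> n)"
  proof (rule L2_complete[OF fm])
    show "u n \<in> borel_measurable (lebesgue_on {0..T})" for n using uL[of n] by (simp add: L2_control_iff)
    show "(\<integral>\<^sup>+s. ennreal ((norm (u n s - u m s))\<^sup>2) \<partial>lebesgue_on {0..T}) \<le> ennreal (\<rho> n)" if "n \<le> m" for n m
      using nn_integral_L2_control[OF L2_control_diff[OF uL uL], of n m] cauchy[OF that] by (simp add: ennreal_leI)
  qed (use \<rho>0 in auto)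
  have um[measurable]: "u n \<in> borel_measurable (lebesgue_on {0..T})" for n using uL[of n] by (simp add: L2_control_iff)
  note hm[measurable]
  have dL: "L2_control T (\<lambda>s. u n s - h s)" for n
    using hn[of n] by (auto simp: L2_control_iff intro: le_less_trans)
  have hL: "L2_control T h"
    using L2_control_diff[OF uL dL, of 0 0] by simp
  have dE: "energy T (\<lambda>s. u n s - h s) \<le> \<rho> n" for n
  proof -
    have "0 \<le> \<rho> n" using cle[of n] by (simp add: \<rho>_def)
    then show ?thesis
      using hn[of n] unfolding nn_integral_L2_control[OF dL] by (simp add: ennreal_le_iff)
  qed
  show ?thesis
  proof (rule that[OF hL])
    show "integral {0..t} h = H t" if t: "t \<in> {0..T}" for t
    proof -
      have "norm (integral {0..t} h - H t) \<le> sqrt (T * \<rho> n) + 1 / (real n + 1)" for n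
      proof -
        have "norm (integral {0..t} (u n) - integral {0..t} h) \<le> sqrt (T * \<rho> n)"
          by (rule integral_control_diff_le[OF _ uL hL dE t]) (use T in simp)
        moreover have "norm (integral {0..t} (u n) - H t) \<le> 1 / (real n + 1)" using uK[of n] t by (simp add: K_def)
        moreover have "norm (integral {0..t} h - H t) \<le> norm (integral {0..t} (u n) - H t) + norm (integral {0..t} (u n) - integral {0..t} h)"
          using norm_triangle_ineq4[of "integral {0..t} (u n) - H t" "integral {0..t} (u n) - integral {0..t} h"]
by simp
        ultimately show ?thesis by linarith
      qed
      moreover have "(\<lambda>n. sqrt (T * \<rho> n) + 1 / (real n + 1)) \<longlonglongrightarrow> sqrt (T * 0) + 0"
        by (intro tendsto_intros \<rho>0) real_asymp
      ultimately have "norm (integral {0..t} h - H t) \<le> sqrt (T * 0) + 0"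
        by (intro LIMSEQ_le_const) auto
      then show ?thesis by simp
    qed
    \<comment> \<open>A weighted square of a sum: the factor of the energy of \<open>u n\<close> can
      be brought as close to 1 as desired, while the large factor \<open>1 + 1 / e\<close>
      multiplies a quantity that tends to 0. The limits are taken first in \<open>n\<close>, then in
      \<open>e\<close>.\<close>
    have "energy T h \<le> (1 + e) * (E + 1 / (real n + 1)) + (1 + 1 / e) * \<rho> n" if e: "0 < e" for e n
    proof -
      have "energy T h \<le> integral {0..T} (\<lambda>s. (1 + e) * (norm (u n s))\<^sup>2 + (1 + 1 / e) * (norm (u n s - h s))\<^sup>2)"
        unfolding energy_def
      proof (rule integral_le)
        fix s
        let ?x = "norm (u n s)" and ?y = "norm (u n s - h s)"
        have "norm (h s) \<le> ?x + ?y" using norm_triangle_ineq4[of "u n s" "u n s - h s"] by simp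
        then have "(norm (h s))\<^sup>2 \<le> (?x + ?y)\<^sup>2" by (intro power_mono) auto
        also have "\<dots> = (1 + e) * ?x\<^sup>2 + (1 + 1 / e) * ?y\<^sup>2 - (e * ?x - ?y)\<^sup>2 / e"
          using e by (simp add: power2_eq_square field_simps)
        also have "\<dots> \<le> (1 + e) * ?x\<^sup>2 + (1 + 1 / e) * ?y\<^sup>2" using e by simp
        finally show "(norm (h s))\<^sup>2 \<le> (1 + e) * ?x\<^sup>2 + (1 + 1 / e) * ?y\<^sup>2" .
      qed (intro integrable_add integrable_on_mult_right L2_controlD(3) hL uL dL)+
      also have "\<dots> = (1 + e) * energy T (u n) + (1 + 1 / e) * energy T (\<lambda>s. u n s - h s)"
        unfolding energy_def
        by (simp only: Henstock_Kurzweil_Integration.integral_add[OF integrable_on_mult_right[OF L2_controlD(3)[OF uL]] integrable_on_mult_right[OF L2_controlD(3)[OF dL]]]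
            integral_mult_right)
      also have "\<dots> \<le> (1 + e) * (E + 1 / (real n + 1)) + (1 + 1 / e) * \<rho> n"
        using e uE[of n] cE[of n] dE[of n] by (intro add_mono mult_left_mono) auto
      finally show ?thesis .
    qed
    note bound = this
    have "energy T h \<le> (1 + e) * E" if e: "0 < e" for e
    proof -
      have "(\<lambda>n. 1 / (real n + 1)) \<longlonglongrightarrow> 0" by real_asymp
      then have "(\<lambda>n. (1 + e) * (E + 1 / (real n + 1)) + (1 + 1 / e) * \<rho> n) \<longlonglongrightarrow> (1 + e) * (E + 0) + (1 + 1 / e) * 0"
        by (intro tendsto_intros \<rho>0)
      then have "energy T h \<le> (1 + e) * (E + 0) + (1 + 1 / e) * 0"
        using bound[OF e] by (intro LIMSEQ_le_const) auto
      then show ?thesis by simp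
    qed
    moreover have "((\<lambda>e. (1 + e) * E) \<longlongrightarrow> (1 + 0) * E) (at_right 0)" by (intro tendsto_intros)
    ultimately have "energy T h \<le> (1 + 0) * E"
      by (intro tendsto_lowerbound) (auto intro!: eventually_at_rightI[of 0 1])
    then show "energy T h \<le> E" by simp
  qed
qed

section \<open>Solutions of the skeleton equation\<close>

context osgood_lyapunov begin

text \<open>Picard iteration for the delayed equation \<open>Y(t) = x + \<integral>\<^sub>0\<^sup>t field h (Y(\<cdot> - D))\<close>;
  after \<open>k\<close> steps it is stationary on \<open>[0, k D]\<close>.\<close>

primrec delayed :: "real \<Rightarrow> real ^ 'd \<Rightarrow> (real \<Rightarrow> real ^ 'm) \<Rightarrow> nat \<Rightarrow> real \<Rightarrow> real ^ 'd" where
  "delayed D x h 0 = (\<lambda>_. x)"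
| "delayed D x h (Suc k) = (\<lambda>t. x + integral {0..t} (field h (\<lambda>s. delayed D x h k (max 0 (s - D)))))"

lemma delayed_continuous:
  assumes h: "L2_control T h" and D: "0 \<le> D"
  shows "continuous_on {0..T} (delayed D x h k)" "continuous_on {0..T} (\<lambda>s. delayed D x h k (max 0 (s - D)))"
proof -
  have shift: "continuous_on {0..T} (\<lambda>s. Y (max 0 (s - D)))" if "continuous_on {0..T} Y" for Y :: "real \<Rightarrow> real^'d"
    by (rule continuous_on_compose2[OF that]) (use D in \<open>auto intro!: continuous_intros\<close>)
  show *: "continuous_on {0..T} (delayed D x h k)"
  proof (induction k)
    case (Suc k)
    have "field h (\<lambda>s. delayed D x h k (max 0 (s - D))) integrable_on {0..T}"
      using field_absolutely_integrable[OF shift[OF Suc] h order_refl] by (simp add: absolutely_integrable_on_def)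
    from indefinite_integral_continuous_1[OF this] show ?case by (auto intro!: continuous_intros)
  qed auto
  show "continuous_on {0..T} (\<lambda>s. delayed D x h k (max 0 (s - D)))" by (rule shift[OF *])
qed

lemma delayed_stationary:
  assumes "0 \<le> D" "t \<in> {0..real k * D}"
  shows "delayed D x h (Suc k) t = delayed D x h k t"
  using assms(2)
proof (induction k arbitrary: t)
  case (Suc k)
  have "integral {0..t} (field h (\<lambda>s. delayed D x h (Suc k) (max 0 (s - D))))
      = integral {0..t} (field h (\<lambda>s. delayed D x h k (max 0 (s - D))))"
  proof (rule integral_cong)
    fix s assume "s \<in> {0..t}"
    then have "max 0 (s - D) \<in> {0..real k * D}"
      using Suc.prems assms(1) by (auto simp: algebra_simps)
    from Suc.IH[OF this]
    show "field h (\<lambda>s. delayed D x h (Suc k) (max 0 (s - D))) s = field h (\<lambda>s. delayed D x h k (max 0 (s - D))) s"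
      unfolding field_def by (simp only:)
  qed
  then show ?case by (simp only: delayed.simps(2))
qed simp

text \<open>In the delayed equation the right-hand side at \<open>t\<close> only sees the path up to
  \<open>t - D\<close>, so a solution is reached after finitely many steps. Read as a path for the
  equation without delay, its defect is the effect of shifting time by \<open>D\<close>, which
  equicontinuity makes small while the path is in the ball. No growth bound is available yet, hence
  the conditional form.\<close>

lemma approximate_solution_exists:
  assumes h: "L2_control T h" and e: "0 < e"
  obtains Y where "continuous_on {0..T} Y" "Y 0 = x"
    "\<And>t. t \<in> {0..T} \<Longrightarrow> (\<And>s. s \<in> {0..t} \<Longrightarrow> norm (Y s) \<le> R) \<Longrightarrow> norm (defect x h Y t) \<le> e"
proof -
  define N where "N = energy T h"
  have N: "0 \<le> N" unfolding N_def by (rule energy_nonneg)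
  obtain C where C: "0 < C" "\<And>s y. s \<in> {0..T} \<Longrightarrow> norm y \<le> R \<Longrightarrow> norm (b s y) \<le> C \<and> norm (\<sigma> s y) \<le> C"
    using coefficients_bounded by blast
  obtain d where d: "0 < d" "\<And>h Y Y' t. L2_control T h \<Longrightarrow> energy T h \<le> N \<Longrightarrow> continuous_on {0..T} Y \<Longrightarrow>
      continuous_on {0..T} Y' \<Longrightarrow> t \<in> {0..T} \<Longrightarrow> (\<And>s. s \<in> {0..t} \<Longrightarrow> norm (Y s) \<le> R \<and> norm (Y' s) \<le> R) \<Longrightarrow>
      (\<And>s. s \<in> {0..t} \<Longrightarrow> norm (Y s - Y' s) \<le> d) \<Longrightarrow>
      norm (integral {0..t} (field h Y) - integral {0..t} (field h Y')) \<le> e"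
    using integral_field_close[OF e N] by blast
  have "(\<lambda>n. C * (T / real n) + C * sqrt (T / real n * N)) \<longlonglongrightarrow> C * 0 + C * sqrt (0 * N)"
    by (intro tendsto_intros lim_const_over_n)
  then have "\<forall>\<^sub>F n in sequentially. C * (T / real n) + C * sqrt (T / real n * N) < d"
    by (rule order_tendstoD) (use d in simp)
  then have "\<forall>\<^sub>F n in sequentially. C * (T / real n) + C * sqrt (T / real n * N) < d \<and> 0 < n"
    using eventually_gt_at_top by (rule eventually_conj)
  then obtain n where n: "C * (T / real n) + C * sqrt (T / real n * N) < d" "0 < n"
    by (auto simp: eventually_sequentially)
  define D where "D = T / real n"
  have D: "0 < D" "real n * D = T" using n T by (auto simp: D_def)
  define Y where "Y = delayed D x h n"
  define Z where "Z = (\<lambda>s. Y (max 0 (s - D)))"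
  have Yc: "continuous_on {0..T} Y" and Zc: "continuous_on {0..T} Z"
    using delayed_continuous[OF h] D unfolding Y_def Z_def by auto
  \<comment> \<open>As \<open>real n * D = T\<close>, the iteration has become stationary on all of
    \<open>{0..T}\<close> after \<open>n\<close> steps.\<close>
  have Yeq: "Y t = x + integral {0..t} (field h Z)" if "t \<in> {0..T}" for t
    using delayed_stationary[of D t n x h] that D by (simp add: Y_def Z_def)
  show ?thesis
  proof (rule that[OF Yc])
    show "Y 0 = x" using Yeq[of 0] T by simp
    fix t assume t: "t \<in> {0..T}" and R: "\<And>s. s \<in> {0..t} \<Longrightarrow> norm (Y s) \<le> R"
    have ZR: "norm (Z s) \<le> R" if "s \<in> {0..t}" for s
      unfolding Z_def by (rule R) (use that D in auto)
    have close: "norm (Z s - Y s) \<le> d" if s: "s \<in> {0..t}" for s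
    proof -
      let ?a = "max 0 (s - D)"
      have a: "0 \<le> ?a" "?a \<le> s" "s \<le> T" using s t D by auto
      have "field h Z integrable_on {0..T}"
        using field_absolutely_integrable[OF Zc h order_refl] by (simp add: absolutely_integrable_on_def)
      then have eq: "Y s - Z s = integral {?a..s} (field h Z)"
        using Yeq[of s] Yeq[of ?a] a integral_diff_interval[of "field h Z" 0 T ?a s] by (simp add: Z_def)
      have fai: "field h Z absolutely_integrable_on {?a..s}"
        by (rule absolutely_integrable_on_subinterval[OF field_absolutely_integrable[OF Zc h order_refl]]) (use a in auto)
      have "norm (Y s - Z s) \<le> integral {?a..s} (\<lambda>r. norm (field h Z r))"
        unfolding eq by (rule integral_norm_bound[OF fai])
      also have "\<dots> \<le> C * (s - ?a) + C * sqrt ((s - ?a) * N)"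
      proof (rule integral_field_norm_le[OF Zc h])
        show "norm (b r (Z r)) \<le> C \<and> norm (\<sigma> r (Z r)) \<le> C" if "r \<in> {?a..s}" for r
          using that s t by (intro C(2) ZR) auto
      qed (use C a in \<open>auto simp: N_def\<close>)
      also have "\<dots> \<le> C * D + C * sqrt (D * N)"
        using C N by (intro add_mono mult_left_mono real_sqrt_le_mono mult_right_mono) auto
      also have "\<dots> \<le> d" using n by (simp add: D_def)
      finally show ?thesis by (simp add: norm_minus_commute)
    qed
    have "defect x h Y t = integral {0..t} (field h Z) - integral {0..t} (field h Y)"
      unfolding defect_def Yeq[OF t] by simp
    also have "norm \<dots> \<le> e"
      by (rule d(2)[OF h _ Zc Yc t]) (use R ZR close in \<open>auto simp: N_def\<close>)
    finally show "norm (defect x h Y t) \<le> e" .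
  qed
qed

text \<open>The Lyapunov bound confines approximate solutions to one ball, and the Osgood estimate
  shows that those with defect tending to 0 are uniformly Cauchy. Completeness replaces a
  compactness argument, and the defect is continuous under uniform convergence.\<close>

lemma skeleton_solution_exists:
  assumes h: "L2_control T h"
  shows "\<exists>\<phi>. skeleton_solution T b \<sigma> x h \<phi>"
proof -
  define N where "N = energy T h"
  have N: "0 \<le> N" unfolding N_def by (rule energy_nonneg)
  obtain R e0 where R: "0 < R" and e0: "0 < e0" and bdd: "\<And>y h Y t. y \<in> {x} \<Longrightarrow> L2_control T h \<Longrightarrow> energy T h \<le> N \<Longrightarrow>
     continuous_on {0..T} Y \<Longrightarrow> Y 0 \<in> {x} \<Longrightarrow>
     (\<And>t. t \<in> {0..T} \<Longrightarrow> (\<And>s. s \<in> {0..t} \<Longrightarrow> norm (Y s) \<le> R) \<Longrightarrow> norm (defect y h Y t) \<le> e0) \<Longrightarrow>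
     t \<in> {0..T} \<Longrightarrow> norm (Y t) < R"
    using approximate_solution_bounded[OF bounded_insert[THEN iffD2, OF bounded_empty] N] by metis
  have "\<exists>Y. continuous_on {0..T} Y \<and> (\<forall>t\<in>{0..T}. norm (Y t) \<le> R \<and> norm (defect x h Y t) \<le> e)" if "0 < e" for e
  proof -
    have "0 < min e e0" using that e0 by simp
    from approximate_solution_exists[OF h this, of x R] obtain Y where Y: "continuous_on {0..T} Y" "Y 0 = x"
      "\<And>t. t \<in> {0..T} \<Longrightarrow> (\<And>s. s \<in> {0..t} \<Longrightarrow> norm (Y s) \<le> R) \<Longrightarrow> norm (defect x h Y t) \<le> min e e0" by blast
    have YR: "norm (Y t) < R" if "t \<in> {0..T}" for t
      by (rule bdd[OF singletonI h _ Y(1) _ _ that]) (use Y(3) in \<open>auto simp: Y(2) N_def\<close>)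
    have "norm (defect x h Y t) \<le> min e e0" if "t \<in> {0..T}" for t
      by (rule Y(3)[OF that]) (use YR that in \<open>auto intro: less_imp_le\<close>)
    then show ?thesis using Y(1) YR by (intro exI[of _ Y]) (auto intro: less_imp_le)
  qed
  then have "\<exists>Y. continuous_on {0..T} Y \<and> (\<forall>t\<in>{0..T}. norm (Y t) \<le> R \<and> norm (defect x h Y t) \<le> 1 / (real n + 1))" for n
    by (simp add: add_nonneg_pos)
  then obtain Y where Yc: "\<And>n. continuous_on {0..T} (Y n)"
    and YR: "\<And>n t. t \<in> {0..T} \<Longrightarrow> norm (Y n t) \<le> R" and Yd: "\<And>n t. t \<in> {0..T} \<Longrightarrow> norm (defect x h (Y n) t) \<le> 1 / (real n + 1)"
    by metis
  have ev: "\<exists>k. \<forall>n\<ge>k. 1 / (real n + 1) \<le> e" if "0 < e" for e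
  proof -
    have "(\<lambda>n. 1 / (real n + 1)) \<longlonglongrightarrow> 0" by real_asymp
    then have "\<forall>\<^sub>F n in sequentially. 1 / (real n + 1) < e" by (rule order_tendstoD) (rule that)
    then show ?thesis by (auto simp: eventually_sequentially intro: less_imp_le)
  qed
  have cauchy: "\<exists>k. \<forall>m n t. k \<le> m \<and> k \<le> n \<and> t \<in> {0..T} \<longrightarrow> dist (Y m t) (Y n t) < \<delta>" if \<delta>: "0 < \<delta>" for \<delta>
  proof -
    obtain e where e: "0 < e" "\<And>x h Y Y' t. L2_control T h \<Longrightarrow> energy T h \<le> N \<Longrightarrow>
       continuous_on {0..T} Y \<Longrightarrow> continuous_on {0..T} Y' \<Longrightarrow>
       (\<And>s. s \<in> {0..T} \<Longrightarrow> norm (Y s) \<le> R \<and> norm (Y' s) \<le> R \<and> norm (defect x h Y s) \<le> e \<and> norm (defect x h Y' s) \<le> e) \<Longrightarrow>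
       t \<in> {0..T} \<Longrightarrow> norm (Y t - Y' t) < \<delta>"
      using approximate_solutions_close[OF R N \<delta>] by blast
    obtain k where k: "\<And>n. k \<le> n \<Longrightarrow> 1 / (real n + 1) \<le> e" using ev[OF e(1)] by blast
    have "dist (Y m t) (Y n t) < \<delta>" if "k \<le> m" "k \<le> n" "t \<in> {0..T}" for m n t
      unfolding dist_norm
    proof (rule e(2)[OF h _ Yc Yc _ that(3)])
      show "norm (Y m s) \<le> R \<and> norm (Y n s) \<le> R \<and> norm (defect x h (Y m) s) \<le> e \<and> norm (defect x h (Y n) s) \<le> e"
        if s: "s \<in> {0..T}" for s
        using YR[OF s] Yd[OF s, of m] Yd[OF s, of n] k[OF \<open>k \<le> m\<close>] k[OF \<open>k \<le> n\<close>] by (meson order_trans)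
    qed (simp add: N_def)
    then show ?thesis by blast
  qed
  have "uniformly_Cauchy_on {0..T} Y"
  proof (rule uniformly_Cauchy_onI)
    fix e :: real assume "0 < e"
    then show "\<exists>M. \<forall>x\<in>{0..T}. \<forall>m\<ge>M. \<forall>n\<ge>M. dist (Y m x) (Y n x) < e"
      using cauchy by blast
  qed
  then have "uniformly_convergent_on {0..T} Y" by (rule Cauchy_uniformly_convergent)
  then obtain Z where Zu: "uniform_limit {0..T} Y Z sequentially"
    by (auto simp: uniformly_convergent_on_def)
  then have Z: "\<exists>k. \<forall>n\<ge>k. \<forall>t\<in>{0..T}. dist (Y n t) (Z t) < e" if "0 < e" for e
    using that by (simp add: uniform_limit_sequentially_iff)
  from Zu have Zc: "continuous_on {0..T} Z"
    by (rule uniform_limit_theorem[rotated]) (use Yc in auto)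
  have Zlim: "(\<lambda>n. Y n t) \<longlonglongrightarrow> Z t" if "t \<in> {0..T}" for t
    by (rule tendsto_uniform_limitI[OF Zu that])
  have ZR: "norm (Z t) \<le> R" if "t \<in> {0..T}" for t
    by (rule Lim_norm_ubound[OF _ Zlim[OF that]]) (use YR that in auto)
  have Zd: "defect x h Z t = 0" if t: "t \<in> {0..T}" for t
  proof -
    have "norm (defect x h Z t) \<le> 0 + e" if e: "0 < e" for e
    proof -
      have e3: "0 < e / 3" using e by simp
      obtain d where d: "0 < d" "\<And>h Y Y' t. L2_control T h \<Longrightarrow> energy T h \<le> N \<Longrightarrow> continuous_on {0..T} Y \<Longrightarrow>
        continuous_on {0..T} Y' \<Longrightarrow> t \<in> {0..T} \<Longrightarrow> (\<And>s. s \<in> {0..t} \<Longrightarrow> norm (Y s) \<le> R \<and> norm (Y' s) \<le> R) \<Longrightarrow>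
        (\<And>s. s \<in> {0..t} \<Longrightarrow> norm (Y s - Y' s) \<le> d) \<Longrightarrow>
        norm (integral {0..t} (field h Y) - integral {0..t} (field h Y')) \<le> e / 3"
        using integral_field_close[OF e3 N, of R] by blast
      obtain k where k: "\<And>n t. k \<le> n \<Longrightarrow> t \<in> {0..T} \<Longrightarrow> dist (Y n t) (Z t) < min d (e / 3)"
        using Z[of "min d (e / 3)"] d(1) e3 by (metis min_less_iff_conj)
      obtain k' where k': "\<And>n. k' \<le> n \<Longrightarrow> 1 / (real n + 1) \<le> e / 3" using ev[OF e3] by blast
      let ?n = "max k k'"
      have "norm (Y ?n s - Z s) \<le> d" "norm (Y ?n s - Z s) \<le> e / 3" if "s \<in> {0..T}" for s
        using k[of ?n s] that by (auto simp: dist_norm)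
      note close = this
      have 1: "norm (integral {0..t} (field h (Y ?n)) - integral {0..t} (field h Z)) \<le> e / 3"
        by (rule d(2)[OF h _ Yc Zc t]) (use t in \<open>auto simp: N_def intro!: YR ZR close(1)\<close>)
      have 2: "norm (defect x h (Y ?n) t) \<le> e / 3" by (rule order_trans[OF Yd[OF t] k']) simp
      define a where "a = defect x h (Y ?n) t"
      define c where "c = Y ?n t - Z t"
      define d where "d = integral {0..t} (field h (Y ?n)) - integral {0..t} (field h Z)"
      have eq: "defect x h Z t = a - c + d"
        by (simp add: defect_def a_def c_def d_def)
      have "norm (a - c + d) \<le> norm a + norm c + norm d"
        using norm_triangle_ineq[of "a - c" d] norm_triangle_ineq4[of a c] by linarith
      moreover have "norm a \<le> e / 3" "norm c \<le> e / 3" "norm d \<le> e / 3"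
        using 1 2 close(2)[OF t] unfolding a_def c_def d_def by blast+
      ultimately show ?thesis unfolding eq by linarith
    qed
    then have "norm (defect x h Z t) \<le> 0" by (rule field_le_epsilon)
    then show ?thesis by simp
  qed
  \<comment> \<open>Elements of the path space are \<open>undefined\<close> outside the interval, so
    the uniform limit has to be restricted.\<close>
  have "skeleton_solution T b \<sigma> x h (restrict Z {0..T})"
    unfolding skeleton_solution_iff[OF h]
  proof (intro conjI ballI)
    have "continuous_on {0..T} (restrict Z {0..T})"
      by (rule continuous_on_eq[OF Zc]) simp
    then show "restrict Z {0..T} \<in> mspace (path_space T)" by (simp add: mspace_path_space)
    fix t assume t: "t \<in> {0..T}"
    have "integral {0..t} (field h (restrict Z {0..T})) = integral {0..t} (field h Z)"
      by (rule integral_cong) (use t in \<open>auto simp: field_def\<close>)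
    then show "defect x h (restrict Z {0..T}) t = 0" using Zd[OF t] t by (simp add: defect_def)
  qed
  then show ?thesis by blast
qed

lemma skeleton_solutionD:
  assumes h: "L2_control T h" and sol: "skeleton_solution T b \<sigma> x h \<phi>"
  shows "continuous_on {0..T} \<phi>" "\<phi> \<in> extensional {0..T}" "t \<in> {0..T} \<Longrightarrow> defect x h \<phi> t = 0" "\<phi> 0 = x"
proof -
  show "continuous_on {0..T} \<phi>" "\<phi> \<in> extensional {0..T}" and *: "t \<in> {0..T} \<Longrightarrow> defect x h \<phi> t = 0" for t
    using sol by (auto simp: skeleton_solution_iff[OF h] mspace_path_space)
  show "\<phi> 0 = x" using *[of 0] T by (simp add: defect_def)
qed

text \<open>Exact solutions are approximate ones for every tolerance, so their distance is below
  every \<delta>. The ball is supplied by boundedness of the two continuous paths.\<close>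

lemma skeleton_solution_unique:
  assumes h: "L2_control T h" and "skeleton_solution T b \<sigma> x h \<phi>" "skeleton_solution T b \<sigma> x h \<psi>"
  shows "\<phi> = \<psi>"
proof -
  note D1 = skeleton_solutionD[OF h assms(2)] and D2 = skeleton_solutionD[OF h assms(3)]
  have "bounded (\<phi> ` {0..T})" "bounded (\<psi> ` {0..T})"
    by (intro compact_imp_bounded compact_continuous_image D1 D2 compact_Icc)+
  then obtain B1 B2 where "\<And>t. t \<in> {0..T} \<Longrightarrow> norm (\<phi> t) \<le> B1" "\<And>t. t \<in> {0..T} \<Longrightarrow> norm (\<psi> t) \<le> B2"
    unfolding bounded_iff ball_simps by blast
  then have B: "norm (\<phi> t) \<le> max 1 (max B1 B2) \<and> norm (\<psi> t) \<le> max 1 (max B1 B2)" if "t \<in> {0..T}" for t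
    using that by (meson le_max_iff_disj)
  have "norm (\<phi> t - \<psi> t) \<le> 0 + \<delta>" if t: "t \<in> {0..T}" and \<delta>: "0 < \<delta>" for t \<delta>
  proof -
    obtain e where e: "0 < e" "\<And>x h' Y Y' t. L2_control T h' \<Longrightarrow> energy T h' \<le> energy T h \<Longrightarrow>
       continuous_on {0..T} Y \<Longrightarrow> continuous_on {0..T} Y' \<Longrightarrow>
       (\<And>s. s \<in> {0..T} \<Longrightarrow> norm (Y s) \<le> max 1 (max B1 B2) \<and> norm (Y' s) \<le> max 1 (max B1 B2)
          \<and> norm (defect x h' Y s) \<le> e \<and> norm (defect x h' Y' s) \<le> e) \<Longrightarrow>
       t \<in> {0..T} \<Longrightarrow> norm (Y t - Y' t) < \<delta>"
      using approximate_solutions_close[of "max 1 (max B1 B2)" "energy T h" \<delta>] energy_nonneg[of T h] \<delta> by (metis max.strict_coboundedI1 zero_less_one)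
    have "norm (\<phi> t - \<psi> t) < \<delta>"
      by (rule e(2)[OF h order_refl D1(1) D2(1) _ t, of x]) (use B e(1) D1(3) D2(3) in auto)
    then show ?thesis by simp
  qed
  note le = this
  have "norm (\<phi> t - \<psi> t) \<le> 0" if "t \<in> {0..T}" for t
    by (rule field_le_epsilon) (rule le[OF that])
  then show ?thesis
    by (intro extensionalityI[OF D1(2) D2(2)]) simp
qed

lemma skeleton_solution_skeleton:
  assumes h: "L2_control T h"
  shows "skeleton_solution T b \<sigma> x h (skeleton T b \<sigma> x h)"
proof -
  obtain \<phi> where \<phi>: "skeleton_solution T b \<sigma> x h \<phi>" using skeleton_solution_exists[OF h] by blast
  show ?thesis
    unfolding skeleton_def
    by (rule theI[where P = "skeleton_solution T b \<sigma> x h", OF \<phi>]) (rule skeleton_solution_unique[OF h _ \<phi>])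
qed

lemma skeletonD:
  assumes h: "L2_control T h"
  shows "continuous_on {0..T} (skeleton T b \<sigma> x h)" "skeleton T b \<sigma> x h \<in> extensional {0..T}"
    "t \<in> {0..T} \<Longrightarrow> defect x h (skeleton T b \<sigma> x h) t = 0" "skeleton T b \<sigma> x h 0 = x"
  using skeleton_solutionD[OF h skeleton_solution_skeleton[OF h]] by auto

lemma skeleton_in_path_space: "L2_control T h \<Longrightarrow> skeleton T b \<sigma> x h \<in> mspace (path_space T)"
  using skeletonD by (simp add: mspace_path_space)

text \<open>The only fact about the deterministic equation that the later parts use:
  \<open>R\<close> and \<open>e\<close> are chosen from \<open>A\<close>, \<open>N\<close> and
  \<delta> alone, and the defect has to be controlled only on time intervals in which the path has
  remained in the ball.\<close>

lemma stability:
  assumes A: "bounded A" and N: "0 \<le> N" and \<delta>: "0 < \<delta>"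
  obtains R e where "0 < R" "0 < e"
    "\<And>x h t. x \<in> A \<Longrightarrow> L2_control T h \<Longrightarrow> energy T h \<le> N \<Longrightarrow> t \<in> {0..T} \<Longrightarrow> norm (skeleton T b \<sigma> x h t) < R"
    "\<And>x h Y t. x \<in> A \<Longrightarrow> L2_control T h \<Longrightarrow> energy T h \<le> N \<Longrightarrow>
     continuous_on {0..T} Y \<Longrightarrow> Y 0 \<in> A \<Longrightarrow>
     (\<And>t. t \<in> {0..T} \<Longrightarrow> (\<And>s. s \<in> {0..t} \<Longrightarrow> norm (Y s) \<le> R) \<Longrightarrow> norm (defect x h Y t) \<le> e) \<Longrightarrow>
     t \<in> {0..T} \<Longrightarrow> norm (Y t - skeleton T b \<sigma> x h t) < \<delta>"
proof -
  obtain R e1 where R: "0 < R" and e1: "0 < e1" and bdd: "\<And>x h Y t. x \<in> A \<Longrightarrow> L2_control T h \<Longrightarrow> energy T h \<le> N \<Longrightarrow>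
     continuous_on {0..T} Y \<Longrightarrow> Y 0 \<in> A \<Longrightarrow>
     (\<And>t. t \<in> {0..T} \<Longrightarrow> (\<And>s. s \<in> {0..t} \<Longrightarrow> norm (Y s) \<le> R) \<Longrightarrow> norm (defect x h Y t) \<le> e1) \<Longrightarrow>
     t \<in> {0..T} \<Longrightarrow> norm (Y t) < R"
    using approximate_solution_bounded[OF A N] by blast
  obtain e2 where e2: "0 < e2" and close: "\<And>x h Y Y' t. L2_control T h \<Longrightarrow> energy T h \<le> N \<Longrightarrow>
     continuous_on {0..T} Y \<Longrightarrow> continuous_on {0..T} Y' \<Longrightarrow>
     (\<And>s. s \<in> {0..T} \<Longrightarrow> norm (Y s) \<le> R \<and> norm (Y' s) \<le> R \<and> norm (defect x h Y s) \<le> e2 \<and> norm (defect x h Y' s) \<le> e2) \<Longrightarrow>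
     t \<in> {0..T} \<Longrightarrow> norm (Y t - Y' t) < \<delta>"
    using approximate_solutions_close[OF R N \<delta>] by blast
  have sk: "norm (skeleton T b \<sigma> x h t) < R"
    if "x \<in> A" "L2_control T h" "energy T h \<le> N" "t \<in> {0..T}" for x h t
    by (rule bdd[OF that(1-3)]) (use that e1 in \<open>auto simp: skeletonD\<close>)
  show ?thesis
  proof (rule that[OF R, of "min e1 e2"])
    show "0 < min e1 e2" using e1 e2 by simp
    fix x h Y t
    assume *: "x \<in> A" "L2_control T h" "energy T h \<le> N" "continuous_on {0..T} Y" "Y 0 \<in> A"
      and def: "\<And>t. t \<in> {0..T} \<Longrightarrow> (\<And>s. s \<in> {0..t} \<Longrightarrow> norm (Y s) \<le> R) \<Longrightarrow> norm (defect x h Y t) \<le> min e1 e2"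
      and t: "t \<in> {0..T}"
    have YR: "norm (Y s) < R" if "s \<in> {0..T}" for s
      by (rule bdd[OF *]) (use def that in auto)
    have Yd: "norm (defect x h Y s) \<le> min e1 e2" if "s \<in> {0..T}" for s
      by (rule def) (use YR that in \<open>auto intro: less_imp_le\<close>)
    show "norm (Y t - skeleton T b \<sigma> x h t) < \<delta>"
    proof (rule close[OF *(2-4) _ _ t])
      show "continuous_on {0..T} (skeleton T b \<sigma> x h)" by (rule skeletonD(1)[OF *(2)])
      show "norm (Y s) \<le> R \<and> norm (skeleton T b \<sigma> x h s) \<le> R \<and> norm (defect x h Y s) \<le> e2
          \<and> norm (defect x h (skeleton T b \<sigma> x h) s) \<le> e2" if s: "s \<in> {0..T}" for s
        using YR[OF s] sk[OF *(1-3) s] Yd[OF s] skeletonD(3)[OF *(2) s, of x] e2 by auto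
    qed
  qed (rule sk; assumption)
qed

end

section \<open>Compactness of the level sets\<close>

definition grid :: "real \<Rightarrow> nat \<Rightarrow> nat \<Rightarrow> real" where
  "grid T n i = real i * (T / real n)"

lemma grid_0 [simp]: "grid T n 0 = 0"
  by (simp add: grid_def)

lemma grid_end: "0 < n \<Longrightarrow> grid T n n = T"
  by (simp add: grid_def)

lemma grid_Suc: "grid T n (Suc i) = grid T n i + T / real n"
  unfolding grid_def of_nat_Suc distrib_right by simp

lemma grid_mono: "0 \<le> T \<Longrightarrow> i \<le> j \<Longrightarrow> grid T n i \<le> grid T n j"
  unfolding grid_def by (intro mult_right_mono) auto

lemma grid_nonneg: "0 \<le> T \<Longrightarrow> 0 \<le> grid T n i"
  using grid_mono[of T 0 i n] by simp

lemma grid_le: "0 \<le> T \<Longrightarrow> 0 < n \<Longrightarrow> i \<le> n \<Longrightarrow> grid T n i \<le> T"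
  using grid_mono[of T i n n] by (simp add: grid_end)

lemma grid_cell:
  assumes "0 < T" "0 < n" "t \<in> {0..T}"
  obtains i where "i < n" "t \<in> {grid T n i..grid T n (Suc i)}"
proof -
  have "\<exists>i<n. t \<in> {grid T n i..grid T n (Suc i)}" if "t \<in> {0..grid T n k}" "k \<le> n" "0 < k" for k
    using that
  proof (induction k)
    case (Suc k)
    show ?case
    proof (cases "t \<le> grid T n k \<and> 0 < k")
      case True
      then show ?thesis using Suc by auto
    next
      case False
      then have "grid T n k \<le> t" using Suc.prems by (cases "k = 0") auto
      then show ?thesis using Suc.prems by (intro exI[of _ k]) auto
    qed
  qed simp
  from this[of n] show ?thesis using that assms by (auto simp: grid_end)
qed

text \<open>On each cell, freezing \<open>Z\<close> at the left end changes the integrand by at most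
  \<omega> times the norm of the control; these errors add up over the cells.\<close>

lemma grid_sum_integral:
  fixes Z :: "real \<Rightarrow> real ^ 'm ^ 'd"
  assumes T: "0 < T" "0 < n" and h: "L2_control T h" and Z: "continuous_on {0..T} Z" and i: "i \<le> n"
    and osc: "\<And>j s. j < i \<Longrightarrow> s \<in> {grid T n j..grid T n (Suc j)} \<Longrightarrow> norm (Z s - Z (grid T n j)) \<le> \<omega>"
  shows "norm (integral {0..grid T n i} (\<lambda>s. Z s *v h s)
      - (\<Sum>j<i. Z (grid T n j) *v integral {grid T n j..grid T n (Suc j)} h)) \<le> \<omega> * integral {0..grid T n i} (\<lambda>s. norm (h s))"
  using i osc
proof (induction i)
  case (Suc i)
  let ?a = "grid T n i" and ?b = "grid T n (Suc i)"
  have ab: "0 \<le> ?a" "?a \<le> ?b" "?b \<le> T"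
    using Suc.prems(1) T by (auto intro: grid_nonneg grid_mono grid_le)
  have Zh: "(\<lambda>s. Z s *v h s) absolutely_integrable_on {0..T}"
    by (rule absolutely_integrable_matrix_vector_mult[OF Z L2_controlD(1)[OF h]])
  have Zhi: "(\<lambda>s. Z s *v h s) integrable_on {p..q}" and hi: "h integrable_on {p..q}" and hni: "(\<lambda>s. norm (h s)) integrable_on {p..q}"
    if "0 \<le> p" "q \<le> T" for p q
  proof -
    have sub: "{p..q} \<subseteq> {0..T}" using that by auto
    show "(\<lambda>s. Z s *v h s) integrable_on {p..q}" "h integrable_on {p..q}" "(\<lambda>s. norm (h s)) integrable_on {p..q}"
      using absolutely_integrable_on_subinterval[OF Zh sub] absolutely_integrable_on_subinterval[OF L2_controlD(1)[OF h] sub]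
      by (simp_all add: absolutely_integrable_on_def)
  qed
  have IH: "norm (integral {0..?a} (\<lambda>s. Z s *v h s)
      - (\<Sum>j<i. Z (grid T n j) *v integral {grid T n j..grid T n (Suc j)} h)) \<le> \<omega> * integral {0..?a} (\<lambda>s. norm (h s))"
    using Suc by simp
  have c1: "integral {0..?b} (\<lambda>s. Z s *v h s) = integral {0..?a} (\<lambda>s. Z s *v h s) + integral {?a..?b} (\<lambda>s. Z s *v h s)"
    using Henstock_Kurzweil_Integration.integral_combine[OF ab(1,2) Zhi] ab by simp
  have c2: "integral {0..?b} (\<lambda>s. norm (h s)) = integral {0..?a} (\<lambda>s. norm (h s)) + integral {?a..?b} (\<lambda>s. norm (h s))"
    using Henstock_Kurzweil_Integration.integral_combine[OF ab(1,2) hni] ab by simp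
  have "integral {?a..?b} (\<lambda>s. Z ?a *v h s) = Z ?a *v integral {?a..?b} h"
    using integral_linear[OF hi matrix_vector_mul_bounded_linear[of "Z ?a"], of ?a ?b] ab by (simp add: o_def)
  moreover have ci: "(\<lambda>s. Z ?a *v h s) integrable_on {?a..?b}"
    using integrable_linear[OF hi matrix_vector_mul_bounded_linear[of "Z ?a"], of ?a ?b] ab by (simp add: o_def)
  ultimately have "integral {?a..?b} (\<lambda>s. Z s *v h s) - Z ?a *v integral {?a..?b} h = integral {?a..?b} (\<lambda>s. Z s *v h s - Z ?a *v h s)"
    using Zhi[of ?a ?b] ab by (simp add: Henstock_Kurzweil_Integration.integral_diff)
  also have "norm \<dots> \<le> integral {?a..?b} (\<lambda>s. \<omega> * norm (h s))"
  proof (rule integral_norm_bound_integral)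
    fix s assume s: "s \<in> {?a..?b}"
    have "norm (Z s *v h s - Z ?a *v h s) = norm ((Z s - Z ?a) *v h s)" by (simp add: matrix_vector_mult_diff_rdistrib)
    also have "\<dots> \<le> norm (Z s - Z ?a) * norm (h s)" by (rule norm_matrix_vector_mult_le)
    also have "\<dots> \<le> \<omega> * norm (h s)" using Suc.prems(2)[of i s] s by (intro mult_right_mono) auto
    finally show "norm (Z s *v h s - Z ?a *v h s) \<le> \<omega> * norm (h s)" .
  qed (use ab ci Zhi hni in \<open>auto intro!: integrable_diff integrable_on_mult_right\<close>)
  finally have "norm (integral {?a..?b} (\<lambda>s. Z s *v h s) - Z ?a *v integral {?a..?b} h) \<le> \<omega> * integral {?a..?b} (\<lambda>s. norm (h s))"
    by simp
  from norm_triangle_mono[OF IH this] show ?case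
    unfolding c1 c2 sum.lessThan_Suc distrib_left by (simp only: add_diff_add)
qed simp

text \<open>One estimate with two uses. \<open>J\<close> is the integral against another control
  when level sets are studied, and a scaled stochastic integral for the diffusion. It is tied to the
  control \<open>h\<close> only through the finitely many vectors \<open>\<Delta> j\<close>, which
  are close to the cell integrals of \<open>h\<close>.\<close>

lemma grid_compare:
  fixes Z :: "real \<Rightarrow> real ^ 'm ^ 'd" and J :: "real \<Rightarrow> real ^ 'd" and \<Delta> :: "nat \<Rightarrow> real ^ 'm"
  assumes T: "0 < T" "0 < n" and h: "L2_control T h" "energy T h \<le> N" and Z: "continuous_on {0..T} Z"
    and t: "t \<in> {0..T}" and nonneg: "0 \<le> \<omega>" "0 \<le> C" "0 \<le> r2"
    and C: "\<And>s. s \<in> {0..t} \<Longrightarrow> norm (Z s) \<le> C"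
    and osc: "\<And>j s. j < n \<Longrightarrow> s \<in> {grid T n j..grid T n (Suc j)} \<Longrightarrow> s \<le> t \<Longrightarrow> norm (Z s - Z (grid T n j)) \<le> \<omega>"
    and r1: "\<And>i. i \<le> n \<Longrightarrow> grid T n i \<le> t \<Longrightarrow> norm (J (grid T n i) - (\<Sum>j<i. Z (grid T n j) *v \<Delta> j)) \<le> r1"
    and r2: "\<And>j. j < n \<Longrightarrow> norm (integral {grid T n j..grid T n (Suc j)} h - \<Delta> j) \<le> r2"
    and r3: "\<And>i. i < n \<Longrightarrow> grid T n i \<le> t \<Longrightarrow> t \<le> grid T n (Suc i) \<Longrightarrow> norm (J t - J (grid T n i)) \<le> r3"
  shows "norm (J t - integral {0..t} (\<lambda>s. Z s *v h s)) \<le> r1 + real n * (C * r2) + r3 + \<omega> * sqrt (T * N) + C * sqrt (T / real n * N)"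
proof -
  obtain i where i: "i < n" "t \<in> {grid T n i..grid T n (Suc i)}" using grid_cell[OF T t] by blast
  let ?a = "grid T n i"
  have a: "0 \<le> ?a" "?a \<le> t" "t \<le> T" "t - ?a \<le> T / real n"
    using i t T grid_nonneg[of T n i] by (auto simp: grid_Suc)
  have N: "0 \<le> N" using energy_nonneg[of T h] h(2) by simp
  have Zh: "(\<lambda>s. Z s *v h s) absolutely_integrable_on {0..T}"
    by (rule absolutely_integrable_matrix_vector_mult[OF Z L2_controlD(1)[OF h(1)]])
  have Zhi: "(\<lambda>s. Z s *v h s) integrable_on {0..T}" using Zh by (rule set_lebesgue_integral_eq_integral(1))
  \<comment> \<open>The five errors: \<open>J\<close> on the last incomplete cell, \<open>J\<close>
    against its frozen sum, increments against cell integrals, the integral of \<open>h\<close>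
    against its frozen sum, and the integral of \<open>h\<close> on the last incomplete
    cell.\<close>
  define e1 where "e1 = J t - J ?a"
  define e2 where "e2 = J ?a - (\<Sum>j<i. Z (grid T n j) *v \<Delta> j)"
  define e3 where "e3 = (\<Sum>j<i. Z (grid T n j) *v (integral {grid T n j..grid T n (Suc j)} h - \<Delta> j))"
  define e4 where "e4 = integral {0..?a} (\<lambda>s. Z s *v h s) - (\<Sum>j<i. Z (grid T n j) *v integral {grid T n j..grid T n (Suc j)} h)"
  define e5 where "e5 = integral {?a..t} (\<lambda>s. Z s *v h s)"
  have "integral {0..t} (\<lambda>s. Z s *v h s) - integral {0..?a} (\<lambda>s. Z s *v h s) = e5"
    unfolding e5_def by (rule integral_diff_interval[OF Zhi a(1-3)])
  then have eq: "J t - integral {0..t} (\<lambda>s. Z s *v h s) = e1 + (e2 + (- e3 + (- e4 + - e5)))"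
    by (simp add: e1_def e2_def e3_def e4_def matrix_vector_mult_diff_distrib sum_subtractf algebra_simps)
  have "norm e1 \<le> r3" unfolding e1_def by (rule r3) (use i in auto)
  moreover have "norm e2 \<le> r1" unfolding e2_def by (rule r1) (use i in auto)
  moreover have "norm e3 \<le> real n * (C * r2)"
  proof -
    have "norm e3 \<le> (\<Sum>j<i. C * r2)"
      unfolding e3_def
    proof (rule sum_norm_le)
      fix j assume j: "j \<in> {..<i}"
      then have "grid T n j \<le> t" using grid_mono[of T j i n] T a by auto
      then have "norm (Z (grid T n j)) \<le> C" using T by (intro C) (auto intro: grid_nonneg)
      then show "norm (Z (grid T n j) *v (integral {grid T n j..grid T n (Suc j)} h - \<Delta> j)) \<le> C * r2"
        using r2[of j] j i nonneg by (intro order_trans[OF norm_matrix_vector_mult_le] mult_mono) auto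
    qed
    also have "\<dots> \<le> real n * (C * r2)" using i nonneg by (auto intro!: mult_right_mono)
    finally show ?thesis .
  qed
  moreover have "norm e4 \<le> \<omega> * sqrt (T * N)"
  proof -
    have "norm e4 \<le> \<omega> * integral {0..?a} (\<lambda>s. norm (h s))"
      unfolding e4_def
    proof (rule grid_sum_integral[OF T h(1) Z])
      fix j s assume j: "j < i" "s \<in> {grid T n j..grid T n (Suc j)}"
      then have "s \<le> t" using grid_mono[of T "Suc j" i n] T a by auto
      then show "norm (Z s - Z (grid T n j)) \<le> \<omega>" using j i by (intro osc) auto
    qed (use i in simp)
    also have "\<dots> \<le> \<omega> * sqrt ((?a - 0) * N)"
      by (intro mult_left_mono integral_norm_control_le[OF h]) (use a nonneg in auto)
    also have "\<dots> \<le> \<omega> * sqrt (T * N)"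
      using a N nonneg by (intro mult_left_mono real_sqrt_le_mono mult_right_mono) auto
    finally show ?thesis .
  qed
  moreover have "norm e5 \<le> C * sqrt (T / real n * N)"
  proof -
    have sub: "{?a..t} \<subseteq> {0..T}" using a by auto
    have hni: "(\<lambda>s. norm (h s)) integrable_on {?a..t}"
      using absolutely_integrable_on_subinterval[OF L2_controlD(1)[OF h(1)] sub] by (simp add: absolutely_integrable_on_def)
    have "norm e5 \<le> integral {?a..t} (\<lambda>s. C * norm (h s))"
      unfolding e5_def
    proof (rule integral_norm_bound_integral[OF _ integrable_on_mult_right[OF hni]])
      show "(\<lambda>s. Z s *v h s) integrable_on {?a..t}" by (rule integrable_subinterval_real[OF Zhi sub])
      fix s assume "s \<in> {?a..t}"
      then show "norm (Z s *v h s) \<le> C * norm (h s)"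
        using a by (intro order_trans[OF norm_matrix_vector_mult_le] mult_right_mono C) auto
    qed
    also have "\<dots> \<le> C * sqrt ((t - ?a) * N)"
      using integral_norm_control_le[OF h a(1-3)] nonneg by (simp add: mult_left_mono)
    also have "\<dots> \<le> C * sqrt (T / real n * N)"
      using a N nonneg by (intro mult_left_mono real_sqrt_le_mono mult_right_mono) auto
    finally show ?thesis .
  qed
  moreover have "norm (J t - integral {0..t} (\<lambda>s. Z s *v h s)) \<le> norm e1 + (norm e2 + (norm e3 + (norm e4 + norm e5)))"
    unfolding eq
    by (intro order_trans[OF norm_triangle_ineq] add_left_mono) (simp add: norm_triangle_ineq[of "- e4" "- e5", simplified] norm_triangle_le)
  ultimately show ?thesis by linarith
qed

context osgood_lyapunov begin

lemma integral_field_diff: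
  assumes Y: "continuous_on {0..T} Y" and h: "L2_control T h" and k: "L2_control T k" and t: "t \<in> {0..T}"
  shows "integral {0..t} (field k Y) - integral {0..t} (field h Y)
    = integral {0..t} (\<lambda>s. \<sigma> s (Y s) *v k s) - integral {0..t} (\<lambda>s. \<sigma> s (Y s) *v h s)"
proof -
  have sub: "{0..t} \<subseteq> {0..T}" using t by auto
  have i: "(\<lambda>s. \<sigma> s (Y s) *v u s) integrable_on {0..t}" if "L2_control T u" for u
    by (rule set_lebesgue_integral_eq_integral(1), rule absolutely_integrable_matrix_vector_mult)
       (use continuous_on_subset[OF coefficients_continuous_on(2)[OF Y] sub] absolutely_integrable_on_subinterval[OF L2_controlD(1)[OF that] sub] in auto)
  have bi: "(\<lambda>s. b s (Y s)) integrable_on {0..t}"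
    by (rule integrable_continuous_interval) (rule continuous_on_subset[OF coefficients_continuous_on(1)[OF Y] sub])
  show ?thesis
    unfolding field_def[abs_def]
    by (simp add: Henstock_Kurzweil_Integration.integral_add[OF bi i[OF h]] Henstock_Kurzweil_Integration.integral_add[OF bi i[OF k]])
qed

lemma grid_fine:
  assumes "0 < e" "0 \<le> N"
  obtains n0 where "0 < n0" "\<And>n. n0 \<le> n \<Longrightarrow> C * (T / real n) + C * sqrt (T / real n * N) \<le> e"
proof -
  have "(\<lambda>n. C * (T / real n) + C * sqrt (T / real n * N)) \<longlonglongrightarrow> C * 0 + C * sqrt (0 * N)"
    by (intro tendsto_intros lim_const_over_n)
  then have "\<forall>\<^sub>F n in sequentially. C * (T / real n) + C * sqrt (T / real n * N) < e"
    by (rule order_tendstoD) (use assms in simp)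
  then obtain k where "\<And>n. k \<le> n \<Longrightarrow> C * (T / real n) + C * sqrt (T / real n * N) < e"
    by (auto simp: eventually_sequentially)
  note k = this
  show ?thesis
  proof (rule that[of "Suc k"])
    show "C * (T / real n) + C * sqrt (T / real n * N) \<le> e" if "Suc k \<le> n" for n
      using k[of n] that by (meson Suc_leD less_imp_le)
  qed simp
qed

text \<open>The exact solution for \<open>h n\<close> is an approximate solution for
  \<open>k\<close>: its defect is the difference of initial points plus that of two integrals of the
  same matrix path against the two controls. Uniform closeness of the primitives, the form in which
  weak convergence enters, makes the cell integrals close, and \<open>grid_compare\<close> does the
  rest.\<close>

lemma skeleton_continuous_weakly:
  fixes h :: "nat \<Rightarrow> real \<Rightarrow> real ^ 'm"
  assumes x: "xs \<longlonglongrightarrow> x" and h: "\<And>n. L2_control T (h n)" "\<And>n. energy T (h n) \<le> N"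
    and k: "L2_control T k" "energy T k \<le> N"
    and conv: "\<And>e. 0 < e \<Longrightarrow> \<exists>n0. \<forall>n\<ge>n0. \<forall>t\<in>{0..T}. norm (integral {0..t} (h n) - integral {0..t} k) \<le> e"
    and \<delta>: "0 < \<delta>"
  shows "\<exists>n0. \<forall>n\<ge>n0. \<forall>t\<in>{0..T}. norm (skeleton T b \<sigma> (xs n) (h n) t - skeleton T b \<sigma> x k t) < \<delta>"
proof -
  have N: "0 \<le> N" using energy_nonneg[of T k] k by simp
  define A where "A = insert x (range xs)"
  have A: "bounded A" using convergent_imp_bounded[OF x] by (simp add: A_def)
  obtain R e where R: "0 < R" and e: "0 < e"
    and bdd: "\<And>x h t. x \<in> A \<Longrightarrow> L2_control T h \<Longrightarrow> energy T h \<le> N \<Longrightarrow> t \<in> {0..T} \<Longrightarrow> norm (skeleton T b \<sigma> x h t) < R"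
    and stab: "\<And>x h Y t. x \<in> A \<Longrightarrow> L2_control T h \<Longrightarrow> energy T h \<le> N \<Longrightarrow>
     continuous_on {0..T} Y \<Longrightarrow> Y 0 \<in> A \<Longrightarrow>
     (\<And>t. t \<in> {0..T} \<Longrightarrow> (\<And>s. s \<in> {0..t} \<Longrightarrow> norm (Y s) \<le> R) \<Longrightarrow> norm (defect x h Y t) \<le> e) \<Longrightarrow>
     t \<in> {0..T} \<Longrightarrow> norm (Y t - skeleton T b \<sigma> x h t) < \<delta>"
    using stability[OF A N \<delta>] by blast
  obtain C where C: "0 < C" "\<And>s y. s \<in> {0..T} \<Longrightarrow> norm y \<le> R \<Longrightarrow> norm (b s y) \<le> C \<and> norm (\<sigma> s y) \<le> C"
    using coefficients_bounded by blast
  \<comment> \<open>The 1 avoids division by zero when \<open>N\<close> is 0.\<close>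
  define S where "S = 1 + sqrt (T * N)"
  have S: "0 < S" unfolding S_def using T N by (intro add_pos_nonneg) auto
  define \<omega> where "\<omega> = e / (8 * S)"
  have \<omega>0: "0 < \<omega>" unfolding \<omega>_def using e S by simp
  have "\<omega> * sqrt (T * N) \<le> \<omega> * S" using \<omega>0 by (intro mult_left_mono) (auto simp: S_def)
  also have "\<dots> = e / 8" using S by (simp add: \<omega>_def)
  finally have \<omega>: "0 < \<omega>" "\<omega> * sqrt (T * N) \<le> e / 8" using \<omega>0 by auto
  obtain d where d: "0 < d" "\<And>s s' y y'. s \<in> {0..T} \<Longrightarrow> s' \<in> {0..T} \<Longrightarrow> norm y \<le> R \<Longrightarrow> norm y' \<le> R \<Longrightarrow>
      \<bar>s - s'\<bar> \<le> d \<Longrightarrow> norm (y - y') \<le> d \<Longrightarrow> norm (b s y - b s' y') \<le> \<omega> \<and> norm (\<sigma> s y - \<sigma> s' y') \<le> \<omega>"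
    using coefficients_uniformly_continuous[OF \<omega>(1)] by blast
  \<comment> \<open>One fineness condition with three purposes: cells of length at most
    \<open>d\<close>, solutions that move by at most \<open>d\<close> within a cell, and incomplete
    cells that contribute at most \<open>e / 8\<close>.\<close>
  obtain m where m: "0 < m" "C * (T / real m) + C * sqrt (T / real m * N) \<le> min (C * d) (min d (e / 8))"
    using grid_fine[of "min (C * d) (min d (e / 8))" N C] d(1) C(1) e N by (metis min_less_iff_conj divide_pos_pos mult_pos_pos order_refl zero_less_numeral)
  have Tm: "0 \<le> C * (T / real m)" "0 \<le> C * sqrt (T / real m * N)" using C T m N by auto
  have m1: "T / real m \<le> d"
  proof -
    have "C * (T / real m) \<le> C * d" using m(2) Tm by linarith
    then show ?thesis using C(1) by (rule mult_left_le_imp_le)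
  qed
  have m2: "C * sqrt (T / real m * N) \<le> e / 8" "C * (T / real m) + C * sqrt (T / real m * N) \<le> d"
    using m(2) Tm by linarith+
  define r where "r = e / (8 * (real m * C))"
  have r: "0 < r" "real m * (C * r) = e / 8" using e m C by (auto simp: r_def)
  obtain n1 where n1: "\<And>n t. n1 \<le> n \<Longrightarrow> t \<in> {0..T} \<Longrightarrow> norm (integral {0..t} (h n) - integral {0..t} k) \<le> r / 2"
    using conv[of "r / 2"] half_gt_zero[OF r(1)] by blast
  have "\<exists>n2. \<forall>n\<ge>n2. norm (xs n - x) < e / 8"
    using LIMSEQ_D[OF x, of "e / 8"] e by auto
  then obtain n2 where n2: "\<And>n. n2 \<le> n \<Longrightarrow> norm (xs n - x) < e / 8" by blast
  show ?thesis
  proof (intro exI[of _ "max n1 n2"] allI impI ballI)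
    fix n t assume n: "max n1 n2 \<le> n" and t: "t \<in> {0..T}"
    define \<phi> where "\<phi> = skeleton T b \<sigma> (xs n) (h n)"
    have \<phi>R: "norm (\<phi> s) \<le> R" if "s \<in> {0..T}" for s
      unfolding \<phi>_def using bdd[OF _ h that, of "xs n" n] by (auto simp: A_def intro: less_imp_le)
    have \<phi>c: "continuous_on {0..T} \<phi>" and \<phi>d: "\<And>s. s \<in> {0..T} \<Longrightarrow> defect (xs n) (h n) \<phi> s = 0" and \<phi>0: "\<phi> 0 = xs n"
      unfolding \<phi>_def using skeletonD[OF h(1)] by auto
    let ?Z = "\<lambda>s. \<sigma> s (\<phi> s)"
    let ?J = "\<lambda>t. integral {0..t} (\<lambda>s. ?Z s *v h n s)"
    have Zc: "continuous_on {0..T} ?Z" by (rule coefficients_continuous_on[OF \<phi>c])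
    have ZC: "norm (?Z s) \<le> C" if "s \<in> {0..T}" for s using C(2)[OF that \<phi>R[OF that]] by simp
    have osc: "norm (?Z s - ?Z (grid T m j)) \<le> \<omega>" if j: "j < m" "s \<in> {grid T m j..grid T m (Suc j)}" for j s
    proof -
      let ?a = "grid T m j"
      have a: "0 \<le> ?a" "?a \<le> s" "s \<le> T" "s - ?a \<le> T / real m"
        using j T m grid_nonneg[of T m j] grid_le[of T m "Suc j"] by (auto simp: grid_Suc)
      have fi: "field (h n) \<phi> absolutely_integrable_on {0..T}"
        by (rule field_absolutely_integrable[OF \<phi>c h(1) order_refl])
      have "\<phi> s - \<phi> ?a = integral {?a..s} (field (h n) \<phi>)"
        using \<phi>d[of s] \<phi>d[of ?a] a integral_diff_interval[OF set_lebesgue_integral_eq_integral(1)[OF fi] a(1-3)]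
        by (simp add: defect_def algebra_simps)
      also have "norm \<dots> \<le> integral {?a..s} (\<lambda>r. norm (field (h n) \<phi> r))"
        by (rule integral_norm_bound[OF absolutely_integrable_on_subinterval[OF fi]]) (use a in auto)
      also have "\<dots> \<le> C * (s - ?a) + C * sqrt ((s - ?a) * N)"
        by (rule integral_field_norm_le[OF \<phi>c h]) (use a C(1) in \<open>auto intro!: C(2) \<phi>R less_imp_le[OF C(1)]\<close>)
      also have "\<dots> \<le> C * (T / real m) + C * sqrt (T / real m * N)"
        using a C(1) N by (intro add_mono mult_left_mono real_sqrt_le_mono mult_right_mono) auto
      also have "\<dots> \<le> d" by (rule m2)
      finally have "norm (\<phi> s - \<phi> ?a) \<le> d" .
      then show ?thesis
        using d(2)[of s ?a "\<phi> s" "\<phi> ?a"] a m1 \<phi>R[of s] \<phi>R[of ?a] by auto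
    qed
    have Zhi: "(\<lambda>s. ?Z s *v h n s) absolutely_integrable_on {0..T}"
      by (rule absolutely_integrable_matrix_vector_mult[OF Zc L2_controlD(1)[OF h(1)]])
    have "norm (\<phi> t - skeleton T b \<sigma> x k t) < \<delta>"
    proof (rule stab[OF _ k \<phi>c _ _ t])
      show "x \<in> A" "\<phi> 0 \<in> A" by (auto simp: A_def \<phi>0)
      fix t assume t: "t \<in> {0..T}"
      \<comment> \<open>Each of the five summands is at most \<open>e / 8\<close>; a further
        \<open>e / 8\<close> is taken by the initial points.\<close>
      have "norm (?J t - integral {0..t} (\<lambda>s. ?Z s *v k s))
          \<le> \<omega> * sqrt (T * N) + real m * (C * r) + C * sqrt (T / real m * N) + \<omega> * sqrt (T * N) + C * sqrt (T / real m * N)"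
      proof (rule grid_compare[OF T m(1) k Zc t, where \<Delta> = "\<lambda>j. integral {grid T m j..grid T m (Suc j)} (h n)"])
        show "norm (?Z s - ?Z (grid T m j)) \<le> \<omega>" if "j < m" "s \<in> {grid T m j..grid T m (Suc j)}" for j s
          by (rule osc[OF that])
        fix i
        show "norm (?J (grid T m i) - (\<Sum>j<i. ?Z (grid T m j) *v integral {grid T m j..grid T m (Suc j)} (h n))) \<le> \<omega> * sqrt (T * N)"
          if i: "i \<le> m"
        proof -
          have "norm (?J (grid T m i) - (\<Sum>j<i. ?Z (grid T m j) *v integral {grid T m j..grid T m (Suc j)} (h n)))
              \<le> \<omega> * integral {0..grid T m i} (\<lambda>s. norm (h n s))"
            by (rule grid_sum_integral[OF T m(1) h(1) Zc i]) (rule osc, use i in auto)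
          also have "\<dots> \<le> \<omega> * sqrt ((grid T m i - 0) * N)"
            by (intro mult_left_mono integral_norm_control_le[OF h])
               (use i T m \<omega> in \<open>auto intro: grid_nonneg grid_le\<close>)
          also have "\<dots> \<le> \<omega> * sqrt (T * N)"
            using i T m N \<omega> by (intro mult_left_mono real_sqrt_le_mono mult_right_mono) (auto intro: grid_le)
          finally show ?thesis .
        qed
        show "norm (?J t - ?J (grid T m i)) \<le> C * sqrt (T / real m * N)"
          if i: "i < m" "grid T m i \<le> t" "t \<le> grid T m (Suc i)"
        proof -
          let ?a = "grid T m i"
          have a: "0 \<le> ?a" "t - ?a \<le> T / real m" "t \<le> T" using i T t grid_nonneg[of T m i] by (auto simp: grid_Suc)
          have sub: "{?a..t} \<subseteq> {0..T}" using a by auto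
          have hni: "(\<lambda>s. norm (h n s)) integrable_on {?a..t}"
            using absolutely_integrable_on_subinterval[OF L2_controlD(1)[OF h(1)] sub] by (simp add: absolutely_integrable_on_def)
          have "?J t - ?J ?a = integral {?a..t} (\<lambda>s. ?Z s *v h n s)"
            by (rule integral_diff_interval[OF set_lebesgue_integral_eq_integral(1)[OF Zhi] a(1) i(2) a(3)])
          also have "norm \<dots> \<le> integral {?a..t} (\<lambda>s. C * norm (h n s))"
          proof (rule integral_norm_bound_integral[OF _ integrable_on_mult_right[OF hni]])
            show "(\<lambda>s. ?Z s *v h n s) integrable_on {?a..t}"
              by (rule integrable_subinterval_real[OF set_lebesgue_integral_eq_integral(1)[OF Zhi] sub])
            show "norm (?Z s *v h n s) \<le> C * norm (h n s)" if "s \<in> {?a..t}" for s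
              using that a by (intro order_trans[OF norm_matrix_vector_mult_le] mult_right_mono ZC) auto
          qed
          also have "\<dots> \<le> C * sqrt ((t - ?a) * N)"
            using integral_norm_control_le[OF h a(1) i(2) a(3)] C by (simp add: mult_left_mono)
          also have "\<dots> \<le> C * sqrt (T / real m * N)"
            using a N C by (intro mult_left_mono real_sqrt_le_mono mult_right_mono) auto
          finally show ?thesis .
        qed
        fix j assume j: "j < m"
        let ?a = "grid T m j" and ?b = "grid T m (Suc j)"
        have ab: "0 \<le> ?a" "?a \<le> ?b" "?b \<le> T" using j T m by (auto intro: grid_nonneg grid_mono grid_le)
        have hi: "u integrable_on {0..T}" if "L2_control T u" for u :: "real \<Rightarrow> real ^ 'm"
          using L2_controlD(1)[OF that] by (rule set_lebesgue_integral_eq_integral(1))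
        have "integral {?a..?b} k - integral {?a..?b} (h n)
            = (integral {0..?a} (h n) - integral {0..?a} k) - (integral {0..?b} (h n) - integral {0..?b} k)"
          using integral_diff_interval[OF hi[OF k(1)] ab] integral_diff_interval[OF hi[OF h(1)[of n]] ab]
          by (simp add: algebra_simps)
        \<comment> \<open>A cell integral is a difference of two values of the primitive, hence half
          of \<open>r\<close> for each.\<close>
        also have "norm \<dots> \<le> r / 2 + r / 2"
          by (rule order_trans[OF norm_triangle_ineq4 add_mono]; rule n1) (use n ab in auto)
        finally show "norm (integral {?a..?b} k - integral {?a..?b} (h n)) \<le> r" by simp
      qed (use \<omega> C r t in \<open>auto intro: ZC less_imp_le\<close>)
      then have 1: "norm (?J t - integral {0..t} (\<lambda>s. ?Z s *v k s)) \<le> 5 * (e / 8)"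
        using \<omega>(2) r(2) m2(1) by linarith
      have "defect x k \<phi> t = (xs n - x) + (integral {0..t} (field (h n) \<phi>) - integral {0..t} (field k \<phi>))"
        using \<phi>d[OF t] by (simp add: defect_def algebra_simps)
      also have "\<dots> = (xs n - x) + (?J t - integral {0..t} (\<lambda>s. ?Z s *v k s))"
        unfolding integral_field_diff[OF \<phi>c k(1) h(1) t] ..
      finally have eq: "defect x k \<phi> t = (xs n - x) + (?J t - integral {0..t} (\<lambda>s. ?Z s *v k s))" .
      show "norm (defect x k \<phi> t) \<le> e"
        unfolding eq using 1 n2[of n] n e by (intro norm_triangle_le) auto
    qed
    then show "norm (skeleton T b \<sigma> (xs n) (h n) t - skeleton T b \<sigma> x k t) < \<delta>"
      by (simp add: \<phi>_def)
  qed
qed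

text \<open>The infimum is not yet known to be attained, so a slack \<open>e\<close> remains. The
  finite bound on the action rules out an empty set of controls.\<close>

lemma action_lessD:
  assumes "action T b \<sigma> x \<phi> \<le> ennreal a" "0 \<le> a" "0 < e"
  obtains h where "L2_control T h" "\<phi> = skeleton T b \<sigma> x h" "1 / 2 * energy T h \<le> a + e"
proof -
  have "action T b \<sigma> x \<phi> < ennreal (a + e)"
    using assms by (intro le_less_trans[OF assms(1)]) (simp add: ennreal_less_iff)
  then obtain h where h: "L2_control T h" "\<phi> = skeleton T b \<sigma> x h"
    "ennreal (1 / 2 * (LINT s:{0..T}|lebesgue. (norm (h s))\<^sup>2)) < ennreal (a + e)"
    unfolding action_def by (auto simp: INF_less_iff)
  then have "1 / 2 * energy T h < a + e"
    using L2_controlD(5)[OF h(1)] energy_nonneg[of T h] assms by (simp add: ennreal_less_iff del: ennreal_plus)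
  then show ?thesis using that[OF h(1,2)] by simp
qed

lemma action_skeleton_le:
  assumes "L2_control T h"
  shows "action T b \<sigma> x (skeleton T b \<sigma> x h) \<le> ennreal (1 / 2 * energy T h)"
  unfolding action_def using L2_controlD(5)[OF assms] assms
  by (intro INF_lower2[of h]) auto

lemma mdist_path_space_le:
  assumes "\<phi> \<in> mspace (path_space T)" "\<psi> \<in> mspace (path_space T)"
    "\<And>t. t \<in> {0..T} \<Longrightarrow> norm (\<phi> t - \<psi> t) \<le> r"
  shows "mdist (path_space T) \<phi> \<psi> \<le> r"
  unfolding mdist_path_space[OF less_imp_le[OF T] assms(1,2)]
  by (rule cSUP_least) (use T assms(3) in \<open>auto simp: dist_norm\<close>)

text \<open>Sequential compactness. Paths in the union come from near minimal controls; along a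
  subsequence the initial points converge, and by Arzela-Ascoli so do the primitives of the
  controls. The limit of the primitives belongs to a control by
  \<open>control_with_primitive\<close>, and its skeleton is the limit path by
  \<open>skeleton_continuous_weakly\<close>.\<close>

lemma level_sets_compact:
  assumes A: "compact A" and a: "a < \<infinity>"
  shows "compactin (mtopology_of (path_space T)) (\<Union>x\<in>A. level_set (path_space T) (action T b \<sigma> x) a)"
proof -
  interpret M: Metric_space "mspace (path_space T :: (real \<Rightarrow> real ^ 'd) metric)" "mdist (path_space T)"
    by (rule Metric_space_mspace_mdist)
  obtain a' where a': "a = ennreal a'" "0 \<le> a'" using a by (cases a) auto
  show ?thesis
    unfolding mtopology_of_def M.compactin_sequentially
  proof (intro conjI allI impI)
    show "(\<Union>x\<in>A. level_set (path_space T) (action T b \<sigma> x) a) \<subseteq> mspace (path_space T)"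
      by (auto simp: level_set_def)
    fix \<phi> :: "nat \<Rightarrow> real \<Rightarrow> real ^ 'd"
    assume \<phi>: "range \<phi> \<subseteq> (\<Union>x\<in>A. level_set (path_space T) (action T b \<sigma> x) a)"
    \<comment> \<open>The slack has to vanish along the sequence; a fixed slack would only place the
      limit in a larger level set.\<close>
    have "\<exists>x h. x \<in> A \<and> L2_control T h \<and> \<phi> n = skeleton T b \<sigma> x h \<and> 1 / 2 * energy T h \<le> a' + 1 / (real n + 1)" for n
    proof -
      obtain x where x: "x \<in> A" "action T b \<sigma> x (\<phi> n) \<le> ennreal a'"
        using \<phi> by (auto simp: level_set_def a')
      show ?thesis
        by (rule action_lessD[OF x(2) a'(2), of "1 / (real n + 1)"]) (use x(1) in \<open>auto intro: add_nonneg_pos\<close>)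
    qed
    then obtain xs h where xs: "\<And>n. xs n \<in> A" and h: "\<And>n. L2_control T (h n)" and \<phi>h: "\<And>n. \<phi> n = skeleton T b \<sigma> (xs n) (h n)"
      and E: "\<And>n. 1 / 2 * energy T (h n) \<le> a' + 1 / (real n + 1)" by metis
    have EN: "energy T (h n) \<le> 2 * a' + 2" for n
    proof -
      have "1 / (real n + 1) \<le> 1" by simp
      then show ?thesis using E[of n] by linarith
    qed
    obtain x r0 where x: "x \<in> A" and r0: "strict_mono r0" and xlim: "(xs \<circ> r0) \<longlonglongrightarrow> x"
      using A xs unfolding compact_def by blast
    define H where "H = (\<lambda>n t. integral {0..t} (h (r0 n)))"
    have Hdiff: "norm (H n t - H n s) \<le> sqrt ((t - s) * (2 * a' + 2))" if "0 \<le> s" "s \<le> t" "t \<le> T" for n s t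
    proof -
      note hai = L2_controlD(1)[OF h[of "r0 n"]]
      have "H n t - H n s = integral {s..t} (h (r0 n))"
        unfolding H_def by (rule integral_diff_interval[OF set_lebesgue_integral_eq_integral(1)[OF hai] that])
      also have "norm \<dots> \<le> integral {s..t} (\<lambda>r. norm (h (r0 n) r))"
        by (rule integral_norm_bound[OF absolutely_integrable_on_subinterval[OF hai]]) (use that in auto)
      also have "\<dots> \<le> sqrt ((t - s) * (2 * a' + 2))" by (rule integral_norm_control_le[OF h EN that])
      finally show ?thesis .
    qed
    have Hdiff': "norm (H n s - H n t) \<le> sqrt (\<bar>s - t\<bar> * (2 * a' + 2))" if "s \<in> {0..T}" "t \<in> {0..T}" for n s t
      using Hdiff[of s t n] Hdiff[of t s n] that by (cases "s \<le> t") (auto simp: norm_minus_commute)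
    \<comment> \<open>Bounded energy makes the primitives uniformly Hoelder continuous with exponent
      1/2, hence equicontinuous.\<close>
    obtain G k where k: "strict_mono (k :: nat \<Rightarrow> nat)"
      and G: "\<And>e. 0 < e \<Longrightarrow> \<exists>N. \<forall>n t. n \<ge> N \<and> t \<in> {0..T} \<longrightarrow> norm (H (k n) t - G t) < e"
    proof (rule Arzela_Ascoli[of "{0..T}" H "sqrt (T * (2 * a' + 2))"])
      show "norm (H n t) \<le> sqrt (T * (2 * a' + 2))" if t: "t \<in> {0..T}" for n t
      proof -
        have "norm (H n t) \<le> sqrt ((t - 0) * (2 * a' + 2))" using Hdiff[of 0 t n] t by (simp add: H_def)
        also have "\<dots> \<le> sqrt (T * (2 * a' + 2))" using t a' by (intro real_sqrt_le_mono mult_right_mono) auto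
        finally show ?thesis .
      qed
      show "\<exists>d>0. \<forall>n t. t \<in> {0..T} \<and> norm (s - t) < d \<longrightarrow> norm (H n s - H n t) < e" if s: "s \<in> {0..T}" and e: "0 < e" for s e
      proof (intro exI[of _ "e\<^sup>2 / (2 * a' + 2)"] conjI allI impI)
        show "0 < e\<^sup>2 / (2 * a' + 2)" using e a' by simp
        fix n t assume t: "t \<in> {0..T} \<and> norm (s - t) < e\<^sup>2 / (2 * a' + 2)"
        have "norm (H n s - H n t) \<le> sqrt (\<bar>s - t\<bar> * (2 * a' + 2))" using s t by (intro Hdiff') auto
        also have "\<dots> < sqrt (e\<^sup>2)" using t a' by (intro real_sqrt_less_mono) (simp add: less_divide_eq)
        finally show "norm (H n s - H n t) < e" using e by simp
      qed
    qed auto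
    define r where "r = r0 \<circ> k"
    have r: "strict_mono r" unfolding r_def by (rule strict_mono_o[OF r0 k])
    have G': "\<exists>n0. \<forall>n\<ge>n0. \<forall>t\<in>{0..T}. norm (integral {0..t} (h (r n)) - G t) \<le> e" if e: "0 < e" for e
      using G[OF e] unfolding H_def r_def o_def by (meson less_imp_le)
    \<comment> \<open>The bound is exactly \<open>2 * a'\<close>, as members late in the sequence
      have arbitrarily little excess energy. This puts the limit back into the level set.\<close>
    obtain u where u: "L2_control T u" "energy T u \<le> 2 * a'" and uG: "\<And>t. t \<in> {0..T} \<Longrightarrow> integral {0..t} u = G t"
    proof (rule control_with_primitive[OF T])
      fix e :: real assume e: "0 < e"
      obtain n0 where n0: "\<And>n t. n0 \<le> n \<Longrightarrow> t \<in> {0..T} \<Longrightarrow> norm (integral {0..t} (h (r n)) - G t) \<le> e"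
        using G'[OF e] by blast
      have "(\<lambda>n. 2 / (real n + 1)) \<longlonglongrightarrow> 0" by real_asymp
      then have "\<forall>\<^sub>F n in sequentially. 2 / (real n + 1) < e" by (rule order_tendstoD) (rule e)
      then obtain n1 where n1: "\<And>n. n1 \<le> n \<Longrightarrow> 2 / (real n + 1) < e" by (auto simp: eventually_sequentially)
      let ?n = "max n0 n1"
      have "n1 \<le> r ?n" using seq_suble[OF r, of ?n] by simp
      then have "2 / (real (r ?n) + 1) < e" by (rule n1)
      then have "energy T (h (r ?n)) \<le> 2 * a' + e" using E[of "r ?n"] by simp
      then show "\<exists>u. L2_control T u \<and> energy T u \<le> 2 * a' + e \<and> (\<forall>t\<in>{0..T}. norm (integral {0..t} u - G t) \<le> e)"
        using h n0[of ?n] by (intro exI[of _ "h (r ?n)"]) auto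
    qed blast
    have xr: "(xs \<circ> r) \<longlonglongrightarrow> x"
      using LIMSEQ_subseq_LIMSEQ[OF xlim k] by (simp add: r_def comp_assoc)
    define \<psi> where "\<psi> = skeleton T b \<sigma> x u"
    have sk: "\<exists>n0. \<forall>n\<ge>n0. \<forall>t\<in>{0..T}. norm (skeleton T b \<sigma> ((xs \<circ> r) n) (h (r n)) t - \<psi> t) < \<delta>" if \<delta>: "0 < \<delta>" for \<delta>
      unfolding \<psi>_def
    proof (rule skeleton_continuous_weakly[OF xr h EN u(1) _ _ \<delta>])
      show "energy T u \<le> 2 * a' + 2" using u(2) by simp
      show "\<exists>n0. \<forall>n\<ge>n0. \<forall>t\<in>{0..T}. norm (integral {0..t} (h (r n)) - integral {0..t} u) \<le> e" if "0 < e" for e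
        using G'[OF that] uG by auto
    qed
    show "\<exists>l r. l \<in> (\<Union>x\<in>A. level_set (path_space T) (action T b \<sigma> x) a) \<and> strict_mono r \<and>
        limitin M.mtopology (\<phi> \<circ> r) l sequentially"
    proof (intro exI conjI)
      have \<psi>m: "\<psi> \<in> mspace (path_space T)" unfolding \<psi>_def by (rule skeleton_in_path_space[OF u(1)])
      have "action T b \<sigma> x \<psi> \<le> ennreal (1 / 2 * energy T u)" unfolding \<psi>_def by (rule action_skeleton_le[OF u(1)])
      also have "\<dots> \<le> a" unfolding a'(1) using u(2) by (intro ennreal_leI) simp
      finally show "\<psi> \<in> (\<Union>x\<in>A. level_set (path_space T) (action T b \<sigma> x) a)"
        using x \<psi>m by (auto simp: level_set_def)
      show "strict_mono r" by (rule r)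
      show "limitin M.mtopology (\<phi> \<circ> r) \<psi> sequentially"
        unfolding M.limit_metric_sequentially
      proof (intro conjI allI impI \<psi>m)
        fix \<epsilon> :: real assume "0 < \<epsilon>"
        then have "0 < \<epsilon> / 2" by simp
        from sk[OF this] obtain n0 where n0: "\<And>n t. n0 \<le> n \<Longrightarrow> t \<in> {0..T} \<Longrightarrow> norm ((\<phi> \<circ> r) n t - \<psi> t) < \<epsilon> / 2"
          unfolding \<phi>h o_def by blast
        have \<phi>m: "(\<phi> \<circ> r) n \<in> mspace (path_space T)" for n
          unfolding o_def \<phi>h by (rule skeleton_in_path_space[OF h])
        show "\<exists>N. \<forall>n\<ge>N. (\<phi> \<circ> r) n \<in> mspace (path_space T) \<and> mdist (path_space T) ((\<phi> \<circ> r) n) \<psi> < \<epsilon>"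
        proof (intro exI[of _ n0] allI impI conjI \<phi>m)
          fix n assume "n0 \<le> n"
          then have "mdist (path_space T) ((\<phi> \<circ> r) n) \<psi> \<le> \<epsilon> / 2"
            using n0 by (intro mdist_path_space_le[OF \<phi>m \<psi>m]) (auto intro: less_imp_le)
          then show "mdist (path_space T) ((\<phi> \<circ> r) n) \<psi> < \<epsilon>" using \<open>0 < \<epsilon>\<close> by simp
        qed
      qed
    qed
  qed
qed

lemma rate_function_action: "rate_function (path_space T) (action T b \<sigma> x)"
  unfolding rate_function_def using level_sets_compact[of "{x}"] by simp

lemma compact_level_sets_on_compacts_action: "compact_level_sets_on_compacts (path_space T) (action T b \<sigma>)"
  unfolding compact_level_sets_on_compacts_def using level_sets_compact by blast

end

section \<open>Brownian increments and a maximal inequality\<close>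

lemma prod_Basis_vec: "(\<Prod>b\<in>Basis. f b) = (\<Prod>i\<in>UNIV. f (axis i (1::real)))"
  for f :: "real ^ 'm \<Rightarrow> 'a::comm_monoid_mult"
proof -
  have B: "(Basis :: (real ^ 'm) set) = range (\<lambda>i. axis i 1)"
    by (auto simp: Basis_vec_def)
  have "inj (\<lambda>i::'m. axis i (1::real))" by (simp add: inj_on_def axis_eq_axis)
  then show ?thesis unfolding B by (subst prod.reindex) auto
qed

lemma nn_integral_lborel_vec_prod:
  fixes f :: "'m::finite \<Rightarrow> real \<Rightarrow> ennreal"
  assumes [measurable]: "\<And>i. f i \<in> borel_measurable borel"
  shows "(\<integral>\<^sup>+y. (\<Prod>i\<in>UNIV. f i (y $ i)) \<partial>(lborel :: (real ^ 'm) measure)) = (\<Prod>i\<in>UNIV. \<integral>\<^sup>+x. f i x \<partial>lborel)"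
proof -
  define g where "g = (\<lambda>b::real ^ 'm. f (SOME i. b = axis i 1))"
  have g: "g (axis i 1) = f i" for i
  proof -
    have "(SOME j. axis i (1::real) = axis j 1) = i"
      by (rule some_equality) (auto simp: axis_eq_axis)
    then show ?thesis by (simp add: g_def)
  qed
  have [measurable]: "g b \<in> borel_measurable borel" for b by (simp add: g_def)
  have "(\<integral>\<^sup>+y. (\<Prod>b\<in>Basis. g b (y \<bullet> b)) \<partial>(lborel :: (real ^ 'm) measure)) = (\<Prod>b\<in>Basis. \<integral>\<^sup>+x. g b x \<partial>lborel)"
    by (rule nn_integral_lborel_prod) auto
  then show ?thesis unfolding prod_Basis_vec by (simp add: g inner_axis)
qed

definition gauss_density :: "real \<Rightarrow> real ^ 'm \<Rightarrow> real" where
  "gauss_density \<tau> y = (\<Prod>i\<in>UNIV. normal_density 0 (sqrt \<tau>) (y $ i))"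

lemma gauss_density_nonneg: "0 \<le> gauss_density \<tau> y"
  unfolding gauss_density_def by (intro prod_nonneg) auto

lemma gauss_density_measurable[measurable]: "gauss_density \<tau> \<in> borel_measurable borel"
  unfolding gauss_density_def[abs_def] by measurable

lemma norm_vec_power2: "(norm (y :: real ^ 'm))\<^sup>2 = (\<Sum>i\<in>UNIV. (y $ i)\<^sup>2)"
  by (simp add: norm_vec_def L2_set_def sum_nonneg)

lemma gauss_density_eq:
  assumes "0 < \<tau>"
  shows "gauss_density \<tau> (y :: real ^ 'm) = (1 / sqrt (2 * pi * \<tau>)) ^ CARD('m) * exp (- (norm y)\<^sup>2 / (2 * \<tau>))"
proof -
  have "gauss_density \<tau> y = (\<Prod>i\<in>UNIV. (1 / sqrt (2 * pi * \<tau>)) * exp (- (y $ i)\<^sup>2 / (2 * \<tau>)))"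
    unfolding gauss_density_def normal_density_def using assms by (intro prod.cong) auto
  also have "\<dots> = (1 / sqrt (2 * pi * \<tau>)) ^ CARD('m) * exp (\<Sum>i\<in>UNIV. - (y $ i)\<^sup>2 / (2 * \<tau>))"
    by (simp only: prod.distrib prod_constant exp_sum[OF finite])
  also have "(\<Sum>i\<in>UNIV. - (y $ i)\<^sup>2 / (2 * \<tau>)) = - (norm y)\<^sup>2 / (2 * \<tau>)"
    by (simp add: norm_vec_power2 sum_negf sum_divide_distrib)
  finally show ?thesis .
qed

lemma nn_integral_normal_density:
  "0 < s \<Longrightarrow> (\<integral>\<^sup>+x. ennreal (normal_density \<mu> s x) \<partial>lborel) = 1"
  by (subst nn_integral_eq_integral) (auto simp: normal_density_nonneg)

text \<open>Completing the square in each coordinate turns the integrand into the Gaussian density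
  with mean \<open>\<tau> * a $ i\<close>, whose total mass is 1.\<close>

lemma gauss_exponential_moment:
  fixes a :: "real ^ 'm"
  assumes \<tau>: "0 < \<tau>"
  shows "(\<integral>\<^sup>+y. ennreal (exp (a \<bullet> y - (norm a)\<^sup>2 * \<tau> / 2)) * ennreal (gauss_density \<tau> y) \<partial>lborel) = 1"
proof -
  have "exp (a \<bullet> y - (norm a)\<^sup>2 * \<tau> / 2) * gauss_density \<tau> y = (\<Prod>i\<in>UNIV. normal_density (\<tau> * a $ i) (sqrt \<tau>) (y $ i))" for y
  proof -
    have "a \<bullet> y - (norm a)\<^sup>2 * \<tau> / 2 = (\<Sum>i\<in>UNIV. a $ i * y $ i - (a $ i)\<^sup>2 * \<tau> / 2)"
      by (simp add: norm_vec_power2 inner_vec_def sum_subtractf sum_distrib_right sum_divide_distrib)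
    then have "exp (a \<bullet> y - (norm a)\<^sup>2 * \<tau> / 2) * gauss_density \<tau> y
        = (\<Prod>i\<in>UNIV. exp (a $ i * y $ i - (a $ i)\<^sup>2 * \<tau> / 2) * normal_density 0 (sqrt \<tau>) (y $ i))"
      by (simp add: gauss_density_def prod.distrib exp_sum)
    also have "\<dots> = (\<Prod>i\<in>UNIV. normal_density (\<tau> * a $ i) (sqrt \<tau>) (y $ i))"
    proof (rule prod.cong[OF refl])
      fix i
      have "a $ i * y $ i - (a $ i)\<^sup>2 * \<tau> / 2 - (y $ i)\<^sup>2 / (2 * \<tau>) = - (y $ i - \<tau> * a $ i)\<^sup>2 / (2 * \<tau>)"
        using \<tau> by (simp add: power2_eq_square field_simps)
      then have "exp (a $ i * y $ i - (a $ i)\<^sup>2 * \<tau> / 2) * exp (- (y $ i)\<^sup>2 / (2 * \<tau>)) = exp (- (y $ i - \<tau> * a $ i)\<^sup>2 / (2 * \<tau>))"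
        by (simp flip: exp_add)
      then show "exp (a $ i * y $ i - (a $ i)\<^sup>2 * \<tau> / 2) * normal_density 0 (sqrt \<tau>) (y $ i) = normal_density (\<tau> * a $ i) (sqrt \<tau>) (y $ i)"
        using \<tau> by (simp add: normal_density_def)
    qed
    finally show ?thesis .
  qed
  then have "(\<integral>\<^sup>+y. ennreal (exp (a \<bullet> y - (norm a)\<^sup>2 * \<tau> / 2)) * ennreal (gauss_density \<tau> y) \<partial>lborel)
      = (\<integral>\<^sup>+y. (\<Prod>i\<in>UNIV. ennreal (normal_density (\<tau> * a $ i) (sqrt \<tau>) (y $ i))) \<partial>lborel)"
    by (simp add: ennreal_mult[symmetric] gauss_density_nonneg prod_ennreal)
  also have "\<dots> = (\<Prod>i\<in>(UNIV::'m set). 1)"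
    by (subst nn_integral_lborel_vec_prod) (use \<tau> in \<open>auto simp: nn_integral_normal_density\<close>)
  finally show ?thesis by simp
qed

text \<open>The exponents combine to that of a centred Gaussian with variance
  \<open>\<tau> / \<kappa>\<close>; the value is the ratio of the normalising constants. Keeping
  \<kappa> positive keeps it finite.\<close>

lemma gauss_square_exponential_moment:
  assumes \<tau>: "0 < \<tau>" and \<kappa>: "0 < \<kappa>"
  shows "(\<integral>\<^sup>+y. ennreal (exp ((1 - \<kappa>) * (norm y)\<^sup>2 / (2 * \<tau>))) * ennreal (gauss_density \<tau> (y :: real ^ 'm)) \<partial>lborel)
    = ennreal ((1 / sqrt \<kappa>) ^ CARD('m))"
proof -
  have "exp ((1 - \<kappa>) * (norm y)\<^sup>2 / (2 * \<tau>)) * gauss_density \<tau> y = (1 / sqrt \<kappa>) ^ CARD('m) * gauss_density (\<tau> / \<kappa>) y" for y :: "real ^ 'm"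
  proof -
    have "(1 - \<kappa>) * (norm y)\<^sup>2 / (2 * \<tau>) + - (norm y)\<^sup>2 / (2 * \<tau>) = - (norm y)\<^sup>2 / (2 * (\<tau> / \<kappa>))"
      using \<tau> \<kappa> by (simp add: field_simps)
    then have "exp ((1 - \<kappa>) * (norm y)\<^sup>2 / (2 * \<tau>)) * exp (- (norm y)\<^sup>2 / (2 * \<tau>)) = exp (- (norm y)\<^sup>2 / (2 * (\<tau> / \<kappa>)))"
      by (simp flip: exp_add)
    moreover have "(1 / sqrt (2 * pi * \<tau>)) = (1 / sqrt \<kappa>) * (1 / sqrt (2 * pi * (\<tau> / \<kappa>)))"
      using \<tau> \<kappa> by (simp add: real_sqrt_divide real_sqrt_mult field_simps)
    ultimately show ?thesis
      using \<tau> \<kappa> by (simp only: gauss_density_eq[OF \<tau>] gauss_density_eq[OF divide_pos_pos[OF \<tau> \<kappa>]] power_mult_distrib)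
         (simp add: mult_ac)
  qed
  then have "(\<integral>\<^sup>+y. ennreal (exp ((1 - \<kappa>) * (norm y)\<^sup>2 / (2 * \<tau>))) * ennreal (gauss_density \<tau> (y :: real ^ 'm)) \<partial>lborel)
     = (\<integral>\<^sup>+y. ennreal ((1 / sqrt \<kappa>) ^ CARD('m)) * ennreal (gauss_density (\<tau> / \<kappa>) (y :: real ^ 'm)) \<partial>lborel)"
    using \<kappa> by (simp add: ennreal_mult[symmetric] gauss_density_nonneg)
  also have "\<dots> = ennreal ((1 / sqrt \<kappa>) ^ CARD('m)) * (\<integral>\<^sup>+y. ennreal (gauss_density (\<tau> / \<kappa>) (y :: real ^ 'm)) \<partial>lborel)"
    by (rule nn_integral_cmult) measurable
  also have "(\<integral>\<^sup>+y. ennreal (gauss_density (\<tau> / \<kappa>) (y :: real ^ 'm)) \<partial>lborel) = 1"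
    using gauss_exponential_moment[of "\<tau> / \<kappa>" "0 :: real ^ 'm"] \<tau> \<kappa> by simp
  finally show ?thesis by simp
qed

text \<open>After unscaling, the set contains a ball of the unscaled radius \<open>r\<close> because
  \<epsilon> is at most 1. Its volume is independent of \<epsilon>, so \<epsilon> appears only in
  the exponent, which is bounded by means of the largest norm occurring in the set.\<close>

lemma gauss_small_ball:
  fixes v :: "real ^ 'm"
  assumes \<tau>: "0 < \<tau>" and \<epsilon>: "0 < \<epsilon>" "\<epsilon> \<le> 1" and r: "0 < r"
  shows "ennreal ((1 / sqrt (2 * pi * \<tau>)) ^ CARD('m) * measure lborel (ball (0 :: real ^ 'm) r) * exp (- (norm v + r)\<^sup>2 / (2 * \<tau> * \<epsilon>)))
    \<le> (\<integral>\<^sup>+y. indicator {y. norm (sqrt \<epsilon> *\<^sub>R y - v) < r} y * ennreal (gauss_density \<tau> y) \<partial>lborel)"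
proof -
  let ?S = "{y. norm (sqrt \<epsilon> *\<^sub>R y - v) < r}" and ?v = "(1 / sqrt \<epsilon>) *\<^sub>R v"
  define c where "c = (1 / sqrt (2 * pi * \<tau>)) ^ CARD('m) * exp (- (norm v + r)\<^sup>2 / (2 * \<tau> * \<epsilon>))"
  have c: "0 \<le> c" using \<tau> by (simp add: c_def)
  have se: "0 < sqrt \<epsilon>" "sqrt \<epsilon> \<le> 1" using \<epsilon> by auto
  have sub: "ball ?v r \<subseteq> ?S"
  proof
    fix y assume y: "y \<in> ball ?v r"
    have "sqrt \<epsilon> *\<^sub>R y - v = sqrt \<epsilon> *\<^sub>R (y - ?v)" using se by (simp add: scaleR_diff_right)
    then have "norm (sqrt \<epsilon> *\<^sub>R y - v) = sqrt \<epsilon> * norm (y - ?v)" using se by simp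
    also have "\<dots> \<le> 1 * norm (y - ?v)" using se by (intro mult_right_mono) auto
    also have "\<dots> < r" using y by (simp add: dist_norm norm_minus_commute)
    finally show "y \<in> ?S" by simp
  qed
  have dens: "c \<le> gauss_density \<tau> y" if "y \<in> ?S" for y
  proof -
    have "norm (sqrt \<epsilon> *\<^sub>R y) \<le> norm v + r"
      using that norm_triangle_ineq2[of "sqrt \<epsilon> *\<^sub>R y" v] by simp
    then have "sqrt \<epsilon> * norm y \<le> norm v + r" using se by simp
    then have "(sqrt \<epsilon> * norm y)\<^sup>2 \<le> (norm v + r)\<^sup>2" using se by (intro power_mono) auto
    then have "\<epsilon> * (norm y)\<^sup>2 \<le> (norm v + r)\<^sup>2" using \<epsilon> by (simp add: power_mult_distrib)
    then have "(norm y)\<^sup>2 / (2 * \<tau>) \<le> (norm v + r)\<^sup>2 / (2 * \<tau> * \<epsilon>)"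
      using \<tau> \<epsilon> by (simp add: field_simps)
    then show ?thesis
      unfolding gauss_density_eq[OF \<tau>] c_def using \<tau> by (intro mult_left_mono) auto
  qed
  have "ennreal (c * measure lborel (ball (0 :: real ^ 'm) r)) = ennreal (c * measure lborel (ball ?v r))"
    using content_ball_conv_unit_ball[of r "0 :: real ^ 'm"] content_ball_conv_unit_ball[of r ?v] r by simp
  also have "\<dots> = ennreal c * emeasure lborel (ball ?v r)"
    using c emeasure_lborel_ball_finite[of ?v r] by (subst emeasure_eq_ennreal_measure) (auto simp: ennreal_mult)
  also have "\<dots> = (\<integral>\<^sup>+y. ennreal c * indicator (ball ?v r) y \<partial>lborel)"
    by (rule nn_integral_cmult_indicator[symmetric]) simp
  also have "\<dots> \<le> (\<integral>\<^sup>+y. indicator ?S y * ennreal (gauss_density \<tau> y) \<partial>lborel)"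
    using sub dens by (intro nn_integral_mono) (auto simp: indicator_def ennreal_leI)
  finally show ?thesis by (simp add: c_def mult_ac)
qed

text \<open>The hypothesis \<open>step\<close>, for every nonnegative \<open>G\<close> measurable at
  stage \<open>k\<close>, says that the conditional expectation of \<open>D k\<close> is at most
  \<open>C\<close>, phrased with integrals alone. Each induction step takes the product so far as
  the new \<open>G\<close>.\<close>

lemma nn_integral_prod_le:
  fixes D :: "nat \<Rightarrow> 'w \<Rightarrow> ennreal" and N :: "nat \<Rightarrow> 'w measure"
  assumes meas: "\<And>k. k < n \<Longrightarrow> D k \<in> borel_measurable (N (Suc k))"
    and sub: "\<And>k j X. k \<le> j \<Longrightarrow> j \<le> n \<Longrightarrow> X \<in> borel_measurable (N k) \<Longrightarrow> X \<in> (borel_measurable (N j) :: ('w \<Rightarrow> ennreal) set)"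
    and step: "\<And>k G. k < n \<Longrightarrow> G \<in> borel_measurable (N k) \<Longrightarrow> (\<integral>\<^sup>+\<omega>. G \<omega> * D k \<omega> \<partial>M) \<le> C * (\<integral>\<^sup>+\<omega>. G \<omega> \<partial>M)"
    and G: "G \<in> borel_measurable (N 0)"
  shows "(\<integral>\<^sup>+\<omega>. G \<omega> * (\<Prod>k<n. D k \<omega>) \<partial>M) \<le> C ^ n * (\<integral>\<^sup>+\<omega>. G \<omega> \<partial>M)"
proof -
  have "j \<le> n \<Longrightarrow> (\<lambda>\<omega>. G \<omega> * (\<Prod>k<j. D k \<omega>)) \<in> borel_measurable (N j) \<and>
      (\<integral>\<^sup>+\<omega>. G \<omega> * (\<Prod>k<j. D k \<omega>) \<partial>M) \<le> C ^ j * (\<integral>\<^sup>+\<omega>. G \<omega> \<partial>M)" for j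
  proof (induction j)
    case 0
    then show ?case using G by simp
  next
    case (Suc j)
    then have IH: "(\<lambda>\<omega>. G \<omega> * (\<Prod>k<j. D k \<omega>)) \<in> borel_measurable (N j)"
      "(\<integral>\<^sup>+\<omega>. G \<omega> * (\<Prod>k<j. D k \<omega>) \<partial>M) \<le> C ^ j * (\<integral>\<^sup>+\<omega>. G \<omega> \<partial>M)" by auto
    have eq: "(\<lambda>\<omega>. G \<omega> * (\<Prod>k<Suc j. D k \<omega>)) = (\<lambda>\<omega>. (G \<omega> * (\<Prod>k<j. D k \<omega>)) * D j \<omega>)"
      by (simp add: mult.assoc)
    have "(\<lambda>\<omega>. G \<omega> * (\<Prod>k<j. D k \<omega>)) \<in> borel_measurable (N (Suc j))"
      by (rule sub[OF _ Suc.prems IH(1)]) simp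
    then have "(\<lambda>\<omega>. (G \<omega> * (\<Prod>k<j. D k \<omega>)) * D j \<omega>) \<in> borel_measurable (N (Suc j))"
      by (rule borel_measurable_times_ennreal) (use meas[of j] Suc.prems in auto)
    moreover have "(\<integral>\<^sup>+\<omega>. (G \<omega> * (\<Prod>k<j. D k \<omega>)) * D j \<omega> \<partial>M) \<le> C * (\<integral>\<^sup>+\<omega>. G \<omega> * (\<Prod>k<j. D k \<omega>) \<partial>M)"
      using Suc.prems by (intro step IH(1)) simp
    moreover have "\<dots> \<le> C * (C ^ j * (\<integral>\<^sup>+\<omega>. G \<omega> \<partial>M))" by (intro mult_left_mono IH(2)) simp
    ultimately show ?case unfolding eq by (auto simp: mult.assoc)
  qed
  then show ?thesis by blast
qed

text \<open>Freezing the factors after the first passage above \<open>c\<close> keeps the one-step inequalities.\<close>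

lemma (in prob_space) maximal_inequality_prod:
  fixes D :: "nat \<Rightarrow> 'a \<Rightarrow> ennreal" and N :: "nat \<Rightarrow> 'a measure"
  assumes meas: "\<And>k. k < n \<Longrightarrow> D k \<in> borel_measurable (N (Suc k))"
    and N: "\<And>k j. k \<le> j \<Longrightarrow> j \<le> n \<Longrightarrow> subalgebra (N j) (N k)" "\<And>k. k \<le> n \<Longrightarrow> subalgebra M (N k)"
    and step: "\<And>k G. k < n \<Longrightarrow> G \<in> borel_measurable (N k) \<Longrightarrow> (\<integral>\<^sup>+\<omega>. G \<omega> * D k \<omega> \<partial>M) \<le> (\<integral>\<^sup>+\<omega>. G \<omega> \<partial>M)"
    and c: "0 < c"
  shows "prob {\<omega> \<in> space M. \<exists>k\<le>n. ennreal c < (\<Prod>j<k. D j \<omega>)} \<le> 1 / c"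
proof -
  have mono: "X \<in> borel_measurable (N j)" if "k \<le> j" "j \<le> n" "X \<in> borel_measurable (N k)" for k j and X :: "'a \<Rightarrow> ennreal"
    using measurable_from_subalg[OF N(1)[OF that(1,2)] that(3)] .
  have D: "D j \<in> borel_measurable (N k)" if "j < k" "k \<le> n" for j k
    using mono[OF _ that(2) meas[of j]] that by auto
  have prodm: "(\<lambda>\<omega>. \<Prod>j<i. D j \<omega>) \<in> borel_measurable (N k)" if "i \<le> k" "k \<le> n" for i k
    by (intro borel_measurable_prod_ennreal D) (use that in auto)
  define passed where "passed = (\<lambda>k \<omega>. \<exists>i\<le>k. ennreal c < (\<Prod>j<i. D j \<omega>))"
  have pm: "{\<omega> \<in> space (N k). passed k \<omega>} \<in> sets (N k)" if "k \<le> n" for k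
  proof -
    have "{\<omega> \<in> space (N k). ennreal c < (\<Prod>j<i. D j \<omega>)} \<in> sets (N k)" if "i \<le> k" for i
      by (rule borel_measurable_less) (use prodm[OF that \<open>k \<le> n\<close>] in auto)
    moreover have "{\<omega> \<in> space (N k). passed k \<omega>} = (\<Union>i\<le>k. {\<omega> \<in> space (N k). ennreal c < (\<Prod>j<i. D j \<omega>)})"
      by (auto simp: passed_def)
    ultimately show ?thesis by auto
  qed
  define D' where "D' = (\<lambda>k \<omega>. if passed k \<omega> then 1 else D k \<omega>)"
  have sp: "space (N k) = space M" if "k \<le> n" for k using N(2)[OF that] by (simp add: subalgebra_def)
  have m': "D' k \<in> borel_measurable (N (Suc k))" if "k < n" for k
  proof -
    have "sets (N k) \<subseteq> sets (N (Suc k))" "space (N k) = space (N (Suc k))"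
      using N(1)[of k "Suc k"] that by (auto simp: subalgebra_def)
    then have "{\<omega> \<in> space (N (Suc k)). passed k \<omega>} \<in> sets (N (Suc k))"
      using pm[of k] that by auto
    then show ?thesis unfolding D'_def using meas[OF that] by (intro measurable_If) auto
  qed
  have step': "(\<integral>\<^sup>+\<omega>. G \<omega> * D' k \<omega> \<partial>M) \<le> 1 * (\<integral>\<^sup>+\<omega>. G \<omega> \<partial>M)" if k: "k < n" and G: "G \<in> borel_measurable (N k)" for k G
  proof -
    define A where "A = {\<omega> \<in> space M. passed k \<omega>}"
    have A: "A \<in> sets (N k)" using pm[of k] k sp[of k] by (simp add: A_def)
    have G1: "(\<lambda>\<omega>. G \<omega> * indicator A \<omega>) \<in> borel_measurable (N k)" and G2: "(\<lambda>\<omega>. G \<omega> * indicator (space M - A) \<omega>) \<in> borel_measurable (N k)"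
      using G A sets.compl_sets[OF A] sp[of k] k by (auto intro!: borel_measurable_times_ennreal)
    have toM: "X \<in> borel_measurable M" if "X \<in> borel_measurable (N k)" for X :: "'a \<Rightarrow> ennreal"
      using measurable_from_subalg[OF N(2)[of k] that] k by simp
    have DM: "D k \<in> borel_measurable M" using measurable_from_subalg[OF N(2)[of "Suc k"] meas[OF k]] k by simp
    have "(\<integral>\<^sup>+\<omega>. G \<omega> * D' k \<omega> \<partial>M) = (\<integral>\<^sup>+\<omega>. G \<omega> * indicator A \<omega> + G \<omega> * indicator (space M - A) \<omega> * D k \<omega> \<partial>M)"
      by (intro nn_integral_cong) (auto simp: D'_def A_def indicator_def)
    also have "\<dots> = (\<integral>\<^sup>+\<omega>. G \<omega> * indicator A \<omega> \<partial>M) + (\<integral>\<^sup>+\<omega>. G \<omega> * indicator (space M - A) \<omega> * D k \<omega> \<partial>M)"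
      by (intro nn_integral_add toM[OF G1] borel_measurable_times_ennreal toM[OF G2] DM)
    also have "\<dots> \<le> (\<integral>\<^sup>+\<omega>. G \<omega> * indicator A \<omega> \<partial>M) + (\<integral>\<^sup>+\<omega>. G \<omega> * indicator (space M - A) \<omega> \<partial>M)"
      by (intro add_left_mono step[OF k G2])
    also have "\<dots> = (\<integral>\<^sup>+\<omega>. G \<omega> * indicator A \<omega> + G \<omega> * indicator (space M - A) \<omega> \<partial>M)"
      by (intro nn_integral_add[symmetric] toM[OF G1] toM[OF G2])
    also have "\<dots> = (\<integral>\<^sup>+\<omega>. G \<omega> \<partial>M)"
      by (intro nn_integral_cong) (auto simp: indicator_def)
    finally show ?thesis by simp
  qed
  have "(\<integral>\<^sup>+\<omega>. 1 * (\<Prod>k<n. D' k \<omega>) \<partial>M) \<le> 1 ^ n * (\<integral>\<^sup>+\<omega>. 1 \<partial>M)"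
    by (rule nn_integral_prod_le[where N = N, OF m' mono step']) auto
  then have int1: "(\<integral>\<^sup>+\<omega>. (\<Prod>k<n. D' k \<omega>) \<partial>M) \<le> 1" by (simp add: emeasure_space_1)
  have D'M: "(\<lambda>\<omega>. \<Prod>k<n. D' k \<omega>) \<in> borel_measurable M"
  proof (rule borel_measurable_prod_ennreal)
    fix k assume "k \<in> {..<n}"
    then show "D' k \<in> borel_measurable M" using measurable_from_subalg[OF N(2)[of "Suc k"] m'[of k]] by simp
  qed
  have sub: "{\<omega> \<in> space M. \<exists>k\<le>n. ennreal c < (\<Prod>j<k. D j \<omega>)} \<subseteq> {\<omega> \<in> space M. 1 \<le> ennreal (1 / c) * (\<Prod>k<n. D' k \<omega>)}"
  proof safe
    fix \<omega> k assume "k \<le> n" "ennreal c < (\<Prod>j<k. D j \<omega>)"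
    then have ex: "\<exists>k. ennreal c < (\<Prod>j<k. D j \<omega>)" by blast
    define q where "q = (LEAST k. ennreal c < (\<Prod>j<k. D j \<omega>))"
    have q: "ennreal c < (\<Prod>j<q. D j \<omega>)" unfolding q_def by (rule LeastI_ex[OF ex])
    have qk: "q \<le> k" unfolding q_def by (rule Least_le) fact
    have notp: "\<not> passed j \<omega>" if "j < q" for j
      unfolding passed_def using not_less_Least[of _ "\<lambda>k. ennreal c < (\<Prod>j<k. D j \<omega>)"] that
      by (auto simp: q_def[symmetric] dest: le_less_trans)
    have "(\<Prod>j<n. D' j \<omega>) = (\<Prod>j<q. D' j \<omega>) * (\<Prod>j\<in>{q..<n}. D' j \<omega>)"
      using qk \<open>k \<le> n\<close> prod.atLeastLessThan_concat[of 0 q n "\<lambda>j. D' j \<omega>"] by (simp add: atLeast0LessThan)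
    also have "(\<Prod>j<q. D' j \<omega>) = (\<Prod>j<q. D j \<omega>)" by (intro prod.cong) (auto simp: D'_def notp)
    also have "(\<Prod>j\<in>{q..<n}. D' j \<omega>) = 1"
      using q by (intro prod.neutral) (auto simp: D'_def passed_def)
    finally have "ennreal c < (\<Prod>j<n. D' j \<omega>)" using q by simp
    then have "ennreal (1 / c) * ennreal c \<le> ennreal (1 / c) * (\<Prod>j<n. D' j \<omega>)" by (intro mult_left_mono) auto
    then show "1 \<le> ennreal (1 / c) * (\<Prod>k<n. D' k \<omega>)" using c by (simp add: ennreal_mult[symmetric])
  qed
  have "emeasure M {\<omega> \<in> space M. \<exists>k\<le>n. ennreal c < (\<Prod>j<k. D j \<omega>)} \<le> emeasure M {\<omega> \<in> space M. 1 \<le> ennreal (1 / c) * (\<Prod>k<n. D' k \<omega>)}"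
  proof (rule emeasure_mono[OF sub])
    show "{\<omega> \<in> space M. 1 \<le> ennreal (1 / c) * (\<Prod>k<n. D' k \<omega>)} \<in> events"
      by (intro borel_measurable_le borel_measurable_times_ennreal D'M) auto
  qed
  also have "\<dots> \<le> ennreal (1 / c) * (\<integral>\<^sup>+\<omega>. (\<Prod>k<n. D' k \<omega>) * indicator (space M) \<omega> \<partial>M)"
  proof (rule nn_integral_Markov_inequality)
    show "(\<lambda>\<omega>. (\<Prod>k<n. D' k \<omega>) * indicator (space M) \<omega>) \<in> borel_measurable M"
      by (rule borel_measurable_times_ennreal[OF D'M]) simp
  qed simp
  also have "\<dots> \<le> ennreal (1 / c) * 1"
  proof (rule mult_left_mono)
    have "(\<integral>\<^sup>+\<omega>. (\<Prod>k<n. D' k \<omega>) * indicator (space M) \<omega> \<partial>M) = (\<integral>\<^sup>+\<omega>. (\<Prod>k<n. D' k \<omega>) \<partial>M)"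
      by (intro nn_integral_cong) simp
    then show "(\<integral>\<^sup>+\<omega>. (\<Prod>k<n. D' k \<omega>) * indicator (space M) \<omega> \<partial>M) \<le> 1" using int1 by simp
  qed simp
  finally show ?thesis using c by (simp add: emeasure_eq_measure)
qed

locale filtered_brownian = prob_space M for M :: "'w measure" +
  fixes F :: "real \<Rightarrow> 'w measure" and B :: "real \<Rightarrow> 'w \<Rightarrow> real ^ 'm"
  assumes usual: "usual_conditions M F" and brownian: "brownian_motion M F B"
begin

lemma subalgebra_F: "0 \<le> t \<Longrightarrow> subalgebra M (F t)" "0 \<le> s \<Longrightarrow> s \<le> t \<Longrightarrow> subalgebra (F t) (F s)"
proof -
  show 1: "0 \<le> t \<Longrightarrow> subalgebra M (F t)" for t using usual by (simp add: usual_conditions_def)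
  assume st: "0 \<le> s" "s \<le> t"
  have "space (F s) = space (F t)" using 1[of s] 1[of t] st by (simp add: subalgebra_def)
  moreover have "sets (F s) \<subseteq> sets (F t)"
    using usual st unfolding usual_conditions_def by blast
  ultimately show "subalgebra (F t) (F s)" by (simp add: subalgebra_def)
qed

lemma space_F: "0 \<le> t \<Longrightarrow> space (F t) = space M"
  using subalgebra_F(1) by (simp add: subalgebra_def)

lemma measurable_F_mono: "X \<in> measurable (F s) N \<Longrightarrow> 0 \<le> s \<Longrightarrow> s \<le> t \<Longrightarrow> X \<in> measurable (F t) N"
  using measurable_from_subalg[OF subalgebra_F(2)] .

lemma measurable_F_M: "X \<in> measurable (F s) N \<Longrightarrow> 0 \<le> s \<Longrightarrow> X \<in> measurable M N"
  using measurable_from_subalg[OF subalgebra_F(1)] .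

lemma measurable_B: "0 \<le> t \<Longrightarrow> B t \<in> borel_measurable (F t)"
  using brownian by (simp add: brownian_motion_def adapted_on_def)

lemma measurable_B_F: "0 \<le> s \<Longrightarrow> s \<le> t \<Longrightarrow> B s \<in> borel_measurable (F t)"
  using measurable_F_mono[OF measurable_B] by blast

text \<open>The past is represented by the identity map into the measurable space
  \<open>F s\<close>. Independence makes its joint law with the increment a product measure, and
  Tonelli's theorem allows \<open>f\<close> to depend on the whole past.\<close>

lemma nn_integral_increment:
  assumes st: "0 \<le> s" "s < t" and f: "f \<in> borel_measurable (F s \<Otimes>\<^sub>M borel)"
  shows "(\<integral>\<^sup>+\<omega>. f (\<omega>, B t \<omega> - B s \<omega>) \<partial>M) = (\<integral>\<^sup>+\<omega>. (\<integral>\<^sup>+y. f (\<omega>, y) * ennreal (gauss_density (t - s) y) \<partial>lborel) \<partial>M)"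
proof -
  define X where "X = (\<lambda>\<omega>. B t \<omega> - B s \<omega>)"
  have BM: "B s \<in> borel_measurable M" "B t \<in> borel_measurable M"
    using measurable_F_M[OF measurable_B] st by auto
  have X[measurable]: "X \<in> borel_measurable M" unfolding X_def using BM by measurable
  have id: "(\<lambda>\<omega>. \<omega>) \<in> measurable M (F s)"
    using measurable_from_subalg[OF subalgebra_F(1)[OF st(1)] measurable_ident] by (simp add: id_def)
  have ind: "indep_set (sets (F s)) {X -` A \<inter> space M |A. A \<in> sets borel}"
    and dist: "distributed M lborel X (\<lambda>y. ennreal (gauss_density (t - s) y))"
    using brownian st by (auto simp: brownian_motion_def X_def gauss_density_def)
  interpret X: prob_space "distr M borel X" by (rule prob_space_distr[OF X])
  interpret I: prob_space "distr M (F s) (\<lambda>\<omega>. \<omega>)" by (rule prob_space_distr[OF id])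
  have pairm: "(\<lambda>\<omega>. (\<omega>, X \<omega>)) \<in> measurable M (F s \<Otimes>\<^sub>M borel)"
    using id X by (rule measurable_Pair)
  have joint: "distr M (F s) (\<lambda>\<omega>. \<omega>) \<Otimes>\<^sub>M distr M borel X = distr M (F s \<Otimes>\<^sub>M borel) (\<lambda>\<omega>. (\<omega>, X \<omega>))"
  proof (rule pair_measure_eqI[OF I.sigma_finite_measure_axioms X.sigma_finite_measure_axioms])
    show "sets (distr M (F s) (\<lambda>\<omega>. \<omega>) \<Otimes>\<^sub>M distr M borel X) = sets (distr M (F s \<Otimes>\<^sub>M borel) (\<lambda>\<omega>. (\<omega>, X \<omega>)))"
      using sets_pair_measure_cong[OF sets_distr[of M "F s" "\<lambda>\<omega>. \<omega>"] sets_distr[of M borel X]] by simp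
    fix A C assume "A \<in> sets (distr M (F s) (\<lambda>\<omega>. \<omega>))" "C \<in> sets (distr M borel X)"
    then have A: "A \<in> sets (F s)" and C: "C \<in> sets borel" by simp_all
    have AM: "A \<in> sets M" "A \<subseteq> space M"
      using A subalgebra_F(1)[OF st(1)] sets.sets_into_space[OF A] by (auto simp: subalgebra_def)
    let ?C = "X -` C \<inter> space M"
    have CM: "?C \<in> sets M" using measurable_sets[OF X C] .
    have "?C \<in> {X -` A \<inter> space M |A. A \<in> sets borel}" using C by blast
    then have "prob (A \<inter> ?C) = prob A * prob ?C" by (rule indep_setD[OF ind A])
    then have "emeasure M (A \<inter> ?C) = emeasure M A * emeasure M ?C"
      by (simp add: emeasure_eq_measure ennreal_mult)
    moreover have "emeasure (distr M (F s) (\<lambda>\<omega>. \<omega>)) A = emeasure M A"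
      using AM by (simp add: emeasure_distr[OF id A] Int_absorb2)
    moreover have "emeasure (distr M borel X) C = emeasure M ?C"
      by (rule emeasure_distr[OF X C])
    moreover have "emeasure (distr M (F s \<Otimes>\<^sub>M borel) (\<lambda>\<omega>. (\<omega>, X \<omega>))) (A \<times> C) = emeasure M (A \<inter> ?C)"
    proof -
      have "(\<lambda>\<omega>. (\<omega>, X \<omega>)) -` (A \<times> C) \<inter> space M = A \<inter> ?C" using AM by auto
      then show ?thesis using emeasure_distr[OF pairm, of "A \<times> C"] A C by simp
    qed
    ultimately show "emeasure (distr M (F s) (\<lambda>\<omega>. \<omega>)) A * emeasure (distr M borel X) C
        = emeasure (distr M (F s \<Otimes>\<^sub>M borel) (\<lambda>\<omega>. (\<omega>, X \<omega>))) (A \<times> C)" by simp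
  qed
  have dX: "distr M borel X = density lborel (\<lambda>y. ennreal (gauss_density (t - s) y))"
  proof -
    have "distr M borel X = distr M lborel X" by (rule distr_cong) auto
    then show ?thesis using dist by (simp add: distributed_def)
  qed
  have f': "f \<in> borel_measurable (distr M (F s) (\<lambda>\<omega>. \<omega>) \<Otimes>\<^sub>M distr M borel X)"
    using f measurable_cong_sets[OF sets_pair_measure_cong[OF sets_distr sets_distr] refl] by blast
  have "(\<integral>\<^sup>+\<omega>. f (\<omega>, X \<omega>) \<partial>M) = (\<integral>\<^sup>+z. f z \<partial>distr M (F s \<Otimes>\<^sub>M borel) (\<lambda>\<omega>. (\<omega>, X \<omega>)))"
    by (rule nn_integral_distr[OF pairm, symmetric]) (use f in simp)
  also have "\<dots> = (\<integral>\<^sup>+\<omega>. (\<integral>\<^sup>+y. f (\<omega>, y) \<partial>distr M borel X) \<partial>distr M (F s) (\<lambda>\<omega>. \<omega>))"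
    unfolding joint[symmetric] by (rule X.nn_integral_fst[OF f', symmetric])
  also have "\<dots> = (\<integral>\<^sup>+\<omega>. (\<integral>\<^sup>+y. f (\<omega>, y) \<partial>distr M borel X) \<partial>M)"
    by (rule nn_integral_distr[OF id], subst measurable_distr_eq1)
       (rule X.borel_measurable_nn_integral_fst, use f measurable_cong_sets[OF sets_pair_measure_cong[OF refl sets_distr] refl] in blast)
  also have "\<dots> = (\<integral>\<^sup>+\<omega>. (\<integral>\<^sup>+y. f (\<omega>, y) * ennreal (gauss_density (t - s) y) \<partial>lborel) \<partial>M)"
  proof (rule nn_integral_cong)
    fix \<omega> assume "\<omega> \<in> space M"
    then have "(\<lambda>y. f (\<omega>, y)) \<in> borel_measurable borel"
      using measurable_compose[OF measurable_Pair1' f] space_F[OF st(1)] by auto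
    then show "(\<integral>\<^sup>+y. f (\<omega>, y) \<partial>distr M borel X) = (\<integral>\<^sup>+y. f (\<omega>, y) * ennreal (gauss_density (t - s) y) \<partial>lborel)"
      unfolding dX by (subst nn_integral_density) (auto simp: mult.commute)
  qed
  finally show ?thesis by (simp add: X_def)
qed

text \<open>Given the past, the increment is Gaussian and \<open>a \<omega>\<close> is a constant,
  so \<open>gauss_exponential_moment\<close> applies for each sample point. The case of equal times
  is separate because the increment then has no density.\<close>

lemma exponential_step:
  assumes st: "0 \<le> s" "s \<le> t" and G: "G \<in> borel_measurable (F s)" and a: "a \<in> borel_measurable (F s)"
  shows "(\<integral>\<^sup>+\<omega>. G \<omega> * ennreal (exp (a \<omega> \<bullet> (B t \<omega> - B s \<omega>) - (norm (a \<omega>))\<^sup>2 * (t - s) / 2)) \<partial>M) \<le> (\<integral>\<^sup>+\<omega>. G \<omega> \<partial>M)"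
proof (cases "s = t")
  case False
  then have lt: "s < t" using st by simp
  define f where "f = (\<lambda>(\<omega>, y). G \<omega> * ennreal (exp (a \<omega> \<bullet> y - (norm (a \<omega>))\<^sup>2 * (t - s) / 2)))"
  have f: "f \<in> borel_measurable (F s \<Otimes>\<^sub>M borel)"
    unfolding f_def using G a by measurable
  have "(\<integral>\<^sup>+\<omega>. f (\<omega>, B t \<omega> - B s \<omega>) \<partial>M) = (\<integral>\<^sup>+\<omega>. G \<omega> \<partial>M)"
    unfolding nn_integral_increment[OF st(1) lt f]
  proof (rule nn_integral_cong)
    fix \<omega>
    have "(\<integral>\<^sup>+y. f (\<omega>, y) * ennreal (gauss_density (t - s) y) \<partial>lborel)
        = (\<integral>\<^sup>+y. G \<omega> * (ennreal (exp (a \<omega> \<bullet> y - (norm (a \<omega>))\<^sup>2 * (t - s) / 2)) * ennreal (gauss_density (t - s) y)) \<partial>lborel)"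
      by (simp add: f_def mult.assoc)
    also have "\<dots> = G \<omega> * (\<integral>\<^sup>+y. ennreal (exp (a \<omega> \<bullet> y - (norm (a \<omega>))\<^sup>2 * (t - s) / 2)) * ennreal (gauss_density (t - s) y) \<partial>lborel)"
      by (rule nn_integral_cmult) measurable
    also have "\<dots> = G \<omega>" using gauss_exponential_moment[of "t - s" "a \<omega>"] lt by simp
    finally show "(\<integral>\<^sup>+y. f (\<omega>, y) * ennreal (gauss_density (t - s) y) \<partial>lborel) = G \<omega>" .
  qed
  then show ?thesis by (simp add: f_def)
qed simp

end

section \<open>Exponential inequalities for stochastic integrals\<close>

text \<open>Truncated at 1, the variables converge to 0 in L1, and L1 convergence provides the
  subsequence.\<close>

lemma (in prob_space) null_in_probability_AE_subseq:
  fixes Y :: "nat \<Rightarrow> 'a \<Rightarrow> ennreal"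
  assumes Y[measurable]: "\<And>n. Y n \<in> borel_measurable M" and null: "null_in_probability M Y"
  obtains r :: "nat \<Rightarrow> nat" where "strict_mono r" "AE \<omega> in M. (\<lambda>n. Y (r n) \<omega>) \<longlonglongrightarrow> 0"
proof -
  define u where "u = (\<lambda>n \<omega>. enn2real (min 1 (Y n \<omega>)))"
  have u[measurable]: "u n \<in> borel_measurable M" for n unfolding u_def by measurable
  have u01: "0 \<le> u n \<omega>" "u n \<omega> \<le> 1" for n \<omega>
    by (auto simp: u_def intro!: enn2real_leI)
  have ui: "integrable M (u n)" for n
    by (rule integrable_const_bound[of _ 1]) (use u01 in auto)
  have "(\<lambda>n. \<integral>\<omega>. norm (u n \<omega>) \<partial>M) \<longlonglongrightarrow> 0"
  proof (rule LIMSEQ_I)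
    fix e :: real assume e: "0 < e"
    have "(\<lambda>n. prob {\<omega> \<in> space M. ennreal (e / 2) < Y n \<omega>}) \<longlonglongrightarrow> 0"
      using null e by (simp add: null_in_probability_def)
    then have "\<exists>n0. \<forall>n\<ge>n0. norm (prob {\<omega> \<in> space M. ennreal (e / 2) < Y n \<omega>} - 0) < e / 2"
      using e by (intro LIMSEQ_D) auto
    then obtain n0 where n0: "\<And>n. n0 \<le> n \<Longrightarrow> prob {\<omega> \<in> space M. ennreal (e / 2) < Y n \<omega>} < e / 2"
      by auto
    have "(\<integral>\<omega>. norm (u n \<omega>) \<partial>M) < e" if n: "n0 \<le> n" for n
    proof -
      let ?A = "{\<omega> \<in> space M. ennreal (e / 2) < Y n \<omega>}"
      have A: "?A \<in> events" by measurable
      have iA: "integrable M (\<lambda>\<omega>. e / 2 + indicator ?A \<omega> :: real)"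
        by (intro Bochner_Integration.integrable_add integrable_const integrable_real_indicator A)
           (simp add: emeasure_eq_measure)
      have "(\<integral>\<omega>. norm (u n \<omega>) \<partial>M) \<le> (\<integral>\<omega>. e / 2 + indicator ?A \<omega> \<partial>M)"
      proof (rule integral_mono[OF integrable_norm[OF ui] iA])
        fix \<omega> assume \<omega>: "\<omega> \<in> space M"
        show "norm (u n \<omega>) \<le> e / 2 + indicator ?A \<omega>"
        proof (cases "\<omega> \<in> ?A")
          case True
          then show ?thesis using u01[of n \<omega>] e by simp
        next
          case False
          then have "min 1 (Y n \<omega>) \<le> ennreal (e / 2)" using \<omega> by (simp add: min.coboundedI2)
          then have "u n \<omega> \<le> e / 2" unfolding u_def using e by (intro enn2real_leI) auto
          then show ?thesis using u01[of n \<omega>] False by simp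
        qed
      qed
      also have "\<dots> = e / 2 + prob ?A"
        using A by (subst Bochner_Integration.integral_add) (auto simp: prob_space emeasure_eq_measure)
      also have "\<dots> < e" using n0[OF n] by simp
      finally show ?thesis .
    qed
    then show "\<exists>no. \<forall>n\<ge>no. norm ((\<integral>\<omega>. norm (u n \<omega>) \<partial>M) - 0) < e"
      by (intro exI[of _ n0]) auto
  qed
  from tendsto_L1_AE_subseq[OF ui this] obtain r :: "nat \<Rightarrow> nat"
    where r: "strict_mono r" "AE \<omega> in M. (\<lambda>n. u (r n) \<omega>) \<longlonglongrightarrow> 0" by blast
  have "AE \<omega> in M. (\<lambda>n. Y (r n) \<omega>) \<longlonglongrightarrow> 0"
    using r(2)
  proof eventually_elim
    case (elim \<omega>)
    show ?case
    proof (rule order_tendstoI)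
      fix a :: ennreal assume a: "0 < a"
      \<comment> \<open>With \<open>e\<close> below 1 the truncation is invisible:
        \<open>min 1 y < e\<close> already means \<open>y < e\<close>.\<close>
      then obtain e where e: "0 < e" "ennreal e \<le> a" "e < 1"
      proof (cases a)
        case (real x)
        then show ?thesis using a that[of "min x (1/2)"] by (auto simp: ennreal_leI min_def)
      next
        case top
        then show ?thesis using that[of "1/2"] by simp
      qed
      have "\<forall>\<^sub>F n in sequentially. u (r n) \<omega> < e"
        using elim e(1) by (rule order_tendstoD)
      then show "\<forall>\<^sub>F n in sequentially. Y (r n) \<omega> < a"
      proof eventually_elim
        case (elim n)
        have fin: "min 1 (Y (r n) \<omega>) < top" by (simp add: min_less_iff_disj)
        have "min 1 (Y (r n) \<omega>) = ennreal (u (r n) \<omega>)" unfolding u_def using fin by simp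
        also have "\<dots> < ennreal e" using elim u01 by (simp add: ennreal_less_iff)
        finally have "min 1 (Y (r n) \<omega>) < ennreal e" .
        moreover have "ennreal e < 1" using e by simp
        ultimately have "Y (r n) \<omega> < ennreal e" by (auto simp: min_less_iff_disj)
        then show ?case using e(2) by (rule less_le_trans)
      qed
    qed simp
  qed
  then show ?thesis using that r(1) by blast
qed

text \<open>Tonelli's theorem. This is where progressive measurability is used: it makes the
  quadratic variation up to time \<open>t\<close> measurable at time \<open>t\<close>.\<close>

lemma borel_measurable_time_integral:
  fixes f :: "real \<Rightarrow> 'w \<Rightarrow> ennreal"
  assumes f: "(\<lambda>(r, \<omega>). f r \<omega>) \<in> borel_measurable (restrict_space borel {0..t} \<Otimes>\<^sub>M N)"
    and A: "A \<in> sets borel" "A \<subseteq> {0..t}"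
  shows "(\<lambda>\<omega>. \<integral>\<^sup>+r\<in>A. f r \<omega> \<partial>lborel) \<in> borel_measurable N"
proof -
  let ?R = "restrict_space lborel {0..t}"
  interpret sigma_finite_measure ?R by (rule sigma_finite_measure_restrict_space[OF sigma_finite_lborel]) simp
  have R: "sets ?R = sets (restrict_space borel {0..t})" by (simp add: sets_restrict_space)
  have "(\<lambda>(r, \<omega>). f r \<omega>) \<in> borel_measurable (?R \<Otimes>\<^sub>M N)"
    using f measurable_cong_sets[OF sets_pair_measure_cong[OF R refl] refl] by blast
  then have 1: "(\<lambda>(\<omega>, r). f r \<omega>) \<in> borel_measurable (N \<Otimes>\<^sub>M ?R)"
    using measurable_pair_swap_iff[of "\<lambda>(r, \<omega>). f r \<omega>"] by simp
  have "indicator A \<in> borel_measurable ?R"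
    by (rule measurable_restrict_space1) (use A in simp)
  then have "(\<lambda>(\<omega>, r). f r \<omega> * indicator A r) \<in> borel_measurable (N \<Otimes>\<^sub>M ?R)"
    using 1 measurable_compose[OF measurable_snd[of N ?R]] by (auto simp: split_beta' intro!: borel_measurable_times_ennreal)
  then have "(\<lambda>\<omega>. \<integral>\<^sup>+r. f r \<omega> * indicator A r \<partial>?R) \<in> borel_measurable N"
    by (rule borel_measurable_nn_integral)
  moreover have "(\<integral>\<^sup>+r. f r \<omega> * indicator A r \<partial>?R) = (\<integral>\<^sup>+r\<in>A. f r \<omega> \<partial>lborel)" for \<omega>
    using A(2) by (subst nn_integral_restrict_space) (auto intro!: nn_integral_cong simp: indicator_def)
  ultimately show ?thesis by simp
qed

lemma transpose_mult_measurable: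
  fixes A :: "'w \<Rightarrow> real ^ 'm ^ 'd"
  assumes "A \<in> borel_measurable N"
  shows "(\<lambda>\<omega>. transpose (A \<omega>) *v v) \<in> borel_measurable N"
proof -
  have "linear (\<lambda>A :: real ^ 'm ^ 'd. transpose A *v v)"
    by (rule linearI) (auto simp: vec_eq_iff matrix_vector_mult_def transpose_def sum.distrib sum_distrib_left algebra_simps)
  then have "continuous_on UNIV (\<lambda>A :: real ^ 'm ^ 'd. transpose A *v v)"
    by (simp add: linear_continuous_on linear_conv_bounded_linear)
  from measurable_compose[OF assms borel_measurable_continuous_onI[OF this]] show ?thesis .
qed

lemma matrix_vector_mult_measurable:
  fixes A :: "'w \<Rightarrow> real ^ 'm ^ 'd"
  assumes "A \<in> borel_measurable N" "v \<in> borel_measurable N"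
  shows "(\<lambda>\<omega>. A \<omega> *v v \<omega>) \<in> borel_measurable N"
proof -
  have "bounded_bilinear ((*v) :: real ^ 'm ^ 'd \<Rightarrow> _)"
    using bilinear_matrix_vector_mult by (simp add: bilinear_conv_bounded_bilinear)
  then have "continuous_on UNIV (\<lambda>p :: (real ^ 'm ^ 'd) \<times> (real ^ 'm). fst p *v snd p)"
    by (rule bounded_bilinear.continuous_on) (intro continuous_intros)+
  from measurable_compose[OF measurable_Pair[OF assms], of "\<lambda>p. fst p *v snd p" borel] show ?thesis
    using borel_measurable_continuous_onI[OF \<open>continuous_on UNIV _\<close>] by (simp add: borel_prod)
qed

context filtered_brownian begin

lemma simple_exponential_step:
  fixes \<xi> :: "nat \<Rightarrow> 'w \<Rightarrow> real ^ 'm ^ 'd"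
  assumes simple: "simple_integrand M F T N \<tau> \<xi>" and st: "0 \<le> s" "s \<le> t"
    and S: "S \<in> borel_measurable (F s)" and G: "G \<in> borel_measurable (F s)"
  shows "(\<integral>\<^sup>+\<omega>. G \<omega> * ennreal (exp (v \<bullet> (simple_integral B N \<tau> \<xi> t \<omega> - simple_integral B N \<tau> \<xi> s \<omega> - S \<omega> *v (B t \<omega> - B s \<omega>))
       - (norm v)\<^sup>2 / 2 * enn2real (\<integral>\<^sup>+r\<in>{s<..t}. ennreal ((norm (simple_process N \<tau> \<xi> r \<omega> - S \<omega>))\<^sup>2) \<partial>lborel))) \<partial>M)
    \<le> (\<integral>\<^sup>+\<omega>. G \<omega> \<partial>M)"
proof -
  define c where "c = (\<lambda>r. max s (min t r))"
  \<comment> \<open>There are \<open>N + 2\<close> cells: the \<open>N\<close> clipped ones, one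
    from \<open>s\<close> to the first partition point and one from the last to \<open>t\<close>.
    The simple process vanishes on the two extra cells.\<close>
  define p where "p = (\<lambda>k. if k = 0 then s else if k \<le> Suc N then c (\<tau> (k - 1)) else t)"
  \<comment> \<open>If \<open>\<tau> (k - 1)\<close> is not below \<open>t\<close>, the cell is
    degenerate and \<open>\<xi> (k - 1)\<close> need not be measurable at its left end; the value 0
    is then harmless and restores adaptedness.\<close>
  define X where "X = (\<lambda>k \<omega>. if 0 < k \<and> k \<le> N \<and> \<tau> (k - 1) < t then \<xi> (k - 1) \<omega> else 0)"
  define A where "A = (\<lambda>k \<omega>. X k \<omega> - S \<omega>)"
  define a where "a = (\<lambda>k \<omega>. transpose (A k \<omega>) *v v)"
  define n where "n = N + 2"
  have \<tau>S: "\<tau> k < \<tau> (Suc k)" and \<xi>: "\<xi> k \<in> borel_measurable (F (\<tau> k))" if "k < N" for k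
    using simple that by (auto simp: simple_integrand_def)
  have \<tau>0: "0 \<le> \<tau> 0" using simple by (simp add: simple_integrand_def)
  have \<tau>m: "\<tau> i \<le> \<tau> j" if "i \<le> j" "j \<le> N" for i j
    using that
  proof (induction j)
    case (Suc j)
    then show ?case using \<tau>S[of j] by (cases "i = Suc j") auto
  qed simp
  have \<tau>nn: "0 \<le> \<tau> k" if "k \<le> N" for k using \<tau>m[of 0 k] \<tau>0 that by simp
  have cm: "c x \<le> c y" if "x \<le> y" for x y using that by (auto simp: c_def)
  have cst: "s \<le> c x" "c x \<le> t" for x using st by (auto simp: c_def)
  have pS: "p k \<le> p (Suc k)" for k
  proof (cases "k = 0 \<or> N < k")
    case True
    then show ?thesis using st cst by (auto simp: p_def)
  next
    case False
    then have "\<tau> (k - 1) \<le> \<tau> k" by (intro \<tau>m) auto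
    then show ?thesis using False cst by (auto simp: p_def intro: cm)
  qed
  have pm: "p i \<le> p j" if "i \<le> j" for i j using pS that by (rule lift_Suc_mono_le)
  have p0: "p 0 = s" and pn: "p n = t" by (auto simp: p_def n_def)
  have pnn: "0 \<le> p k" for k using pm[of 0 k] p0 st by simp
  have Xm: "X k \<in> borel_measurable (F (p k))" for k
  proof (cases "0 < k \<and> k \<le> N \<and> \<tau> (k - 1) < t")
    case True
    then obtain i where i: "k = Suc i" "i < N" "\<tau> i < t" by (cases k) auto
    have "\<tau> i \<le> p k" using i by (simp add: p_def c_def)
    have "0 \<le> \<tau> i" using i by (intro \<tau>nn) simp
    have "\<xi> i \<in> borel_measurable (F (p k))"
      by (rule measurable_F_mono[OF \<xi>[OF i(2)]]) fact+
    moreover have "X k = \<xi> i" using i by (simp add: X_def[abs_def])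
    ultimately show ?thesis by simp
  qed (auto simp: X_def[abs_def])
  have Sm: "S \<in> borel_measurable (F (p k))" for k
    using measurable_F_mono[OF S st(1)] pm[of 0 k] p0 by simp
  have am: "a k \<in> borel_measurable (F (p k))" for k
    unfolding a_def A_def by (intro transpose_mult_measurable borel_measurable_diff Xm Sm)
  define D where "D = (\<lambda>k \<omega>. ennreal (exp (a k \<omega> \<bullet> (B (p (Suc k)) \<omega> - B (p k) \<omega>) - (norm (a k \<omega>))\<^sup>2 * (p (Suc k) - p k) / 2)))"
  have "(\<integral>\<^sup>+\<omega>. G \<omega> * (\<Prod>k<n. D k \<omega>) \<partial>M) \<le> 1 ^ n * (\<integral>\<^sup>+\<omega>. G \<omega> \<partial>M)"
  proof (rule nn_integral_prod_le[where N = "\<lambda>k. F (p k)"])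
    show "D k \<in> borel_measurable (F (p (Suc k)))" for k
    proof -
      have "a k \<in> borel_measurable (F (p (Suc k)))" by (rule measurable_F_mono[OF am pnn pS])
      moreover have "B (p (Suc k)) \<in> borel_measurable (F (p (Suc k)))" "B (p k) \<in> borel_measurable (F (p (Suc k)))"
        using measurable_B_F[OF pnn pS] measurable_B[OF pnn] by auto
      ultimately show ?thesis unfolding D_def by measurable
    qed
    show "X \<in> borel_measurable (F (p j))" if "k \<le> j" "X \<in> borel_measurable (F (p k))" for k j and X :: "'w \<Rightarrow> ennreal"
      by (rule measurable_F_mono[OF that(2) pnn pm[OF that(1)]])
    show "(\<integral>\<^sup>+\<omega>. G \<omega> * D k \<omega> \<partial>M) \<le> 1 * (\<integral>\<^sup>+\<omega>. G \<omega> \<partial>M)" if "G \<in> borel_measurable (F (p k))" for k G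
      unfolding D_def using exponential_step[OF pnn pS that am] by simp
    show "G \<in> borel_measurable (F (p 0))" using G by (simp add: p0)
  qed
  then have le: "(\<integral>\<^sup>+\<omega>. G \<omega> * (\<Prod>k<n. D k \<omega>) \<partial>M) \<le> (\<integral>\<^sup>+\<omega>. G \<omega> \<partial>M)" by simp
  have pt: "ennreal (exp (v \<bullet> (simple_integral B N \<tau> \<xi> t \<omega> - simple_integral B N \<tau> \<xi> s \<omega> - S \<omega> *v (B t \<omega> - B s \<omega>))
       - (norm v)\<^sup>2 / 2 * enn2real (\<integral>\<^sup>+r\<in>{s<..t}. ennreal ((norm (simple_process N \<tau> \<xi> r \<omega> - S \<omega>))\<^sup>2) \<partial>lborel)))
    \<le> (\<Prod>k<n. D k \<omega>)" for \<omega>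
  proof -
    let ?dB = "\<lambda>k. B (p (Suc k)) \<omega> - B (p k) \<omega>"
    have SI: "simple_integral B N \<tau> \<xi> t \<omega> - simple_integral B N \<tau> \<xi> s \<omega> = (\<Sum>k<n. X k \<omega> *v ?dB k)"
    proof -
      have clip: "B (min t x) \<omega> - B (min s x) \<omega> = B (c x) \<omega> - B s \<omega>" for x
        using st by (cases "x \<le> s"; cases "x \<le> t") (auto simp: c_def min_def max_def)
      have "\<xi> k \<omega> *v (B (min t (\<tau> (Suc k))) \<omega> - B (min t (\<tau> k)) \<omega>) - \<xi> k \<omega> *v (B (min s (\<tau> (Suc k))) \<omega> - B (min s (\<tau> k)) \<omega>)
          = X (Suc k) \<omega> *v ?dB (Suc k)" if k: "k < N" for k
      proof -
        have "\<xi> k \<omega> *v (B (min t (\<tau> (Suc k))) \<omega> - B (min t (\<tau> k)) \<omega>) - \<xi> k \<omega> *v (B (min s (\<tau> (Suc k))) \<omega> - B (min s (\<tau> k)) \<omega>)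
            = \<xi> k \<omega> *v ((B (min t (\<tau> (Suc k))) \<omega> - B (min s (\<tau> (Suc k))) \<omega>) - (B (min t (\<tau> k)) \<omega> - B (min s (\<tau> k)) \<omega>))"
          by (simp add: matrix_vector_mult_diff_distrib)
        also have "\<dots> = \<xi> k \<omega> *v (B (c (\<tau> (Suc k))) \<omega> - B (c (\<tau> k)) \<omega>)" by (simp add: clip)
        also have "\<dots> = X (Suc k) \<omega> *v (B (c (\<tau> (Suc k))) \<omega> - B (c (\<tau> k)) \<omega>)"
        proof (cases "\<tau> k < t")
          case True
          then show ?thesis using k by (simp add: X_def)
        next
          case False
          then have "c (\<tau> (Suc k)) = c (\<tau> k)" using \<tau>S[OF k] st by (simp add: c_def)
          then show ?thesis by simp
        qed
        finally show ?thesis using k by (simp add: p_def)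
      qed
      then have "simple_integral B N \<tau> \<xi> t \<omega> - simple_integral B N \<tau> \<xi> s \<omega> = (\<Sum>k<N. X (Suc k) \<omega> *v ?dB (Suc k))"
        unfolding simple_integral_def sum_subtractf[symmetric] by (intro sum.cong) auto
      also have "\<dots> = (\<Sum>k<Suc N. X (Suc k) \<omega> *v ?dB (Suc k))" by (simp add: X_def)
      also have "\<dots> = (\<Sum>k<Suc (Suc N). X k \<omega> *v ?dB k)"
        by (subst (2) sum.lessThan_Suc_shift) (simp add: X_def)
      finally show ?thesis by (simp add: n_def)
    qed
    have tel: "(\<Sum>k<n. ?dB k) = B t \<omega> - B s \<omega>"
      using sum_lessThan_telescope[of "\<lambda>k. B (p k) \<omega>" n] by (simp add: p0 pn)
    have SB: "S \<omega> *v (B t \<omega> - B s \<omega>) = (\<Sum>k<n. S \<omega> *v ?dB k)"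
      unfolding tel[symmetric] by (simp add: linear_sum[OF matrix_vector_mul_linear])
    have lin: "(\<Sum>k<n. a k \<omega> \<bullet> ?dB k) = v \<bullet> (simple_integral B N \<tau> \<xi> t \<omega> - simple_integral B N \<tau> \<xi> s \<omega> - S \<omega> *v (B t \<omega> - B s \<omega>))"
    proof -
      have "a k \<omega> \<bullet> ?dB k = v \<bullet> (X k \<omega> *v ?dB k - S \<omega> *v ?dB k)" for k
        unfolding a_def A_def using inner_matrix_vector_mult[of "X k \<omega> - S \<omega>" "?dB k" v]
        by (simp add: inner_commute matrix_vector_mult_diff_rdistrib)
      then show ?thesis by (simp add: SI SB inner_sum_right sum_subtractf inner_diff_right)
    qed
    have SP: "simple_process N \<tau> \<xi> r \<omega> = X k \<omega>" if k: "k < n" and r: "r \<in> {p k<..p (Suc k)}" for k r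
    proof -
      have other: "indicator {\<tau> j<..\<tau> (Suc j)} r *\<^sub>R \<xi> j \<omega> = 0" if "j < N" "r \<le> \<tau> j \<or> \<tau> (Suc j) < r" for j
        using that by (auto simp: indicator_def)
      have rs: "s < r" "r \<le> t" using r pm[of 0 k] pm[of "Suc k" n] k p0 pn by auto
      consider "k = 0" | "0 < k" "k \<le> N" | "k = Suc N" using k by (force simp: n_def)
      then show ?thesis
      proof cases
        case 1
        have "r \<le> \<tau> 0" using r rs 1 by (auto simp: p_def c_def)
        then have "simple_process N \<tau> \<xi> r \<omega> = 0"
          unfolding simple_process_def
        proof (intro sum.neutral ballI other)
          fix j assume j: "j \<in> {..<N}"
          then have "\<tau> 0 \<le> \<tau> j" by (intro \<tau>m) auto
          then show "r \<le> \<tau> j \<or> \<tau> (Suc j) < r" using \<open>r \<le> \<tau> 0\<close> by simp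
        qed simp
        then show ?thesis using 1 by (simp add: X_def)
      next
        case 2
        then obtain i where i: "k = Suc i" by (cases k) auto
        have "r \<le> \<tau> k" "\<tau> i < r" using r rs 2 i by (auto simp: p_def c_def)
        have "simple_process N \<tau> \<xi> r \<omega> = (\<Sum>j\<in>{i}. indicator {\<tau> j<..\<tau> (Suc j)} r *\<^sub>R \<xi> j \<omega>)"
          unfolding simple_process_def
        proof (rule sum.mono_neutral_right)
          show "\<forall>j\<in>{..<N} - {i}. indicator {\<tau> j<..\<tau> (Suc j)} r *\<^sub>R \<xi> j \<omega> = 0"
          proof
            fix j assume j: "j \<in> {..<N} - {i}"
            show "indicator {\<tau> j<..\<tau> (Suc j)} r *\<^sub>R \<xi> j \<omega> = 0"
            proof (cases "j < i")
              case True
              then have "\<tau> (Suc j) \<le> \<tau> i" using i 2 by (intro \<tau>m) auto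
              then show ?thesis using \<open>\<tau> i < r\<close> j by (intro other) auto
            next
              case False
              then have "\<tau> k \<le> \<tau> j" using i j by (intro \<tau>m) auto
              then show ?thesis using \<open>r \<le> \<tau> k\<close> j by (intro other) auto
            qed
          qed
        qed (use i 2 in auto)
        also have "\<dots> = \<xi> i \<omega>" using \<open>r \<le> \<tau> k\<close> \<open>\<tau> i < r\<close> i by simp
        finally show ?thesis using i 2 rs \<open>\<tau> i < r\<close> by (simp add: X_def)
      next
        case 3
        have "\<tau> N < r" using r rs 3 by (auto simp: p_def c_def)
        then have "simple_process N \<tau> \<xi> r \<omega> = 0"
          unfolding simple_process_def
        proof (intro sum.neutral ballI other)
          fix j assume j: "j \<in> {..<N}"
          then have "\<tau> (Suc j) \<le> \<tau> N" by (intro \<tau>m) auto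
          then show "r \<le> \<tau> j \<or> \<tau> (Suc j) < r" using \<open>\<tau> N < r\<close> by simp
        qed simp
        then show ?thesis using 3 by (simp add: X_def)
      qed
    qed
    have ind: "(\<Sum>k<j. indicator {p k<..p (Suc k)} r * y) = indicator {p 0<..p j} r * y" for j and r :: real and y :: ennreal
    proof (induction j)
      case (Suc j)
      have "indicator {p 0<..p (Suc j)} r = (indicator {p 0<..p j} r + indicator {p j<..p (Suc j)} r :: ennreal)"
        using pm[of 0 j] pS[of j] by (auto simp: indicator_def)
      then show ?case using Suc by (simp add: distrib_right)
    qed simp
    have "(\<integral>\<^sup>+r\<in>{s<..t}. ennreal ((norm (simple_process N \<tau> \<xi> r \<omega> - S \<omega>))\<^sup>2) \<partial>lborel)
        = (\<integral>\<^sup>+r. (\<Sum>k<n. indicator {p k<..p (Suc k)} r * ennreal ((norm (A k \<omega>))\<^sup>2)) \<partial>lborel)"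
    proof (rule nn_integral_cong)
      fix r
      have "ennreal ((norm (simple_process N \<tau> \<xi> r \<omega> - S \<omega>))\<^sup>2) * indicator {s<..t} r
          = (\<Sum>k<n. indicator {p k<..p (Suc k)} r * ennreal ((norm (simple_process N \<tau> \<xi> r \<omega> - S \<omega>))\<^sup>2))"
        unfolding ind p0 pn by (simp add: mult.commute)
      also have "\<dots> = (\<Sum>k<n. indicator {p k<..p (Suc k)} r * ennreal ((norm (A k \<omega>))\<^sup>2))"
        by (intro sum.cong refl) (auto simp: indicator_def SP A_def)
      finally show "ennreal ((norm (simple_process N \<tau> \<xi> r \<omega> - S \<omega>))\<^sup>2) * indicator {s<..t} r
          = (\<Sum>k<n. indicator {p k<..p (Suc k)} r * ennreal ((norm (A k \<omega>))\<^sup>2))" .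
    qed
    also have "\<dots> = (\<Sum>k<n. \<integral>\<^sup>+r. indicator {p k<..p (Suc k)} r * ennreal ((norm (A k \<omega>))\<^sup>2) \<partial>lborel)"
      by (rule nn_integral_sum) simp
    also have "\<dots> = (\<Sum>k<n. ennreal ((norm (A k \<omega>))\<^sup>2 * (p (Suc k) - p k)))"
      using pS by (intro sum.cong) (auto simp: nn_integral_multc ennreal_mult' mult.commute)
    also have "\<dots> = ennreal (\<Sum>k<n. (norm (A k \<omega>))\<^sup>2 * (p (Suc k) - p k))"
      using pS by (intro sum_ennreal) auto
    finally have q: "enn2real (\<integral>\<^sup>+r\<in>{s<..t}. ennreal ((norm (simple_process N \<tau> \<xi> r \<omega> - S \<omega>))\<^sup>2) \<partial>lborel)
        = (\<Sum>k<n. (norm (A k \<omega>))\<^sup>2 * (p (Suc k) - p k))"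
      using pS by (simp add: sum_nonneg)
    \<comment> \<open>Here the exact compensator of the direction \<open>v\<close> is replaced by
      the larger Hilbert-Schmidt one; this makes the exponent smaller and so keeps the
      inequality.\<close>
    have "(\<Sum>k<n. (norm (a k \<omega>))\<^sup>2 * (p (Suc k) - p k) / 2) \<le> (\<Sum>k<n. (norm v)\<^sup>2 / 2 * ((norm (A k \<omega>))\<^sup>2 * (p (Suc k) - p k)))"
    proof (rule sum_mono)
      fix k
      have "norm (a k \<omega>) \<le> norm (A k \<omega>) * norm v" unfolding a_def by (rule norm_transpose_mult_le)
      then have "(norm (a k \<omega>))\<^sup>2 \<le> (norm (A k \<omega>) * norm v)\<^sup>2" by (intro power_mono) auto
      then have "(norm (a k \<omega>))\<^sup>2 * ((p (Suc k) - p k) / 2) \<le> (norm (A k \<omega>) * norm v)\<^sup>2 * ((p (Suc k) - p k) / 2)"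
        using pS[of k] by (intro mult_right_mono) auto
      then show "(norm (a k \<omega>))\<^sup>2 * (p (Suc k) - p k) / 2 \<le> (norm v)\<^sup>2 / 2 * ((norm (A k \<omega>))\<^sup>2 * (p (Suc k) - p k))"
        by (simp add: power_mult_distrib mult_ac)
    qed
    then have quad: "(\<Sum>k<n. (norm (a k \<omega>))\<^sup>2 * (p (Suc k) - p k) / 2)
        \<le> (norm v)\<^sup>2 / 2 * enn2real (\<integral>\<^sup>+r\<in>{s<..t}. ennreal ((norm (simple_process N \<tau> \<xi> r \<omega> - S \<omega>))\<^sup>2) \<partial>lborel)"
      unfolding q by (simp add: sum_distrib_left)
    have "(\<Prod>k<n. D k \<omega>) = ennreal (exp ((\<Sum>k<n. a k \<omega> \<bullet> ?dB k) - (\<Sum>k<n. (norm (a k \<omega>))\<^sup>2 * (p (Suc k) - p k) / 2)))"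
      unfolding D_def by (simp add: prod_ennreal exp_sum sum_subtractf[symmetric])
    then show ?thesis using quad lin by (simp add: ennreal_leI)
  qed
  show ?thesis
    by (rule order_trans[OF _ le]) (intro nn_integral_mono mult_left_mono pt, simp)
qed

end

lemma null_in_probability_subseq:
  assumes "null_in_probability M Y" "strict_mono r"
  shows "null_in_probability M (\<lambda>n. Y (r n))"
  unfolding null_in_probability_def
proof (intro allI impI)
  fix e :: real assume "0 < e"
  then have "(\<lambda>n. measure M {\<omega> \<in> space M. ennreal e < Y n \<omega>}) \<longlonglongrightarrow> 0"
    using assms(1) by (simp add: null_in_probability_def)
  from LIMSEQ_subseq_LIMSEQ[OF this assms(2)]
  show "(\<lambda>n. measure M {\<omega> \<in> space M. ennreal e < Y (r n) \<omega>}) \<longlonglongrightarrow> 0" by (simp add: o_def)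
qed

lemma norm_diff_power2_le: "(norm (x - z))\<^sup>2 \<le> 2 * (norm (y - z))\<^sup>2 + 2 * (norm (x - y))\<^sup>2"
  for x y z :: "'a::real_normed_vector"
proof -
  have "norm (x - z) \<le> norm (y - z) + norm (x - y)"
    using norm_triangle_ineq[of "y - z" "x - y"] by simp
  then have "(norm (x - z))\<^sup>2 \<le> (norm (y - z) + norm (x - y))\<^sup>2" by (intro power_mono) auto
  also have "\<dots> \<le> 2 * (norm (y - z))\<^sup>2 + 2 * (norm (x - y))\<^sup>2"
    using zero_le_power2[of "norm (y - z) - norm (x - y)"] by (simp add: power2_eq_square algebra_simps)
  finally show ?thesis .
qed

context filtered_brownian begin

lemma measurable_simple_process:
  fixes \<xi> :: "nat \<Rightarrow> 'w \<Rightarrow> real ^ 'm ^ 'd"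
  assumes "simple_integrand M F T N \<tau> \<xi>" "0 \<le> T"
  shows "(\<lambda>(r, \<omega>). simple_process N \<tau> \<xi> r \<omega>) \<in> borel_measurable (restrict_space borel {0..T} \<Otimes>\<^sub>M F T)"
proof -
  have \<tau>S: "\<tau> k < \<tau> (Suc k)" and \<xi>: "\<xi> k \<in> borel_measurable (F (\<tau> k))" if "k < N" for k
    using assms(1) that by (auto simp: simple_integrand_def)
  have \<tau>m: "\<tau> i \<le> \<tau> j" if "i \<le> j" "j \<le> N" for i j
    using that
  proof (induction j)
    case (Suc j)
    then show ?case using \<tau>S[of j] by (cases "i = Suc j") auto
  qed simp
  have "(\<lambda>z. indicator {\<tau> k<..\<tau> (Suc k)} (fst z) *\<^sub>R \<xi> k (snd z)) \<in> borel_measurable (restrict_space borel {0..T} \<Otimes>\<^sub>M F T)"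
    if k: "k < N" for k
  proof (rule borel_measurable_scaleR)
    have "indicator {\<tau> k<..\<tau> (Suc k)} \<in> (borel_measurable (restrict_space borel {0..T}) :: (real \<Rightarrow> real) set)"
      by (rule measurable_restrict_space1) simp
    from measurable_compose[OF measurable_fst this]
    show "(\<lambda>z. indicator {\<tau> k<..\<tau> (Suc k)} (fst z)) \<in> (borel_measurable (restrict_space borel {0..T} \<Otimes>\<^sub>M F T) :: (real \<times> 'w \<Rightarrow> real) set)" .
    have "0 \<le> \<tau> k" "\<tau> k \<le> T"
      using \<tau>m[of 0 k] \<tau>m[of k N] k assms(1) by (auto simp: simple_integrand_def)
    then have "\<xi> k \<in> borel_measurable (F T)" by (rule measurable_F_mono[OF \<xi>[OF k]])
    from measurable_compose[OF measurable_snd this]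
    show "(\<lambda>z. \<xi> k (snd z)) \<in> borel_measurable (restrict_space borel {0..T} \<Otimes>\<^sub>M F T)" .
  qed
  then show ?thesis
    unfolding simple_process_def split_beta' by (intro borel_measurable_sum) auto
qed

lemma measurable_simple_integral:
  fixes \<xi> :: "nat \<Rightarrow> 'w \<Rightarrow> real ^ 'm ^ 'd"
  assumes "simple_integrand M F T N \<tau> \<xi>" "0 \<le> t"
  shows "simple_integral B N \<tau> \<xi> t \<in> borel_measurable M"
proof -
  have \<tau>S: "\<tau> k < \<tau> (Suc k)" and \<xi>: "\<xi> k \<in> borel_measurable (F (\<tau> k))" if "k < N" for k
    using assms(1) that by (auto simp: simple_integrand_def)
  have \<tau>nn: "0 \<le> \<tau> k" if "k \<le> N" for k
    using that
  proof (induction k)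
    case (Suc k)
    then show ?case using \<tau>S[of k] by simp
  qed (use assms in \<open>simp add: simple_integrand_def\<close>)
  have BM: "B r \<in> borel_measurable M" if "0 \<le> r" for r using measurable_F_M[OF measurable_B] that by blast
  have "(\<lambda>\<omega>. \<xi> k \<omega> *v (B (min t (\<tau> (Suc k))) \<omega> - B (min t (\<tau> k)) \<omega>)) \<in> borel_measurable M" if k: "k < N" for k
    by (intro matrix_vector_mult_measurable measurable_F_M[OF \<xi>] borel_measurable_diff BM)
       (use k \<tau>nn[of k] \<tau>nn[of "Suc k"] assms(2) in auto)
  then show ?thesis
    unfolding simple_integral_def[abs_def] by (intro borel_measurable_sum) auto
qed

text \<open>The exponential supermartingale inequality passes from simple integrands to the limit by
  Fatou's lemma; since \<open>L\<^sup>2\<close> convergence only enters through \<open>|x|\<^sup>2 \<le> 2|y|\<^sup>2 + 2|x-y|\<^sup>2\<close>,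
  the factor \<open>1/2\<close> in front of the quadratic variation is lost.\<close>

lemma ito_exponential_step:
  fixes Z :: "real \<Rightarrow> 'w \<Rightarrow> real ^ 'm ^ 'd"
  assumes ito: "is_ito_integral M F B T Z J" and st: "0 \<le> s" "s \<le> t" "t \<le> T"
    and S: "S \<in> borel_measurable (F s)" and G: "G \<in> borel_measurable (F s)"
    and fin: "\<And>\<omega>. \<omega> \<in> space M \<Longrightarrow> (\<integral>\<^sup>+r\<in>{s<..t}. ennreal ((norm (Z r \<omega> - S \<omega>))\<^sup>2) \<partial>lborel) < \<infinity>"
  shows "(\<integral>\<^sup>+\<omega>. G \<omega> * ennreal (exp (v \<bullet> (J t \<omega> - J s \<omega> - S \<omega> *v (B t \<omega> - B s \<omega>))
       - (norm v)\<^sup>2 * enn2real (\<integral>\<^sup>+r\<in>{s<..t}. ennreal ((norm (Z r \<omega> - S \<omega>))\<^sup>2) \<partial>lborel))) \<partial>M)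
    \<le> (\<integral>\<^sup>+\<omega>. G \<omega> \<partial>M)"
proof -
  have T0: "0 \<le> T" and t0: "0 \<le> t" using st by auto
  have prog: "(\<lambda>(r, \<omega>). Z r \<omega>) \<in> borel_measurable (restrict_space borel {0..T} \<Otimes>\<^sub>M F T)"
    using ito T0 by (simp add: is_ito_integral_def progressive_def)
  have JM: "J r \<in> borel_measurable M" if "0 \<le> r" "r \<le> T" for r
    using ito measurable_F_M[of "J r" r] that by (simp add: is_ito_integral_def adapted_on_def)
  obtain N \<tau> \<xi> where simple: "\<And>n. simple_integrand M F T (N n) (\<tau> n) (\<xi> n)"
    and R0: "null_in_probability M (\<lambda>n \<omega>. \<integral>\<^sup>+r\<in>{0..T}. ennreal ((norm (simple_process (N n) (\<tau> n) (\<xi> n) r \<omega> - Z r \<omega>))\<^sup>2) \<partial>lborel)"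
    and I0: "\<And>t. t \<in> {0..T} \<Longrightarrow> null_in_probability M (\<lambda>n \<omega>. ennreal (dist (simple_integral B (N n) (\<tau> n) (\<xi> n) t \<omega>) (J t \<omega>)))"
    using ito unfolding is_ito_integral_def by blast
  define SP where "SP = (\<lambda>n. simple_process (N n) (\<tau> n) (\<xi> n))"
  define SI where "SI = (\<lambda>n. simple_integral B (N n) (\<tau> n) (\<xi> n))"
  define R where "R = (\<lambda>n \<omega>. \<integral>\<^sup>+r\<in>{0..T}. ennreal ((norm (SP n r \<omega> - Z r \<omega>))\<^sup>2) \<partial>lborel)"
  define E where "E = (\<lambda>n r \<omega>. ennreal (dist (SI n r \<omega>) (J r \<omega>)))"
  have SIM: "SI n r \<in> borel_measurable M" if "0 \<le> r" for n r
    unfolding SI_def by (rule measurable_simple_integral[OF simple that])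
  have SPm: "(\<lambda>(r, \<omega>). SP n r \<omega>) \<in> borel_measurable (restrict_space borel {0..T} \<Otimes>\<^sub>M F T)" for n
    unfolding SP_def by (rule measurable_simple_process[OF simple T0])
  have Rm: "R n \<in> borel_measurable M" for n
  proof -
    have "(\<lambda>(r, \<omega>). ennreal ((norm (SP n r \<omega> - Z r \<omega>))\<^sup>2)) \<in> borel_measurable (restrict_space borel {0..T} \<Otimes>\<^sub>M F T)"
      using SPm[of n] prog unfolding split_beta' by measurable
    from borel_measurable_time_integral[OF this, of "{0..T}"] have "R n \<in> borel_measurable (F T)"
      by (simp add: R_def)
    then show ?thesis using measurable_F_M T0 by blast
  qed
  have Em: "E n r \<in> borel_measurable M" if "0 \<le> r" "r \<le> T" for n r
    unfolding E_def using SIM[of r n] JM[of r] that by (intro measurable_compose[OF _ measurable_ennreal] borel_measurable_dist) auto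
  have nullR: "null_in_probability M R" using R0 by (simp add: R_def[abs_def] SP_def)
  have nullE: "null_in_probability M (\<lambda>n. E n r)" if "r \<in> {0..T}" for r
    using I0[OF that] by (simp add: E_def[abs_def] SI_def)
  \<comment> \<open>Three nested extractions provide one subsequence along which the integrands and
    the integrals at \<open>t\<close> and at \<open>s\<close> converge almost surely.\<close>
  obtain r1 where r1: "strict_mono r1" "AE \<omega> in M. (\<lambda>n. R (r1 n) \<omega>) \<longlonglongrightarrow> 0"
    using null_in_probability_AE_subseq[OF Rm nullR] by blast
  have tT: "t \<in> {0..T}" and sT: "s \<in> {0..T}" using st by auto
  have Etm: "E n t \<in> borel_measurable M" and Esm: "E n s \<in> borel_measurable M" for n
    using Em[of t n] Em[of s n] tT sT by auto
  obtain r2 where r2: "strict_mono r2" "AE \<omega> in M. (\<lambda>n. E (r1 (r2 n)) t \<omega>) \<longlonglongrightarrow> 0"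
    using null_in_probability_AE_subseq[OF Etm null_in_probability_subseq[OF nullE[OF tT] r1(1)]] by blast
  obtain r3 where r3: "strict_mono r3" "AE \<omega> in M. (\<lambda>n. E (r1 (r2 (r3 n))) s \<omega>) \<longlonglongrightarrow> 0"
    using null_in_probability_AE_subseq[OF Esm null_in_probability_subseq[OF null_in_probability_subseq[OF nullE[OF sT] r1(1)] r2(1)]] by blast
  define q where "q = (\<lambda>n. r1 (r2 (r3 n)))"
  have AE: "AE \<omega> in M. (\<lambda>n. R (q n) \<omega>) \<longlonglongrightarrow> 0 \<and> (\<lambda>n. E (q n) t \<omega>) \<longlonglongrightarrow> 0 \<and> (\<lambda>n. E (q n) s \<omega>) \<longlonglongrightarrow> 0"
    using r1(2) r2(2) r3(2)
  proof eventually_elim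
    case (elim \<omega>)
    then show ?case
      using LIMSEQ_subseq_LIMSEQ[OF elim(1) strict_mono_o[OF r2(1) r3(1)]] LIMSEQ_subseq_LIMSEQ[OF elim(2) r3(1)]
      by (simp add: q_def o_def)
  qed
  define Q where "Q = (\<lambda>\<omega>. \<integral>\<^sup>+r\<in>{s<..t}. ennreal ((norm (Z r \<omega> - S \<omega>))\<^sup>2) \<partial>lborel)"
  define Qn where "Qn = (\<lambda>n \<omega>. \<integral>\<^sup>+r\<in>{s<..t}. ennreal ((norm (SP n r \<omega> - S \<omega>))\<^sup>2) \<partial>lborel)"
  define I where "I = (\<lambda>\<omega>. J t \<omega> - J s \<omega> - S \<omega> *v (B t \<omega> - B s \<omega>))"
  define In where "In = (\<lambda>n \<omega>. SI n t \<omega> - SI n s \<omega> - S \<omega> *v (B t \<omega> - B s \<omega>))"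
  define f where "f = (\<lambda>n \<omega>. G \<omega> * ennreal (exp (v \<bullet> In n \<omega> - (norm v)\<^sup>2 / 2 * enn2real (Qn n \<omega>))))"
  have f_le: "(\<integral>\<^sup>+\<omega>. f n \<omega> \<partial>M) \<le> (\<integral>\<^sup>+\<omega>. G \<omega> \<partial>M)" for n
    unfolding f_def In_def Qn_def SP_def SI_def by (rule simple_exponential_step[OF simple st(1,2) S G])
  have SM: "S \<in> borel_measurable M" and GM: "G \<in> borel_measurable M"
    using measurable_F_M[OF S st(1)] measurable_F_M[OF G st(1)] .
  have ST: "S \<in> borel_measurable (F T)" using measurable_F_mono[OF S st(1)] st by simp
  have SZm: "(\<lambda>z. S (snd z)) \<in> borel_measurable (restrict_space borel {0..T} \<Otimes>\<^sub>M F T)"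
    using measurable_compose[OF measurable_snd ST] .
  have sub: "{s<..t} \<subseteq> {0..T}" using st by auto
  have Qnm: "Qn n \<in> borel_measurable M" for n
  proof -
    have "(\<lambda>(r, \<omega>). ennreal ((norm (SP n r \<omega> - S \<omega>))\<^sup>2)) \<in> borel_measurable (restrict_space borel {0..T} \<Otimes>\<^sub>M F T)"
      using SPm[of n] SZm unfolding split_beta' by measurable
    from borel_measurable_time_integral[OF this _ sub] have "Qn n \<in> borel_measurable (F T)"
      by (simp add: Qn_def)
    then show ?thesis using measurable_F_M T0 by blast
  qed
  have BM: "B r \<in> borel_measurable M" if "0 \<le> r" for r using measurable_F_M[OF measurable_B] that by blast
  have Inm: "In n \<in> borel_measurable M" for n
    unfolding In_def by (intro borel_measurable_diff matrix_vector_mult_measurable SIM SM BM st t0)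
  have fm: "f n \<in> borel_measurable M" for n
    unfolding f_def using GM Inm[of n] Qnm[of n] by measurable
  have Zm: "(\<lambda>r. Z r \<omega>) \<in> borel_measurable (restrict_space borel {0..T})" if "\<omega> \<in> space M" for \<omega>
    using measurable_compose[OF measurable_Pair2' prog, of \<omega>] that space_F[OF T0] by simp
  have SPm': "(\<lambda>r. SP n r \<omega>) \<in> borel_measurable (restrict_space borel {0..T})" if "\<omega> \<in> space M" for n \<omega>
    using measurable_compose[OF measurable_Pair2' SPm, of \<omega>] that space_F[OF T0] by simp
  have Qle: "Qn n \<omega> \<le> 2 * Q \<omega> + 2 * R n \<omega>" if \<omega>: "\<omega> \<in> space M" for n \<omega>
  proof -
    have ext: "(\<lambda>r. indicator A r * X r) \<in> borel_measurable borel"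
      if "X \<in> borel_measurable (restrict_space borel {0..T})" "A \<in> sets borel" "A \<subseteq> {0..T}" for A and X :: "real \<Rightarrow> ennreal"
    proof -
      have X: "(\<lambda>r. indicator {0..T} r * X r) \<in> borel_measurable borel"
        using that(1) by (simp add: borel_measurable_restrict_space_iff_ennreal mult.commute)
      have "(\<lambda>r. indicator A r * (indicator {0..T} r * X r)) \<in> borel_measurable borel"
        by (rule borel_measurable_times_ennreal[OF _ X]) (use that(2) in simp)
      moreover have "indicator A r * (indicator {0..T} r * X r) = indicator A r * X r" for r
        using that(3) by (auto simp: indicator_def)
      ultimately show ?thesis by simp
    qed
    have m1: "(\<lambda>r. indicator {s<..t} r * ennreal ((norm (Z r \<omega> - S \<omega>))\<^sup>2)) \<in> borel_measurable borel"
      by (rule ext) (use Zm[OF \<omega>] st in \<open>auto intro!: measurable_compose[OF _ measurable_ennreal]\<close>)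
    have m2: "(\<lambda>r. indicator {0..T} r * ennreal ((norm (SP n r \<omega> - Z r \<omega>))\<^sup>2)) \<in> borel_measurable borel"
      by (rule ext) (use Zm[OF \<omega>] SPm'[OF \<omega>, of n] st in \<open>auto intro!: measurable_compose[OF _ measurable_ennreal]\<close>)
    have "Qn n \<omega> \<le> (\<integral>\<^sup>+r. 2 * (indicator {s<..t} r * ennreal ((norm (Z r \<omega> - S \<omega>))\<^sup>2))
        + 2 * (indicator {0..T} r * ennreal ((norm (SP n r \<omega> - Z r \<omega>))\<^sup>2)) \<partial>lborel)"
      unfolding Qn_def
    proof (rule nn_integral_mono)
      fix r
      have "ennreal ((norm (SP n r \<omega> - S \<omega>))\<^sup>2) \<le> ennreal (2 * (norm (Z r \<omega> - S \<omega>))\<^sup>2 + 2 * (norm (SP n r \<omega> - Z r \<omega>))\<^sup>2)"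
        by (intro ennreal_leI norm_diff_power2_le)
      also have "\<dots> = 2 * ennreal ((norm (Z r \<omega> - S \<omega>))\<^sup>2) + 2 * ennreal ((norm (SP n r \<omega> - Z r \<omega>))\<^sup>2)"
        by (simp add: ennreal_plus ennreal_mult)
      finally have le: "ennreal ((norm (SP n r \<omega> - S \<omega>))\<^sup>2) \<le> 2 * ennreal ((norm (Z r \<omega> - S \<omega>))\<^sup>2) + 2 * ennreal ((norm (SP n r \<omega> - Z r \<omega>))\<^sup>2)" .
      show "ennreal ((norm (SP n r \<omega> - S \<omega>))\<^sup>2) * indicator {s<..t} r
          \<le> 2 * (indicator {s<..t} r * ennreal ((norm (Z r \<omega> - S \<omega>))\<^sup>2)) + 2 * (indicator {0..T} r * ennreal ((norm (SP n r \<omega> - Z r \<omega>))\<^sup>2))"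
        using le st by (auto simp: indicator_def)
    qed
    also have "\<dots> = 2 * (\<integral>\<^sup>+r. indicator {s<..t} r * ennreal ((norm (Z r \<omega> - S \<omega>))\<^sup>2) \<partial>lborel)
        + 2 * (\<integral>\<^sup>+r. indicator {0..T} r * ennreal ((norm (SP n r \<omega> - Z r \<omega>))\<^sup>2) \<partial>lborel)"
      using m1 m2 by (subst nn_integral_add) (auto simp: nn_integral_cmult)
    finally show ?thesis by (simp add: Q_def R_def mult.commute)
  qed
  have "(\<integral>\<^sup>+\<omega>. G \<omega> * ennreal (exp (v \<bullet> I \<omega> - (norm v)\<^sup>2 * enn2real (Q \<omega>))) \<partial>M) \<le> (\<integral>\<^sup>+\<omega>. liminf (\<lambda>n. f (q n) \<omega>) \<partial>M)"
  proof (rule nn_integral_mono_AE)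
    show "AE \<omega> in M. G \<omega> * ennreal (exp (v \<bullet> I \<omega> - (norm v)\<^sup>2 * enn2real (Q \<omega>))) \<le> liminf (\<lambda>n. f (q n) \<omega>)"
      using AE AE_space
    proof eventually_elim
      case (elim \<omega>)
      then have \<omega>: "\<omega> \<in> space M" and R: "(\<lambda>n. R (q n) \<omega>) \<longlonglongrightarrow> 0"
        and Et: "(\<lambda>n. E (q n) t \<omega>) \<longlonglongrightarrow> 0" and Es: "(\<lambda>n. E (q n) s \<omega>) \<longlonglongrightarrow> 0" by auto
      have SIlim: "(\<lambda>n. SI (q n) r \<omega>) \<longlonglongrightarrow> J r \<omega>" if "(\<lambda>n. E (q n) r \<omega>) \<longlonglongrightarrow> 0" for r
      proof -
        have "(\<lambda>n. dist (SI (q n) r \<omega>) (J r \<omega>)) \<longlonglongrightarrow> 0"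
          using that unfolding E_def ennreal_0[symmetric] by (subst (asm) tendsto_ennreal_iff) auto
        then show ?thesis by (rule tendsto_dist_iff[THEN iffD2])
      qed
      have Il: "(\<lambda>n. In (q n) \<omega>) \<longlonglongrightarrow> I \<omega>"
        unfolding In_def I_def by (intro tendsto_intros SIlim Et Es)
      have Rr: "(\<lambda>n. enn2real (R (q n) \<omega>)) \<longlonglongrightarrow> 0"
        by (rule tendsto_enn2real) (use R in simp_all)
      \<comment> \<open>A lower bound for the exponential in \<open>f (q n)\<close>: the factor 1/2
        cancels the 2 from \<open>Qle\<close>. Unlike \<open>Qn\<close>, whose limit is never
        computed, it contains only the fixed \<open>Q\<close> and the vanishing
        \<open>R\<close>.\<close>
      define e where "e = (\<lambda>n. exp (v \<bullet> In (q n) \<omega> - (norm v)\<^sup>2 * enn2real (Q \<omega>) - (norm v)\<^sup>2 * enn2real (R (q n) \<omega>)))"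
      have "e \<longlonglongrightarrow> exp (v \<bullet> I \<omega> - (norm v)\<^sup>2 * enn2real (Q \<omega>) - (norm v)\<^sup>2 * 0)"
        unfolding e_def by (intro tendsto_intros Il Rr)
      then have el: "(\<lambda>n. ennreal (e n)) \<longlonglongrightarrow> ennreal (exp (v \<bullet> I \<omega> - (norm v)\<^sup>2 * enn2real (Q \<omega>)))"
        by (intro tendsto_ennrealI) simp
      have Gl: "(\<lambda>n. G \<omega> * ennreal (e n)) \<longlonglongrightarrow> G \<omega> * ennreal (exp (v \<bullet> I \<omega> - (norm v)\<^sup>2 * enn2real (Q \<omega>)))"
        by (rule tendsto_mult_ennreal[OF tendsto_const el]) (simp add: ennreal_eq_0_iff)
      have "G \<omega> * ennreal (exp (v \<bullet> I \<omega> - (norm v)\<^sup>2 * enn2real (Q \<omega>))) = liminf (\<lambda>n. G \<omega> * ennreal (e n))"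
        by (rule lim_imp_Liminf[OF trivial_limit_sequentially Gl, symmetric])
      also have "\<dots> \<le> liminf (\<lambda>n. f (q n) \<omega>)"
      proof (rule Liminf_mono)
        \<comment> \<open>\<open>enn2real\<close> sends infinity to 0, so finiteness of the
          remainder has to be known before real arithmetic is used.\<close>
        have "\<forall>\<^sub>F n in sequentially. R (q n) \<omega> < 1"
          using R by (rule order_tendstoD) simp
        then show "\<forall>\<^sub>F n in sequentially. G \<omega> * ennreal (e n) \<le> f (q n) \<omega>"
        proof eventually_elim
          case (elim n)
          have Rf: "R (q n) \<omega> < top" using elim by (rule less_trans) simp
          have Qf: "Q \<omega> < top" using fin[OF \<omega>] by (simp add: Q_def)
          have "Qn (q n) \<omega> \<le> ennreal (2 * enn2real (Q \<omega>) + 2 * enn2real (R (q n) \<omega>))"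
            using Qle[OF \<omega>, of "q n"] Rf Qf by (simp add: ennreal_plus ennreal_mult)
          then have "enn2real (Qn (q n) \<omega>) \<le> 2 * enn2real (Q \<omega>) + 2 * enn2real (R (q n) \<omega>)"
            by (intro enn2real_leI) auto
          then have "(norm v)\<^sup>2 / 2 * enn2real (Qn (q n) \<omega>) \<le> (norm v)\<^sup>2 / 2 * (2 * enn2real (Q \<omega>) + 2 * enn2real (R (q n) \<omega>))"
            by (intro mult_left_mono) auto
          then have "e n \<le> exp (v \<bullet> In (q n) \<omega> - (norm v)\<^sup>2 / 2 * enn2real (Qn (q n) \<omega>))"
            unfolding e_def by (simp add: algebra_simps)
          then show ?case unfolding f_def by (intro mult_left_mono ennreal_leI) auto
        qed
      qed
      finally show ?case .
    qed
  qed
  also have "\<dots> \<le> liminf (\<lambda>n. \<integral>\<^sup>+\<omega>. f (q n) \<omega> \<partial>M)"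
    by (rule nn_integral_liminf) (rule fm)
  also have "\<dots> \<le> liminf (\<lambda>n::nat. \<integral>\<^sup>+\<omega>. G \<omega> \<partial>M)"
    by (intro Liminf_mono always_eventually allI f_le)
  also have "\<dots> = (\<integral>\<^sup>+\<omega>. G \<omega> \<partial>M)" by (simp add: Liminf_const)
  finally show ?thesis by (simp add: I_def Q_def)
qed

lemma ito_maximal:
  fixes Z :: "real \<Rightarrow> 'w \<Rightarrow> real ^ 'm ^ 'd" and S :: "nat \<Rightarrow> 'w \<Rightarrow> real ^ 'm ^ 'd"
  assumes ito: "is_ito_integral M F B T Z J" and p: "\<And>k. k < n \<Longrightarrow> p k \<le> p (Suc k)" "0 \<le> p 0" "p n \<le> T"
    and S: "\<And>k. k < n \<Longrightarrow> S k \<in> borel_measurable (F (p k))"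
    and fin: "\<And>\<omega> k. \<omega> \<in> space M \<Longrightarrow> k < n \<Longrightarrow> (\<integral>\<^sup>+r\<in>{p k<..p (Suc k)}. ennreal ((norm (Z r \<omega> - S k \<omega>))\<^sup>2) \<partial>lborel) < \<infinity>"
  shows "{\<omega> \<in> space M. \<exists>k\<le>n. a < (\<Sum>j<k. v \<bullet> (J (p (Suc j)) \<omega> - J (p j) \<omega> - S j \<omega> *v (B (p (Suc j)) \<omega> - B (p j) \<omega>))
       - (norm v)\<^sup>2 * enn2real (\<integral>\<^sup>+r\<in>{p j<..p (Suc j)}. ennreal ((norm (Z r \<omega> - S j \<omega>))\<^sup>2) \<partial>lborel))} \<in> events" (is "?A \<in> _")
    and "prob {\<omega> \<in> space M. \<exists>k\<le>n. a < (\<Sum>j<k. v \<bullet> (J (p (Suc j)) \<omega> - J (p j) \<omega> - S j \<omega> *v (B (p (Suc j)) \<omega> - B (p j) \<omega>))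
       - (norm v)\<^sup>2 * enn2real (\<integral>\<^sup>+r\<in>{p j<..p (Suc j)}. ennreal ((norm (Z r \<omega> - S j \<omega>))\<^sup>2) \<partial>lborel))} \<le> exp (- a)"
proof -
  have pm: "p i \<le> p j" if "i \<le> j" "j \<le> n" for i j
    using that
  proof (induction j)
    case (Suc j)
    then show ?case using p(1)[of j] by (cases "i = Suc j") auto
  qed simp
  have pnn: "0 \<le> p k" "p k \<le> T" if "k \<le> n" for k using pm[of 0 k] pm[of k n] that p by auto
  define x where "x j \<omega> = v \<bullet> (J (p (Suc j)) \<omega> - J (p j) \<omega> - S j \<omega> *v (B (p (Suc j)) \<omega> - B (p j) \<omega>))
       - (norm v)\<^sup>2 * enn2real (\<integral>\<^sup>+r\<in>{p j<..p (Suc j)}. ennreal ((norm (Z r \<omega> - S j \<omega>))\<^sup>2) \<partial>lborel)" for j \<omega>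
  have J: "J r \<in> borel_measurable (F r)" if "r \<in> {0..T}" for r
    using ito that by (simp add: is_ito_integral_def adapted_on_def)
  have xm: "x k \<in> borel_measurable (F (p (Suc k)))" if k: "k < n" for k
  proof -
    let ?N = "F (p (Suc k))"
    have ord: "0 \<le> p k" "p k \<le> p (Suc k)" "p (Suc k) \<le> T" using pnn[of k] pnn[of "Suc k"] p(1)[OF k] k by auto
    have Sm: "S k \<in> borel_measurable ?N" by (rule measurable_F_mono[OF S[OF k] ord(1,2)])
    have Jm: "J (p k) \<in> borel_measurable ?N" "J (p (Suc k)) \<in> borel_measurable ?N"
      using measurable_F_mono[OF J ord(1,2)] J[of "p (Suc k)"] ord by auto
    have Bm: "B (p k) \<in> borel_measurable ?N" "B (p (Suc k)) \<in> borel_measurable ?N"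
      using measurable_B_F[OF ord(1,2)] measurable_B[of "p (Suc k)"] ord by auto
    have "(\<lambda>(r, \<omega>). Z r \<omega>) \<in> borel_measurable (restrict_space borel {0..p (Suc k)} \<Otimes>\<^sub>M ?N)"
      using ito ord by (simp add: is_ito_integral_def progressive_def)
    moreover have "(\<lambda>z. S k (snd z)) \<in> borel_measurable (restrict_space borel {0..p (Suc k)} \<Otimes>\<^sub>M ?N)"
      using measurable_compose[OF measurable_snd Sm] .
    ultimately have "(\<lambda>(r, \<omega>). ennreal ((norm (Z r \<omega> - S k \<omega>))\<^sup>2)) \<in> borel_measurable (restrict_space borel {0..p (Suc k)} \<Otimes>\<^sub>M ?N)"
      unfolding split_beta' by measurable
    note meas = this
    have sub: "{p k<..p (Suc k)} \<subseteq> {0..p (Suc k)}" using ord by auto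
    have Qm: "(\<lambda>\<omega>. \<integral>\<^sup>+r\<in>{p k<..p (Suc k)}. ennreal ((norm (Z r \<omega> - S k \<omega>))\<^sup>2) \<partial>lborel) \<in> borel_measurable ?N"
      by (rule borel_measurable_time_integral[OF meas _ sub]) simp
    show ?thesis
      unfolding x_def[abs_def]
      by (intro borel_measurable_diff borel_measurable_inner borel_measurable_times borel_measurable_const
          matrix_vector_mult_measurable Jm Bm Sm borel_measurable_enn2real[OF Qm])
  qed
  have xM: "x k \<in> borel_measurable M" if "k < n" for k
    using measurable_F_M[OF xm[OF that]] pnn[of "Suc k"] that by simp
  have eq: "{\<omega> \<in> space M. \<exists>k\<le>n. a < (\<Sum>j<k. x j \<omega>)} = (\<Union>k\<le>n. {\<omega> \<in> space M. a < (\<Sum>j<k. x j \<omega>)})" by auto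
  show "?A \<in> events"
    unfolding x_def[symmetric] eq
  proof (intro sets.finite_UN)
    fix k assume "k \<in> {..n}"
    then have "(\<lambda>\<omega>. \<Sum>j<k. x j \<omega>) \<in> borel_measurable M" by (intro borel_measurable_sum xM) auto
    then show "{\<omega> \<in> space M. a < (\<Sum>j<k. x j \<omega>)} \<in> events" by measurable
  qed simp
  have prodexp: "(\<Prod>j<k. ennreal (exp (x j \<omega>))) = ennreal (exp (\<Sum>j<k. x j \<omega>))" for k \<omega>
    by (simp add: prod_ennreal exp_sum)
  have "prob {\<omega> \<in> space M. \<exists>k\<le>n. ennreal (exp a) < (\<Prod>j<k. ennreal (exp (x j \<omega>)))} \<le> 1 / exp a"
  proof (rule maximal_inequality_prod[where N = "\<lambda>k. F (p k)"])
    show "(\<lambda>\<omega>. ennreal (exp (x k \<omega>))) \<in> borel_measurable (F (p (Suc k)))" if "k < n" for k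
      using xm[OF that] by measurable
    show "subalgebra (F (p j)) (F (p k))" if "k \<le> j" "j \<le> n" for k j
      using pm[OF that] pnn[of k] that by (intro subalgebra_F) auto
    show "subalgebra M (F (p k))" if "k \<le> n" for k using pnn[OF that] by (intro subalgebra_F)
    show "(\<integral>\<^sup>+\<omega>. G \<omega> * ennreal (exp (x k \<omega>)) \<partial>M) \<le> (\<integral>\<^sup>+\<omega>. G \<omega> \<partial>M)"
      if k: "k < n" and G: "G \<in> borel_measurable (F (p k))" for k G
      unfolding x_def
      by (rule ito_exponential_step[OF ito _ p(1)[OF k] _ S[OF k] G fin[OF _ k]]) (use pnn[of k] pnn[of "Suc k"] k in auto)
  qed simp
  then show "prob ?A \<le> exp (- a)"
    unfolding x_def[symmetric] prodexp by (simp add: ennreal_less_iff exp_minus inverse_eq_divide)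
qed

end

text \<open>Exponential inequalities bound one linear functional at a time; the positive and
  negative coordinate directions suffice, and the l1 norm supplies the dimension factor.\<close>

lemma norm_le_of_directions:
  fixes x :: "real ^ 'd"
  assumes c: "0 < c" and le: "\<And>i s. s \<in> {1, -1} \<Longrightarrow> ((s * c) *\<^sub>R axis i 1) \<bullet> x \<le> y"
  shows "norm x \<le> real CARD('d) * (y / c)"
proof -
  have "\<bar>x $ i\<bar> \<le> y / c" for i
  proof -
    have "c * x $ i \<le> y" "- (c * x $ i) \<le> y"
      using le[of 1 i] le[of "-1" i] by (auto simp: inner_axis inner_commute)
    then show ?thesis using c by (simp add: abs_le_iff le_divide_eq mult.commute minus_divide_left)
  qed
  then have "(\<Sum>i\<in>UNIV. \<bar>x $ i\<bar>) \<le> real CARD('d) * (y / c)"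
    using sum_bounded_above[of UNIV "\<lambda>i. \<bar>x $ i\<bar>" "y / c"] by simp
  then show ?thesis using norm_le_l1_cart[of x] by simp
qed

lemma (in prob_space) direction_union:
  fixes A :: "real ^ 'd \<Rightarrow> 'a set"
  assumes "\<And>v. A v \<in> events" "\<And>v. prob (A v) \<le> \<delta>"
  shows "(\<Union>(i, s) \<in> UNIV \<times> {1, -1}. A ((s * c) *\<^sub>R axis i 1)) \<in> events"
    and "prob (\<Union>(i, s) \<in> UNIV \<times> {1, -1}. A ((s * c) *\<^sub>R axis i 1)) \<le> 2 * real CARD('d) * \<delta>"
proof -
  let ?I = "(UNIV :: 'd set) \<times> {1, -1 :: real}"
  have fin: "finite ?I" by simp
  have card: "card ?I = CARD('d) * 2" by (simp add: card_cartesian_product)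
  let ?A = "\<lambda>(i, s). A ((s * c) *\<^sub>R axis i 1)"
  show "(\<Union>p \<in> ?I. ?A p) \<in> events"
    using assms(1) by (intro sets.finite_UN fin) auto
  have "prob (\<Union>p \<in> ?I. ?A p) \<le> (\<Sum>p\<in>?I. prob (?A p))"
    using assms(1) by (intro measure_UNION_le fin) auto
  also have "\<dots> \<le> (\<Sum>p\<in>?I. \<delta>)" using assms(2) by (intro sum_mono) auto
  also have "\<dots> = 2 * real CARD('d) * \<delta>" by (simp add: card)
  finally show "prob (\<Union>p \<in> ?I. ?A p) \<le> 2 * real CARD('d) * \<delta>" .
qed

context filtered_brownian begin

text \<open>\<open>is_ito_integral\<close> fixes \<open>J\<close> only through limits of simple
  integrals. These vanish at time 0, so the constant sequence \<open>norm (J 0)\<close> tends to 0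
  in probability.\<close>

lemma ito_at_0:
  assumes ito: "is_ito_integral M F B T Z J" and T: "0 \<le> T"
  shows "AE \<omega> in M. J 0 \<omega> = 0"
proof -
  obtain N \<tau> \<xi> where simple: "\<And>n. simple_integrand M F T (N n) (\<tau> n) (\<xi> n)"
    and I0: "\<And>t. t \<in> {0..T} \<Longrightarrow> null_in_probability M (\<lambda>n \<omega>. ennreal (dist (simple_integral B (N n) (\<tau> n) (\<xi> n) t \<omega>) (J t \<omega>)))"
    using ito unfolding is_ito_integral_def by blast
  have "simple_integral B (N n) (\<tau> n) (\<xi> n) 0 \<omega> = 0" for n \<omega>
  proof -
    have \<tau>S: "\<tau> n k < \<tau> n (Suc k)" if "k < N n" for k using simple[of n] that by (auto simp: simple_integrand_def)
    have \<tau>nn: "0 \<le> \<tau> n k" if "k \<le> N n" for k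
      using that
    proof (induction k)
      case (Suc k)
      then show ?case using \<tau>S[of k] by simp
    qed (use simple[of n] in \<open>simp add: simple_integrand_def\<close>)
    show ?thesis
      unfolding simple_integral_def
    proof (intro sum.neutral ballI)
      fix k assume "k \<in> {..<N n}"
      then have "min 0 (\<tau> n (Suc k)) = 0" "min 0 (\<tau> n k) = 0" using \<tau>nn[of k] \<tau>nn[of "Suc k"] by auto
      then show "\<xi> n k \<omega> *v (B (min 0 (\<tau> n (Suc k))) \<omega> - B (min 0 (\<tau> n k)) \<omega>) = 0" by simp
    qed
  qed
  then have null: "null_in_probability M (\<lambda>(n::nat) \<omega>. ennreal (norm (J 0 \<omega>)))"
    using I0[of 0] T by (simp add: dist_norm)
  have "J 0 \<in> borel_measurable (F 0)" using ito T by (simp add: is_ito_integral_def adapted_on_def)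
  then have "J 0 \<in> borel_measurable M" by (rule measurable_F_M) simp
  then have "(\<lambda>\<omega>. ennreal (norm (J 0 \<omega>))) \<in> borel_measurable M" by measurable
  from null_in_probability_AE_subseq[OF this null]
  have "AE \<omega> in M. (\<lambda>n::nat. ennreal (norm (J 0 \<omega>))) \<longlonglongrightarrow> 0" by blast
  then show ?thesis
  proof eventually_elim
    case (elim \<omega>)
    then have "ennreal (norm (J 0 \<omega>)) = 0" unfolding LIMSEQ_const_iff .
    then show ?case by simp
  qed
qed

text \<open>Directions of length \<open>\<theta> / sqrt \<epsilon>\<close> put both the threshold
  and the quadratic term on the scale 1 / \<epsilon>. The exceptional event does not depend on
  \<open>q\<close> or \<open>k\<close>: the quadratic variation is part of the event, and
  \<open>q\<close> may be any bound observed along the given path. A large \<theta> makes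
  \<open>L / \<theta>\<close> small, after which \<open>q\<close> is made small.\<close>

lemma ito_deviation:
  fixes Z :: "real \<Rightarrow> 'w \<Rightarrow> real ^ 'm ^ 'd" and S :: "nat \<Rightarrow> 'w \<Rightarrow> real ^ 'm ^ 'd"
  assumes ito: "is_ito_integral M F B T Z J" and p: "\<And>k. k < n \<Longrightarrow> p k \<le> p (Suc k)" "0 \<le> p 0" "p n \<le> T"
    and S: "\<And>k. k < n \<Longrightarrow> S k \<in> borel_measurable (F (p k))"
    and fin: "\<And>\<omega> k. \<omega> \<in> space M \<Longrightarrow> k < n \<Longrightarrow> (\<integral>\<^sup>+r\<in>{p k<..p (Suc k)}. ennreal ((norm (Z r \<omega> - S k \<omega>))\<^sup>2) \<partial>lborel) < \<infinity>"
    and \<epsilon>: "0 < \<epsilon>" and \<theta>: "0 < \<theta>"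
  obtains A where "A \<in> events" "prob A \<le> 2 * real CARD('d) * exp (- L / \<epsilon>)"
    "\<And>\<omega> k q. \<omega> \<in> space M - A \<Longrightarrow> k \<le> n \<Longrightarrow> 0 \<le> q \<Longrightarrow> (\<And>j r. j < k \<Longrightarrow> r \<in> {p j<..p (Suc j)} \<Longrightarrow> norm (Z r \<omega> - S j \<omega>) \<le> q) \<Longrightarrow>
       sqrt \<epsilon> * norm (\<Sum>j<k. J (p (Suc j)) \<omega> - J (p j) \<omega> - S j \<omega> *v (B (p (Suc j)) \<omega> - B (p j) \<omega>))
         \<le> real CARD('d) * (L / \<theta> + \<theta> * q\<^sup>2 * (p k - p 0))"
proof -
  define x where "x j \<omega> = J (p (Suc j)) \<omega> - J (p j) \<omega> - S j \<omega> *v (B (p (Suc j)) \<omega> - B (p j) \<omega>)" for j \<omega>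
  define Q where "Q j \<omega> = enn2real (\<integral>\<^sup>+r\<in>{p j<..p (Suc j)}. ennreal ((norm (Z r \<omega> - S j \<omega>))\<^sup>2) \<partial>lborel)" for j \<omega>
  define A0 where "A0 v = {\<omega> \<in> space M. \<exists>k\<le>n. L / \<epsilon> < (\<Sum>j<k. v \<bullet> x j \<omega> - (norm v)\<^sup>2 * Q j \<omega>)}" for v :: "real ^ 'd"
  have A0: "A0 v \<in> events" "prob (A0 v) \<le> exp (- L / \<epsilon>)" for v
  proof -
    show "A0 v \<in> events"
      unfolding A0_def x_def Q_def by (rule ito_maximal(1)[OF ito p S fin])
    have "prob (A0 v) \<le> exp (- (L / \<epsilon>))"
      unfolding A0_def x_def Q_def by (rule ito_maximal(2)[OF ito p S fin])
    then show "prob (A0 v) \<le> exp (- L / \<epsilon>)" by simp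
  qed
  define c where "c = \<theta> / sqrt \<epsilon>"
  have c: "0 < c" "c\<^sup>2 = \<theta>\<^sup>2 / \<epsilon>" using \<epsilon> \<theta> by (auto simp: c_def power_divide)
  show ?thesis
  proof (rule that[OF direction_union[of A0, OF A0, of c]])
    fix \<omega> k q
    assume \<omega>: "\<omega> \<in> space M - (\<Union>(i, s) \<in> UNIV \<times> {1, -1}. A0 ((s * c) *\<^sub>R axis i 1))" and k: "k \<le> n" and q: "0 \<le> q"
      and le: "\<And>j r. j < k \<Longrightarrow> r \<in> {p j<..p (Suc j)} \<Longrightarrow> norm (Z r \<omega> - S j \<omega>) \<le> q"
    have Q: "Q j \<omega> \<le> q\<^sup>2 * (p (Suc j) - p j)" if j: "j < k" for j
    proof -
      have pj: "p j \<le> p (Suc j)" using p(1)[of j] j k by simp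
      have "(\<integral>\<^sup>+r\<in>{p j<..p (Suc j)}. ennreal ((norm (Z r \<omega> - S j \<omega>))\<^sup>2) \<partial>lborel)
          \<le> (\<integral>\<^sup>+r. ennreal (q\<^sup>2) * indicator {p j<..p (Suc j)} r \<partial>lborel)"
        using le[OF j] by (intro nn_integral_mono) (auto simp: indicator_def intro!: ennreal_leI power_mono)
      also have "\<dots> = ennreal (q\<^sup>2 * (p (Suc j) - p j))"
        using pj by (simp add: nn_integral_cmult_indicator ennreal_mult)
      finally show ?thesis unfolding Q_def using pj by (intro enn2real_leI) auto
    qed
    have sumQ: "(\<Sum>j<k. Q j \<omega>) \<le> q\<^sup>2 * (p k - p 0)"
    proof -
      have "(\<Sum>j<k. Q j \<omega>) \<le> (\<Sum>j<k. q\<^sup>2 * (p (Suc j) - p j))" using Q by (intro sum_mono) auto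
      also have "\<dots> = q\<^sup>2 * (p k - p 0)" by (simp add: sum_distrib_left[symmetric] sum_lessThan_telescope)
      finally show ?thesis .
    qed
    have "norm (\<Sum>j<k. x j \<omega>) \<le> real CARD('d) * ((L / \<epsilon> + \<theta>\<^sup>2 / \<epsilon> * (q\<^sup>2 * (p k - p 0))) / c)"
    proof (rule norm_le_of_directions[OF c(1)])
      fix i and s :: real assume s: "s \<in> {1, -1}"
      let ?v = "(s * c) *\<^sub>R (axis i 1 :: real ^ 'd)"
      have "(norm ?v)\<^sup>2 = \<theta>\<^sup>2 / \<epsilon>" using s c by (auto simp: power_mult_distrib)
      moreover have "\<omega> \<notin> A0 ?v" using \<omega> s by blast
      then have "(\<Sum>j<k. ?v \<bullet> x j \<omega> - (norm ?v)\<^sup>2 * Q j \<omega>) \<le> L / \<epsilon>" using \<omega> k by (auto simp: A0_def not_less)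
      ultimately have "?v \<bullet> (\<Sum>j<k. x j \<omega>) - \<theta>\<^sup>2 / \<epsilon> * (\<Sum>j<k. Q j \<omega>) \<le> L / \<epsilon>"
        by (simp only: sum_subtractf inner_sum_right sum_distrib_left)
      moreover have "\<theta>\<^sup>2 / \<epsilon> * (\<Sum>j<k. Q j \<omega>) \<le> \<theta>\<^sup>2 / \<epsilon> * (q\<^sup>2 * (p k - p 0))"
        using sumQ \<epsilon> by (intro mult_left_mono) auto
      ultimately show "?v \<bullet> (\<Sum>j<k. x j \<omega>) \<le> L / \<epsilon> + \<theta>\<^sup>2 / \<epsilon> * (q\<^sup>2 * (p k - p 0))" by linarith
    qed
    then have "sqrt \<epsilon> * norm (\<Sum>j<k. x j \<omega>) \<le> sqrt \<epsilon> * (real CARD('d) * ((L / \<epsilon> + \<theta>\<^sup>2 / \<epsilon> * (q\<^sup>2 * (p k - p 0))) / c))"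
      using \<epsilon> by (intro mult_left_mono) auto
    also have "\<dots> = real CARD('d) * (L / \<theta> + \<theta> * q\<^sup>2 * (p k - p 0))"
    proof -
      have "sqrt \<epsilon> * (y / \<epsilon> / c) = y / \<theta>" for y
        using \<epsilon> \<theta> by (simp add: c_def field_simps)
      from this[of "L + \<theta>\<^sup>2 * (q\<^sup>2 * (p k - p 0))"]
      have "sqrt \<epsilon> * ((L / \<epsilon> + \<theta>\<^sup>2 / \<epsilon> * (q\<^sup>2 * (p k - p 0))) / c) = (L + \<theta>\<^sup>2 * (q\<^sup>2 * (p k - p 0))) / \<theta>"
        by (simp add: add_divide_distrib)
      also have "\<dots> = L / \<theta> + \<theta> * q\<^sup>2 * (p k - p 0)"
        using \<theta> by (simp add: add_divide_distrib power2_eq_square)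
      finally show ?thesis by (metis mult.left_commute)
    qed
    finally show "sqrt \<epsilon> * norm (\<Sum>j<k. J (p (Suc j)) \<omega> - J (p j) \<omega> - S j \<omega> *v (B (p (Suc j)) \<omega> - B (p j) \<omega>))
         \<le> real CARD('d) * (L / \<theta> + \<theta> * q\<^sup>2 * (p k - p 0))" by (simp add: x_def)
  qed
qed

text \<open>The discrete maximal inequality with zero matrices holds on every dyadic grid with the
  same bound. The grids are nested, so the events increase and continuity of the measure keeps the
  bound for their union.\<close>

lemma ito_dyadic_maximal:
  fixes Z :: "real \<Rightarrow> 'w \<Rightarrow> real ^ 'm ^ 'd"
  assumes ito: "is_ito_integral M F B T Z J" and ac: "0 \<le> a" "a \<le> c" "c \<le> T"
    and fin: "\<And>\<omega>. \<omega> \<in> space M \<Longrightarrow> (\<integral>\<^sup>+r\<in>{a<..c}. ennreal ((norm (Z r \<omega>))\<^sup>2) \<partial>lborel) < \<infinity>"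
    and Zm: "\<And>\<omega>. \<omega> \<in> space M \<Longrightarrow> continuous_on {0..T} (\<lambda>r. Z r \<omega>)"
  defines "U \<equiv> \<lambda>v t \<omega>. v \<bullet> (J t \<omega> - J a \<omega>) - (norm v)\<^sup>2 * enn2real (\<integral>\<^sup>+r\<in>{a<..t}. ennreal ((norm (Z r \<omega>))\<^sup>2) \<partial>lborel)"
  shows "(\<Union>m. {\<omega> \<in> space M. \<exists>k\<le>2^m. y < U v (a + real k * ((c - a) / 2^m)) \<omega>}) \<in> events"
    and "prob (\<Union>m. {\<omega> \<in> space M. \<exists>k\<le>2^m. y < U v (a + real k * ((c - a) / 2^m)) \<omega>}) \<le> exp (- y)"
proof -
  define p where "p m k = a + real k * ((c - a) / 2^m)" for m k :: nat
  define E where "E m = {\<omega> \<in> space M. \<exists>k\<le>2^m. y < U v (p m k) \<omega>}" for m :: nat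
  have pS: "p m k \<le> p m (Suc k)" for m k using ac by (simp add: p_def divide_right_mono mult_right_mono)
  have p0: "p m 0 = a" for m by (simp add: p_def)
  have pn: "p m (2^m) = c" for m by (simp add: p_def)
  have pm: "p m i \<le> p m j" if "i \<le> j" for m i j using pS that by (rule lift_Suc_mono_le)
  have pc: "p m k \<le> c" if "k \<le> 2^m" for m k using pm[OF that, of m] by (simp add: pn)
  have pa: "a \<le> p m k" for m k using pm[of 0 k m] by (simp add: p0)
  have fin': "(\<integral>\<^sup>+r\<in>{s<..t}. ennreal ((norm (Z r \<omega>))\<^sup>2) \<partial>lborel) < \<infinity>"
    if "\<omega> \<in> space M" "a \<le> s" "t \<le> c" for \<omega> s t
  proof -
    have "(\<integral>\<^sup>+r\<in>{s<..t}. ennreal ((norm (Z r \<omega>))\<^sup>2) \<partial>lborel) \<le> (\<integral>\<^sup>+r\<in>{a<..c}. ennreal ((norm (Z r \<omega>))\<^sup>2) \<partial>lborel)"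
      using that by (intro nn_integral_mono) (auto simp: indicator_def)
    then show ?thesis using fin[OF that(1)] by (rule le_less_trans)
  qed
  have mZ: "(\<lambda>r. ennreal ((norm (Z r \<omega>))\<^sup>2) * indicator {s<..t} r) \<in> borel_measurable borel"
    if "\<omega> \<in> space M" "a \<le> s" "t \<le> c" for \<omega> s t
  proof -
    have "continuous_on {s<..t} (\<lambda>r. Z r \<omega>)"
      by (rule continuous_on_subset[OF Zm[OF that(1)]]) (use that ac in auto)
    then have "(\<lambda>r. Z r \<omega>) \<in> borel_measurable (restrict_space borel {s<..t})"
      by (rule borel_measurable_continuous_on_restrict)
    then have "(\<lambda>r. ennreal ((norm (Z r \<omega>))\<^sup>2)) \<in> borel_measurable (restrict_space borel {s<..t})"
      by measurable
    moreover have "((\<lambda>r. ennreal ((norm (Z r \<omega>))\<^sup>2)) \<in> borel_measurable (restrict_space borel {s<..t}))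
        \<longleftrightarrow> (\<lambda>r. ennreal ((norm (Z r \<omega>))\<^sup>2) * indicator {s<..t} r) \<in> borel_measurable borel"
      by (rule borel_measurable_restrict_space_iff_ennreal) simp
    ultimately show ?thesis by (rule iffD1[rotated])
  qed
  \<comment> \<open>The telescoped expression no longer mentions the cells, which makes the events
    for different dyadic grids comparable.\<close>
  have tel: "(\<Sum>j<k. v \<bullet> (J (p m (Suc j)) \<omega> - J (p m j) \<omega> - 0 *v (B (p m (Suc j)) \<omega> - B (p m j) \<omega>))
       - (norm v)\<^sup>2 * enn2real (\<integral>\<^sup>+r\<in>{p m j<..p m (Suc j)}. ennreal ((norm (Z r \<omega> - 0))\<^sup>2) \<partial>lborel)) = U v (p m k) \<omega>"
    if \<omega>: "\<omega> \<in> space M" and k: "k \<le> 2^m" for \<omega> m k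
    using k
  proof (induction k)
    case (Suc k)
    let ?q = "\<lambda>s t. \<integral>\<^sup>+r\<in>{s<..t}. ennreal ((norm (Z r \<omega>))\<^sup>2) \<partial>lborel"
    have le: "a \<le> p m k" "p m k \<le> p m (Suc k)" "p m (Suc k) \<le> c" using pa pS pc Suc.prems by auto
    have "?q a (p m (Suc k)) = (\<integral>\<^sup>+r. ennreal ((norm (Z r \<omega>))\<^sup>2) * indicator {a<..p m k} r + ennreal ((norm (Z r \<omega>))\<^sup>2) * indicator {p m k<..p m (Suc k)} r \<partial>lborel)"
      using le by (intro nn_integral_cong) (auto simp: indicator_def)
    also have "\<dots> = ?q a (p m k) + ?q (p m k) (p m (Suc k))"
      by (rule nn_integral_add) (use mZ[OF \<omega>] le in auto)
    finally have "enn2real (?q a (p m (Suc k))) = enn2real (?q a (p m k)) + enn2real (?q (p m k) (p m (Suc k)))"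
      using fin'[OF \<omega>, of a "p m k"] fin'[OF \<omega>, of "p m k" "p m (Suc k)"] le by (simp add: enn2real_plus)
    then show ?case
      using Suc by (simp add: U_def algebra_simps inner_diff_right)
  qed (simp add: U_def p0)
  have E: "E m \<in> events \<and> prob (E m) \<le> exp (- y)" for m
  proof -
    have S: "(\<lambda>_. 0 :: real ^ 'm ^ 'd) \<in> borel_measurable (F (p m k))" for k by simp
    have "(\<integral>\<^sup>+r\<in>{p m k<..p m (Suc k)}. ennreal ((norm (Z r \<omega> - 0))\<^sup>2) \<partial>lborel) < \<infinity>" if "\<omega> \<in> space M" "k < 2^m" for \<omega> k
      using fin'[OF that(1) pa[of m k] pc[of "Suc k" m]] that(2) by simp
    note fin0 = this
    have prem: "0 \<le> p m 0" "p m (2^m) \<le> T" using ac by (simp_all add: p0 pn)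
    have eq: "E m = {\<omega> \<in> space M. \<exists>k\<le>2^m. y < (\<Sum>j<k. v \<bullet> (J (p m (Suc j)) \<omega> - J (p m j) \<omega> - 0 *v (B (p m (Suc j)) \<omega> - B (p m j) \<omega>))
       - (norm v)\<^sup>2 * enn2real (\<integral>\<^sup>+r\<in>{p m j<..p m (Suc j)}. ennreal ((norm (Z r \<omega> - 0))\<^sup>2) \<partial>lborel))}"
      unfolding E_def
      by (rule Collect_cong, rule conj_cong[OF refl], rule ex_cong1, rule conj_cong[OF refl]) (simp only: tel)
    show ?thesis
    proof
      show "E m \<in> events" unfolding eq by (rule ito_maximal(1)[OF ito pS prem S fin0])
      show "prob (E m) \<le> exp (- y)" unfolding eq by (rule ito_maximal(2)[OF ito pS prem S fin0])
    qed
  qed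
  have inc: "incseq E"
  proof (rule incseq_SucI)
    fix m
    show "E m \<subseteq> E (Suc m)"
    proof
      fix \<omega> assume "\<omega> \<in> E m"
      then obtain k where k: "\<omega> \<in> space M" "k \<le> 2^m" "y < U v (p m k) \<omega>" by (auto simp: E_def)
      have "p m k = p (Suc m) (2 * k)" by (simp add: p_def)
      then show "\<omega> \<in> E (Suc m)" using k by (auto simp: E_def intro!: exI[of _ "2 * k"])
    qed
  qed
  have "(\<lambda>m. prob (E m)) \<longlonglongrightarrow> prob (\<Union>m. E m)"
    using E inc by (intro finite_Lim_measure_incseq) auto
  then have "prob (\<Union>m. E m) \<le> exp (- y)"
    by (rule LIMSEQ_le_const2) (use E in auto)
  then show "prob (\<Union>m. {\<omega> \<in> space M. \<exists>k\<le>2^m. y < U v (a + real k * ((c - a) / 2^m)) \<omega>}) \<le> exp (- y)"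
    unfolding E_def p_def .
  have "(\<Union>m. E m) \<in> events" using E by auto
  then show "(\<Union>m. {\<omega> \<in> space M. \<exists>k\<le>2^m. y < U v (a + real k * ((c - a) / 2^m)) \<omega>}) \<in> events"
    unfolding E_def p_def .
qed

text \<open>On the complement of the exceptional event the estimate holds at all dyadic times, and
  path continuity extends it to every \<open>t\<close>. As in \<open>ito_deviation\<close>, the
  event is the same for every bound \<open>q\<close>.\<close>

lemma ito_oscillation:
  fixes Z :: "real \<Rightarrow> 'w \<Rightarrow> real ^ 'm ^ 'd"
  assumes ito: "is_ito_integral M F B T Z J" and ac: "0 \<le> a" "a < c" "c \<le> T"
    and fin: "\<And>\<omega>. \<omega> \<in> space M \<Longrightarrow> (\<integral>\<^sup>+r\<in>{a<..c}. ennreal ((norm (Z r \<omega>))\<^sup>2) \<partial>lborel) < \<infinity>"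
    and Zm: "\<And>\<omega>. \<omega> \<in> space M \<Longrightarrow> continuous_on {0..T} (\<lambda>r. Z r \<omega>)"
    and \<epsilon>: "0 < \<epsilon>" and \<theta>: "0 < \<theta>" and L: "0 \<le> L"
  obtains A where "A \<in> events" "prob A \<le> 2 * real CARD('d) * exp (- L / \<epsilon>)"
    "\<And>\<omega> t q. \<omega> \<in> space M - A \<Longrightarrow> t \<in> {a..c} \<Longrightarrow> 0 \<le> q \<Longrightarrow> (\<And>r. r \<in> {a<..t} \<Longrightarrow> norm (Z r \<omega>) \<le> q) \<Longrightarrow>
       sqrt \<epsilon> * norm (J t \<omega> - J a \<omega>) \<le> real CARD('d) * (L / \<theta> + \<theta> * q\<^sup>2 * (c - a))"
proof -
  define U where "U v t \<omega> = v \<bullet> (J t \<omega> - J a \<omega>) - (norm v)\<^sup>2 * enn2real (\<integral>\<^sup>+r\<in>{a<..t}. ennreal ((norm (Z r \<omega>))\<^sup>2) \<partial>lborel)" for v t \<omega>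
  define A0 where "A0 v = (\<Union>m. {\<omega> \<in> space M. \<exists>k\<le>2^m. L / \<epsilon> < U v (a + real k * ((c - a) / 2^m)) \<omega>})" for v
  have A0: "A0 v \<in> events" "prob (A0 v) \<le> exp (- L / \<epsilon>)" for v
  proof -
    show "A0 v \<in> events"
      unfolding A0_def U_def by (rule ito_dyadic_maximal(1)[OF ito ac(1) less_imp_le[OF ac(2)] ac(3) fin Zm])
    have "prob (A0 v) \<le> exp (- (L / \<epsilon>))"
      unfolding A0_def U_def by (rule ito_dyadic_maximal(2)[OF ito ac(1) less_imp_le[OF ac(2)] ac(3) fin Zm])
    then show "prob (A0 v) \<le> exp (- L / \<epsilon>)" by simp
  qed
  define cc where "cc = \<theta> / sqrt \<epsilon>"
  have cc: "0 < cc" "cc\<^sup>2 = \<theta>\<^sup>2 / \<epsilon>" using \<epsilon> \<theta> by (auto simp: cc_def power_divide)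
  show ?thesis
  proof (rule that[OF direction_union[of A0, OF A0, of cc]])
    fix \<omega> t q
    assume \<omega>: "\<omega> \<in> space M - (\<Union>(i, s) \<in> UNIV \<times> {1, -1}. A0 ((s * cc) *\<^sub>R axis i 1))" and t: "t \<in> {a..c}" and q: "0 \<le> q"
      and le: "\<And>r. r \<in> {a<..t} \<Longrightarrow> norm (Z r \<omega>) \<le> q"
    \<comment> \<open>Dyadic points approach \<open>t\<close> from below, so the bound on
      \<open>Z\<close>, known only up to \<open>t\<close>, covers the interval up to each of
      them.\<close>
    define k where "k m = nat \<lfloor>(t - a) / ((c - a) / 2^m)\<rfloor>" for m :: nat
    define g where "g m = a + real (k m) * ((c - a) / 2^m)" for m :: nat
    have gap: "0 < (c - a) / 2^m" for m :: nat using ac by simp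
    have kf: "real (k m) \<le> (t - a) / ((c - a) / 2^m)" "(t - a) / ((c - a) / 2^m) < real (k m) + 1" for m
    proof -
      have "0 \<le> (t - a) / ((c - a) / 2^m)" using t gap[of m] by (intro divide_nonneg_pos) auto
      then show "real (k m) \<le> (t - a) / ((c - a) / 2^m)" "(t - a) / ((c - a) / 2^m) < real (k m) + 1"
        unfolding k_def by linarith+
    qed
    have gt: "g m \<le> t" "t < g m + (c - a) / 2^m" for m
    proof -
      have "real (k m) * ((c - a) / 2^m) \<le> t - a" using kf(1)[of m] gap[of m] by (simp only: pos_le_divide_eq)
      then show "g m \<le> t" by (simp add: g_def)
      have "t - a < (real (k m) + 1) * ((c - a) / 2^m)" using kf(2)[of m] gap[of m] by (simp only: pos_divide_less_eq)
      then show "t < g m + (c - a) / 2^m" unfolding g_def distrib_right by simp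
    qed
    have ga: "a \<le> g m" for m
      using mult_nonneg_nonneg[OF of_nat_0_le_iff less_imp_le[OF gap[of m]], of "k m"] by (simp only: g_def le_add_same_cancel1)
    have k2: "k m \<le> 2^m" for m
    proof -
      have "(t - a) / ((c - a) / 2^m) \<le> 2^m" using t ac by (simp add: divide_le_eq mult.commute mult_left_mono)
      then have "real (k m) \<le> 2^m" using kf(1)[of m] by linarith
      then show ?thesis by (metis of_nat_le_iff of_nat_numeral of_nat_power)
    qed
    have glim: "g \<longlonglongrightarrow> t"
    proof (rule tendsto_sandwich)
      show "\<forall>\<^sub>F m in sequentially. t - (c - a) * (1/2)^m \<le> g m" 
      proof (intro always_eventually allI)
        fix m
        have "(c - a) * (1/2)^m = (c - a) / 2^m" by (simp add: power_one_over)
        then show "t - (c - a) * (1/2)^m \<le> g m" using gt(2)[of m] by linarith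
      qed
      show "\<forall>\<^sub>F m in sequentially. g m \<le> t" using gt(1) by (intro always_eventually allI)
      have "(\<lambda>m. t - (c - a) * (1/2)^m) \<longlonglongrightarrow> t - (c - a) * 0"
        by (intro tendsto_intros LIMSEQ_realpow_zero) auto
      then show "(\<lambda>m. t - (c - a) * (1/2)^m) \<longlonglongrightarrow> t" by simp
    qed simp
    have "continuous_on {0..T} (\<lambda>t. J t \<omega>)" using ito \<omega> by (simp add: is_ito_integral_def)
    then have Jlim: "(\<lambda>m. J (g m) \<omega>) \<longlonglongrightarrow> J t \<omega>"
      by (rule continuous_on_tendsto_compose[OF _ glim]) (use t ac in \<open>auto intro!: always_eventually order_trans[OF _ ga] order_trans[OF gt(1)]\<close>)
    have "sqrt \<epsilon> * norm (J (g m) \<omega> - J a \<omega>) \<le> real CARD('d) * (L / \<theta> + \<theta> * q\<^sup>2 * (c - a))" for m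
    proof -
      have Q: "enn2real (\<integral>\<^sup>+r\<in>{a<..g m}. ennreal ((norm (Z r \<omega>))\<^sup>2) \<partial>lborel) \<le> q\<^sup>2 * (c - a)"
      proof (rule enn2real_leI)
        have "(\<integral>\<^sup>+r\<in>{a<..g m}. ennreal ((norm (Z r \<omega>))\<^sup>2) \<partial>lborel) \<le> (\<integral>\<^sup>+r. ennreal (q\<^sup>2) * indicator {a<..c} r \<partial>lborel)"
          using gt(1)[of m] t by (intro nn_integral_mono) (auto simp: indicator_def intro!: ennreal_leI power_mono le)
        also have "\<dots> = ennreal (q\<^sup>2 * (c - a))"
          using ac by (simp add: nn_integral_cmult_indicator ennreal_mult)
        finally show "(\<integral>\<^sup>+r\<in>{a<..g m}. ennreal ((norm (Z r \<omega>))\<^sup>2) \<partial>lborel) \<le> ennreal (q\<^sup>2 * (c - a))" .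
      qed (use ac in simp)
      have "norm (J (g m) \<omega> - J a \<omega>) \<le> real CARD('d) * ((L / \<epsilon> + \<theta>\<^sup>2 / \<epsilon> * (q\<^sup>2 * (c - a))) / cc)"
      proof (rule norm_le_of_directions[OF cc(1)])
        fix i and s :: real assume s: "s \<in> {1, -1}"
        let ?v = "(s * cc) *\<^sub>R (axis i 1 :: real ^ 'd)"
        have nv: "(norm ?v)\<^sup>2 = \<theta>\<^sup>2 / \<epsilon>" using s cc by (auto simp: power_mult_distrib)
        have "\<omega> \<notin> A0 ?v" using \<omega> s by blast
        then have "U ?v (g m) \<omega> \<le> L / \<epsilon>" using \<omega> k2[of m] unfolding A0_def g_def by (auto simp: not_less)
        then have "?v \<bullet> (J (g m) \<omega> - J a \<omega>) \<le> L / \<epsilon> + \<theta>\<^sup>2 / \<epsilon> * enn2real (\<integral>\<^sup>+r\<in>{a<..g m}. ennreal ((norm (Z r \<omega>))\<^sup>2) \<partial>lborel)"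
          unfolding U_def nv by linarith
        also have "\<dots> \<le> L / \<epsilon> + \<theta>\<^sup>2 / \<epsilon> * (q\<^sup>2 * (c - a))"
          using \<epsilon> by (intro add_left_mono mult_left_mono Q) auto
        finally show "?v \<bullet> (J (g m) \<omega> - J a \<omega>) \<le> L / \<epsilon> + \<theta>\<^sup>2 / \<epsilon> * (q\<^sup>2 * (c - a))" .
      qed
      then have "sqrt \<epsilon> * norm (J (g m) \<omega> - J a \<omega>) \<le> sqrt \<epsilon> * (real CARD('d) * ((L / \<epsilon> + \<theta>\<^sup>2 / \<epsilon> * (q\<^sup>2 * (c - a))) / cc))"
        using \<epsilon> by (intro mult_left_mono) auto
      also have "\<dots> = real CARD('d) * (L / \<theta> + \<theta> * q\<^sup>2 * (c - a))"
      proof -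
        have "sqrt \<epsilon> * (y / \<epsilon> / cc) = y / \<theta>" for y
          using \<epsilon> \<theta> by (simp add: cc_def field_simps)
        from this[of "L + \<theta>\<^sup>2 * (q\<^sup>2 * (c - a))"]
        have "sqrt \<epsilon> * ((L / \<epsilon> + \<theta>\<^sup>2 / \<epsilon> * (q\<^sup>2 * (c - a))) / cc) = (L + \<theta>\<^sup>2 * (q\<^sup>2 * (c - a))) / \<theta>"
          by (simp add: add_divide_distrib)
        also have "\<dots> = L / \<theta> + \<theta> * q\<^sup>2 * (c - a)"
          using \<theta> by (simp add: add_divide_distrib power2_eq_square)
        finally show ?thesis by (metis mult.left_commute)
      qed
      finally show ?thesis .
    qed
    note le' = this
    have "(\<lambda>m. sqrt \<epsilon> * norm (J (g m) \<omega> - J a \<omega>)) \<longlonglongrightarrow> sqrt \<epsilon> * norm (J t \<omega> - J a \<omega>)"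
      by (intro tendsto_intros Jlim)
    then show "sqrt \<epsilon> * norm (J t \<omega> - J a \<omega>) \<le> real CARD('d) * (L / \<theta> + \<theta> * q\<^sup>2 * (c - a))"
      by (rule LIMSEQ_le_const2) (use le' in auto)
  qed
qed

end

section \<open>The diffusion as a perturbed skeleton equation\<close>

locale small_noise = osgood_lyapunov T b \<sigma> \<epsilon>0 \<theta> eta K Mc f g l \<gamma> \<eta> V + filtered_brownian M F B
  for T :: real and b :: "real \<Rightarrow> real ^ 'd \<Rightarrow> real ^ 'd" and \<sigma> :: "real \<Rightarrow> real ^ 'd \<Rightarrow> real ^ 'm ^ 'd"
    and \<epsilon>0 \<theta> eta K Mc :: real and f g l \<gamma> :: "real \<Rightarrow> real" and \<eta> :: "real \<Rightarrow> real \<Rightarrow> real"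
    and V :: "real ^ 'd \<Rightarrow> real"
    and M :: "'w measure" and F :: "real \<Rightarrow> 'w measure" and B :: "real \<Rightarrow> 'w \<Rightarrow> real ^ 'm"
begin

text \<open>Continuity on a compact interval bounds the diffusion matrix along each path. Finiteness
  is needed because \<open>enn2real\<close> would turn an infinite quadratic variation into
  0.\<close>

lemma nn_integral_diffusion_finite:
  assumes Y: "continuous_on {0..T} Y" and ac: "0 \<le> a" "c \<le> T"
  shows "(\<integral>\<^sup>+r\<in>{a<..c}. ennreal ((norm (\<sigma> r (Y r) - S))\<^sup>2) \<partial>lborel) < \<infinity>"
proof -
  have "bounded ((\<lambda>r. \<sigma> r (Y r)) ` {0..T})"
    by (intro compact_imp_bounded compact_continuous_image coefficients_continuous_on Y compact_Icc)
  then obtain C where C: "\<And>r. r \<in> {0..T} \<Longrightarrow> norm (\<sigma> r (Y r)) \<le> C" unfolding bounded_iff ball_simps by blast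
  have "(\<integral>\<^sup>+r\<in>{a<..c}. ennreal ((norm (\<sigma> r (Y r) - S))\<^sup>2) \<partial>lborel) \<le> (\<integral>\<^sup>+r. ennreal ((C + norm S)\<^sup>2) * indicator {a<..c} r \<partial>lborel)"
  proof (rule nn_integral_mono)
    fix r
    show "ennreal ((norm (\<sigma> r (Y r) - S))\<^sup>2) * indicator {a<..c} r \<le> ennreal ((C + norm S)\<^sup>2) * indicator {a<..c} r"
    proof (cases "r \<in> {a<..c}")
      case True
      then have "norm (\<sigma> r (Y r) - S) \<le> C + norm S"
        using ac by (intro order_trans[OF norm_triangle_ineq4] add_right_mono C) auto
      then have "(norm (\<sigma> r (Y r) - S))\<^sup>2 \<le> (C + norm S)\<^sup>2" by (intro power_mono) auto
      then show ?thesis using True by (simp add: ennreal_leI)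
    qed simp
  qed
  also have "\<dots> = ennreal ((C + norm S)\<^sup>2) * emeasure lborel {a<..c}"
    by (rule nn_integral_cmult_indicator) simp
  also have "\<dots> < \<infinity>"
    by (cases "a \<le> c") (simp_all add: ennreal_mult_less_top)
  finally show ?thesis .
qed

text \<open>Collects the almost sure statements in one null set and rewrites the Lebesgue integral
  of the continuous drift as a gauge integral, so that outside this set every path can be treated
  deterministically.\<close>

lemma sde_path_equation:
  assumes sol: "sde_solution M F B T b \<sigma> \<epsilon> x Y"
  obtains J A where "is_ito_integral M F B T (\<lambda>s \<omega>. \<sigma> s (Y s \<omega>)) J" "A \<in> null_sets M"
    "\<And>\<omega>. \<omega> \<in> space M \<Longrightarrow> continuous_on {0..T} (\<lambda>t. Y t \<omega>)"
    "\<And>t. t \<in> {0..T} \<Longrightarrow> Y t \<in> borel_measurable (F t)"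
    "\<And>\<omega>. \<omega> \<in> space M - A \<Longrightarrow> Y 0 \<omega> = x \<and> J 0 \<omega> = 0 \<and>
       (\<forall>t\<in>{0..T}. Y t \<omega> = x + integral {0..t} (\<lambda>s. b s (Y s \<omega>)) + sqrt \<epsilon> *\<^sub>R J t \<omega>)"
proof -
  obtain J where J: "is_ito_integral M F B T (\<lambda>s \<omega>. \<sigma> s (Y s \<omega>)) J"
    and eq: "AE \<omega> in M. \<forall>t\<in>{0..T}. Y t \<omega> = x + (LINT s:{0..t}|lborel. b s (Y s \<omega>)) + sqrt \<epsilon> *\<^sub>R J t \<omega>"
    using sol unfolding sde_solution_def by blast
  have Yc: "continuous_on {0..T} (\<lambda>t. Y t \<omega>)" if "\<omega> \<in> space M" for \<omega>
    using sol that by (simp add: sde_solution_def)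
  have Ym: "Y t \<in> borel_measurable (F t)" if "t \<in> {0..T}" for t
    using sol that by (simp add: sde_solution_def adapted_on_def)
  have "AE \<omega> in M. Y 0 \<omega> = x \<and> J 0 \<omega> = 0 \<and>
       (\<forall>t\<in>{0..T}. Y t \<omega> = x + integral {0..t} (\<lambda>s. b s (Y s \<omega>)) + sqrt \<epsilon> *\<^sub>R J t \<omega>)"
    using eq ito_at_0[OF J less_imp_le[OF T]] AE_space
  proof eventually_elim
    case (elim \<omega>)
    have int: "(LINT s:{0..t}|lborel. b s (Y s \<omega>)) = integral {0..t} (\<lambda>s. b s (Y s \<omega>))" if "t \<in> {0..T}" for t
    proof (rule set_borel_integral_eq_integral(2))
      have "continuous_on {0..t} (\<lambda>s. b s (Y s \<omega>))"
        by (intro coefficients_continuous_on continuous_on_subset[OF Yc[OF elim(3)]]) (use that in auto)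
      then show "set_integrable lborel {0..t} (\<lambda>s. b s (Y s \<omega>))" by (rule borel_integrable_atLeastAtMost')
    qed
    have *: "\<forall>t\<in>{0..T}. Y t \<omega> = x + integral {0..t} (\<lambda>s. b s (Y s \<omega>)) + sqrt \<epsilon> *\<^sub>R J t \<omega>"
    proof
      fix t assume t: "t \<in> {0..T}"
      show "Y t \<omega> = x + integral {0..t} (\<lambda>s. b s (Y s \<omega>)) + sqrt \<epsilon> *\<^sub>R J t \<omega>"
        unfolding int[OF t, symmetric] using elim(1) t by blast
    qed
    have "0 \<in> {0..T}" using T by simp
    then have "Y 0 \<omega> = x + integral {0..0} (\<lambda>s. b s (Y s \<omega>)) + sqrt \<epsilon> *\<^sub>R J 0 \<omega>" using * by blast
    then have "Y 0 \<omega> = x" using elim(2) by simp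
    then show ?case using * elim(2) by blast
  qed
  then obtain A where A: "{\<omega> \<in> space M. \<not> (Y 0 \<omega> = x \<and> J 0 \<omega> = 0 \<and>
       (\<forall>t\<in>{0..T}. Y t \<omega> = x + integral {0..t} (\<lambda>s. b s (Y s \<omega>)) + sqrt \<epsilon> *\<^sub>R J t \<omega>))} \<subseteq> A"
    "emeasure M A = 0" "A \<in> sets M"
    by (rule AE_E)
  show ?thesis
  proof (rule that[OF J _ Yc Ym])
    show "A \<in> null_sets M" using A(2,3) by (rule null_setsI)
    fix \<omega> assume "\<omega> \<in> space M - A"
    then show "Y 0 \<omega> = x \<and> J 0 \<omega> = 0 \<and>
       (\<forall>t\<in>{0..T}. Y t \<omega> = x + integral {0..t} (\<lambda>s. b s (Y s \<omega>)) + sqrt \<epsilon> *\<^sub>R J t \<omega>)"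
      using A(1) by blast
  qed
qed

text \<open>The stochastic integral is compared with the sum that freezes \<open>\<sigma>\<close> at the left end points of the
  grid; while the path stays in the ball, uniform continuity makes the difference of the integrands small.
  Only finitely many exceptional events occur, so their number is absorbed by taking \<open>L + 1\<close> for \<open>L\<close>.\<close>

lemma sde_near_skeleton:
  assumes R: "0 < R" and e: "0 < e" and L: "0 \<le> L" and N: "0 \<le> N"
  obtains n r2 \<epsilon>' where "0 < n" "0 < r2" "0 < \<epsilon>'"
    "\<And>\<epsilon> x Y. 0 < \<epsilon> \<Longrightarrow> \<epsilon> < \<epsilon>' \<Longrightarrow> sde_solution M F B T b \<sigma> \<epsilon> x Y \<Longrightarrow>
      \<exists>A\<in>events. prob A \<le> exp (- L / \<epsilon>) \<and> (\<forall>\<omega>\<in>space M - A. Y 0 \<omega> = x \<and>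
        (\<forall>h. L2_control T h \<longrightarrow> energy T h \<le> N \<longrightarrow>
           (\<forall>j<n. norm (integral {grid T n j..grid T n (Suc j)} h - sqrt \<epsilon> *\<^sub>R (B (grid T n (Suc j)) \<omega> - B (grid T n j) \<omega>)) \<le> r2) \<longrightarrow>
           (\<forall>t\<in>{0..T}. (\<forall>s\<in>{0..t}. norm (Y s \<omega>) \<le> R) \<longrightarrow> norm (defect x h (\<lambda>s. Y s \<omega>) t) \<le> e)))"
proof -
  obtain C where C: "0 < C" "\<And>s y. s \<in> {0..T} \<Longrightarrow> norm y \<le> R \<Longrightarrow> norm (b s y) \<le> C \<and> norm (\<sigma> s y) \<le> C"
    using coefficients_bounded by blast
  define D where "D = real CARD('d)"
  have D: "0 < D" by (simp add: D_def)
  define L' where "L' = L + 1"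
  have L': "0 < L'" using L by (simp add: L'_def)
  \<comment> \<open>Large enough for the part of the freezing error that does not shrink with the
    oscillation to be \<open>e / 16\<close>. Then come the oscillation bound, the resolution
    \<open>d\<close> of the coefficients, the cell error \<open>r3\<close>, the parameter
    \<open>\<theta>2\<close> and at last the grid.\<close>
  define \<theta>1 where "\<theta>1 = 16 * D * L' / e"
  have \<theta>1: "0 < \<theta>1" "D * (L' / \<theta>1) = e / 16" using D L' e by (auto simp: \<theta>1_def)
  define S where "S = 1 + sqrt (T * N)"
  have S: "0 < S" "sqrt (T * N) \<le> S" unfolding S_def using T N by (auto intro: add_pos_nonneg)
  \<comment> \<open>In this proof \<omega> is the oscillation allowed for the coefficients, and
    sample points are called \<open>w\<close>. The two bounds serve the error against the control
    and the quadratic part of the freezing error.\<close>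
  obtain \<omega> where \<omega>: "0 < \<omega>" "\<omega> * S \<le> e / 8" "D * (\<theta>1 * \<omega>\<^sup>2 * T) \<le> e / 16"
  proof -
    define W where "W = min 1 (min (e / (8 * S)) (e / (16 * D * \<theta>1 * T)))"
    have pos: "0 < W" using S D \<theta>1 T e by (simp add: W_def)
    have "W * S \<le> e / 8"
    proof -
      have "W \<le> e / (8 * S)" by (simp add: W_def)
      then have "W * S \<le> e / (8 * S) * S" using S by (intro mult_right_mono) auto
      then show ?thesis using S by simp
    qed
    moreover have "D * (\<theta>1 * W\<^sup>2 * T) \<le> e / 16"
    proof -
      have "W \<le> 1" by (simp add: W_def)
      then have "W\<^sup>2 \<le> W" using pos by (simp add: power2_eq_square mult_left_le)
      also have "W \<le> e / (16 * D * \<theta>1 * T)" by (simp add: W_def)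
      finally have "D * \<theta>1 * T * W\<^sup>2 \<le> D * \<theta>1 * T * (e / (16 * D * \<theta>1 * T))"
        using D \<theta>1 T by (intro mult_left_mono) auto
      also have "\<dots> = e / 16" using D \<theta>1 T by simp
      finally show ?thesis by (simp add: mult_ac)
    qed
    ultimately show ?thesis using that pos by blast
  qed
  obtain d where d: "0 < d" "\<And>s s' y y'. s \<in> {0..T} \<Longrightarrow> s' \<in> {0..T} \<Longrightarrow> norm y \<le> R \<Longrightarrow> norm y' \<le> R \<Longrightarrow>
      \<bar>s - s'\<bar> \<le> d \<Longrightarrow> norm (y - y') \<le> d \<Longrightarrow> norm (b s y - b s' y') \<le> \<omega> \<and> norm (\<sigma> s y - \<sigma> s' y') \<le> \<omega>"
    using coefficients_uniformly_continuous[OF \<omega>(1)] by blast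
  \<comment> \<open>Half of \<open>d\<close> pays for the noise in the oscillation of the path, the
    drift taking the other half; \<open>e / 8\<close> is the share of the last incomplete
    cell.\<close>
  define r3 where "r3 = min (d / 2) (e / 8)"
  have r3: "0 < r3" "r3 \<le> d / 2" "r3 \<le> e / 8" using d(1) e by (auto simp: r3_def)
  define \<theta>2 where "\<theta>2 = 2 * D * L' / r3"
  have \<theta>2: "0 < \<theta>2" "D * (L' / \<theta>2) = r3 / 2" using D L' r3 by (auto simp: \<theta>2_def)
  obtain n where n: "0 < n" "C * (T / real n) \<le> d / 2" "T / real n \<le> d"
    "C * sqrt (T / real n * N) \<le> e / 8" "D * (\<theta>2 * C\<^sup>2 * (T / real n)) \<le> r3 / 2"
  proof -
    have "(\<lambda>n. T / real n) \<longlonglongrightarrow> 0" by (rule lim_const_over_n)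
    note lim = this
    have "\<forall>\<^sub>F n in sequentially. C * (T / real n) < d / 2"
      by (rule order_tendstoD(2)[OF tendsto_mult_left[OF lim, of C]]) (use d in simp)
    moreover have "\<forall>\<^sub>F n in sequentially. T / real n < d"
      by (rule order_tendstoD(2)[OF lim]) (use d in simp)
    moreover have "\<forall>\<^sub>F n in sequentially. C * sqrt (T / real n * N) < e / 8"
    proof -
      have "(\<lambda>n. C * sqrt (T / real n * N)) \<longlonglongrightarrow> C * sqrt (0 * N)" by (intro tendsto_intros lim)
      then show ?thesis by (rule order_tendstoD) (use e in simp)
    qed
    moreover have "\<forall>\<^sub>F n in sequentially. D * (\<theta>2 * C\<^sup>2 * (T / real n)) < r3 / 2"
    proof -
      have "(\<lambda>n. D * (\<theta>2 * C\<^sup>2 * (T / real n))) \<longlonglongrightarrow> D * (\<theta>2 * C\<^sup>2 * 0)" by (intro tendsto_intros lim)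
      then show ?thesis by (rule order_tendstoD) (use r3 in simp)
    qed
    ultimately have "\<forall>\<^sub>F n in sequentially. 0 < n \<and> C * (T / real n) \<le> d / 2 \<and> T / real n \<le> d \<and>
       C * sqrt (T / real n * N) \<le> e / 8 \<and> D * (\<theta>2 * C\<^sup>2 * (T / real n)) \<le> r3 / 2"
      using eventually_gt_at_top[of 0] by eventually_elim simp
    then show ?thesis using that by (auto simp: eventually_sequentially)
  qed
  let ?t = "grid T n"
  define r2 where "r2 = e / (8 * (real n * C))"
  have r2: "0 < r2" "real n * (C * r2) = e / 8" using e n C by (auto simp: r2_def)
  \<comment> \<open>Makes the number \<open>2 * D * (1 + real n)\<close> at most 1 / \<epsilon>,
    hence at most the exponential of 1 / \<epsilon>, which is the unit of rate by which
    \<open>L'\<close> exceeds \<open>L\<close>.\<close>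
  define \<epsilon>' where "\<epsilon>' = 1 / (2 * D * (1 + real n))"
  have \<epsilon>': "0 < \<epsilon>'" using D by (simp add: \<epsilon>'_def add_pos_nonneg)
  have tmono: "?t i \<le> ?t j" if "i \<le> j" for i j using grid_mono[OF less_imp_le[OF T] that] .
  have tnn: "0 \<le> ?t i" for i using grid_nonneg[OF less_imp_le[OF T]] .
  have tT: "?t i \<le> T" if "i \<le> n" for i using grid_le[OF less_imp_le[OF T] n(1) that] .
  have tS: "?t i < ?t (Suc i)" for i using T n by (simp add: grid_Suc)
  show ?thesis
  proof (rule that[OF n(1) r2(1) \<epsilon>'])
    fix \<epsilon> x Y
    assume \<epsilon>: "0 < \<epsilon>" "\<epsilon> < \<epsilon>'" and sol: "sde_solution M F B T b \<sigma> \<epsilon> x Y"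
    obtain J A0 where J: "is_ito_integral M F B T (\<lambda>s \<omega>. \<sigma> s (Y s \<omega>)) J" and A0: "A0 \<in> null_sets M"
      and Yc: "\<And>\<omega>. \<omega> \<in> space M \<Longrightarrow> continuous_on {0..T} (\<lambda>t. Y t \<omega>)"
      and Ym: "\<And>t. t \<in> {0..T} \<Longrightarrow> Y t \<in> borel_measurable (F t)"
      and eq: "\<And>\<omega>. \<omega> \<in> space M - A0 \<Longrightarrow> Y 0 \<omega> = x \<and> J 0 \<omega> = 0 \<and>
       (\<forall>t\<in>{0..T}. Y t \<omega> = x + integral {0..t} (\<lambda>s. b s (Y s \<omega>)) + sqrt \<epsilon> *\<^sub>R J t \<omega>)"
      using sde_path_equation[OF sol] by blast
    define Z where "Z s \<omega> = \<sigma> s (Y s \<omega>)" for s \<omega>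
    have J': "is_ito_integral M F B T Z J" using J by (simp add: Z_def[abs_def])
    have Zc: "continuous_on {0..T} (\<lambda>s. Z s w)" if "w \<in> space M" for w
      unfolding Z_def by (rule coefficients_continuous_on[OF Yc[OF that]])
    \<comment> \<open>Adapted for all sample points, and equal to \<open>Z\<close> at the grid point
      on paths that are still in the ball, the only ones to which the estimate is applied.\<close>
    define \<Sigma> where "\<Sigma> j w = (if norm (Y (?t j) w) \<le> R then Z (?t j) w else 0)" for j w
    have \<Sigma>m: "\<Sigma> j \<in> borel_measurable (F (?t j))" if "j < n" for j
    proof -
      have tj: "?t j \<in> {0..T}" using tnn tT[of j] that by simp
      have "continuous_on UNIV (\<lambda>y :: real ^ 'd. (?t j, y))"
        by (intro continuous_on_Pair continuous_on_const continuous_on_id)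
      from continuous_on_compose2[OF \<sigma>_cont this subset_UNIV]
      have "continuous_on UNIV (\<sigma> (?t j))" by simp
      then have "(\<lambda>w. \<sigma> (?t j) (Y (?t j) w)) \<in> borel_measurable (F (?t j))"
        by (rule measurable_compose[OF Ym[OF tj] borel_measurable_continuous_onI])
      then show ?thesis unfolding \<Sigma>_def[abs_def] Z_def using Ym[OF tj] by measurable
    qed
    have fin1: "(\<integral>\<^sup>+r\<in>{?t j<..?t (Suc j)}. ennreal ((norm (Z r w - \<Sigma> j w))\<^sup>2) \<partial>lborel) < \<infinity>"
      if "w \<in> space M" "j < n" for w j
      unfolding Z_def using nn_integral_diffusion_finite[OF Yc[OF that(1)] tnn tT] that by simp
    obtain AW where AW: "AW \<in> events" "prob AW \<le> 2 * real CARD('d) * exp (- L' / \<epsilon>)"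
      and W: "\<And>w k q. w \<in> space M - AW \<Longrightarrow> k \<le> n \<Longrightarrow> 0 \<le> q \<Longrightarrow> (\<And>j r. j < k \<Longrightarrow> r \<in> {?t j<..?t (Suc j)} \<Longrightarrow> norm (Z r w - \<Sigma> j w) \<le> q) \<Longrightarrow>
       sqrt \<epsilon> * norm (\<Sum>j<k. J (?t (Suc j)) w - J (?t j) w - \<Sigma> j w *v (B (?t (Suc j)) w - B (?t j) w))
         \<le> real CARD('d) * (L' / \<theta>1 + \<theta>1 * q\<^sup>2 * (?t k - ?t 0))"
    proof (rule ito_deviation[OF J', of n ?t \<Sigma> \<epsilon> \<theta>1 L'])
      show "?t k \<le> ?t (Suc k)" for k using tS[of k] by simp
    qed (use \<Sigma>m fin1 \<epsilon> \<theta>1 tT in auto)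
    have "\<exists>A\<in>events. prob A \<le> 2 * real CARD('d) * exp (- L' / \<epsilon>) \<and>
      (\<forall>w t q. w \<in> space M - A \<longrightarrow> t \<in> {?t i..?t (Suc i)} \<longrightarrow> 0 \<le> q \<longrightarrow> (\<forall>r\<in>{?t i<..t}. norm (Z r w) \<le> q) \<longrightarrow>
       sqrt \<epsilon> * norm (J t w - J (?t i) w) \<le> real CARD('d) * (L' / \<theta>2 + \<theta>2 * q\<^sup>2 * (?t (Suc i) - ?t i)))" if i: "i < n" for i
    proof -
      have fin2: "(\<integral>\<^sup>+r\<in>{?t i<..?t (Suc i)}. ennreal ((norm (Z r w))\<^sup>2) \<partial>lborel) < \<infinity>" if "w \<in> space M" for w
        unfolding Z_def using nn_integral_diffusion_finite[where S = 0, OF Yc[OF that] tnn[of i] tT[of "Suc i"]] i by simp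
      obtain A where "A \<in> events" "prob A \<le> 2 * real CARD('d) * exp (- L' / \<epsilon>)"
        "\<And>w t q. w \<in> space M - A \<Longrightarrow> t \<in> {?t i..?t (Suc i)} \<Longrightarrow> 0 \<le> q \<Longrightarrow> (\<And>r. r \<in> {?t i<..t} \<Longrightarrow> norm (Z r w) \<le> q) \<Longrightarrow>
         sqrt \<epsilon> * norm (J t w - J (?t i) w) \<le> real CARD('d) * (L' / \<theta>2 + \<theta>2 * q\<^sup>2 * (?t (Suc i) - ?t i))"
        using ito_oscillation[OF J' tnn tS tT fin2 Zc \<epsilon>(1) \<theta>2(1) less_imp_le[OF L']] i by auto
      then show ?thesis by (intro bexI[of _ A]) auto
    qed
    then obtain AO where AO: "\<And>i. i < n \<Longrightarrow> AO i \<in> events" "\<And>i. i < n \<Longrightarrow> prob (AO i) \<le> 2 * real CARD('d) * exp (- L' / \<epsilon>)"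
      and O: "\<And>i w t q. i < n \<Longrightarrow> w \<in> space M - AO i \<Longrightarrow> t \<in> {?t i..?t (Suc i)} \<Longrightarrow> 0 \<le> q \<Longrightarrow> \<forall>r\<in>{?t i<..t}. norm (Z r w) \<le> q \<Longrightarrow>
       sqrt \<epsilon> * norm (J t w - J (?t i) w) \<le> real CARD('d) * (L' / \<theta>2 + \<theta>2 * q\<^sup>2 * (?t (Suc i) - ?t i))"
      by metis
    define A where "A = A0 \<union> (AW \<union> (\<Union>i<n. AO i))"
    have A: "A \<in> events" unfolding A_def using A0 AW(1) AO(1) by auto
    have "prob A \<le> prob A0 + (prob AW + prob (\<Union>i<n. AO i))"
      unfolding A_def using A0 AW(1) AO(1) by (intro order_trans[OF measure_Un_le] add_left_mono measure_Un_le) auto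
    also have "prob (\<Union>i<n. AO i) \<le> (\<Sum>i<n. prob (AO i))"
      using AO(1) by (intro measure_UNION_le) auto
    also have "\<dots> \<le> (\<Sum>i<n. 2 * D * exp (- L' / \<epsilon>))" using AO(2) by (intro sum_mono) (auto simp: D_def)
    also have "prob A0 = 0" using A0 by (simp add: null_sets_def measure_def)
    finally have "prob A \<le> 2 * D * (1 + real n) * exp (- L' / \<epsilon>)"
      using AW(2) by (simp add: D_def algebra_simps)
    also have "\<dots> \<le> exp (1 / \<epsilon>) * exp (- L' / \<epsilon>)"
    proof (rule mult_right_mono)
      have "\<epsilon> * (2 * D * (1 + real n)) \<le> 1"
        using \<epsilon>(2) D unfolding \<epsilon>'_def by (subst (asm) pos_less_divide_eq) (auto intro: add_pos_nonneg)
      then have "2 * D * (1 + real n) \<le> 1 / \<epsilon>" using \<epsilon> by (simp add: le_divide_eq mult.commute)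
      also have "\<dots> \<le> exp (1 / \<epsilon>)" using exp_ge_add_one_self[of "1 / \<epsilon>"] by linarith
      finally show "2 * D * (1 + real n) \<le> exp (1 / \<epsilon>)" .
    qed simp
    also have "\<dots> = exp (- L / \<epsilon>)"
      using \<epsilon> by (simp add: exp_add[symmetric] L'_def add_divide_distrib[symmetric] diff_divide_distrib[symmetric])
    finally have pA: "prob A \<le> exp (- L / \<epsilon>)" .
    show "\<exists>A\<in>events. prob A \<le> exp (- L / \<epsilon>) \<and> (\<forall>w\<in>space M - A. Y 0 w = x \<and>
        (\<forall>h. L2_control T h \<longrightarrow> energy T h \<le> N \<longrightarrow>
           (\<forall>j<n. norm (integral {?t j..?t (Suc j)} h - sqrt \<epsilon> *\<^sub>R (B (?t (Suc j)) w - B (?t j) w)) \<le> r2) \<longrightarrow>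
           (\<forall>t\<in>{0..T}. (\<forall>s\<in>{0..t}. norm (Y s w) \<le> R) \<longrightarrow> norm (defect x h (\<lambda>s. Y s w) t) \<le> e)))"
    proof (intro bexI[OF _ A] conjI pA ballI allI impI)
      fix w assume w: "w \<in> space M - A"
      then have w0: "w \<in> space M - A0" "w \<in> space M - AW" "\<And>i. i < n \<Longrightarrow> w \<in> space M - AO i" by (auto simp: A_def)
      show "Y 0 w = x" using eq[OF w0(1)] by blast
      fix h t
      assume h: "L2_control T h" "energy T h \<le> N"
        and inc: "\<forall>j<n. norm (integral {?t j..?t (Suc j)} h - sqrt \<epsilon> *\<^sub>R (B (?t (Suc j)) w - B (?t j) w)) \<le> r2"
        and t: "t \<in> {0..T}" and YR: "\<forall>s\<in>{0..t}. norm (Y s w) \<le> R"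
      have wM: "w \<in> space M" using w by simp
      have J0: "J 0 w = 0" using eq[OF w0(1)] by blast
      have Yeq: "Y s w = x + integral {0..s} (\<lambda>r. b r (Y r w)) + sqrt \<epsilon> *\<^sub>R J s w" if "s \<in> {0..T}" for s
        using eq[OF w0(1)] that by blast
      have ZC: "norm (Z s w) \<le> C" and bC: "norm (b s (Y s w)) \<le> C" if "s \<in> {0..t}" for s
        using C(2)[of s "Y s w"] that t YR by (auto simp: Z_def)
      \<comment> \<open>Uses only the bound \<open>C\<close> in the ball and no smallness of the
        integrand, so it can precede the oscillation estimate for \<open>Z\<close> that relies on
        it.\<close>
      have osc1: "sqrt \<epsilon> * norm (J s w - J (?t i) w) \<le> r3" if i: "i < n" and s: "s \<in> {?t i..?t (Suc i)}" "s \<le> t" for i s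
      proof -
        have "sqrt \<epsilon> * norm (J s w - J (?t i) w) \<le> real CARD('d) * (L' / \<theta>2 + \<theta>2 * C\<^sup>2 * (?t (Suc i) - ?t i))"
        proof (rule O[OF i w0(3)[OF i] s(1)])
          show "\<forall>r\<in>{?t i<..s}. norm (Z r w) \<le> C" using s(2) tnn[of i] by (auto intro!: ZC)
        qed (use C in simp)
        also have "\<dots> = D * (L' / \<theta>2) + D * (\<theta>2 * C\<^sup>2 * (T / real n))"
          by (simp add: D_def grid_Suc distrib_left)
        also have "\<dots> \<le> r3" using \<theta>2(2) n(5) by linarith
        finally show ?thesis .
      qed
      have osc: "norm (Z s w - Z (?t j) w) \<le> \<omega>" if j: "j < n" and s: "s \<in> {?t j..?t (Suc j)}" "s \<le> t" for j s
      proof -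
        have tj: "0 \<le> ?t j" "?t j \<le> s" "s \<le> T" "s - ?t j \<le> T / real n" "?t j \<in> {0..T}" "s \<in> {0..T}"
          using tnn[of j] s t by (auto simp: grid_Suc)
        have bi: "(\<lambda>r. b r (Y r w)) integrable_on {0..T}"
          by (intro integrable_continuous_interval coefficients_continuous_on Yc wM)
        have sub: "{?t j..s} \<subseteq> {0..T}" using tj by auto
        have "Y s w - Y (?t j) w = (integral {0..s} (\<lambda>r. b r (Y r w)) - integral {0..?t j} (\<lambda>r. b r (Y r w))) + sqrt \<epsilon> *\<^sub>R (J s w - J (?t j) w)"
          using Yeq[of s] Yeq[of "?t j"] tj by (simp add: algebra_simps)
        also have "\<dots> = integral {?t j..s} (\<lambda>r. b r (Y r w)) + sqrt \<epsilon> *\<^sub>R (J s w - J (?t j) w)"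
          unfolding integral_diff_interval[OF bi tj(1-3)] ..
        finally have Yd: "Y s w - Y (?t j) w = integral {?t j..s} (\<lambda>r. b r (Y r w)) + sqrt \<epsilon> *\<^sub>R (J s w - J (?t j) w)" .
        have "norm (integral {?t j..s} (\<lambda>r. b r (Y r w))) \<le> integral {?t j..s} (\<lambda>r. C)"
          by (rule integral_norm_bound_integral[OF integrable_subinterval_real[OF bi sub]])
             (use bC s tj in auto)
        also have "\<dots> \<le> C * (T / real n)" using mult_left_mono[OF tj(4) less_imp_le[OF C(1)]] tj(2) by (simp add: mult.commute)
        also have "\<dots> \<le> d / 2" by (rule n(2))
        finally have "norm (integral {?t j..s} (\<lambda>r. b r (Y r w))) \<le> d / 2" .
        moreover have "norm (sqrt \<epsilon> *\<^sub>R (J s w - J (?t j) w)) \<le> d / 2"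
          using osc1[OF j s] r3(2) \<epsilon> by simp
        ultimately have "norm (Y s w - Y (?t j) w) \<le> d"
          unfolding Yd by (intro norm_triangle_le) simp
        then show ?thesis
          using d(2)[of s "?t j" "Y s w" "Y (?t j) w"] tj YR s n(3) by (auto simp: Z_def)
      qed
      \<comment> \<open>Five errors of at most \<open>e / 8\<close> each, again through
        \<open>grid_compare\<close>, now with scaled Brownian increments as
        \<open>\<Delta>\<close>.\<close>
      have "norm (sqrt \<epsilon> *\<^sub>R J t w - integral {0..t} (\<lambda>s. Z s w *v h s))
          \<le> e / 8 + real n * (C * r2) + r3 + \<omega> * sqrt (T * N) + C * sqrt (T / real n * N)"
      proof (rule grid_compare[where J = "\<lambda>s. sqrt \<epsilon> *\<^sub>R J s w" and \<Delta> = "\<lambda>j. sqrt \<epsilon> *\<^sub>R (B (?t (Suc j)) w - B (?t j) w)", OF T n(1) h Zc[OF wM] t])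
        show "norm (Z s w - Z (?t j) w) \<le> \<omega>" if "j < n" "s \<in> {?t j..?t (Suc j)}" "s \<le> t" for j s
          by (rule osc[OF that])
        show "norm (integral {?t j..?t (Suc j)} h - sqrt \<epsilon> *\<^sub>R (B (?t (Suc j)) w - B (?t j) w)) \<le> r2" if "j < n" for j
          using inc that by blast
        show "norm (sqrt \<epsilon> *\<^sub>R J t w - sqrt \<epsilon> *\<^sub>R J (?t i) w) \<le> r3" if "i < n" "?t i \<le> t" "t \<le> ?t (Suc i)" for i
          using osc1[of i t] that \<epsilon> by (simp add: scaleR_diff_right[symmetric])
        fix i assume i: "i \<le> n" "?t i \<le> t"
        have \<Sigma>Z: "\<Sigma> j w = Z (?t j) w" if "j < i" for j
        proof -
          have "?t j \<in> {0..t}" using tnn[of j] tmono[of j i] that i by simp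
          then show ?thesis using YR by (simp add: \<Sigma>_def)
        qed
        have tele: "(\<Sum>j<i. J (?t (Suc j)) w - J (?t j) w) = J (?t i) w"
          using sum_lessThan_telescope[of "\<lambda>j. J (?t j) w" i] J0 by simp
        have "sqrt \<epsilon> *\<^sub>R J (?t i) w - (\<Sum>j<i. Z (?t j) w *v (sqrt \<epsilon> *\<^sub>R (B (?t (Suc j)) w - B (?t j) w)))
            = sqrt \<epsilon> *\<^sub>R (\<Sum>j<i. J (?t (Suc j)) w - J (?t j) w - \<Sigma> j w *v (B (?t (Suc j)) w - B (?t j) w))"
          unfolding tele[symmetric] scaleR_right.sum sum_subtractf[symmetric]
          by (intro sum.cong refl) (simp only: \<Sigma>Z lessThan_iff matrix_vector_mult_scaleR, simp only: scaleR_diff_right)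
        also have "norm \<dots> = sqrt \<epsilon> * norm (\<Sum>j<i. J (?t (Suc j)) w - J (?t j) w - \<Sigma> j w *v (B (?t (Suc j)) w - B (?t j) w))"
          using \<epsilon> by simp
        also have "\<dots> \<le> real CARD('d) * (L' / \<theta>1 + \<theta>1 * \<omega>\<^sup>2 * (?t i - ?t 0))"
        proof (rule W[OF w0(2) i(1)])
          fix j r assume j: "j < i" and r: "r \<in> {?t j<..?t (Suc j)}"
          have "r \<le> t" using r tmono[of "Suc j" i] j i by auto
          then show "norm (Z r w - \<Sigma> j w) \<le> \<omega>" using osc[of j r] j i r \<Sigma>Z[OF j] by auto
        qed (use \<omega> in simp)
        also have "\<dots> \<le> D * (L' / \<theta>1) + D * (\<theta>1 * \<omega>\<^sup>2 * T)"
          unfolding D_def distrib_left[symmetric] using tT[OF i(1)] \<theta>1 by (intro mult_left_mono add_left_mono) auto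
        also have "\<dots> \<le> e / 8" using \<theta>1(2) \<omega>(3) by linarith
        finally show "norm (sqrt \<epsilon> *\<^sub>R J (?t i) w - (\<Sum>j<i. Z (?t j) w *v (sqrt \<epsilon> *\<^sub>R (B (?t (Suc j)) w - B (?t j) w)))) \<le> e / 8" .
      qed (use \<omega> C r2 ZC in \<open>auto intro: less_imp_le\<close>)
      also have "\<omega> * sqrt (T * N) \<le> \<omega> * S" using \<omega> S by (intro mult_left_mono) auto
      finally have main: "norm (sqrt \<epsilon> *\<^sub>R J t w - integral {0..t} (\<lambda>s. Z s w *v h s)) \<le> e"
        using r2(2) r3(3) \<omega>(2) n(4) e by linarith
      have sub: "{0..t} \<subseteq> {0..T}" using t by auto
      have "(\<lambda>s. Z s w *v h s) absolutely_integrable_on {0..t}"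
        by (intro absolutely_integrable_matrix_vector_mult continuous_on_subset[OF Zc[OF wM] sub]
            absolutely_integrable_on_subinterval[OF L2_controlD(1)[OF h(1)] sub])
      then have zi: "(\<lambda>s. Z s w *v h s) integrable_on {0..t}" by (rule set_lebesgue_integral_eq_integral(1))
      have bi: "(\<lambda>s. b s (Y s w)) integrable_on {0..t}"
        by (intro integrable_continuous_interval coefficients_continuous_on continuous_on_subset[OF Yc[OF wM] sub])
      have "integral {0..t} (field h (\<lambda>s. Y s w)) = integral {0..t} (\<lambda>s. b s (Y s w)) + integral {0..t} (\<lambda>s. Z s w *v h s)"
        unfolding field_def[abs_def] Z_def using Henstock_Kurzweil_Integration.integral_add[OF bi zi] by (simp add: Z_def)
      then have "defect x h (\<lambda>s. Y s w) t = sqrt \<epsilon> *\<^sub>R J t w - integral {0..t} (\<lambda>s. Z s w *v h s)"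
        using Yeq[OF t] by (simp add: defect_def)
      then show "norm (defect x h (\<lambda>s. Y s w) t) \<le> e" using main by simp
    qed
  qed
qed

end

section \<open>Increments on a grid\<close>

text \<open>The control with constant velocity on each cell. By \<open>cell_integrals_le\<close> no
  control with these cell integrals has less energy, so in the upper bound its energy is exactly the
  quadratic form of the Gaussian increments.\<close>

lemma step_control:
  fixes v :: "nat \<Rightarrow> real ^ 'm"
  assumes T: "0 < T" and n: "0 < n"
  obtains h where "L2_control T h" "energy T h = (\<Sum>j<n. (norm (v j))\<^sup>2 / (T / real n))"
    "\<And>j. j < n \<Longrightarrow> integral {grid T n j..grid T n (Suc j)} h = v j"
proof -
  let ?t = "grid T n" and ?\<Delta> = "T / real n"
  have \<Delta>: "0 < ?\<Delta>" using T n by simp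
  have tm: "?t i \<le> ?t j" if "i \<le> j" for i j using grid_mono[OF less_imp_le[OF T] that] .
  define h where "h s = (\<Sum>j<n. indicator {?t j<..?t (Suc j)} s *\<^sub>R ((1 / ?\<Delta>) *\<^sub>R v j))" for s
  have h: "h s = (1 / ?\<Delta>) *\<^sub>R v j" if j: "j < n" "s \<in> {?t j<..?t (Suc j)}" for j s
  proof -
    have "h s = (\<Sum>i\<in>{j}. indicator {?t i<..?t (Suc i)} s *\<^sub>R ((1 / ?\<Delta>) *\<^sub>R v i))"
      unfolding h_def
    proof (rule sum.mono_neutral_right)
      show "\<forall>i\<in>{..<n} - {j}. indicator {?t i<..?t (Suc i)} s *\<^sub>R ((1 / ?\<Delta>) *\<^sub>R v i) = 0"
      proof
        fix i assume "i \<in> {..<n} - {j}"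
        then have "s \<notin> {?t i<..?t (Suc i)}"
          using tm[of "Suc i" j] tm[of "Suc j" i] j by (cases "i < j") auto
        then show "indicator {?t i<..?t (Suc i)} s *\<^sub>R ((1 / ?\<Delta>) *\<^sub>R v i) = 0" by simp
      qed
    qed (use j in auto)
    then show ?thesis using j by simp
  qed
  have hm: "h \<in> borel_measurable (lebesgue_on {0..T})"
  proof -
    have "h \<in> borel_measurable borel" unfolding h_def[abs_def] by measurable
    then have "h \<in> borel_measurable lebesgue" by (simp add: measurable_completion)
    then show ?thesis by (rule measurable_restrict_space1)
  qed
  have L2: "L2_control T h"
    unfolding L2_control_iff
  proof
    define K where "K = (\<Sum>j<n. norm ((1 / ?\<Delta>) *\<^sub>R v j))"
    have bound: "norm (h s) \<le> K" for s
      unfolding h_def K_def by (rule sum_norm_le) (simp add: indicator_def)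
    have "(\<integral>\<^sup>+s. ennreal ((norm (h s))\<^sup>2) \<partial>lebesgue_on {0..T}) \<le> (\<integral>\<^sup>+s. ennreal (K\<^sup>2) \<partial>lebesgue_on {0..T})"
      by (intro nn_integral_mono ennreal_leI power_mono bound) simp
    also have "\<dots> = ennreal (K\<^sup>2) * emeasure (lebesgue_on {0..T}) {0..T}" by simp
    also have "\<dots> < \<infinity>" using T by (simp add: emeasure_restrict_space ennreal_mult_less_top)
    finally show "(\<integral>\<^sup>+s. ennreal ((norm (h s))\<^sup>2) \<partial>lebesgue_on {0..T}) < \<infinity>" .
  qed (rule hm)
  show ?thesis
  proof (rule that[OF L2])
    show "integral {?t j..?t (Suc j)} h = v j" if j: "j < n" for j
    proof -
      \<comment> \<open>Cells are open on the left, so the value at \<open>?t j\<close> belongs to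
        the previous cell; a single point does not affect the integral.\<close>
      have "integral {?t j..?t (Suc j)} h = integral {?t j..?t (Suc j)} (\<lambda>_. (1 / ?\<Delta>) *\<^sub>R v j)"
        by (rule integral_spike[of "{?t j}"]) (use h[OF j] in auto)
      also have "\<dots> = v j" using \<Delta> T n by (simp add: grid_Suc)
      finally show ?thesis .
    qed
    have "integral {0..?t i} (\<lambda>s. (norm (h s))\<^sup>2) = (\<Sum>j<i. (norm (v j))\<^sup>2 / ?\<Delta>)" if "i \<le> n" for i
      using that
    proof (induction i)
      case (Suc i)
      have i: "0 \<le> ?t i" "?t i \<le> ?t (Suc i)" "?t (Suc i) \<le> T"
        using T n Suc.prems by (auto intro: grid_nonneg grid_mono grid_le)
      have int: "(\<lambda>s. (norm (h s))\<^sup>2) integrable_on {0..?t (Suc i)}"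
        by (rule integrable_subinterval_real[OF L2_controlD(3)[OF L2]]) (use i in auto)
      have "integral {?t i..?t (Suc i)} (\<lambda>s. (norm (h s))\<^sup>2) = integral {?t i..?t (Suc i)} (\<lambda>_. (norm ((1 / ?\<Delta>) *\<^sub>R v i))\<^sup>2)"
      proof (rule integral_spike[of "{?t i}"])
        fix s assume "s \<in> {?t i..?t (Suc i)} - {?t i}"
        then have "h s = (1 / ?\<Delta>) *\<^sub>R v i" using Suc.prems by (intro h) auto
        then show "(norm ((1 / ?\<Delta>) *\<^sub>R v i))\<^sup>2 = (norm (h s))\<^sup>2" by simp
      qed simp
      also have "\<dots> = ?\<Delta> * (norm ((1 / ?\<Delta>) *\<^sub>R v i))\<^sup>2" using \<Delta> by (simp add: grid_Suc)
      also have "\<dots> = (norm (v i))\<^sup>2 / ?\<Delta>"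
        using \<Delta> T n by (simp add: power_mult_distrib power_divide power2_eq_square field_simps)
      finally show ?case
        using Henstock_Kurzweil_Integration.integral_combine[OF i(1,2) int] Suc by simp
    qed simp
    from this[of n] show "energy T h = (\<Sum>j<n. (norm (v j))\<^sup>2 / ?\<Delta>)"
      using n by (simp add: energy_def grid_end)
  qed
qed

text \<open>Cauchy-Schwarz on each cell. The first bound says that prescribing only the cell
  integrals is no dearer than the control itself, which the lower bound rests on; the second
  controls the cross term when the targets are thickened by a radius.\<close>

lemma cell_integrals_le:
  fixes h :: "real \<Rightarrow> real ^ 'm"
  assumes T: "0 < T" and n: "0 < n" and h: "L2_control T h" "energy T h \<le> N"
  shows "(\<Sum>j<n. (norm (integral {grid T n j..grid T n (Suc j)} h))\<^sup>2 / (T / real n)) \<le> energy T h"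
    and "(\<Sum>j<n. norm (integral {grid T n j..grid T n (Suc j)} h)) \<le> sqrt (T * N)"
proof -
  let ?t = "grid T n" and ?\<Delta> = "T / real n"
  have \<Delta>: "0 < ?\<Delta>" using T n by simp
  have "(\<Sum>j<i. (norm (integral {?t j..?t (Suc j)} h))\<^sup>2 / ?\<Delta>) \<le> integral {0..?t i} (\<lambda>s. (norm (h s))\<^sup>2) \<and>
      (\<Sum>j<i. norm (integral {?t j..?t (Suc j)} h)) \<le> integral {0..?t i} (\<lambda>s. norm (h s))" if "i \<le> n" for i
    using that
  proof (induction i)
    case (Suc i)
    have i: "0 \<le> ?t i" "?t i \<le> ?t (Suc i)" "?t (Suc i) \<le> T"
      using T n Suc.prems by (auto intro: grid_nonneg grid_mono grid_le)
    have sub: "{?t i..?t (Suc i)} \<subseteq> {0..T}" and sub0: "{0..?t (Suc i)} \<subseteq> {0..T}" using i by auto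
    have hi: "h absolutely_integrable_on {?t i..?t (Suc i)}"
      by (rule absolutely_integrable_on_subinterval[OF L2_controlD(1)[OF h(1)] sub])
    have h2: "(\<lambda>s. (norm (h s))\<^sup>2) integrable_on {?t i..?t (Suc i)}"
      by (rule integrable_subinterval_real[OF L2_controlD(3)[OF h(1)] sub])
    have h20: "(\<lambda>s. (norm (h s))\<^sup>2) integrable_on {0..?t (Suc i)}" and hn0: "(\<lambda>s. norm (h s)) integrable_on {0..?t (Suc i)}"
      by (rule integrable_subinterval_real[OF L2_controlD(3)[OF h(1)] sub0] integrable_subinterval_real[OF L2_controlD(4)[OF h(1)] sub0])+
    let ?q = "integral {?t i..?t (Suc i)} (\<lambda>s. (norm (h s))\<^sup>2)"
    have n1: "norm (integral {?t i..?t (Suc i)} h) \<le> integral {?t i..?t (Suc i)} (\<lambda>s. norm (h s))"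
      by (rule integral_norm_bound[OF hi])
    also have "\<dots> \<le> sqrt ((?t (Suc i) - ?t i) * ?q)"
      by (rule integral_norm_le_sqrt[OF i(2) hi h2 order_refl])
    finally have "(norm (integral {?t i..?t (Suc i)} h))\<^sup>2 \<le> (sqrt (?\<Delta> * ?q))\<^sup>2"
      by (intro power_mono) (auto simp: grid_Suc)
    also have "\<dots> = ?\<Delta> * ?q"
      using \<Delta> integral_nonneg[OF h2] by (intro real_sqrt_pow2 mult_nonneg_nonneg) auto
    finally have "(norm (integral {?t i..?t (Suc i)} h))\<^sup>2 / ?\<Delta> \<le> ?q"
      using \<Delta> by (simp only: pos_divide_le_eq mult.commute)
    then show ?case
      using Henstock_Kurzweil_Integration.integral_combine[OF i(1,2) h20]
        Henstock_Kurzweil_Integration.integral_combine[OF i(1,2) hn0] Suc n1 by simp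
  qed simp
  from this[of n] have *: "(\<Sum>j<n. (norm (integral {?t j..?t (Suc j)} h))\<^sup>2 / ?\<Delta>) \<le> energy T h"
      "(\<Sum>j<n. norm (integral {?t j..?t (Suc j)} h)) \<le> integral {0..T} (\<lambda>s. norm (h s))"
    using n by (auto simp: energy_def grid_end)
  show "(\<Sum>j<n. (norm (integral {?t j..?t (Suc j)} h))\<^sup>2 / ?\<Delta>) \<le> energy T h" by (rule *(1))
  show "(\<Sum>j<n. norm (integral {?t j..?t (Suc j)} h)) \<le> sqrt (T * N)"
    using *(2) integral_norm_control_le[OF h, of 0 T] T by simp
qed

context filtered_brownian begin

lemma increments_measurable:
  assumes "0 < T" "j < k"
  shows "(\<lambda>\<omega>. B (grid T n (Suc j)) \<omega> - B (grid T n j) \<omega>) \<in> borel_measurable (F (grid T n k))"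
  by (intro borel_measurable_diff measurable_B_F)
     (use assms in \<open>auto intro: grid_nonneg grid_mono\<close>)

text \<open>The conditional moment does not depend on the past, so it comes out of the integral as a
  constant factor.\<close>

lemma square_exponential_step:
  assumes st: "0 \<le> s" "s < t" and \<kappa>: "0 < \<kappa>" and G: "G \<in> borel_measurable (F s)"
  shows "(\<integral>\<^sup>+\<omega>. G \<omega> * ennreal (exp ((1 - \<kappa>) * (norm (B t \<omega> - B s \<omega>))\<^sup>2 / (2 * (t - s)))) \<partial>M)
    = ennreal ((1 / sqrt \<kappa>) ^ CARD('m)) * (\<integral>\<^sup>+\<omega>. G \<omega> \<partial>M)"
proof -
  define f where "f = (\<lambda>(\<omega>, y :: real ^ 'm). G \<omega> * ennreal (exp ((1 - \<kappa>) * (norm y)\<^sup>2 / (2 * (t - s)))))"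
  have f: "f \<in> borel_measurable (F s \<Otimes>\<^sub>M borel)" unfolding f_def using G by measurable
  have "(\<integral>\<^sup>+y. f (\<omega>, y) * ennreal (gauss_density (t - s) y) \<partial>lborel) = ennreal ((1 / sqrt \<kappa>) ^ CARD('m)) * G \<omega>" for \<omega>
  proof -
    have "(\<integral>\<^sup>+y. f (\<omega>, y) * ennreal (gauss_density (t - s) y) \<partial>lborel)
        = (\<integral>\<^sup>+y. G \<omega> * (ennreal (exp ((1 - \<kappa>) * (norm y)\<^sup>2 / (2 * (t - s)))) * ennreal (gauss_density (t - s) (y :: real ^ 'm))) \<partial>lborel)"
      by (simp add: f_def mult.assoc)
    also have "\<dots> = G \<omega> * (\<integral>\<^sup>+y. ennreal (exp ((1 - \<kappa>) * (norm y)\<^sup>2 / (2 * (t - s)))) * ennreal (gauss_density (t - s) (y :: real ^ 'm)) \<partial>lborel)"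
      by (rule nn_integral_cmult) measurable
    also have "\<dots> = G \<omega> * ennreal ((1 / sqrt \<kappa>) ^ CARD('m))"
      by (subst gauss_square_exponential_moment) (use st \<kappa> in auto)
    finally show ?thesis by (simp add: mult.commute)
  qed
  then have "(\<integral>\<^sup>+\<omega>. f (\<omega>, B t \<omega> - B s \<omega>) \<partial>M) = (\<integral>\<^sup>+\<omega>. ennreal ((1 / sqrt \<kappa>) ^ CARD('m)) * G \<omega> \<partial>M)"
    unfolding nn_integral_increment[OF st f] by simp
  also have "\<dots> = ennreal ((1 / sqrt \<kappa>) ^ CARD('m)) * (\<integral>\<^sup>+\<omega>. G \<omega> \<partial>M)"
    by (rule nn_integral_cmult[OF measurable_F_M[OF G st(1)]])
  finally show ?thesis by (simp add: f_def)
qed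

text \<open>Exponential Chebyshev bound with the fraction \<open>1 - \<kappa>\<close> of the
  critical exponent, at which the moment would be infinite. The loss is a factor \<kappa> in the
  rate and a prefactor that depends on \<open>n\<close> but not on \<epsilon>.\<close>

lemma chi_square_tail:
  fixes s :: real
  assumes T: "0 < T" and n: "0 < n" and \<kappa>: "0 < \<kappa>" "\<kappa> < 1" and \<epsilon>: "0 < \<epsilon>"
  defines "E \<equiv> {\<omega> \<in> space M. s < \<epsilon> / 2 * (\<Sum>j<n. (norm (B (grid T n (Suc j)) \<omega> - B (grid T n j) \<omega>))\<^sup>2 / (T / real n))}"
  shows "E \<in> events" and "prob E \<le> ((1 / sqrt \<kappa>) ^ CARD('m)) ^ n * exp (- (1 - \<kappa>) * s / \<epsilon>)"
proof -
  let ?t = "grid T n" and ?\<Delta> = "T / real n"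
  have \<Delta>: "0 < ?\<Delta>" using T n by simp
  let ?dB = "\<lambda>j \<omega>. B (?t (Suc j)) \<omega> - B (?t j) \<omega>"
  define D where "D j \<omega> = ennreal (exp ((1 - \<kappa>) * (norm (?dB j \<omega>))\<^sup>2 / (2 * ?\<Delta>)))" for j \<omega>
  have tnn: "0 \<le> ?t j" for j using T by (simp add: grid_nonneg)
  have dM: "?dB j \<in> borel_measurable M" for j
    using measurable_F_M[OF increments_measurable[OF T, of j "Suc j"] tnn] by simp
  have Dm: "D j \<in> borel_measurable (F (?t (Suc j)))" for j
    unfolding D_def using increments_measurable[OF T, of j "Suc j" n] by measurable
  have DM: "D j \<in> borel_measurable M" for j using measurable_F_M[OF Dm tnn] .
  show E: "E \<in> events" unfolding E_def using dM by measurable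
  have "(\<integral>\<^sup>+\<omega>. 1 * (\<Prod>j<n. D j \<omega>) \<partial>M) \<le> (ennreal ((1 / sqrt \<kappa>) ^ CARD('m))) ^ n * (\<integral>\<^sup>+\<omega>. 1 \<partial>M)"
  proof (rule nn_integral_prod_le[where N = "\<lambda>j. F (?t j)"])
    show "D j \<in> borel_measurable (F (?t (Suc j)))" for j by (rule Dm)
    show "X \<in> borel_measurable (F (?t j))" if "k \<le> j" "X \<in> borel_measurable (F (?t k))" for k j and X :: "'w \<Rightarrow> ennreal"
      by (rule measurable_F_mono[OF that(2) tnn grid_mono[OF less_imp_le[OF T] that(1)]])
    show "(\<integral>\<^sup>+\<omega>. G \<omega> * D k \<omega> \<partial>M) \<le> ennreal ((1 / sqrt \<kappa>) ^ CARD('m)) * (\<integral>\<^sup>+\<omega>. G \<omega> \<partial>M)"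
      if "G \<in> borel_measurable (F (?t k))" for k G
      using square_exponential_step[OF tnn _ \<kappa>(1) that, of "?t (Suc k)"] \<Delta> by (simp add: D_def grid_Suc)
  qed simp
  then have int: "(\<integral>\<^sup>+\<omega>. (\<Prod>j<n. D j \<omega>) \<partial>M) \<le> ennreal (((1 / sqrt \<kappa>) ^ CARD('m)) ^ n)"
    using \<kappa> by (simp add: emeasure_space_1 ennreal_power)
  let ?c = "exp ((1 - \<kappa>) * s / \<epsilon>)"
  have PM: "(\<lambda>\<omega>. \<Prod>j<n. D j \<omega>) \<in> borel_measurable M" by (intro borel_measurable_prod_ennreal DM)
  have sub: "E \<subseteq> {\<omega> \<in> space M. 1 \<le> ennreal (1 / ?c) * (\<Prod>j<n. D j \<omega>)}"
  proof
    fix \<omega> assume \<omega>: "\<omega> \<in> E"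
    let ?S = "\<Sum>j<n. (norm (?dB j \<omega>))\<^sup>2 / ?\<Delta>"
    have "(\<Prod>j<n. D j \<omega>) = ennreal (exp (\<Sum>j<n. (1 - \<kappa>) * (norm (?dB j \<omega>))\<^sup>2 / (2 * ?\<Delta>)))"
      unfolding D_def by (simp add: prod_ennreal exp_sum)
    also have "(\<Sum>j<n. (1 - \<kappa>) * (norm (?dB j \<omega>))\<^sup>2 / (2 * ?\<Delta>)) = (1 - \<kappa>) * (?S / 2)"
      unfolding sum_distrib_left sum_divide_distrib by (intro sum.cong) auto
    finally have P: "(\<Prod>j<n. D j \<omega>) = ennreal (exp ((1 - \<kappa>) * (?S / 2)))" .
    have "s \<le> \<epsilon> * (?S / 2)" using \<omega> by (simp add: E_def)
    then have "s / \<epsilon> \<le> ?S / 2" using \<epsilon> by (simp add: pos_divide_le_eq mult.commute)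
    then have "(1 - \<kappa>) * (s / \<epsilon>) \<le> (1 - \<kappa>) * (?S / 2)" using \<kappa> by (intro mult_left_mono) auto
    then have "?c \<le> exp ((1 - \<kappa>) * (?S / 2))" by simp
    then have "1 \<le> (1 / ?c) * exp ((1 - \<kappa>) * (?S / 2))" by (simp add: le_divide_eq)
    then have "ennreal 1 \<le> ennreal ((1 / ?c) * exp ((1 - \<kappa>) * (?S / 2)))" by (rule ennreal_leI)
    then have "1 \<le> ennreal (1 / ?c) * (\<Prod>j<n. D j \<omega>)" unfolding P by (simp add: ennreal_mult[symmetric])
    then show "\<omega> \<in> {\<omega> \<in> space M. 1 \<le> ennreal (1 / ?c) * (\<Prod>j<n. D j \<omega>)}" using \<omega> by (simp add: E_def)
  qed
  have "emeasure M E \<le> emeasure M {\<omega> \<in> space M. 1 \<le> ennreal (1 / ?c) * (\<Prod>j<n. D j \<omega>)}"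
    by (rule emeasure_mono[OF sub]) (intro borel_measurable_le borel_measurable_times_ennreal PM; simp)
  also have "\<dots> \<le> ennreal (1 / ?c) * (\<integral>\<^sup>+\<omega>. (\<Prod>j<n. D j \<omega>) * indicator (space M) \<omega> \<partial>M)"
  proof (rule nn_integral_Markov_inequality)
    show "(\<lambda>\<omega>. (\<Prod>j<n. D j \<omega>) * indicator (space M) \<omega>) \<in> borel_measurable M"
      by (rule borel_measurable_times_ennreal[OF PM]) simp
  qed simp
  also have "(\<integral>\<^sup>+\<omega>. (\<Prod>j<n. D j \<omega>) * indicator (space M) \<omega> \<partial>M) = (\<integral>\<^sup>+\<omega>. (\<Prod>j<n. D j \<omega>) \<partial>M)"
    by (intro nn_integral_cong) simp
  also have "ennreal (1 / ?c) * (\<integral>\<^sup>+\<omega>. (\<Prod>j<n. D j \<omega>) \<partial>M) \<le> ennreal (1 / ?c) * ennreal (((1 / sqrt \<kappa>) ^ CARD('m)) ^ n)"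
    by (intro mult_left_mono int) simp
  also have "\<dots> = ennreal (1 / ?c * ((1 / sqrt \<kappa>) ^ CARD('m)) ^ n)"
    using \<kappa> by (subst ennreal_mult) auto
  finally have "prob E \<le> 1 / ?c * ((1 / sqrt \<kappa>) ^ CARD('m)) ^ n"
    using \<kappa> by (simp add: emeasure_eq_measure)
  also have "1 / ?c = exp (- (1 - \<kappa>) * s / \<epsilon>)" by (simp only: mult_minus_left minus_divide_left[symmetric] exp_minus inverse_eq_divide)
  finally show "prob E \<le> ((1 / sqrt \<kappa>) ^ CARD('m)) ^ n * exp (- (1 - \<kappa>) * s / \<epsilon>)" by (simp add: mult.commute)
qed

text \<open>The indicators of the first \<open>k\<close> conditions are measurable at the
  \<open>k\<close>-th grid point, so the next condition contributes at least its own Gaussian ball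
  probability as a factor. All \<epsilon> dependence sits in the exponent.\<close>

lemma increments_small_ball:
  fixes r :: real and v :: "nat \<Rightarrow> real ^ 'm"
  assumes T: "0 < T" and n: "0 < n" and \<epsilon>: "0 < \<epsilon>" "\<epsilon> \<le> 1" and r: "0 < r"
  defines "E \<equiv> {\<omega> \<in> space M. \<forall>j<n. norm (sqrt \<epsilon> *\<^sub>R (B (grid T n (Suc j)) \<omega> - B (grid T n j) \<omega>) - v j) < r}"
  shows "E \<in> events" and "((1 / sqrt (2 * pi * (T / real n))) ^ CARD('m) * measure lborel (ball (0 :: real ^ 'm) r)) ^ n
      * exp (- (\<Sum>j<n. (norm (v j) + r)\<^sup>2) / (2 * (T / real n) * \<epsilon>)) \<le> prob E"
proof -
  let ?t = "grid T n" and ?\<Delta> = "T / real n"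
  have \<Delta>: "0 < ?\<Delta>" using T n by simp
  let ?dB = "\<lambda>j \<omega>. B (?t (Suc j)) \<omega> - B (?t j) \<omega>"
  let ?S = "\<lambda>j. {y. norm (sqrt \<epsilon> *\<^sub>R y - v j) < r}"
  have tnn: "0 \<le> ?t j" for j using T by (simp add: grid_nonneg)
  have S: "?S j \<in> sets borel" for j by measurable
  define q where "q j = (1 / sqrt (2 * pi * ?\<Delta>)) ^ CARD('m) * measure lborel (ball (0 :: real ^ 'm) r) * exp (- (norm (v j) + r)\<^sup>2 / (2 * ?\<Delta> * \<epsilon>))" for j
  have q0: "0 \<le> q j" for j unfolding q_def
    by (intro mult_nonneg_nonneg zero_le_power divide_nonneg_nonneg) (use T \<epsilon> in auto)
  define G where "G k \<omega> = (\<Prod>j<k. indicator (?S j) (?dB j \<omega>) :: ennreal)" for k \<omega>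
  have Gm: "G k \<in> borel_measurable (F (?t k))" for k
    unfolding G_def
    by (intro borel_measurable_prod_ennreal measurable_compose[OF increments_measurable[OF T]] borel_measurable_indicator S) auto
  have dM: "?dB j \<in> borel_measurable M" for j
    using measurable_F_M[OF increments_measurable[OF T, of j "Suc j"] tnn] by simp
  show E: "E \<in> events" unfolding E_def using dM by measurable
  have "ennreal (\<Prod>j<k. q j) \<le> (\<integral>\<^sup>+\<omega>. G k \<omega> \<partial>M)" for k
  proof (induction k)
    case 0
    then show ?case by (simp add: G_def emeasure_space_1)
  next
    case (Suc k)
    define f where "f = (\<lambda>(\<omega>, y :: real ^ 'm). G k \<omega> * indicator (?S k) y)"
    have f: "f \<in> borel_measurable (F (?t k) \<Otimes>\<^sub>M borel)"
    proof -
      have "(\<lambda>z. G k (fst z)) \<in> borel_measurable (F (?t k) \<Otimes>\<^sub>M (borel :: (real ^ 'm) measure))"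
        by (rule measurable_compose[OF measurable_fst Gm])
      moreover have "(\<lambda>z. indicator (?S k) (snd z) :: ennreal) \<in> borel_measurable (F (?t k) \<Otimes>\<^sub>M borel)"
        by (rule measurable_compose[OF measurable_snd borel_measurable_indicator[OF S]])
      ultimately show ?thesis unfolding f_def split_beta' by (rule borel_measurable_times_ennreal)
    qed
    have lt: "?t k < ?t (Suc k)" using \<Delta> by (simp add: grid_Suc)
    have "ennreal (\<Prod>j<Suc k. q j) = ennreal (\<Prod>j<k. q j) * ennreal (q k)"
      using q0 by (simp add: ennreal_mult prod_nonneg)
    also have "\<dots> \<le> (\<integral>\<^sup>+\<omega>. G k \<omega> \<partial>M) * ennreal (q k)" by (intro mult_right_mono Suc) simp
    also have "\<dots> = (\<integral>\<^sup>+\<omega>. G k \<omega> * ennreal (q k) \<partial>M)"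
      by (rule nn_integral_multc[symmetric, OF measurable_F_M[OF Gm tnn]])
    also have "\<dots> \<le> (\<integral>\<^sup>+\<omega>. (\<integral>\<^sup>+y. f (\<omega>, y) * ennreal (gauss_density (?t (Suc k) - ?t k) y) \<partial>lborel) \<partial>M)"
    proof (rule nn_integral_mono)
      fix \<omega>
      have "G k \<omega> * ennreal (q k) \<le> G k \<omega> * (\<integral>\<^sup>+y. indicator (?S k) y * ennreal (gauss_density ?\<Delta> y) \<partial>lborel)"
        unfolding q_def by (intro mult_left_mono gauss_small_ball \<Delta> \<epsilon> r) simp
      also have "\<dots> = (\<integral>\<^sup>+y. G k \<omega> * (indicator (?S k) y * ennreal (gauss_density ?\<Delta> y)) \<partial>lborel)"
        by (rule nn_integral_cmult[symmetric])
           (intro borel_measurable_times_ennreal, use borel_measurable_indicator[OF S] in simp, measurable)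
      also have "\<dots> = (\<integral>\<^sup>+y. f (\<omega>, y) * ennreal (gauss_density (?t (Suc k) - ?t k) y) \<partial>lborel)"
        by (simp add: f_def grid_Suc mult.assoc)
      finally show "G k \<omega> * ennreal (q k) \<le> (\<integral>\<^sup>+y. f (\<omega>, y) * ennreal (gauss_density (?t (Suc k) - ?t k) y) \<partial>lborel)" .
    qed
    also have "\<dots> = (\<integral>\<^sup>+\<omega>. f (\<omega>, ?dB k \<omega>) \<partial>M)"
      by (rule nn_integral_increment[OF tnn lt f, symmetric])
    also have "\<dots> = (\<integral>\<^sup>+\<omega>. G (Suc k) \<omega> \<partial>M)" by (simp add: f_def G_def)
    finally show ?case .
  qed
  from this[of n] have "ennreal (\<Prod>j<n. q j) \<le> (\<integral>\<^sup>+\<omega>. G n \<omega> \<partial>M)" .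
  also have "\<dots> = (\<integral>\<^sup>+\<omega>. indicator E \<omega> \<partial>M)"
  proof (rule nn_integral_cong)
    fix \<omega> assume \<omega>: "\<omega> \<in> space M"
    show "G n \<omega> = indicator E \<omega>"
    proof (cases "\<omega> \<in> E")
      case True
      then have "G n \<omega> = 1" unfolding G_def by (intro prod.neutral) (auto simp: E_def)
      then show ?thesis using True by simp
    next
      case False
      then obtain j where "j < n" "?dB j \<omega> \<notin> ?S j" using \<omega> by (auto simp: E_def)
      then have "G n \<omega> = 0" unfolding G_def by (intro prod_zero bexI[of _ j]) auto
      then show ?thesis using False by simp
    qed
  qed
  also have "\<dots> = emeasure M E" using E by simp
  finally have "(\<Prod>j<n. q j) \<le> prob E" by (simp add: emeasure_eq_measure)
  also have "(\<Prod>j<n. q j) = ((1 / sqrt (2 * pi * ?\<Delta>)) ^ CARD('m) * measure lborel (ball (0 :: real ^ 'm) r)) ^ n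
      * exp (- (\<Sum>j<n. (norm (v j) + r)\<^sup>2) / (2 * ?\<Delta> * \<epsilon>))"
  proof -
    have "(\<Prod>j<n. exp (- (norm (v j) + r)\<^sup>2 / (2 * ?\<Delta> * \<epsilon>))) = exp (\<Sum>j<n. - (norm (v j) + r)\<^sup>2 / (2 * ?\<Delta> * \<epsilon>))"
      by (simp add: exp_sum)
    also have "(\<Sum>j<n. - (norm (v j) + r)\<^sup>2 / (2 * ?\<Delta> * \<epsilon>)) = - (\<Sum>j<n. (norm (v j) + r)\<^sup>2) / (2 * ?\<Delta> * \<epsilon>)"
      by (simp only: sum_divide_distrib[symmetric] sum_negf)
    finally show ?thesis unfolding q_def by (simp only: prod.distrib prod_constant card_lessThan power_mult_distrib)
  qed
  finally show "((1 / sqrt (2 * pi * ?\<Delta>)) ^ CARD('m) * measure lborel (ball (0 :: real ^ 'm) r)) ^ n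
      * exp (- (\<Sum>j<n. (norm (v j) + r)\<^sup>2) / (2 * ?\<Delta> * \<epsilon>)) \<le> prob E" .
qed

end

section \<open>Large deviation bounds\<close>

context small_noise begin

lemma sample_path_in_path_space:
  assumes "sde_solution M F B T b \<sigma> \<epsilon> x Y" "\<omega> \<in> space M"
  shows "sample_path T Y \<omega> \<in> mspace (path_space T)"
proof -
  have "continuous_on {0..T} (\<lambda>t. Y t \<omega>)" using assms by (auto simp: sde_solution_def)
  then have "continuous_on {0..T} (sample_path T Y \<omega>)"
    by (rule continuous_on_eq) (simp add: sample_path_def)
  then show ?thesis by (simp add: mspace_path_space sample_path_def)
qed

text \<open>By continuity the uniform distance can be tested at countably many times. The lower
  bound needs this, since there the probability of a union containing the event is estimated from
  above by a sum.\<close>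

lemma mdist_sample_path_measurable:
  assumes Y: "sde_solution M F B T b \<sigma> \<epsilon> x Y" and \<phi>: "\<phi> \<in> mspace (path_space T)"
  shows "{\<omega> \<in> space M. mdist (path_space T) (sample_path T Y \<omega>) \<phi> < \<delta>} \<in> events"
proof -
  obtain D where D: "countable D" "D \<subseteq> {0..T}" "{0..T} \<subseteq> closure D"
    using separable[of "{0..T}"] by blast
  have cl: "closure D = {0..T}" using D(2,3) closure_minimal[OF D(2) closed_atLeastAtMost] by blast
  have c\<phi>: "continuous_on {0..T} \<phi>" using \<phi> by (simp add: mspace_path_space)
  have cY: "continuous_on {0..T} (\<lambda>t. Y t \<omega>)" if "\<omega> \<in> space M" for \<omega>
    using Y that by (auto simp: sde_solution_def)
  have Ym: "Y t \<in> borel_measurable M" if "t \<in> {0..T}" for t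
    using Y that by (intro measurable_F_M[of "Y t" t]) (auto simp: sde_solution_def adapted_on_def)
  \<comment> \<open>A strict inequality for a supremum does not follow from strict inequalities at
    the individual times; a uniform margin \<open>1 / real (Suc k)\<close> expresses it by countably
    many conditions.\<close>
  have eq: "mdist (path_space T) (sample_path T Y \<omega>) \<phi> < \<delta> \<longleftrightarrow>
      (\<exists>k::nat. \<forall>t\<in>D. dist (Y t \<omega>) (\<phi> t) \<le> \<delta> - 1 / real (Suc k))" if \<omega>: "\<omega> \<in> space M" for \<omega>
  proof
    assume lt: "mdist (path_space T) (sample_path T Y \<omega>) \<phi> < \<delta>"
    then obtain k where k: "1 / real (Suc k) < \<delta> - mdist (path_space T) (sample_path T Y \<omega>) \<phi>"
      using nat_approx_posE[of "\<delta> - mdist (path_space T) (sample_path T Y \<omega>) \<phi>"] by (auto simp del: of_nat_Suc)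
    have "dist (Y t \<omega>) (\<phi> t) \<le> mdist (path_space T) (sample_path T Y \<omega>) \<phi>" if t: "t \<in> {0..T}" for t
    proof -
      have "compact ((\<lambda>t. dist (sample_path T Y \<omega> t) (\<phi> t)) ` {0..T})"
        using sample_path_in_path_space[OF Y \<omega>] c\<phi>
        by (intro compact_continuous_image continuous_on_dist) (auto simp: mspace_path_space)
      then have "bdd_above ((\<lambda>t. dist (sample_path T Y \<omega> t) (\<phi> t)) ` {0..T})"
        by (intro bounded_imp_bdd_above compact_imp_bounded)
      then have "dist (sample_path T Y \<omega> t) (\<phi> t) \<le> (SUP t\<in>{0..T}. dist (sample_path T Y \<omega> t) (\<phi> t))"
        by (rule cSUP_upper[OF t])
      then show ?thesis
        using t mdist_path_space[OF less_imp_le[OF T] sample_path_in_path_space[OF Y \<omega>] \<phi>] by (simp add: sample_path_def)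
    qed
    then show "\<exists>k::nat. \<forall>t\<in>D. dist (Y t \<omega>) (\<phi> t) \<le> \<delta> - 1 / real (Suc k)"
      using k D(2) by (intro exI[of _ k]) (fastforce simp del: of_nat_Suc)
  next
    assume "\<exists>k::nat. \<forall>t\<in>D. dist (Y t \<omega>) (\<phi> t) \<le> \<delta> - 1 / real (Suc k)"
    then obtain k where k: "\<And>t. t \<in> D \<Longrightarrow> dist (Y t \<omega>) (\<phi> t) \<le> \<delta> - 1 / real (Suc k)" by blast
    have "dist (Y t \<omega>) (\<phi> t) \<le> \<delta> - 1 / real (Suc k)" if t: "t \<in> {0..T}" for t
      using continuous_le_on_closure[of D "\<lambda>t. dist (Y t \<omega>) (\<phi> t)" t "\<delta> - 1 / real (Suc k)"] k t
        continuous_on_dist[OF cY[OF \<omega>] c\<phi>] unfolding cl by blast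
    then have "mdist (path_space T) (sample_path T Y \<omega>) \<phi> \<le> \<delta> - 1 / real (Suc k)"
      by (intro mdist_path_space_le sample_path_in_path_space[OF Y \<omega>] \<phi>) (simp add: sample_path_def dist_norm)
    also have "\<dots> < \<delta>" by simp
    finally show "mdist (path_space T) (sample_path T Y \<omega>) \<phi> < \<delta>" .
  qed
  have "{\<omega> \<in> space M. \<exists>k::nat. \<forall>t\<in>D. dist (Y t \<omega>) (\<phi> t) \<le> \<delta> - 1 / real (Suc k)} \<in> events"
  proof (intro sets.sets_Collect_countable_Ex sets.sets_Collect_countable_All' D(1))
    fix k :: nat and t assume "t \<in> D"
    then have "Y t \<in> borel_measurable M" using Ym D(2) by blast
    then show "{\<omega> \<in> space M. dist (Y t \<omega>) (\<phi> t) \<le> \<delta> - 1 / real (Suc k)} \<in> events"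
      by measurable
  qed
  also have "{\<omega> \<in> space M. \<exists>k::nat. \<forall>t\<in>D. dist (Y t \<omega>) (\<phi> t) \<le> \<delta> - 1 / real (Suc k)}
      = {\<omega> \<in> space M. mdist (path_space T) (sample_path T Y \<omega>) \<phi> < \<delta>}"
    by (intro Collect_cong conj_cong refl) (rule eq[symmetric])
  finally show ?thesis .
qed

text \<open>Joins the two halves: \<open>sde_near_skeleton\<close> makes the defect small with the
  constants that \<open>stability\<close> asks for. One exceptional event serves all controls at
  once, so the control may be chosen from the sample path itself.\<close>

lemma sde_tracks_skeleton:
  assumes A: "bounded A" and N: "0 \<le> N" and \<delta>: "0 < \<delta>" and L: "0 \<le> L"
  obtains n r \<epsilon>' where "0 < n" "0 < r" "0 < \<epsilon>'"
    "\<And>\<epsilon> x Y. 0 < \<epsilon> \<Longrightarrow> \<epsilon> < \<epsilon>' \<Longrightarrow> x \<in> A \<Longrightarrow> sde_solution M F B T b \<sigma> \<epsilon> x Y \<Longrightarrow>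
      \<exists>E\<in>events. prob E \<le> exp (- L / \<epsilon>) \<and> (\<forall>\<omega>\<in>space M - E.
        \<forall>h. L2_control T h \<longrightarrow> energy T h \<le> N \<longrightarrow>
           (\<forall>j<n. norm (integral {grid T n j..grid T n (Suc j)} h - sqrt \<epsilon> *\<^sub>R (B (grid T n (Suc j)) \<omega> - B (grid T n j) \<omega>)) \<le> r) \<longrightarrow>
           mdist (path_space T) (sample_path T Y \<omega>) (skeleton T b \<sigma> x h) < \<delta>)"
proof -
  \<comment> \<open>A supremum of values below \<open>\<delta> / 2\<close> is only known to be at
    most \<open>\<delta> / 2\<close>; halving keeps the final inequality strict.\<close>
  have \<delta>2: "0 < \<delta> / 2" using \<delta> by simp
  obtain R e where Re: "0 < R" "0 < e"
    and st: "\<And>x h Y t. x \<in> A \<Longrightarrow> L2_control T h \<Longrightarrow> energy T h \<le> N \<Longrightarrow>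
     continuous_on {0..T} Y \<Longrightarrow> Y 0 \<in> A \<Longrightarrow>
     (\<And>t. t \<in> {0..T} \<Longrightarrow> (\<And>s. s \<in> {0..t} \<Longrightarrow> norm (Y s) \<le> R) \<Longrightarrow> norm (defect x h Y t) \<le> e) \<Longrightarrow>
     t \<in> {0..T} \<Longrightarrow> norm (Y t - skeleton T b \<sigma> x h t) < \<delta> / 2"
    by (rule stability[OF A N \<delta>2]) blast
  obtain n r \<epsilon>' where nr: "0 < n" "0 < r" "0 < \<epsilon>'"
    and near: "\<And>\<epsilon> x Y. 0 < \<epsilon> \<Longrightarrow> \<epsilon> < \<epsilon>' \<Longrightarrow> sde_solution M F B T b \<sigma> \<epsilon> x Y \<Longrightarrow>
      \<exists>E\<in>events. prob E \<le> exp (- L / \<epsilon>) \<and> (\<forall>\<omega>\<in>space M - E. Y 0 \<omega> = x \<and>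
        (\<forall>h. L2_control T h \<longrightarrow> energy T h \<le> N \<longrightarrow>
           (\<forall>j<n. norm (integral {grid T n j..grid T n (Suc j)} h - sqrt \<epsilon> *\<^sub>R (B (grid T n (Suc j)) \<omega> - B (grid T n j) \<omega>)) \<le> r) \<longrightarrow>
           (\<forall>t\<in>{0..T}. (\<forall>s\<in>{0..t}. norm (Y s \<omega>) \<le> R) \<longrightarrow> norm (defect x h (\<lambda>s. Y s \<omega>) t) \<le> e)))"
    by (rule sde_near_skeleton[OF Re L N]) blast
  show ?thesis
  proof (rule that[OF nr])
    fix \<epsilon> x Y assume \<epsilon>: "0 < \<epsilon>" "\<epsilon> < \<epsilon>'" and x: "x \<in> A" and Y: "sde_solution M F B T b \<sigma> \<epsilon> x Y"
    obtain E where E: "E \<in> events" "prob E \<le> exp (- L / \<epsilon>)"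
      and nE: "\<And>\<omega>. \<omega> \<in> space M - E \<Longrightarrow> Y 0 \<omega> = x \<and>
        (\<forall>h. L2_control T h \<longrightarrow> energy T h \<le> N \<longrightarrow>
           (\<forall>j<n. norm (integral {grid T n j..grid T n (Suc j)} h - sqrt \<epsilon> *\<^sub>R (B (grid T n (Suc j)) \<omega> - B (grid T n j) \<omega>)) \<le> r) \<longrightarrow>
           (\<forall>t\<in>{0..T}. (\<forall>s\<in>{0..t}. norm (Y s \<omega>) \<le> R) \<longrightarrow> norm (defect x h (\<lambda>s. Y s \<omega>) t) \<le> e))"
      using near[OF \<epsilon> Y] by blast
    show "\<exists>E\<in>events. prob E \<le> exp (- L / \<epsilon>) \<and> (\<forall>\<omega>\<in>space M - E.
        \<forall>h. L2_control T h \<longrightarrow> energy T h \<le> N \<longrightarrow>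
           (\<forall>j<n. norm (integral {grid T n j..grid T n (Suc j)} h - sqrt \<epsilon> *\<^sub>R (B (grid T n (Suc j)) \<omega> - B (grid T n j) \<omega>)) \<le> r) \<longrightarrow>
           mdist (path_space T) (sample_path T Y \<omega>) (skeleton T b \<sigma> x h) < \<delta>)"
    proof (intro bexI[OF _ E(1)] conjI E(2) ballI allI impI)
      fix \<omega> h assume \<omega>: "\<omega> \<in> space M - E" and h: "L2_control T h" "energy T h \<le> N"
        and cells: "\<forall>j<n. norm (integral {grid T n j..grid T n (Suc j)} h - sqrt \<epsilon> *\<^sub>R (B (grid T n (Suc j)) \<omega> - B (grid T n j) \<omega>)) \<le> r"
      have \<omega>M: "\<omega> \<in> space M" using \<omega> by blast
      have c: "continuous_on {0..T} (\<lambda>t. Y t \<omega>)" using Y \<omega>M unfolding sde_solution_def by blast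
      have Y0: "Y 0 \<omega> \<in> A" using nE[OF \<omega>] x by blast
      have "norm (Y t \<omega> - skeleton T b \<sigma> x h t) < \<delta> / 2" if t: "t \<in> {0..T}" for t
      proof (rule st[OF x h c Y0 _ t])
        fix t assume "t \<in> {0..T}" "\<And>s. s \<in> {0..t} \<Longrightarrow> norm (Y s \<omega>) \<le> R"
        then show "norm (defect x h (\<lambda>t. Y t \<omega>) t) \<le> e" using nE[OF \<omega>] h cells by blast
      qed
      then have "mdist (path_space T) (sample_path T Y \<omega>) (skeleton T b \<sigma> x h) \<le> \<delta> / 2"
        by (intro mdist_path_space_le sample_path_in_path_space[OF Y \<omega>M] skeleton_in_path_space[OF h(1)])
           (simp add: sample_path_def less_imp_le)
      also have "\<dots> < \<delta>" using \<delta> by simp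
      finally show "mdist (path_space T) (sample_path T Y \<omega>) (skeleton T b \<sigma> x h) < \<delta>" .
    qed
  qed
qed

text \<open>Suppose the increments have half square sum, scaled by \<epsilon>, at most
  \<open>s\<close>. Then the step control built from them has action cost at most \<open>s\<close>,
  so its skeleton lies in the level set, and off the tracking event the diffusion is close to it.
  What remains is the tail of the square sum.\<close>

lemma ldp_upper_bound:
  assumes A: "bounded A" and pos: "0 < \<delta>" "0 < \<kappa>" "0 < s0"
  obtains \<epsilon>' where "0 < \<epsilon>'"
    "\<And>\<epsilon> x Y s. 0 < \<epsilon> \<Longrightarrow> \<epsilon> < \<epsilon>' \<Longrightarrow> x \<in> A \<Longrightarrow> sde_solution M F B T b \<sigma> \<epsilon> x Y \<Longrightarrow> s \<in> {0..s0} \<Longrightarrow>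
      prob {\<omega> \<in> space M. ennreal \<delta> \<le> dist_to_set (path_space T) (sample_path T Y \<omega>)
          (level_set (path_space T) (action T b \<sigma> x) (ennreal s))} \<le> exp (- (s - \<kappa>) / \<epsilon>)"
proof -
  have N: "0 \<le> 2 * s0" and s0: "0 \<le> s0" using pos by auto
  obtain n r \<epsilon>1 where nr: "0 < n" "0 < r" "0 < \<epsilon>1"
    and track: "\<And>\<epsilon> x Y. 0 < \<epsilon> \<Longrightarrow> \<epsilon> < \<epsilon>1 \<Longrightarrow> x \<in> A \<Longrightarrow> sde_solution M F B T b \<sigma> \<epsilon> x Y \<Longrightarrow>
      \<exists>E\<in>events. prob E \<le> exp (- s0 / \<epsilon>) \<and> (\<forall>\<omega>\<in>space M - E.
        \<forall>h. L2_control T h \<longrightarrow> energy T h \<le> 2 * s0 \<longrightarrow>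
           (\<forall>j<n. norm (integral {grid T n j..grid T n (Suc j)} h - sqrt \<epsilon> *\<^sub>R (B (grid T n (Suc j)) \<omega> - B (grid T n j) \<omega>)) \<le> r) \<longrightarrow>
           mdist (path_space T) (sample_path T Y \<omega>) (skeleton T b \<sigma> x h) < \<delta>)"
    by (rule sde_tracks_skeleton[OF A N pos(1) s0]) blast
  \<comment> \<open>The fraction of the rate that is given up; the choice limits the loss to
    \<open>\<kappa> / 2\<close> for all \<open>s\<close> up to \<open>s0\<close>.\<close>
  define \<kappa>' where "\<kappa>' = min (1 / 2) (\<kappa> / (2 * s0))"
  have \<kappa>': "0 < \<kappa>'" "\<kappa>' < 1" using pos by (auto simp: \<kappa>'_def)
  have "\<kappa>' * s0 \<le> \<kappa> / (2 * s0) * s0" unfolding \<kappa>'_def using pos by (intro mult_right_mono) auto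
  then have \<kappa>s0: "\<kappa>' * s0 \<le> \<kappa> / 2" using pos by simp
  define C where "C = ((1 / sqrt \<kappa>') ^ CARD('m)) ^ n"
  have C: "0 \<le> C" using \<kappa>' by (simp add: C_def)
  \<comment> \<open>Below this threshold \<open>1 + C\<close> is at most
    \<open>\<kappa> / (2 * \<epsilon>)\<close>, hence at most its exponential: the other half of
    \<kappa> pays for the constants.\<close>
  have p: "0 < \<kappa> / (2 * (1 + C))" using pos C by simp
  show ?thesis
  proof (rule that[of "min \<epsilon>1 (\<kappa> / (2 * (1 + C)))"])
    show "0 < min \<epsilon>1 (\<kappa> / (2 * (1 + C)))" using nr p by simp
    fix \<epsilon> x Y s assume \<epsilon>: "0 < \<epsilon>" "\<epsilon> < min \<epsilon>1 (\<kappa> / (2 * (1 + C)))" and x: "x \<in> A"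
      and Y: "sde_solution M F B T b \<sigma> \<epsilon> x Y" and s: "s \<in> {0..s0}"
    have \<epsilon>1: "\<epsilon> < \<epsilon>1" and "\<epsilon> < \<kappa> / (2 * (1 + C))" using \<epsilon> by auto
    then have "\<epsilon> * (2 * (1 + C)) < \<kappa>" using C by (subst (asm) pos_less_divide_eq) auto
    then have \<epsilon>C: "1 + C \<le> \<kappa> / (2 * \<epsilon>)" using \<epsilon> by (simp add: pos_le_divide_eq mult_ac)
    obtain E where E: "E \<in> events" "prob E \<le> exp (- s0 / \<epsilon>)"
      and nE: "\<And>\<omega> h. \<omega> \<in> space M - E \<Longrightarrow> L2_control T h \<Longrightarrow> energy T h \<le> 2 * s0 \<Longrightarrow>
           (\<And>j. j < n \<Longrightarrow> norm (integral {grid T n j..grid T n (Suc j)} h - sqrt \<epsilon> *\<^sub>R (B (grid T n (Suc j)) \<omega> - B (grid T n j) \<omega>)) \<le> r) \<Longrightarrow>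
           mdist (path_space T) (sample_path T Y \<omega>) (skeleton T b \<sigma> x h) < \<delta>"
      using track[OF \<epsilon>(1) \<epsilon>1 x Y] by blast
    let ?H = "{\<omega> \<in> space M. s < \<epsilon> / 2 * (\<Sum>j<n. (norm (B (grid T n (Suc j)) \<omega> - B (grid T n j) \<omega>))\<^sup>2 / (T / real n))}"
    note H = chi_square_tail[OF T nr(1) \<kappa>' \<epsilon>(1), of s]
    let ?D = "{\<omega> \<in> space M. ennreal \<delta> \<le> dist_to_set (path_space T) (sample_path T Y \<omega>)
          (level_set (path_space T) (action T b \<sigma> x) (ennreal s))}"
    have "?D \<subseteq> E \<union> ?H"
    proof
      fix \<omega> assume \<omega>: "\<omega> \<in> ?D"
      show "\<omega> \<in> E \<union> ?H"
      proof (rule ccontr)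
        assume n: "\<omega> \<notin> E \<union> ?H"
        have \<omega>E: "\<omega> \<in> space M - E" using \<omega> n by blast
        have le: "\<epsilon> / 2 * (\<Sum>j<n. (norm (B (grid T n (Suc j)) \<omega> - B (grid T n j) \<omega>))\<^sup>2 / (T / real n)) \<le> s"
          using \<omega> n by (simp add: not_less)
        obtain h where h: "L2_control T h"
            "energy T h = (\<Sum>j<n. (norm (sqrt \<epsilon> *\<^sub>R (B (grid T n (Suc j)) \<omega> - B (grid T n j) \<omega>)))\<^sup>2 / (T / real n))"
            "\<And>j. j < n \<Longrightarrow> integral {grid T n j..grid T n (Suc j)} h = sqrt \<epsilon> *\<^sub>R (B (grid T n (Suc j)) \<omega> - B (grid T n j) \<omega>)"
          by (rule step_control[OF T nr(1), of "\<lambda>j. sqrt \<epsilon> *\<^sub>R (B (grid T n (Suc j)) \<omega> - B (grid T n j) \<omega>)"]) blast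
        have "energy T h = \<epsilon> * (\<Sum>j<n. (norm (B (grid T n (Suc j)) \<omega> - B (grid T n j) \<omega>))\<^sup>2 / (T / real n))"
          unfolding h(2) sum_distrib_left using \<epsilon> by (intro sum.cong) (auto simp: power_mult_distrib)
        then have en: "1 / 2 * energy T h \<le> s" using le by simp
        then have en2: "energy T h \<le> 2 * s0" using s by simp
        have near: "mdist (path_space T) (sample_path T Y \<omega>) (skeleton T b \<sigma> x h) < \<delta>"
          by (rule nE[OF \<omega>E h(1) en2]) (use h(3) nr(2) in simp)
        have "action T b \<sigma> x (skeleton T b \<sigma> x h) \<le> ennreal s"
          by (rule order_trans[OF action_skeleton_le[OF h(1)] ennreal_leI[OF en]])
        then have "skeleton T b \<sigma> x h \<in> level_set (path_space T) (action T b \<sigma> x) (ennreal s)"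
          using skeleton_in_path_space[OF h(1)] by (simp add: level_set_def)
        then have "dist_to_set (path_space T) (sample_path T Y \<omega>) (level_set (path_space T) (action T b \<sigma> x) (ennreal s))
            \<le> ennreal (mdist (path_space T) (sample_path T Y \<omega>) (skeleton T b \<sigma> x h))"
          unfolding dist_to_set_def by (rule INF_lower)
        also have "\<dots> < ennreal \<delta>" using near pos by (simp add: ennreal_less_iff)
        finally show False using \<omega> by (simp add: not_le[symmetric])
      qed
    qed
    \<comment> \<open>Monotonicity asks only the larger set to be an event.\<close>
    then have "prob ?D \<le> prob (E \<union> ?H)" by (rule finite_measure_mono) (use E H in blast)
    also have "\<dots> \<le> prob E + prob ?H" using E(1) H(1) by (rule measure_Un_le)
    also have "\<dots> \<le> exp (- s0 / \<epsilon>) + C * exp (- (1 - \<kappa>') * s / \<epsilon>)" unfolding C_def by (intro add_mono E(2) H(2))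
    also have "\<dots> \<le> exp (- s / \<epsilon>) * (1 + C * exp (\<kappa> / (2 * \<epsilon>)))"
    proof -
      have 1: "exp (- s0 / \<epsilon>) \<le> exp (- s / \<epsilon>)" using s \<epsilon> by (simp add: divide_right_mono)
      have "\<kappa>' * s \<le> \<kappa>' * s0" using s \<kappa>' by (intro mult_left_mono) auto
      then have "- (1 - \<kappa>') * s \<le> - s + \<kappa> / 2" using \<kappa>s0 by (simp add: left_diff_distrib)
      then have "- (1 - \<kappa>') * s / \<epsilon> \<le> (- s + \<kappa> / 2) / \<epsilon>" using \<epsilon>(1) by (intro divide_right_mono) auto
      also have "\<dots> = - s / \<epsilon> + \<kappa> / (2 * \<epsilon>)" by (simp only: add_divide_distrib divide_divide_eq_left)
      finally have "exp (- (1 - \<kappa>') * s / \<epsilon>) \<le> exp (- s / \<epsilon>) * exp (\<kappa> / (2 * \<epsilon>))" by (simp add: exp_add[symmetric])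
      then have "C * exp (- (1 - \<kappa>') * s / \<epsilon>) \<le> C * (exp (- s / \<epsilon>) * exp (\<kappa> / (2 * \<epsilon>)))" by (rule mult_left_mono[OF _ C])
      with 1 have "exp (- s0 / \<epsilon>) + C * exp (- (1 - \<kappa>') * s / \<epsilon>)
          \<le> exp (- s / \<epsilon>) + C * (exp (- s / \<epsilon>) * exp (\<kappa> / (2 * \<epsilon>)))" by (rule add_mono)
      then show ?thesis by (simp only: distrib_left mult_1_right mult.left_commute)
    qed
    also have "\<dots> \<le> exp (- s / \<epsilon>) * exp (\<kappa> / \<epsilon>)"
    proof (rule mult_left_mono)
      let ?y = "exp (\<kappa> / (2 * \<epsilon>))"
      have "\<kappa> / (2 * \<epsilon>) \<le> ?y" using exp_ge_add_one_self[of "\<kappa> / (2 * \<epsilon>)"] by linarith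
      then have y: "1 + C \<le> ?y" using \<epsilon>C by linarith
      have "1 + C * ?y \<le> (1 + C) * ?y" using y C unfolding distrib_right by linarith
      also have "\<dots> \<le> ?y * ?y" using y by (intro mult_right_mono) auto
      also have "\<dots> = exp (\<kappa> / \<epsilon>)" using \<epsilon> by (simp add: exp_add[symmetric])
      finally show "1 + C * ?y \<le> exp (\<kappa> / \<epsilon>)" .
    qed simp
    also have "\<dots> = exp (- (s - \<kappa>) / \<epsilon>)" by (simp add: exp_add[symmetric] diff_divide_distrib)
    finally show "prob ?D \<le> exp (- (s - \<kappa>) / \<epsilon>)" .
  qed
qed

text \<open>If all increments fall near the cell integrals of a near optimal control for \<phi>, the
  diffusion tracks \<phi>. The control depends on \<phi>, but the grid, the radius and the prefactor
  \<open>c\<close> depend only on the energy bound, which gives uniformity over the level set. The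
  budget \<kappa> is split: \<open>\<kappa> / 4\<close> for near optimality,
  \<open>\<kappa> / 4\<close> for the radius, \<open>\<kappa> / 2\<close> for the prefactor and the
  tracking event.\<close>

lemma ldp_lower_bound:
  assumes A: "bounded A" and pos: "0 < \<delta>" "0 < \<kappa>" "0 < s0"
  obtains \<epsilon>' where "0 < \<epsilon>'"
    "\<And>\<epsilon> x Y \<phi>. 0 < \<epsilon> \<Longrightarrow> \<epsilon> < \<epsilon>' \<Longrightarrow> x \<in> A \<Longrightarrow> sde_solution M F B T b \<sigma> \<epsilon> x Y \<Longrightarrow>
      \<phi> \<in> level_set (path_space T) (action T b \<sigma> x) (ennreal s0) \<Longrightarrow>
      exp (- (enn2real (action T b \<sigma> x \<phi>) + \<kappa>) / \<epsilon>)
        \<le> prob {\<omega> \<in> space M. mdist (path_space T) (sample_path T Y \<omega>) \<phi> < \<delta>}"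
proof -
  \<comment> \<open>Covers every near optimal control, whose energy is at most
    \<open>2 * a + \<kappa> / 2\<close>. The rate \<open>s0 + \<kappa>\<close> of the tracking event
    is chosen so that this event is no likelier than the bound to be proved.\<close>
  define N where "N = 2 * s0 + \<kappa>"
  have N: "0 \<le> N" and L: "0 \<le> s0 + \<kappa>" using pos by (auto simp: N_def)
  obtain n r2 \<epsilon>1 where nr: "0 < n" "0 < r2" "0 < \<epsilon>1"
    and track: "\<And>\<epsilon> x Y. 0 < \<epsilon> \<Longrightarrow> \<epsilon> < \<epsilon>1 \<Longrightarrow> x \<in> A \<Longrightarrow> sde_solution M F B T b \<sigma> \<epsilon> x Y \<Longrightarrow>
      \<exists>E\<in>events. prob E \<le> exp (- (s0 + \<kappa>) / \<epsilon>) \<and> (\<forall>\<omega>\<in>space M - E.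
        \<forall>h. L2_control T h \<longrightarrow> energy T h \<le> N \<longrightarrow>
           (\<forall>j<n. norm (integral {grid T n j..grid T n (Suc j)} h - sqrt \<epsilon> *\<^sub>R (B (grid T n (Suc j)) \<omega> - B (grid T n j) \<omega>)) \<le> r2) \<longrightarrow>
           mdist (path_space T) (sample_path T Y \<omega>) (skeleton T b \<sigma> x h) < \<delta>)"
    by (rule sde_tracks_skeleton[OF A N pos(1) L]) blast
  \<comment> \<open>Expanding the squares \<open>(norm (v j) + r)\<^sup>2\<close> and using that
    \<open>r\<close> is at most 1 leaves an excess of at most \<open>Q * r\<close>; the next line
    makes its cost at most \<open>\<kappa> / 4\<close>.\<close>
  define Q where "Q = 2 * sqrt (T * N) + real n"
  have Q: "0 < Q" unfolding Q_def using nr T N by (intro add_nonneg_pos) auto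
  define r where "r = min r2 (min 1 (\<kappa> * T / (2 * real n * Q)))"
  have r: "0 < r" "r \<le> r2" "r \<le> 1" unfolding r_def using nr pos T Q by auto
  have "r \<le> \<kappa> * T / (2 * real n * Q)" unfolding r_def by simp
  then have "r * (2 * real n * Q) \<le> \<kappa> * T" using nr Q by (subst (asm) pos_le_divide_eq) auto
  then have rQ: "Q * r / (2 * (T / real n)) \<le> \<kappa> / 4" using T nr by (simp add: field_simps)
  define c where "c = ((1 / sqrt (2 * pi * (T / real n))) ^ CARD('m) * measure lborel (ball (0 :: real ^ 'm) r)) ^ n"
  have c: "0 < c" unfolding c_def
    by (intro zero_less_power mult_pos_pos content_ball_pos r divide_pos_pos real_sqrt_gt_zero) (use T nr in auto)
  show ?thesis
  \<comment> \<open>The last bound gives \<open>2 \<le> c * (\<kappa> / (2 * \<epsilon>))\<close>,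
    so \<open>c\<close> times the spare exponential is at least 2: one unit is the claim, the other
    pays for the tracking event.\<close>
  proof (rule that[of "min \<epsilon>1 (min 1 (c * \<kappa> / 4))"])
    show "0 < min \<epsilon>1 (min 1 (c * \<kappa> / 4))" using nr c pos by simp
    fix \<epsilon> x Y \<phi> assume \<epsilon>: "0 < \<epsilon>" "\<epsilon> < min \<epsilon>1 (min 1 (c * \<kappa> / 4))" and x: "x \<in> A"
      and Y: "sde_solution M F B T b \<sigma> \<epsilon> x Y"
      and \<phi>: "\<phi> \<in> level_set (path_space T) (action T b \<sigma> x) (ennreal s0)"
    have \<epsilon>1: "\<epsilon> < \<epsilon>1" "\<epsilon> \<le> 1" "\<epsilon> < c * \<kappa> / 4" using \<epsilon> by auto
    define a where "a = enn2real (action T b \<sigma> x \<phi>)"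
    have \<phi>m: "\<phi> \<in> mspace (path_space T)" and le: "action T b \<sigma> x \<phi> \<le> ennreal s0"
      using \<phi> by (auto simp: level_set_def)
    have "action T b \<sigma> x \<phi> < \<infinity>" using le by (simp add: le_less_trans)
    then have a: "action T b \<sigma> x \<phi> = ennreal a" by (simp add: a_def)
    have a0: "0 \<le> a" by (simp add: a_def)
    have as0: "a \<le> s0" using le pos unfolding a by simp
    have \<kappa>4: "0 < \<kappa> / 4" using pos by simp
    obtain h where h: "L2_control T h" "\<phi> = skeleton T b \<sigma> x h" "1 / 2 * energy T h \<le> a + \<kappa> / 4"
      by (rule action_lessD[OF eq_refl[OF a] a0 \<kappa>4])
    have hN: "energy T h \<le> N" using h(3) as0 pos by (simp add: N_def)
    obtain E where E: "E \<in> events" "prob E \<le> exp (- (s0 + \<kappa>) / \<epsilon>)"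
      and nE: "\<And>\<omega> h. \<omega> \<in> space M - E \<Longrightarrow> L2_control T h \<Longrightarrow> energy T h \<le> N \<Longrightarrow>
           (\<And>j. j < n \<Longrightarrow> norm (integral {grid T n j..grid T n (Suc j)} h - sqrt \<epsilon> *\<^sub>R (B (grid T n (Suc j)) \<omega> - B (grid T n j) \<omega>)) \<le> r2) \<Longrightarrow>
           mdist (path_space T) (sample_path T Y \<omega>) (skeleton T b \<sigma> x h) < \<delta>"
      using track[OF \<epsilon>(1) \<epsilon>1(1) x Y] by blast
    define v where "v j = integral {grid T n j..grid T n (Suc j)} h" for j
    define H where "H = {\<omega> \<in> space M. \<forall>j<n. norm (sqrt \<epsilon> *\<^sub>R (B (grid T n (Suc j)) \<omega> - B (grid T n j) \<omega>) - v j) < r}"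
    let ?D = "{\<omega> \<in> space M. mdist (path_space T) (sample_path T Y \<omega>) \<phi> < \<delta>}"
    have D: "?D \<in> events" by (rule mdist_sample_path_measurable[OF Y \<phi>m])
    have H: "H \<in> events" "c * exp (- (\<Sum>j<n. (norm (v j) + r)\<^sup>2) / (2 * (T / real n) * \<epsilon>)) \<le> prob H"
      unfolding H_def c_def by (rule increments_small_ball[OF T nr(1) \<epsilon>(1) \<epsilon>1(2) r(1)])+
    have "H \<subseteq> ?D \<union> E"
    proof
      fix \<omega> assume \<omega>: "\<omega> \<in> H"
      show "\<omega> \<in> ?D \<union> E"
      proof (cases "\<omega> \<in> E")
        case False
        then have \<omega>E: "\<omega> \<in> space M - E" using \<omega> by (simp add: H_def)
        have "mdist (path_space T) (sample_path T Y \<omega>) (skeleton T b \<sigma> x h) < \<delta>"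
        proof (rule nE[OF \<omega>E h(1) hN])
          fix j assume "j < n"
          then have "norm (sqrt \<epsilon> *\<^sub>R (B (grid T n (Suc j)) \<omega> - B (grid T n j) \<omega>) - v j) < r"
            using \<omega> unfolding H_def by blast
          then show "norm (integral {grid T n j..grid T n (Suc j)} h - sqrt \<epsilon> *\<^sub>R (B (grid T n (Suc j)) \<omega> - B (grid T n j) \<omega>)) \<le> r2"
            using r(2) unfolding v_def by (simp add: norm_minus_commute)
        qed
        then show ?thesis using \<omega> unfolding h(2) H_def by blast
      qed simp
    qed
    then have "prob H \<le> prob (?D \<union> E)" by (rule finite_measure_mono) (use D E in blast)
    also have "\<dots> \<le> prob ?D + prob E" using D E(1) by (rule measure_Un_le)
    finally have HD: "prob H \<le> prob ?D + exp (- (s0 + \<kappa>) / \<epsilon>)" using E(2) by linarith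
    have "(\<Sum>j<n. (norm (v j) + r)\<^sup>2) / (2 * (T / real n)) \<le> a + \<kappa> / 2"
    proof -
      let ?\<Delta> = "T / real n"
      have \<Delta>: "0 < ?\<Delta>" using T nr by simp
      have v: "(\<Sum>j<n. (norm (v j))\<^sup>2 / ?\<Delta>) \<le> energy T h" "(\<Sum>j<n. norm (v j)) \<le> sqrt (T * N)"
        unfolding v_def using cell_integrals_le[OF T nr(1) h(1) hN] by auto
      have "(\<Sum>j<n. (norm (v j) + r)\<^sup>2) = (\<Sum>j<n. (norm (v j))\<^sup>2) + 2 * r * (\<Sum>j<n. norm (v j)) + real n * r\<^sup>2"
        by (simp add: power2_sum sum.distrib sum_distrib_left mult_ac)
      also have "\<dots> \<le> (\<Sum>j<n. (norm (v j))\<^sup>2) + 2 * r * sqrt (T * N) + real n * r"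
      proof (intro add_mono order_refl mult_left_mono v(2))
        show "r\<^sup>2 \<le> r" using r by (simp add: power2_eq_square mult_left_le)
      qed (use r in auto)
      also have "\<dots> = (\<Sum>j<n. (norm (v j))\<^sup>2) + Q * r" by (simp add: Q_def algebra_simps)
      finally have "(\<Sum>j<n. (norm (v j) + r)\<^sup>2) / (2 * ?\<Delta>) \<le> ((\<Sum>j<n. (norm (v j))\<^sup>2) + Q * r) / (2 * ?\<Delta>)"
        by (rule divide_right_mono) (use \<Delta> in linarith)
      also have "\<dots> = 1 / 2 * (\<Sum>j<n. (norm (v j))\<^sup>2 / ?\<Delta>) + Q * r / (2 * ?\<Delta>)"
      proof -
        have "(S + q) / (2 * d) = 1 / 2 * (S / d) + q / (2 * d)" for S q d :: real by (simp add: add_divide_distrib)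
        then show ?thesis unfolding sum_divide_distrib[symmetric] .
      qed
      also have "\<dots> \<le> a + \<kappa> / 2" using v(1) h(3) rQ by linarith
      finally show ?thesis .
    qed
    then have "(\<Sum>j<n. (norm (v j) + r)\<^sup>2) / (2 * (T / real n)) / \<epsilon> \<le> (a + \<kappa> / 2) / \<epsilon>"
      by (rule divide_right_mono) (use \<epsilon> in simp)
    then have "- (a + \<kappa> / 2) / \<epsilon> \<le> - (\<Sum>j<n. (norm (v j) + r)\<^sup>2) / (2 * (T / real n) * \<epsilon>)"
      unfolding divide_divide_eq_left minus_divide_left[symmetric] by linarith
    then have "c * exp (- (a + \<kappa> / 2) / \<epsilon>) \<le> c * exp (- (\<Sum>j<n. (norm (v j) + r)\<^sup>2) / (2 * (T / real n) * \<epsilon>))"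
      using c by (intro mult_left_mono) auto
    with H(2) HD have *: "c * exp (- (a + \<kappa> / 2) / \<epsilon>) - exp (- (s0 + \<kappa>) / \<epsilon>) \<le> prob ?D" by linarith
    have "exp (- (s0 + \<kappa>) / \<epsilon>) \<le> exp (- (a + \<kappa>) / \<epsilon>)" using as0 \<epsilon> by (simp add: divide_right_mono)
    moreover have "2 * exp (- (a + \<kappa>) / \<epsilon>) \<le> c * exp (- (a + \<kappa> / 2) / \<epsilon>)"
    proof -
      have "2 \<le> c * (\<kappa> / (2 * \<epsilon>))" using \<epsilon>1(3) \<epsilon>(1) by (simp add: field_simps)
      also have "\<dots> \<le> c * exp (\<kappa> / (2 * \<epsilon>))"
        using c exp_ge_add_one_self[of "\<kappa> / (2 * \<epsilon>)"] by (intro mult_left_mono) linarith+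
      finally have "2 * exp (- (a + \<kappa>) / \<epsilon>) \<le> c * exp (\<kappa> / (2 * \<epsilon>)) * exp (- (a + \<kappa>) / \<epsilon>)"
        by (rule mult_right_mono) simp
      also have "\<dots> = c * exp (\<kappa> / (2 * \<epsilon>) + - (a + \<kappa>) / \<epsilon>)" by (simp only: exp_add mult.assoc)
      also have "\<kappa> / (2 * \<epsilon>) + - (a + \<kappa>) / \<epsilon> = - (a + \<kappa> / 2) / \<epsilon>" using \<epsilon>(1) by (simp add: field_simps)
      finally show ?thesis .
    qed
    ultimately show "exp (- (enn2real (action T b \<sigma> x \<phi>) + \<kappa>) / \<epsilon>) \<le> prob ?D"
      using * unfolding a_def[symmetric] by linarith
  qed
qed

lemma uniform_ldp_sample_path:
  assumes "0 < \<epsilon>1" and X: "\<And>\<epsilon> x. 0 < \<epsilon> \<Longrightarrow> \<epsilon> < \<epsilon>1 \<Longrightarrow> sde_solution M F B T b \<sigma> \<epsilon> x (X \<epsilon> x)"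
  shows "uniform_ldp M (path_space T) (\<lambda>\<epsilon> x. sample_path T (X \<epsilon> x)) (action T b \<sigma>)"
  unfolding uniform_ldp_def
proof (intro allI impI)
  fix A :: "(real ^ 'd) set" and \<delta> \<kappa> s0 :: real
  assume "bounded A \<and> 0 < \<delta> \<and> 0 < \<kappa> \<and> 0 < s0"
  then have A: "bounded A" "0 < \<delta>" "0 < \<kappa>" "0 < s0" by auto
  obtain \<epsilon>u where u: "0 < \<epsilon>u"
    "\<And>\<epsilon> x Y s. 0 < \<epsilon> \<Longrightarrow> \<epsilon> < \<epsilon>u \<Longrightarrow> x \<in> A \<Longrightarrow> sde_solution M F B T b \<sigma> \<epsilon> x Y \<Longrightarrow> s \<in> {0..s0} \<Longrightarrow>
      prob {\<omega> \<in> space M. ennreal \<delta> \<le> dist_to_set (path_space T) (sample_path T Y \<omega>)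
          (level_set (path_space T) (action T b \<sigma> x) (ennreal s))} \<le> exp (- (s - \<kappa>) / \<epsilon>)"
    by (rule ldp_upper_bound[OF A]) blast
  obtain \<epsilon>l where l: "0 < \<epsilon>l"
    "\<And>\<epsilon> x Y \<phi>. 0 < \<epsilon> \<Longrightarrow> \<epsilon> < \<epsilon>l \<Longrightarrow> x \<in> A \<Longrightarrow> sde_solution M F B T b \<sigma> \<epsilon> x Y \<Longrightarrow>
      \<phi> \<in> level_set (path_space T) (action T b \<sigma> x) (ennreal s0) \<Longrightarrow>
      exp (- (enn2real (action T b \<sigma> x \<phi>) + \<kappa>) / \<epsilon>)
        \<le> prob {\<omega> \<in> space M. mdist (path_space T) (sample_path T Y \<omega>) \<phi> < \<delta>}"
    by (rule ldp_lower_bound[OF A]) blast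
  show "\<exists>\<epsilon>'>0. \<forall>\<epsilon>\<in>{0<..<\<epsilon>'}. \<forall>x\<in>A.
      (\<forall>\<phi>\<in>level_set (path_space T) (action T b \<sigma> x) (ennreal s0).
        exp (- (enn2real (action T b \<sigma> x \<phi>) + \<kappa>) / \<epsilon>)
          \<le> prob {\<omega> \<in> space M. mdist (path_space T) (sample_path T (X \<epsilon> x) \<omega>) \<phi> < \<delta>}) \<and>
      (\<forall>s\<in>{0..s0}. prob {\<omega> \<in> space M. ennreal \<delta> \<le> dist_to_set (path_space T) (sample_path T (X \<epsilon> x) \<omega>)
          (level_set (path_space T) (action T b \<sigma> x) (ennreal s))} \<le> exp (- (s - \<kappa>) / \<epsilon>))"
  proof (intro exI[of _ "min \<epsilon>1 (min \<epsilon>u \<epsilon>l)"] conjI ballI)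
    show "0 < min \<epsilon>1 (min \<epsilon>u \<epsilon>l)" using assms(1) u(1) l(1) by simp
    fix \<epsilon> x assume \<epsilon>: "\<epsilon> \<in> {0<..<min \<epsilon>1 (min \<epsilon>u \<epsilon>l)}" and x: "x \<in> A"
    have X': "sde_solution M F B T b \<sigma> \<epsilon> x (X \<epsilon> x)" using \<epsilon> by (intro X) auto
    show "exp (- (enn2real (action T b \<sigma> x \<phi>) + \<kappa>) / \<epsilon>)
          \<le> prob {\<omega> \<in> space M. mdist (path_space T) (sample_path T (X \<epsilon> x) \<omega>) \<phi> < \<delta>}"
      if "\<phi> \<in> level_set (path_space T) (action T b \<sigma> x) (ennreal s0)" for \<phi>
      by (rule l(2)[OF _ _ x X' that]) (use \<epsilon> in auto)
    show "prob {\<omega> \<in> space M. ennreal \<delta> \<le> dist_to_set (path_space T) (sample_path T (X \<epsilon> x) \<omega>)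
          (level_set (path_space T) (action T b \<sigma> x) (ennreal s))} \<le> exp (- (s - \<kappa>) / \<epsilon>)" if "s \<in> {0..s0}" for s
      by (rule u(2)[OF _ _ x X' that]) (use \<epsilon> in auto)
  qed
qed

end

theorem theorem2p1:
  fixes T \<epsilon>0 \<epsilon>1 \<theta> eta K Mc :: real
    and b :: "real \<Rightarrow> real ^ 'd \<Rightarrow> real ^ 'd"
    and \<sigma> :: "real \<Rightarrow> real ^ 'd \<Rightarrow> real ^ 'm ^ 'd"
    and f g l \<gamma> :: "real \<Rightarrow> real"
    and \<eta> :: "real \<Rightarrow> real \<Rightarrow> real"
    and V :: "real ^ 'd \<Rightarrow> real"
    and M :: "'w measure" and F :: "real \<Rightarrow> 'w measure" and B :: "real \<Rightarrow> 'w \<Rightarrow> real ^ 'm"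
    and X :: "real \<Rightarrow> real ^ 'd \<Rightarrow> real \<Rightarrow> 'w \<Rightarrow> real ^ 'd"
  assumes prob: "prob_space M" "complete_measure M" "usual_conditions M F" "brownian_motion M F B"
    and T: "0 < T"
    and b_cont: "continuous_on UNIV (\<lambda>(s, x). b s x)"
    and \<sigma>_cont: "continuous_on UNIV (\<lambda>(s, x). \<sigma> s x)"
    and f: "set_integrable lebesgue {0..T} f" "\<forall>s\<in>{0..T}. 0 \<le> f s"
    and g: "set_integrable lebesgue {0..T} g" "\<forall>s\<in>{0..T}. 0 \<le> g s"
    and l: "set_integrable lebesgue {0..T} l" "\<forall>s\<in>{0..T}. 0 \<le> l s"
    and A1: "\<forall>R>0. (\<integral>\<^sup>+s\<in>{0..T}.
        (SUP x\<in>{x. norm x \<le> R}. ennreal (norm (b s x) + (norm (\<sigma> s x))\<^sup>2)) \<partial>lborel) < \<infinity>"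
    and A2: "0 < \<epsilon>0" "\<epsilon>0 < 1"
      "\<forall>R>0. (\<forall>u\<in>{0..<1}. 0 \<le> \<eta> R u) \<and> mono_on {0..<1} (\<eta> R) \<and> continuous_on {0..<1} (\<eta> R)
         \<and> \<eta> R 0 = 0
         \<and> (\<forall>\<delta>\<in>{0<..<1}. (\<integral>\<^sup>+u\<in>{0<..<\<delta>}. 1 / ennreal (\<eta> R u) \<partial>lborel) = \<infinity>)"
      "\<forall>R>0. \<forall>x y. \<forall>s\<in>{0..T}. max (norm x) (norm y) \<le> R \<and> norm (x - y) \<le> \<epsilon>0 \<longrightarrow>
         2 * ((x - y) \<bullet> (b s x - b s y)) + (norm (\<sigma> s x - \<sigma> s y))\<^sup>2
           \<le> g s * \<eta> R ((norm (x - y))\<^sup>2)"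
    and A3: "C2 V" "\<forall>x. 0 \<le> V x" "filterlim V at_top at_infinity"
      "0 < \<theta>" "0 < eta" "0 < K" "0 < Mc"
      "\<forall>u\<in>{0..}. 0 \<le> \<gamma> u" "mono_on {0..} \<gamma>" "continuous_on {0..} \<gamma>"
      "(\<integral>\<^sup>+u\<in>{0..}. ennreal (1 / (\<gamma> u + 1)) \<partial>lborel) = \<infinity>"
      "\<forall>s\<in>{0..T}. \<forall>x.
         b s x \<bullet> gradient V x
           + \<theta> / 2 * trace (transpose (\<sigma> s x) ** hessian V x ** \<sigma> s x)
           + (norm (transpose (\<sigma> s x) *v gradient V x))\<^sup>2 / (eta * V x)
         \<le> f s * (1 + \<gamma> (V x))"
      "\<forall>s\<in>{0..T}. \<forall>x.
         trace (transpose (\<sigma> s x) ** hessian V x ** \<sigma> s x) \<ge> - l s * (Mc + K * \<gamma> (V x))"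
    and A4: "\<forall>c\<in>{0..1}. \<forall>R>0.
         (SUP s\<in>{0..\<epsilon>0}. ennreal (c * \<eta> R s) / ennreal (\<eta> R (c * s))) < \<infinity>"
      "\<forall>c\<in>{0..1}. (SUP s\<in>{0..}. ennreal (c * \<gamma> s) / ennreal (\<gamma> (c * s))) < \<infinity>"
    and X: "0 < \<epsilon>1" "\<epsilon>1 \<le> 1"
      "\<forall>\<epsilon>\<in>{0<..<\<epsilon>1}. \<forall>x. sde_solution M F B T b \<sigma> \<epsilon> x (X \<epsilon> x)"
  shows "(\<forall>x. rate_function (path_space T) (action T b \<sigma> x))
    \<and> compact_level_sets_on_compacts (path_space T) (action T b \<sigma>)
    \<and> uniform_ldp M (path_space T) (\<lambda>\<epsilon> x. sample_path T (X \<epsilon> x)) (action T b \<sigma>)"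
proof -
  interpret small_noise T b \<sigma> \<epsilon>0 \<theta> eta K Mc f g l \<gamma> \<eta> V M F B
    by (intro small_noise.intro osgood_lyapunov.intro continuous_coefficients.intro osgood_lyapunov_axioms.intro
        filtered_brownian.intro filtered_brownian_axioms.intro prob(1,3,4) T b_cont \<sigma>_cont f g l A2 A3)
  have "uniform_ldp M (path_space T) (\<lambda>\<epsilon> x. sample_path T (X \<epsilon> x)) (action T b \<sigma>)"
    by (rule uniform_ldp_sample_path[OF X(1)]) (use X(3) in simp)
  then show ?thesis
    using rate_function_action compact_level_sets_on_compacts_action by blast
qed


end
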